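(* Let $d\ge 2$ be an integer, let $F$ be a probability distribution on $\mathrm{Sym}(d)$, and let $\mu=\mu_{F,\mathrm{Unif}}$ be the random permuton with random side lengths induced by $F$. Then there exists a deterministic constant $c\in[0,+\infty)$ such that $H_n(\mu)/n\to c$ almost surely as $n\to\infty$. Moreover, $c=0$ if and only if $F$ is a Dirac measure on $(1,2,\dots,d)$ or on $(d,d-1,\dots,1)$ (one-line notation).
   Context: Permutons and sampling entropy: a permuton is a Borel probability measure on $[0,1]^2$ with uniform marginals. For a permuton $\mu$ and $n\ge 1$, draw $n$ i.i.d. points from $\mu$ and read the relative order of their heights from left to right; this gives a random permutation whose distribution on $\mathrm{Sym}(n)$ is denoted $\mu^{(n)}$, and $H_n(\mu)$ is the Shannon entropy of $\mu^{(n)}$ (natural logarithm). If $\mu$ is a random permuton, $H_n(\mu)$ is the random variable obtained by evaluating $H_n$ at the realization of $\mu$. The random permuton $\mu_{F,\mathrm{Unif}}$: let $\Omega$ be the set of finite strings over $\{0,1,\dots,d-1\}$. Let $(\alpha_s)_{s\in\Omega}$ be i.i.d. random permutations in $\mathrm{Sym}(d)$ with law $F$. Independently of these and independently for each $s\in\Omega$, draw $d-1$ i.i.d. uniform points on $[0,1]$, with order statistics $U_{(1)}\le\dots\le U_{(d-1)}$, put $U_{(0)}=0$, $U_{(d)}=1$, and set $\tau_{s\oplus(i-1)}=U_{(i)}-U_{(i-1)}$ for $i=1,\dots,d$. Define squares $Q_s\subseteq[0,1]^2$ recursively: $Q_\emptyset=[0,1]^2$; if $Q_s$ has side length $T(s)$,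 then $Q_{s\oplus(i-1)}$, $i=1,\dots,d$, are squares inside $Q_s$ of side length $T(s)\tau_{s\oplus(i-1)}$ whose horizontal projections tile the horizontal projection of $Q_s$ from left to right in the order $i=1,\dots,d$, and whose vertical projections tile the vertical projection of $Q_s$ so that $Q_{s\oplus(i-1)}$ is the $\alpha_s(i)$-th from the bottom. Let $\mu_n$ be the permuton giving mass $T(s)$ to each $Q_s$ with $|s|=n$, distributed uniformly on it. Almost surely $\mu_n$ converges weakly to a permuton, which is $\mu_{F,\mathrm{Unif}}$. *)

theory Defs
  imports "HOL-Probability.Probability" "HOL-Combinatorics.Permutations"
begin

section \<open>Permutons and sampling entropy\<close>

text \<open>
  \<^term>\<open>Sym n\<close> is the set of permutations of \<open>{1..n}\<close>, extended by the identity outside \<open>{1..n}\<close>.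
\<close>

definition Sym :: "nat \<Rightarrow> (nat \<Rightarrow> nat) set" where
  "Sym n = {p. p permutes {1..n}}"

definition unif01 :: "real measure" where
  "unif01 = uniform_measure lborel {0..1}"

text \<open>
  A permuton is represented as a Borel measure on the whole plane; the condition on the
  marginals forces it to be carried by the unit square.
\<close>

definition permuton :: "(real \<times> real) measure \<Rightarrow> bool" where
  "permuton \<mu> \<longleftrightarrow> prob_space \<mu> \<and> sets \<mu> = sets borel
     \<and> distr \<mu> borel fst = unif01 \<and> distr \<mu> borel snd = unif01"

text \<open>
  Position of \<open>f i\<close> in the increasing rearrangement of \<open>f 1, \<dots>, f n\<close>. Ties are broken by the
  index, so that \<open>rank_of n f\<close> is always a bijection of \<open>{1..n}\<close>; ties have probability zero
  when sampling from a permuton.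
\<close>

definition rank_of :: "nat \<Rightarrow> (nat \<Rightarrow> real) \<Rightarrow> nat \<Rightarrow> nat" where
  "rank_of n f i = card {j \<in> {1..n}. f j < f i \<or> (f j = f i \<and> j \<le> i)}"

text \<open>
  The permutation read off \<open>n\<close> points: it maps \<open>i\<close> to the rank of the height of the \<open>i\<close>-th point
  from the left.
\<close>

definition pattern :: "nat \<Rightarrow> (nat \<Rightarrow> real \<times> real) \<Rightarrow> nat \<Rightarrow> nat" where
  "pattern n z i =
     (if i \<in> {1..n}
      then rank_of n (\<lambda>j. snd (z j)) (the_inv_into {1..n} (rank_of n (\<lambda>j. fst (z j))) i)
      else i)"

definition sample_law :: "(real \<times> real) measure \<Rightarrow> nat \<Rightarrow> (nat \<Rightarrow> nat) measure" where
  "sample_law \<mu> n = distr (PiM {1..n} (\<lambda>_. \<mu>)) (count_space (Sym n)) (pattern n)"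

text \<open>The convention \<open>0 ln 0 = 0\<close> is built into multiplication by zero.\<close>

definition sampling_entropy :: "nat \<Rightarrow> (real \<times> real) measure \<Rightarrow> real" where
  "sampling_entropy n \<mu> =
     - (\<Sum>\<pi>\<in>Sym n. measure (sample_law \<mu> n) {\<pi>} * ln (measure (sample_law \<mu> n) {\<pi>}))"

text \<open>Weak convergence in the plane; the library's \<open>weak_conv_m\<close> only covers the real line.\<close>

definition weakly_converges :: "(nat \<Rightarrow> (real \<times> real) measure) \<Rightarrow> (real \<times> real) measure \<Rightarrow> bool" where
  "weakly_converges \<nu> \<mu> \<longleftrightarrow>
     (\<forall>f :: real \<times> real \<Rightarrow> real. continuous_on UNIV f \<and> bounded (range f) \<longrightarrow>
        (\<lambda>n. \<integral>z. f z \<partial>\<nu> n) \<longlonglongrightarrow> (\<integral>z. f z \<partial>\<mu>))"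

section \<open>The nested squares\<close>

text \<open>
  The finite strings over \<open>{0, \<dots>, d-1}\<close> are \<open>lists {..<d}\<close>. Strings are stored with their last
  letter first: \<open>s \<oplus> k\<close> is the list \<open>k # s\<close>, and the recursions below follow it.
  In this section \<open>a\<close> and \<open>u\<close> are one realization of the input: \<open>a s \<in> Sym d\<close> is the permutation
  at \<open>s\<close>, and \<open>u s 0, \<dots>, u s (d-2)\<close> are the \<open>d-1\<close> points at \<open>s\<close>.
\<close>

text \<open>\<open>cut d v k\<close> is the order statistic \<open>U\<^sub>(\<^sub>k\<^sub>)\<close> of \<open>v 0, \<dots>, v (d-2)\<close>, with \<open>U\<^sub>(\<^sub>0\<^sub>) = 0\<close> and \<open>U\<^sub>(\<^sub>d\<^sub>) = 1\<close>.\<close>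

definition cut :: "nat \<Rightarrow> (nat \<Rightarrow> real) \<Rightarrow> nat \<Rightarrow> real" where
  "cut d v k = (0 # sort (map v [0..<d - 1]) @ [1]) ! k"

text \<open>The relative side length \<open>\<tau>\<close> of the child \<open>s \<oplus> k\<close>, where \<open>v = u s\<close>.\<close>

definition gap :: "nat \<Rightarrow> (nat \<Rightarrow> real) \<Rightarrow> nat \<Rightarrow> real" where
  "gap d v k = cut d v (Suc k) - cut d v k"

primrec side :: "nat \<Rightarrow> (nat list \<Rightarrow> nat \<Rightarrow> real) \<Rightarrow> nat list \<Rightarrow> real" where
  "side d u [] = 1"
| "side d u (k # s) = side d u s * gap d (u s) k"

primrec left_edge :: "nat \<Rightarrow> (nat list \<Rightarrow> nat \<Rightarrow> real) \<Rightarrow> nat list \<Rightarrow> real" where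
  "left_edge d u [] = 0"
| "left_edge d u (k # s) = left_edge d u s + side d u s * (\<Sum>j<k. gap d (u s) j)"

text \<open>
  The letter \<open>k\<close> corresponds to the index \<open>i = k + 1\<close>; the siblings below \<open>s \<oplus> k\<close> are those with
  a smaller value of \<open>a s\<close>.
\<close>

primrec bottom_edge ::
  "nat \<Rightarrow> (nat list \<Rightarrow> nat \<Rightarrow> nat) \<Rightarrow> (nat list \<Rightarrow> nat \<Rightarrow> real) \<Rightarrow> nat list \<Rightarrow> real" where
  "bottom_edge d a u [] = 0"
| "bottom_edge d a u (k # s) = bottom_edge d a u s
     + side d u s * (\<Sum>j | j < d \<and> a s (Suc j) < a s (Suc k). gap d (u s) j)"

definition square ::
  "nat \<Rightarrow> (nat list \<Rightarrow> nat \<Rightarrow> nat) \<Rightarrow> (nat list \<Rightarrow> nat \<Rightarrow> real) \<Rightarrow> nat list \<Rightarrow> (real \<times> real) set" where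
  "square d a u s = {left_edge d u s .. left_edge d u s + side d u s}
                  \<times> {bottom_edge d a u s .. bottom_edge d a u s + side d u s}"

text \<open>The mixture \<open>\<mu>\<^sub>n\<close> of the uniform distributions on the squares of level \<open>n\<close>.\<close>

definition level_permuton ::
  "nat \<Rightarrow> (nat list \<Rightarrow> nat \<Rightarrow> nat) \<Rightarrow> (nat list \<Rightarrow> nat \<Rightarrow> real) \<Rightarrow> nat \<Rightarrow> (real \<times> real) measure" where
  "level_permuton d a u n = density lborel
     (\<lambda>z. \<Sum>s | s \<in> lists {..<d} \<and> length s = n.
        ennreal (side d u s) * indicator (square d a u s) z / emeasure lborel (square d a u s))"

text \<open>
  The weak limit is unique when it exists; on realizations for which there is none the value is
  arbitrary.
\<close>

definition limit_permuton ::
  "nat \<Rightarrow> (nat list \<Rightarrow> nat \<Rightarrow> nat) \<Rightarrow> (nat list \<Rightarrow> nat \<Rightarrow> real) \<Rightarrow> (real \<times> real) measure" where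
  "limit_permuton d a u = (SOME \<mu>. permuton \<mu> \<and> weakly_converges (level_permuton d a u) \<mu>)"

section \<open>The random permuton\<close>

text \<open>
  The pairs \<open>(\<alpha>\<^sub>s, (U\<^sub>s\<^sub>,\<^sub>0, \<dots>, U\<^sub>s\<^sub>,\<^sub>d\<^sub>-\<^sub>2))\<close> are i.i.d. over the strings \<open>s\<close>; each of them has as
  its law the product of \<open>F\<close> and \<open>d-1\<close> copies of the uniform distribution on \<open>[0,1]\<close>.
\<close>

locale random_squares = prob_space M
  for M :: "'w measure" +
  fixes d :: nat and F :: "(nat \<Rightarrow> nat) pmf"
    and \<alpha> :: "nat list \<Rightarrow> 'w \<Rightarrow> nat \<Rightarrow> nat"
    and U :: "nat list \<Rightarrow> nat \<Rightarrow> 'w \<Rightarrow> real"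
  assumes indep: "indep_vars
      (\<lambda>_. count_space UNIV \<Otimes>\<^sub>M PiM {..<d - 1} (\<lambda>_. borel))
      (\<lambda>s \<omega>. (\<alpha> s \<omega>, \<lambda>j\<in>{..<d - 1}. U s j \<omega>)) (lists {..<d})"
    and law: "\<And>s. s \<in> lists {..<d} \<Longrightarrow>
      distr M (count_space UNIV \<Otimes>\<^sub>M PiM {..<d - 1} (\<lambda>_. borel))
        (\<lambda>\<omega>. (\<alpha> s \<omega>, \<lambda>j\<in>{..<d - 1}. U s j \<omega>))
      = measure_pmf F \<Otimes>\<^sub>M PiM {..<d - 1} (\<lambda>_. unif01)"
begin

definition mu_F_Unif :: "'w \<Rightarrow> (real \<times> real) measure" where
  "mu_F_Unif \<omega> = limit_permuton d (\<lambda>s. \<alpha> s \<omega>) (\<lambda>s j. U s j \<omega>)"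

end

definition reversal :: "nat \<Rightarrow> nat \<Rightarrow> nat" where
  "reversal d i = (if i \<in> {1..d} then d + 1 - i else i)"

end

(* Almost surely the squares shrink to points. Hence the pattern of n points sampled from the
   permuton mu arises by distributing the points among the d squares of level 1, inside which one
   sees independent copies mu_i of mu; the occupation numbers N_i determine the pattern up to
   polynomially many choices, so H_n(mu) differs from the conditional mean of
   sum_i H_{N_i}(mu_i) by O(log n).

   For uniform spacings (N_1, ..., N_d) is a uniform random composition of n. The means
   g n = E H_n(mu) therefore satisfy an exact linear recursion with an error in [0, O(sqrt n)], and
   normalised iterated partial sums turn it into a cyclic system of averages. This system has a
   conserved weighted mean, up to the nonnegative errors, and a dissipated energy, so that
   g n = c n + O(n^(1 - l)) with c > 0 unless g vanishes identically. The second moment of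
   H_n(mu) - c n satisfies a contracting recursion, because the copies are independent and centred
   up to O(n^(1 - l)). Borel-Cantelli yields convergence along n = m^p, and deleting a sample point,
   which costs at most log n, fills the gaps between these n.

   If F is the Dirac mass at one of the two monotone permutations, only one pattern occurs. In all
   other cases two points see both patterns of size 2 with positive probability, either at one
   vertex or at two nested ones, so that g 2 > 0. *)
theory Submission
  imports Defs "HOL-Real_Asymp.Real_Asymp"
begin

section \<open>Entropy of finite distributions\<close>

text \<open>The permuton is given by a choice operator, so nothing is integrated over it directly.
  Its pattern probabilities are computed from the squares alone: the probability \<open>Q\<close>
  that \<open>n\<close> points occupy distinct squares of level \<open>k\<close> and show a given
  pattern is, for given permutations, a polynomial in finitely many gaps. It bounds the true
  probability from below, and the bounds add up to one as \<open>k\<close> grows. Hence pattern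
  probabilities are measurable functions of the tree with an exact recursion at the root.

  For the means, the generating function solves a linear differential equation of order d - 1 whose
  exponents at the singularity 1 are the roots of \<lambda> (\<lambda> + 1) ... (\<lambda> + d - 2)
  = d!. The root 2 is linear growth, and the classical route shows that all others have smaller real
  part. The energy estimate replaces this location of roots. It also yields the power saving n^(1 -
  l) on which the second moments depend, since their cross terms are products of two centred means.
  The contraction there comes from the mean 2 / (d + 1) of the sum of squared gaps, at most
  2/3.\<close>

definition ent :: "'a set \<Rightarrow> ('a \<Rightarrow> real) \<Rightarrow> real" where
  "ent S q = - (\<Sum>x\<in>S. q x * ln (q x))"

text \<open>Convexity: x ln x lies above its tangent at \<open>y\<close>. This does the work of
  Jensen's inequality below, also at \<open>x = 0\<close>, where the product is zero.\<close>

lemma xlnx_tangent: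
  fixes x y :: real
  assumes "x \<ge> 0" "y > 0"
  shows "x * ln x \<ge> x * ln y + x - y"
proof (cases "x = 0")
  case False
  then have x: "x > 0" using assms by simp
  have "ln (y / x) \<le> y / x - 1" using x assms by (intro ln_le_minus_one) auto
  then have "x * ln (y / x) \<le> x * (y / x - 1)" using x by (intro mult_left_mono) auto
  then show ?thesis using x assms by (simp add: ln_div algebra_simps)
qed (use assms in auto)

text \<open>No atom exceeds the total, hence neither does its logarithm; merging atoms can only
  lower the entropy.\<close>

lemma xlnx_sum_le:
  fixes f :: "'a \<Rightarrow> real"
  assumes "finite S" "\<And>x. x \<in> S \<Longrightarrow> f x \<ge> 0"
  shows "(\<Sum>x\<in>S. f x * ln (f x)) \<le> (\<Sum>x\<in>S. f x) * ln (\<Sum>x\<in>S. f x)"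
  unfolding sum_distrib_right
proof (rule sum_mono)
  fix x assume x: "x \<in> S"
  show "f x * ln (f x) \<le> f x * ln (\<Sum>x\<in>S. f x)"
  proof (cases "f x = 0")
    case False
    then have "f x > 0" using assms(2)[OF x] by simp
    moreover have "f x \<le> (\<Sum>x\<in>S. f x)" using x assms by (intro member_le_sum) auto
    ultimately show ?thesis by (intro mult_left_mono) auto
  qed simp
qed

text \<open>Tangents at the uniform value s / K, where s is the total: merging at most
  \<open>K\<close> atoms lowers the entropy by at most ln K per unit of mass.\<close>

lemma xlnx_sum_ge:
  fixes f :: "'a \<Rightarrow> real"
  assumes "finite S" "\<And>x. x \<in> S \<Longrightarrow> f x \<ge> 0" "real (card S) \<le> K" "K \<ge> 1"
  shows "(\<Sum>x\<in>S. f x) * ln (\<Sum>x\<in>S. f x) \<le> (\<Sum>x\<in>S. f x * ln (f x)) + (\<Sum>x\<in>S. f x) * ln K"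
proof (cases "(\<Sum>x\<in>S. f x) = 0")
  case True
  then have "\<forall>x\<in>S. f x = 0" using assms by (simp add: sum_nonneg_eq_0_iff)
  then show ?thesis using True by simp
next
  case False
  define s where "s = (\<Sum>x\<in>S. f x)"
  have s: "s > 0" using False assms sum_nonneg[of S f] unfolding s_def by (simp add: less_eq_real_def)
  have "(\<Sum>x\<in>S. f x * ln (s / K) + f x - s / K) \<le> (\<Sum>x\<in>S. f x * ln (f x))"
    using assms s by (intro sum_mono xlnx_tangent) auto
  also have "(\<Sum>x\<in>S. f x * ln (s / K) + f x - s / K) = s * ln (s / K) + s - real (card S) * (s / K)"
    by (simp add: sum.distrib sum_subtractf s_def sum_distrib_right)
  finally have "s * ln (s / K) + s - real (card S) * (s / K) \<le> (\<Sum>x\<in>S. f x * ln (f x))" .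
  moreover have "real (card S) * (s / K) \<le> s" using assms s by (simp add: field_simps)
  ultimately have "s * ln (s / K) \<le> (\<Sum>x\<in>S. f x * ln (f x))" by linarith
  then show ?thesis using s assms by (simp add: s_def[symmetric] ln_div algebra_simps)
qed

lemma ent_nonneg: "(\<And>x. x \<in> S \<Longrightarrow> 0 \<le> q x \<and> q x \<le> 1) \<Longrightarrow> ent S q \<ge> 0"
  unfolding ent_def neg_0_le_iff_le
proof (rule sum_nonpos)
  fix x assume "x \<in> S"
  moreover assume "\<And>x. x \<in> S \<Longrightarrow> 0 \<le> q x \<and> q x \<le> 1"
  ultimately have "0 \<le> q x" "q x \<le> 1" by auto
  then show "q x * ln (q x) \<le> 0" by (cases "q x = 0") (auto intro!: mult_nonneg_nonpos)
qed

lemma ent_le_ln_card: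
  assumes "finite S" "\<And>x. x \<in> S \<Longrightarrow> q x \<ge> 0" "(\<Sum>x\<in>S. q x) = 1" "real (card S) \<le> K"
  shows "ent S q \<le> ln K"
proof -
  have "S \<noteq> {}" using assms(3) by auto
  then have "card S \<ge> 1" using assms(1) by (simp add: Suc_leI card_gt_0_iff)
  then have "K \<ge> 1" using assms(4) by linarith
  then show ?thesis using xlnx_sum_ge[of S q K] assms by (simp add: ent_def)
qed

lemma ent_coarse_le:
  assumes "finite S" "finite T" "g ` S \<subseteq> T" "\<And>x. x \<in> S \<Longrightarrow> f x \<ge> 0"
  shows "ent T (\<lambda>y. \<Sum>x\<in>{x\<in>S. g x = y}. f x) \<le> ent S f"
proof -
  have "(\<Sum>x\<in>S. f x * ln (f x)) = (\<Sum>y\<in>T. \<Sum>x\<in>{x\<in>S. g x = y}. f x * ln (f x))"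
    by (rule sum.group[OF assms(1-3), symmetric])
  also have "\<dots> \<le> (\<Sum>y\<in>T. (\<Sum>x\<in>{x\<in>S. g x = y}. f x) * ln (\<Sum>x\<in>{x\<in>S. g x = y}. f x))"
    using assms by (intro sum_mono xlnx_sum_le) auto
  finally show ?thesis by (simp add: ent_def)
qed

text \<open>The conditional entropy of a point given its image is at most \<open>ln K\<close>,
  because a fibre of \<open>g\<close> has at most \<open>K\<close> points.\<close>

lemma ent_coarse_ge:
  assumes "finite S" "finite T" "g ` S \<subseteq> T" "\<And>x. x \<in> S \<Longrightarrow> f x \<ge> 0" "(\<Sum>x\<in>S. f x) = 1"
    and "\<And>y. y \<in> T \<Longrightarrow> real (card {x\<in>S. g x = y}) \<le> K" "K \<ge> 1"
  shows "ent S f \<le> ent T (\<lambda>y. \<Sum>x\<in>{x\<in>S. g x = y}. f x) + ln K"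
proof -
  have "(\<Sum>y\<in>T. (\<Sum>x\<in>{x\<in>S. g x = y}. f x) * ln (\<Sum>x\<in>{x\<in>S. g x = y}. f x))
    \<le> (\<Sum>y\<in>T. (\<Sum>x\<in>{x\<in>S. g x = y}. f x * ln (f x)) + (\<Sum>x\<in>{x\<in>S. g x = y}. f x) * ln K)"
    using assms by (intro sum_mono xlnx_sum_ge) auto
  also have "\<dots> = (\<Sum>x\<in>S. f x * ln (f x)) + (\<Sum>x\<in>S. f x) * ln K"
    unfolding sum.distrib sum_distrib_right[symmetric] sum.group[OF assms(1-3)] ..
  finally show ?thesis using assms(5) by (simp add: ent_def)
qed

text \<open>Concavity of entropy: at each \<open>x\<close> the tangents are taken at the value of
  the mixture there, and their linear parts cancel after averaging with weights of total
  one.\<close>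

lemma ent_mixture_ge:
  assumes L: "finite L" "\<And>l. l \<in> L \<Longrightarrow> p l \<ge> 0" "(\<Sum>l\<in>L. p l) = 1"
    and r: "\<And>l x. l \<in> L \<Longrightarrow> x \<in> S \<Longrightarrow> r l x \<ge> 0"
  shows "(\<Sum>l\<in>L. p l * ent S (r l)) \<le> ent S (\<lambda>x. \<Sum>l\<in>L. p l * r l x)"
proof -
  have "(\<Sum>l\<in>L. p l * r l x) * ln (\<Sum>l\<in>L. p l * r l x) \<le> (\<Sum>l\<in>L. p l * (r l x * ln (r l x)))"
    if x: "x \<in> S" for x
  proof (cases "(\<Sum>l\<in>L. p l * r l x) = 0")
    case True
    then have "\<forall>l\<in>L. p l * r l x = 0" using L r x by (subst (asm) sum_nonneg_eq_0_iff) auto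
    then have "(\<Sum>l\<in>L. p l * (r l x * ln (r l x))) = 0" by (intro sum.neutral) auto
    then show ?thesis using True by simp
  next
    case False
    define y where "y = (\<Sum>l\<in>L. p l * r l x)"
    have y: "y > 0" unfolding y_def
      using False L r x by (intro order_le_neq_trans[OF sum_nonneg]) auto
    have "(\<Sum>l\<in>L. p l * (r l x * ln y + r l x - y)) \<le> (\<Sum>l\<in>L. p l * (r l x * ln (r l x)))"
      using L r x y by (intro sum_mono mult_left_mono xlnx_tangent) auto
    also have "(\<Sum>l\<in>L. p l * (r l x * ln y + r l x - y)) = y * ln y + y - (\<Sum>l\<in>L. p l) * y"
      by (simp add: y_def sum.distrib sum_subtractf sum_distrib_right algebra_simps)
    finally show ?thesis using L by (simp add: y_def)
  qed
  then have "(\<Sum>x\<in>S. (\<Sum>l\<in>L. p l * r l x) * ln (\<Sum>l\<in>L. p l * r l x)) \<le> (\<Sum>x\<in>S. \<Sum>l\<in>L. p l * (r l x * ln (r l x)))"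
    by (rule sum_mono)
  also have "\<dots> = (\<Sum>l\<in>L. p l * (\<Sum>x\<in>S. r l x * ln (r l x)))"
    by (subst sum.swap) (simp add: sum_distrib_left)
  finally show ?thesis by (simp add: ent_def sum_negf)
qed

text \<open>A component depends on its label only through the class \<open>\<kappa> l\<close>. The
  outcome together with its class has entropy at most \<open>ln K\<close> plus the mean conditional
  entropy, and forgetting the class cannot increase it. Counting classes instead of labels matters:
  there are d^n assignments of points to subsquares, but only polynomially many vectors of
  occupation numbers.\<close>

lemma ent_mixture_le:
  assumes L: "finite L" "\<And>l. l \<in> L \<Longrightarrow> p l \<ge> 0" "(\<Sum>l\<in>L. p l) = 1"
    and S: "finite S" and r: "\<And>l x. l \<in> L \<Longrightarrow> x \<in> S \<Longrightarrow> r (\<kappa> l) x \<ge> 0"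
    and r1: "\<And>l. l \<in> L \<Longrightarrow> (\<Sum>x\<in>S. r (\<kappa> l) x) = 1"
    and K: "real (card (\<kappa> ` L)) \<le> K"
  shows "ent S (\<lambda>x. \<Sum>l\<in>L. p l * r (\<kappa> l) x) \<le> (\<Sum>l\<in>L. p l * ent S (r (\<kappa> l))) + ln K"
proof -
  define C where "C = \<kappa> ` L"
  define P where "P = (\<lambda>c. \<Sum>l\<in>{l\<in>L. \<kappa> l = c}. p l)"
  have C: "finite C" using L by (simp add: C_def)
  have P0: "P c \<ge> 0" for c unfolding P_def using L by (intro sum_nonneg) auto
  have grp: "(\<Sum>l\<in>L. p l * F (\<kappa> l)) = (\<Sum>c\<in>C. P c * F c)" for F
  proof -
    have "(\<Sum>l\<in>L. p l * F (\<kappa> l)) = (\<Sum>c\<in>C. \<Sum>l\<in>{l\<in>L. \<kappa> l = c}. p l * F (\<kappa> l))"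
      unfolding C_def by (rule sum.image_gen[OF L(1)])
    also have "\<dots> = (\<Sum>c\<in>C. P c * F c)" unfolding P_def sum_distrib_right by (intro sum.cong) auto
    finally show ?thesis .
  qed
  have P1: "(\<Sum>c\<in>C. P c) = 1" using grp[of "\<lambda>_. 1"] L by simp
  have rC: "r c x \<ge> 0" if "c \<in> C" "x \<in> S" for c x using that r by (auto simp: C_def)
  have rC1: "(\<Sum>x\<in>S. r c x) = 1" if "c \<in> C" for c using that r1 by (auto simp: C_def)
  define f where "f = (\<lambda>(c, x). P c * r c x)"
  have "ent S (\<lambda>y. \<Sum>z\<in>{z\<in>C \<times> S. snd z = y}. f z) \<le> ent (C \<times> S) f"
    using C S P0 rC by (intro ent_coarse_le) (auto simp: f_def)
  also have "ent S (\<lambda>y. \<Sum>z\<in>{z\<in>C \<times> S. snd z = y}. f z) = ent S (\<lambda>x. \<Sum>l\<in>L. p l * r (\<kappa> l) x)"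
    unfolding ent_def
  proof (intro arg_cong[of _ _ uminus] sum.cong refl)
    fix y assume y: "y \<in> S"
    have "(\<Sum>z\<in>{z\<in>C \<times> S. snd z = y}. f z) = (\<Sum>c\<in>C. P c * r c y)"
      by (rule sum.reindex_bij_witness[of _ "\<lambda>c. (c, y)" fst]) (use y in \<open>auto simp: f_def\<close>)
    also have "\<dots> = (\<Sum>l\<in>L. p l * r (\<kappa> l) y)" using grp[of "\<lambda>c. r c y"] by simp
    finally show "(\<Sum>z\<in>{z\<in>C \<times> S. snd z = y}. f z) * ln (\<Sum>z\<in>{z\<in>C \<times> S. snd z = y}. f z) =
      (\<Sum>l\<in>L. p l * r (\<kappa> l) y) * ln (\<Sum>l\<in>L. p l * r (\<kappa> l) y)" by simp
  qed
  also have "ent (C \<times> S) f = ent C P + (\<Sum>c\<in>C. P c * ent S (r c))"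
  proof -
    \<comment> \<open>The chain rule, atom by atom; vanishing factors are treated apart because the
      logarithm of a product splits only for positive factors.\<close>
    have 1: "P c * r c x * ln (P c * r c x) = P c * ln (P c) * r c x + P c * (r c x * ln (r c x))"
      if "c \<in> C" "x \<in> S" for c x
      using P0[of c] rC[OF that] by (cases "P c = 0"; cases "r c x = 0") (auto simp: ln_mult algebra_simps)
    have "(\<Sum>z\<in>C \<times> S. f z * ln (f z)) = (\<Sum>c\<in>C. \<Sum>x\<in>S. P c * r c x * ln (P c * r c x))"
      by (simp add: f_def sum.cartesian_product case_prod_unfold)
    also have "\<dots> = (\<Sum>c\<in>C. \<Sum>x\<in>S. P c * ln (P c) * r c x + P c * (r c x * ln (r c x)))"
      using 1 by (intro sum.cong) auto
    also have "\<dots> = (\<Sum>c\<in>C. P c * ln (P c) * (\<Sum>x\<in>S. r c x) + P c * (\<Sum>x\<in>S. r c x * ln (r c x)))"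
      by (simp add: sum.distrib sum_distrib_left)
    also have "\<dots> = (\<Sum>c\<in>C. P c * ln (P c) + P c * (\<Sum>x\<in>S. r c x * ln (r c x)))"
      using rC1 by (intro sum.cong) auto
    finally show ?thesis by (simp add: ent_def sum.distrib sum_negf)
  qed
  also have "(\<Sum>c\<in>C. P c * ent S (r c)) = (\<Sum>l\<in>L. p l * ent S (r (\<kappa> l)))"
    using grp[of "\<lambda>c. ent S (r c)"] by simp
  also have "ent C P \<le> ln K" using C P0 P1 K by (intro ent_le_ln_card) (auto simp: C_def)
  finally show ?thesis by simp
qed

text \<open>Additivity for independent components: the logarithm of the product splits, and in each
  summand the factors of the other components sum to one.\<close>

lemma ent_product:
  assumes I: "finite I" "\<And>i. i \<in> I \<Longrightarrow> finite (S i)" "\<And>i. i \<in> I \<Longrightarrow> (\<Sum>x\<in>S i. q i x) = 1"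
    and q: "\<And>i x. i \<in> I \<Longrightarrow> x \<in> S i \<Longrightarrow> q i x \<ge> 0"
  shows "ent (PiE I S) (\<lambda>x. \<Prod>i\<in>I. q i (x i)) = (\<Sum>i\<in>I. ent (S i) (q i))"
proof -
  have 1: "(\<Prod>i\<in>I. q i (x i)) * ln (\<Prod>i\<in>I. q i (x i)) = (\<Sum>i\<in>I. (\<Prod>j\<in>I. q j (x j)) * ln (q i (x i)))"
    if x: "x \<in> PiE I S" for x
  proof (cases "(\<Prod>i\<in>I. q i (x i)) = 0")
    case False
    then have "q i (x i) \<noteq> 0" if "i \<in> I" for i using that I by auto
    then show ?thesis using I by (subst ln_prod) (auto simp: sum_distrib_left)
  qed simp
  have 2: "(\<Sum>x\<in>PiE I S. (\<Prod>j\<in>I. q j (x j)) * ln (q i (x i))) = (\<Sum>y\<in>S i. q i y * ln (q i y))"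
    if i: "i \<in> I" for i
  proof -
    have "(\<Prod>j\<in>I. q j (x j)) * ln (q i (x i)) = (\<Prod>j\<in>I. q j (x j) * (if j = i then ln (q j (x j)) else 1))" for x
      using I i by (simp add: prod.distrib)
    then have "(\<Sum>x\<in>PiE I S. (\<Prod>j\<in>I. q j (x j)) * ln (q i (x i)))
       = (\<Prod>j\<in>I. \<Sum>y\<in>S j. q j y * (if j = i then ln (q j y) else 1))"
      using I by (simp add: prod_sum_PiE)
    also have "\<dots> = (\<Prod>j\<in>I. if j = i then \<Sum>y\<in>S i. q i y * ln (q i y) else 1)"
      using I by (intro prod.cong) auto
    also have "\<dots> = (\<Sum>y\<in>S i. q i y * ln (q i y))" using I i by simp
    finally show ?thesis .
  qed
  have "(\<Sum>x\<in>PiE I S. (\<Prod>i\<in>I. q i (x i)) * ln (\<Prod>i\<in>I. q i (x i)))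
     = (\<Sum>x\<in>PiE I S. \<Sum>i\<in>I. (\<Prod>j\<in>I. q j (x j)) * ln (q i (x i)))"
    using 1 by (rule sum.cong[OF refl])
  also have "\<dots> = (\<Sum>i\<in>I. \<Sum>y\<in>S i. q i y * ln (q i y))" by (subst sum.swap) (simp add: 2)
  finally show ?thesis by (simp add: ent_def sum_negf)
qed

text \<open>Relabelling by an injection. The push-forward is written with an indicator because the
  conditional law \<open>mixture_part\<close> of a pattern has this shape.\<close>

lemma ent_inj_image:
  assumes "finite S" "inj_on f A" "f ` A \<subseteq> S"
  shows "ent S (\<lambda>y. \<Sum>x\<in>A. if f x = y then w x else 0) = ent A w"
proof -
  have A: "finite A" using assms finite_imageD finite_subset by blast
  have 1: "(\<Sum>x\<in>A. if f x = f z then w x else 0) = w z" if z: "z \<in> A" for z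
  proof -
    have "(\<Sum>x\<in>A. if f x = f z then w x else 0) = (\<Sum>x\<in>A. if x = z then w x else 0)"
      using z assms(2) by (intro sum.cong refl) (auto dest: inj_onD)
    then show ?thesis using A z by simp
  qed
  have 2: "(\<Sum>x\<in>A. if f x = y then w x else 0) = 0" if "y \<notin> f ` A" for y
    using that by (intro sum.neutral) auto
  have "(\<Sum>y\<in>S. (\<Sum>x\<in>A. if f x = y then w x else 0) * ln (\<Sum>x\<in>A. if f x = y then w x else 0))
     = (\<Sum>y\<in>f ` A. (\<Sum>x\<in>A. if f x = y then w x else 0) * ln (\<Sum>x\<in>A. if f x = y then w x else 0))"
    using assms 2 by (intro sum.mono_neutral_right) auto
  also have "\<dots> = (\<Sum>z\<in>A. w z * ln (w z))" by (simp add: sum.reindex assms(2) 1)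
  finally show ?thesis by (simp add: ent_def)
qed

section \<open>A recursion driven by uniform compositions\<close>

text \<open>Here \<open>y\<close> is the state before \<open>x\<close>. The weights
  \<open>1 / (J + 1)\<close> cancel the speeds J + 1 of the averages, so that the polarisation
  identity for 2 (x J - c) (x (J - 1) - x J) telescopes in \<open>J\<close> and leaves the squared
  differences as dissipation.\<close>

lemma energy_step:
  fixes x y :: "nat \<Rightarrow> real"
  assumes "\<And>J. J \<in> {1..D} \<Longrightarrow> N * (x J - y J) = (real J + 1) * (x (J - 1) - x J)"
    and "N \<ge> 0"
  shows "N * ((\<Sum>J=1..D. (x J - c)\<^sup>2 / (real J + 1)) - (\<Sum>J=1..D. (y J - c)\<^sup>2 / (real J + 1)))
    \<le> (x 0 - c)\<^sup>2 - (x D - c)\<^sup>2 - (\<Sum>J=1..D. (x (J - 1) - x J)\<^sup>2)"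
proof -
  have 1: "N * ((x J - c)\<^sup>2 / (real J + 1) - (y J - c)\<^sup>2 / (real J + 1))
     \<le> (x (J - 1) - c)\<^sup>2 - (x J - c)\<^sup>2 - (x (J - 1) - x J)\<^sup>2" if J: "J \<in> {1..D}" for J
  proof -
    \<comment> \<open>The slope of the square is taken at the new state, as in an implicit Euler
      step, so the discretisation error has the favourable sign.\<close>
    have "(x J - c)\<^sup>2 - (y J - c)\<^sup>2 \<le> 2 * (x J - c) * (x J - y J)"
      using zero_le_power2[of "x J - y J"] by (simp add: power2_eq_square algebra_simps)
    then have "N * ((x J - c)\<^sup>2 - (y J - c)\<^sup>2) \<le> N * (2 * (x J - c) * (x J - y J))"
      using assms(2) by (rule mult_left_mono)
    also have "\<dots> = 2 * (x J - c) * (N * (x J - y J))" by simp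
    also have "\<dots> = (real J + 1) * (2 * (x J - c) * (x (J - 1) - x J))"
      using assms(1)[OF J] by simp
    finally have "N * ((x J - c)\<^sup>2 - (y J - c)\<^sup>2) / (real J + 1) \<le> 2 * (x J - c) * (x (J - 1) - x J)"
      by (simp add: divide_le_eq mult.commute)
    also have "\<dots> = (x (J - 1) - c)\<^sup>2 - (x J - c)\<^sup>2 - (x (J - 1) - x J)\<^sup>2"
      by (simp add: power2_eq_square algebra_simps)
    finally show ?thesis by (simp add: diff_divide_distrib right_diff_distrib)
  qed
  have tele: "(\<Sum>J=1..D. f (J - 1) - f J) = f 0 - f D" for f :: "nat \<Rightarrow> real"
    by (induction D) auto
  have "N * ((\<Sum>J=1..D. (x J - c)\<^sup>2 / (real J + 1)) - (\<Sum>J=1..D. (y J - c)\<^sup>2 / (real J + 1)))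
    = (\<Sum>J=1..D. N * ((x J - c)\<^sup>2 / (real J + 1) - (y J - c)\<^sup>2 / (real J + 1)))"
    by (simp add: sum_subtractf sum_distrib_left right_diff_distrib)
  also have "\<dots> \<le> (\<Sum>J=1..D. (x (J - 1) - c)\<^sup>2 - (x J - c)\<^sup>2 - (x (J - 1) - x J)\<^sup>2)"
    by (rule sum_mono) (rule 1)
  also have "\<dots> = (\<Sum>J=1..D. (x (J - 1) - c)\<^sup>2 - (x J - c)\<^sup>2) - (\<Sum>J=1..D. (x (J - 1) - x J)\<^sup>2)"
    by (simp only: sum_subtractf)
  also have "(\<Sum>J=1..D. (x (J - 1) - c)\<^sup>2 - (x J - c)\<^sup>2) = (x 0 - c)\<^sup>2 - (x D - c)\<^sup>2"
    using tele[of "\<lambda>J. (x J - c)\<^sup>2"] .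
  finally show ?thesis .
qed

text \<open>Any two values are joined by at most \<open>D\<close> consecutive differences;
  Cauchy-Schwarz then makes the dissipation control all differences at once.\<close>

lemma path_difference_bound:
  fixes x :: "nat \<Rightarrow> real"
  assumes "J \<in> {1..D}" "J' \<in> {1..D}"
  shows "\<bar>x J - x J'\<bar> \<le> sqrt (real D * (\<Sum>i=1..D. (x (i - 1) - x i)\<^sup>2))"
proof -
  have aux: "\<bar>x J - x J'\<bar> \<le> (\<Sum>i=1..D. \<bar>x (i - 1) - x i\<bar>)" if "J \<le> J'" "J' \<le> D" for J J'
  proof -
    have "\<bar>x J - x J'\<bar> \<le> (\<Sum>i=Suc J..J'. \<bar>x (i - 1) - x i\<bar>)" using that(1)
      by (induction J' rule: dec_induct) auto
    also have "\<dots> \<le> (\<Sum>i=1..D. \<bar>x (i - 1) - x i\<bar>)"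
      by (rule sum_mono2) (use that in auto)
    finally show ?thesis .
  qed
  have "\<bar>x J - x J'\<bar> \<le> (\<Sum>i=1..D. \<bar>x (i - 1) - x i\<bar>)"
    using aux[of J J'] aux[of J' J] assms by (cases "J \<le> J'") (auto simp: abs_minus_commute)
  also have "\<dots> \<le> sqrt (real D * (\<Sum>i=1..D. (x (i - 1) - x i)\<^sup>2))"
  proof (rule real_le_rsqrt)
    show "(\<Sum>i=1..D. \<bar>x (i - 1) - x i\<bar>)\<^sup>2 \<le> real D * (\<Sum>i=1..D. (x (i - 1) - x i)\<^sup>2)"
      using Cauchy_Schwarz_ineq_sum[of "\<lambda>_. 1" "\<lambda>i. \<bar>x (i - 1) - x i\<bar>" "{1..D}"] by simp
  qed
  finally show ?thesis .
qed

text \<open>A telescoping majorant of N^(-3/2), the order of the increments of the weighted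
  mean.\<close>

lemma inverse_sqrt_telescope:
  assumes "i \<ge> (1::nat)"
  shows "1 / (real (Suc i) * sqrt (real (Suc i))) \<le> 2 * (1 / sqrt (real i) - 1 / sqrt (real (Suc i)))"
proof -
  define a b where "a = sqrt (real i)" and "b = sqrt (real (Suc i))"
  have ab: "a > 0" "b > 0" "a \<le> b" "b\<^sup>2 = a\<^sup>2 + 1" "b\<^sup>2 = real (Suc i)"
    using assms by (auto simp: a_def b_def)
  have "(b - a) * (b + a) = 1" using ab(4) by (simp add: power2_eq_square algebra_simps)
  then have "b - a = 1 / (b + a)" using ab by (simp add: field_simps)
  then have 1: "b - a \<ge> 1 / (2 * b)" using ab by (simp add: frac_le)
  have "2 * (1 / a - 1 / b) = 2 * (b - a) / (a * b)" using ab by (simp add: field_simps)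
  also have "\<dots> \<ge> (1 / b) / (a * b)" using 1 ab by (intro divide_right_mono) (auto simp: field_simps)
  also have "(1 / b) / (a * b) \<ge> (1 / b) / (b * b)"
    using ab by (intro divide_left_mono mult_right_mono) auto
  finally have "2 * (1 / a - 1 / b) \<ge> 1 / (b\<^sup>2 * b)" by (simp add: power2_eq_square)
  then show ?thesis using ab by (simp add: a_def b_def)
qed

text \<open>A discrete version of the differential inequality N E' \<le> - a E + C / sqrt N. Some
  power decay is all that is needed, so the exponent is not optimised.\<close>

lemma damped_recursion_decay:
  fixes E :: "nat \<Rightarrow> real"
  assumes step: "\<And>N. N \<ge> 1 \<Longrightarrow> real N * (E N - E (N - 1)) \<le> - a * E N + C / sqrt (real N)"
    and a: "a > 0" and C: "C \<ge> 0" and E: "\<And>N. E N \<ge> 0"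
  shows "\<exists>K l. l > 0 \<and> l \<le> 1/2 \<and> K \<ge> 0 \<and> (\<forall>N\<ge>1. E N \<le> K * real N powr (- l))"
proof -
  \<comment> \<open>Giving up part of the exponent keeps \<open>a - 2 * l\<close> positive:
    \<open>2 * l\<close> pays for passing from \<open>N\<close> to \<open>Suc N\<close>, whose ratio
    is at most 2, and the remainder pays for the forcing term.\<close>
  define l where "l = min (a / 4) (1/2)"
  have l: "l > 0" "l \<le> 1/2" "a - 2 * l > 0" using a by (auto simp: l_def)
  define K where "K = max (E 1) (C / (a - 2 * l))"
  have K: "K \<ge> E 1" "C \<le> K * (a - 2 * l)" "K \<ge> 0"
    using l E[of 1] by (auto simp: K_def pos_divide_le_eq[symmetric])
  have "E N \<le> K * real N powr (- l)" if "N \<ge> 1" for N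
    using that
  proof (induction N rule: dec_induct)
    case base
    then show ?case using K by simp
  next
    case (step N)
    let ?M = "real (Suc N)"
    have N: "real N \<ge> 1" using step by simp
    have "(?M + a) * E (Suc N) \<le> ?M * E N + C / sqrt ?M"
      using assms(1)[of "Suc N"] by (simp add: algebra_simps)
    also have "\<dots> \<le> ?M * (K * real N powr (- l)) + C / sqrt ?M"
      using step by (intro add_mono mult_left_mono) auto
    also have "real N powr (-l) = ?M powr (-l) * (?M / real N) powr l"
      using N by (simp add: powr_divide powr_minus field_simps)
    also have "?M * (K * (?M powr (-l) * (?M / real N) powr l)) \<le> ?M * (K * (?M powr (-l) * (1 + l / real N)))"
    proof -
      have "(?M / real N) powr l = (1 + 1 / real N) powr l" using N by (simp add: field_simps)
      \<comment> \<open>Bernoulli's inequality for an exponent below 1, as a case of weighted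
        arithmetic and geometric means.\<close>
      also have "\<dots> \<le> 1 + l * (1 / real N)"
      proof -
        have "1 + 1 / real N > 0" using N by (simp add: add_pos_nonneg)
        then show ?thesis
          using Youngs_inequality_0[of l "1 - l" "1 + 1 / real N" 1] l N
          by (simp add: algebra_simps)
      qed
      finally show ?thesis using K by (intro mult_left_mono) auto
    qed
    also have "?M * (K * (?M powr (-l) * (1 + l / real N))) = K * ?M powr (-l) * (?M + l * (?M / real N))"
      using N by (simp add: field_simps)
    also have "\<dots> \<le> K * ?M powr (-l) * (?M + l * 2)"
      using K l N by (intro mult_left_mono add_left_mono) (auto simp: field_simps)
    also have "C / sqrt ?M \<le> K * (a - 2 * l) * ?M powr (-l)"
    proof -
      have "1 / sqrt ?M = ?M powr (-(1/2))" by (simp add: powr_minus powr_half_sqrt field_simps)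
      also have "\<dots> \<le> ?M powr (-l)" using l by (intro powr_mono) auto
      finally have "1 / sqrt ?M \<le> ?M powr (-l)" .
      then have "C * (1 / sqrt ?M) \<le> K * (a - 2 * l) * ?M powr (-l)"
        using K C l by (intro mult_mono) auto
      then show ?thesis by simp
    qed
    finally have "(?M + a) * E (Suc N) \<le> (?M + a) * (K * ?M powr (-l))"
      by (simp add: algebra_simps)
    then show ?case using a by (simp add: mult_le_cancel_left_pos add_pos_pos)
  qed
  then show ?thesis using l K by blast
qed

text \<open>The weighted mean \<open>\<Sum>J=1..D. x J N / (J + 1)\<close> is non-decreasing, which gives \<open>c > 0\<close>, and the
  energy of \<open>energy_step\<close> around it decays polynomially.\<close>

lemma averaging_cascade_converges:
  fixes x :: "nat \<Rightarrow> nat \<Rightarrow> real" and r :: "nat \<Rightarrow> real"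
  assumes D: "D \<ge> 1"
    and rec: "\<And>N J. \<lbrakk>N \<ge> 1; J \<in> {1..D}\<rbrakk> \<Longrightarrow>
      real N * (x J N - x J (N - 1)) = (real J + 1) * (x (J - 1) N - x J N)"
    and cyc: "\<And>N. N \<ge> 1 \<Longrightarrow> x 0 N = x D N + r N"
    and r0: "\<And>N. r N \<ge> 0" and rC: "\<And>N. N \<ge> 1 \<Longrightarrow> r N \<le> C / sqrt (real N)"
    and x0: "\<And>J N. x J N \<ge> 0"
  shows "\<exists>c K l. c \<ge> 0 \<and> l > 0 \<and> l \<le> 1/4 \<and> K \<ge> 0 \<and> (\<forall>N\<ge>1. \<bar>x 0 N - c\<bar> \<le> K * real N powr (- l))
     \<and> ((\<exists>N. x 1 N > 0) \<longrightarrow> c > 0)"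
proof -
  define m where "m = (\<lambda>N. \<Sum>J=1..D. x J N / (real J + 1))"
  define h where "h = (\<Sum>J=1..D. 1 / (real J + 1))"
  have h: "h > 0" using D by (auto simp: h_def intro!: sum_pos)
  have C: "C \<ge> 0" using r0[of 1] rC[of 1] by simp
  have tele: "(\<Sum>J=1..D. f (J - 1) - f J) = f 0 - f D" for f :: "nat \<Rightarrow> real"
    by (induction D) auto
  \<comment> \<open>The weights cancel the factors J + 1, the differences telescope around the
    cycle, and only the closing error remains.\<close>
  have mstep: "m N - m (N - 1) = r N / real N" if N: "N \<ge> 1" for N
  proof -
    have "real N * (m N - m (N - 1)) = (\<Sum>J=1..D. (real N * (x J N - x J (N - 1))) / (real J + 1))"
      by (simp add: m_def sum_subtractf sum_distrib_left right_diff_distrib diff_divide_distrib)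
    also have "\<dots> = (\<Sum>J=1..D. x (J - 1) N - x J N)"
      using rec[OF N] by (intro sum.cong) auto
    also have "\<dots> = r N" using tele[of "\<lambda>J. x J N"] cyc[OF N] by simp
    finally show ?thesis using N by (simp add: field_simps)
  qed
  have mono: "incseq m"
  proof (rule incseq_SucI)
    fix N
    have "r (Suc N) / real (Suc N) \<ge> 0" using r0[of "Suc N"] by simp
    then show "m N \<le> m (Suc N)" using mstep[of "Suc N"] by simp
  qed
  \<comment> \<open>The increments r N / N are of order N^(-3/2), so the weighted mean approaches
    its limit at rate N^(-1/2).\<close>
  have mtail: "m M - m N \<le> 2 * C * (1 / sqrt (real N) - 1 / sqrt (real M))" if "N \<ge> 1" "M \<ge> N" for M N
    using that(2)
  proof (induction M rule: dec_induct)
    case (step M)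
    have "m (Suc M) - m M = r (Suc M) / real (Suc M)" using mstep[of "Suc M"] by simp
    also have "\<dots> \<le> (C / sqrt (real (Suc M))) / real (Suc M)"
      using rC[of "Suc M"] by (intro divide_right_mono) auto
    also have "\<dots> = C * (1 / (real (Suc M) * sqrt (real (Suc M))))" by simp
    also have "\<dots> \<le> C * (2 * (1 / sqrt (real M) - 1 / sqrt (real (Suc M))))"
      using C step that by (intro mult_left_mono inverse_sqrt_telescope) auto
    finally show ?case using step.IH by (simp add: algebra_simps)
  qed simp
  have mtail': "m M \<le> m N + 2 * C / sqrt (real N)" if "N \<ge> 1" "M \<ge> N" for M N
  proof -
    have "2 * C * (1 / sqrt (real N) - 1 / sqrt (real M)) \<le> 2 * C * (1 / sqrt (real N))"
      using C by (intro mult_left_mono) auto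
    with mtail[OF that] show ?thesis by simp
  qed
  have "bdd_above (range m)"
  proof (intro bdd_aboveI2)
    fix M show "m M \<le> m 1 + 2 * C"
    proof (cases "M \<ge> 1")
      case True then show ?thesis using mtail'[of 1 M] by simp
    next
      case False then show ?thesis using incseqD[OF mono, of M 1] C by simp
    qed
  qed
  then obtain L where L: "m \<longlonglongrightarrow> L" using LIMSEQ_incseq_SUP[OF _ mono] by blast
  have mL: "m N \<le> L" for N using incseq_le[OF mono L] .
  have Lm: "L \<le> m N + 2 * C / sqrt (real N)" if "N \<ge> 1" for N
    by (rule LIMSEQ_le_const2[OF L]) (use mtail'[OF that] in blast)
  \<comment> \<open>\<open>h\<close> is the total weight, so \<open>c\<close> is the common value
    that all \<open>x J\<close> must approach if their weighted sum tends to
    \<open>L\<close>.\<close>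
  define c where "c = L / h"
  have m0: "m N \<ge> 0" for N unfolding m_def by (intro sum_nonneg) (use x0 in auto)
  have c0: "c \<ge> 0" using h order.trans[OF m0 mL] by (auto simp: c_def)
  have xB: "x J N \<le> (real D + 1) * L" if "J \<in> {1..D}" for J N
  proof -
    have "x J N / (real J + 1) \<le> m N" unfolding m_def
      using that x0 by (intro member_le_sum) auto
    then have "x J N \<le> (real J + 1) * L" using mL[of N] by (simp add: divide_le_eq mult.commute) (smt (verit) mult_right_mono of_nat_0_le_iff)
    also have "\<dots> \<le> (real D + 1) * L" using that order.trans[OF m0 mL] by (intro mult_right_mono) auto
    finally show ?thesis .
  qed
  define E where "E = (\<lambda>N. \<Sum>J=1..D. (x J N - c)\<^sup>2 / (real J + 1))"
  define Dl where "Dl = (\<lambda>N. \<Sum>J=1..D. (x (J - 1) N - x J N)\<^sup>2)"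
  have E0: "E N \<ge> 0" for N unfolding E_def by (intro sum_nonneg) auto
  have Dl0: "Dl N \<ge> 0" for N unfolding Dl_def by (intro sum_nonneg) auto
  \<comment> \<open>This bounds \<open>x 0 N + x D N - 2 * c\<close>: the value \<open>x D N\<close>
    is at most (D + 1) L, and \<open>x 0 N\<close> exceeds it by at most \<open>C\<close>.\<close>
  define B where "B = 2 * ((real D + 1) * L) + C"
  have B: "B \<ge> 0" using C order.trans[OF m0 mL] by (auto simp: B_def)
  have Estep: "real N * (E N - E (N - 1)) \<le> - Dl N + B * C / sqrt (real N)" if N: "N \<ge> 1" for N
  proof -
    have "real N * (E N - E (N - 1)) \<le> (x 0 N - c)\<^sup>2 - (x D N - c)\<^sup>2 - Dl N"
      unfolding E_def Dl_def by (rule energy_step) (use rec[OF N] in auto)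
    also have "(x 0 N - c)\<^sup>2 - (x D N - c)\<^sup>2 = r N * (x 0 N + x D N - 2 * c)"
      using cyc[OF N] by (simp add: power2_eq_square algebra_simps)
    also have "\<dots> \<le> r N * B"
    proof (rule mult_left_mono)
      have "C / sqrt (real N) \<le> C" using N C by (simp add: divide_le_eq mult_le_cancel_left1)
      then have "r N \<le> C" using rC[OF N] by linarith
      then show "x 0 N + x D N - 2 * c \<le> B"
        using cyc[OF N] xB[of D N] D c0 by (simp add: B_def)
    qed (rule r0)
    also have "\<dots> \<le> (C / sqrt (real N)) * B" using rC[OF N] B by (rule mult_right_mono)
    finally show ?thesis by (simp add: mult.commute)
  qed
  \<comment> \<open>Each \<open>x J\<close> differs from the weighted average at time
    \<open>N\<close> by what the dissipation allows, and that average differs from its limit by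
    O(N^(-1/2)).\<close>
  have dev: "\<bar>x J N - c\<bar> * h \<le> h * sqrt (real D * Dl N) + 2 * C / sqrt (real N)"
    if J: "J \<in> {1..D}" and N: "N \<ge> 1" for J N
  proof -
    have "(x J N - c) * h = (\<Sum>J'=1..D. (x J N - x J' N) / (real J' + 1)) + (m N - L)"
    proof -
      have "(\<Sum>J'=1..D. (x J N - x J' N) / (real J' + 1)) = x J N * h - m N"
        by (simp add: m_def h_def sum_distrib_left sum_subtractf diff_divide_distrib)
      moreover have "c * h = L" using h by (simp add: c_def)
      ultimately show ?thesis by (simp add: algebra_simps)
    qed
    then have "\<bar>(x J N - c) * h\<bar> \<le> \<bar>\<Sum>J'=1..D. (x J N - x J' N) / (real J' + 1)\<bar> + \<bar>m N - L\<bar>"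
      by linarith
    also have "\<bar>m N - L\<bar> \<le> 2 * C / sqrt (real N)" using mL[of N] Lm[OF N] by linarith
    also have "\<bar>\<Sum>J'=1..D. (x J N - x J' N) / (real J' + 1)\<bar>
       \<le> (\<Sum>J'=1..D. sqrt (real D * Dl N) / (real J' + 1))"
      by (rule sum_abs[THEN order.trans], rule sum_mono)
         (use J path_difference_bound[of J D _ "\<lambda>J. x J N"] in \<open>auto simp: Dl_def abs_divide intro!: divide_right_mono\<close>)
    also have "\<dots> = h * sqrt (real D * Dl N)" by (simp add: h_def sum_distrib_right sum_divide_distrib)
    finally show ?thesis using h by (simp add: abs_mult)
  qed
  \<comment> \<open>The constants of the Poincare inequality \<open>poinc\<close>: the square of the
    two-term bound \<open>dev\<close> is split as 2 u^2 + 2 v^2, and summing over \<open>J\<close>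
    brings in the factor \<open>h\<close>.\<close>
  define b where "b = 1 / (2 * real D * h)"
  define A where "A = 2 * (2 * C)\<^sup>2 / h\<^sup>2 * h * b"
  have bA: "b > 0" "A \<ge> 0" using h D by (auto simp: b_def A_def)
  have poinc: "Dl N \<ge> b * E N - A / sqrt (real N)" if N: "N \<ge> 1" for N
  proof -
    have 1: "(x J N - c)\<^sup>2 \<le> 2 * (real D * Dl N) + 2 * (2 * C)\<^sup>2 / h\<^sup>2 / sqrt (real N)" if J: "J \<in> {1..D}" for J
    proof -
      define u v where "u = sqrt (real D * Dl N)" and "v = 2 * C / sqrt (real N) / h"
      have "\<bar>x J N - c\<bar> \<le> (h * u + 2 * C / sqrt (real N)) / h"
        using dev[OF J N] h unfolding u_def by (simp add: pos_le_divide_eq)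
      also have "\<dots> = u + v" using h by (simp add: v_def add_divide_distrib)
      finally have "\<bar>x J N - c\<bar> \<le> u + v" .
      then have "(x J N - c)\<^sup>2 \<le> (u + v)\<^sup>2" by (metis abs_ge_zero power2_abs power_mono)
      also have "\<dots> \<le> 2 * u\<^sup>2 + 2 * v\<^sup>2" using zero_le_power2[of "u - v"] by (simp add: power2_eq_square algebra_simps)
      also have "u\<^sup>2 = real D * Dl N" using Dl0 by (simp add: u_def)
      also have "v\<^sup>2 = (2 * C)\<^sup>2 / h\<^sup>2 / real N" using N by (simp add: v_def power_divide power_mult_distrib)
      also have "\<dots> \<le> (2 * C)\<^sup>2 / h\<^sup>2 / sqrt (real N)"
        using N by (intro divide_left_mono) (auto simp: sqrt_le_D intro!: real_le_lsqrt self_le_power)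
      finally show ?thesis by simp
    qed
    have "E N \<le> (\<Sum>J=1..D. (2 * (real D * Dl N) + 2 * (2 * C)\<^sup>2 / h\<^sup>2 / sqrt (real N)) / (real J + 1))"
      unfolding E_def by (intro sum_mono divide_right_mono 1) auto
    also have "\<dots> = h * (2 * (real D * Dl N) + 2 * (2 * C)\<^sup>2 / h\<^sup>2 / sqrt (real N))"
      by (simp add: h_def sum_distrib_right sum_divide_distrib)
    finally have "b * E N \<le> b * (h * (2 * (real D * Dl N) + 2 * (2 * C)\<^sup>2 / h\<^sup>2 / sqrt (real N)))"
      using bA by (intro mult_left_mono) auto
    also have "\<dots> = Dl N + A / sqrt (real N)"
      using h D by (simp add: b_def A_def field_simps)
    finally show ?thesis by simp
  qed
  have "\<exists>K l. l > 0 \<and> l \<le> 1/2 \<and> K \<ge> 0 \<and> (\<forall>N\<ge>1. E N \<le> K * real N powr (- l))"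
  proof (rule damped_recursion_decay)
    show "real N * (E N - E (N - 1)) \<le> - b * E N + (A + B * C) / sqrt (real N)" if "N \<ge> 1" for N
      using Estep[OF that] poinc[OF that] by (simp add: add_divide_distrib)
  qed (use bA B C E0 in auto)
  then obtain K l where K: "l > 0" "l \<le> 1/2" "K \<ge> 0" "\<And>N. N \<ge> 1 \<Longrightarrow> E N \<le> K * real N powr (- l)"
    by blast
  \<comment> \<open>The energy is quadratic, so the exponent is halved on return to
    \<open>x D\<close>. The last step from \<open>x D\<close> to \<open>x 0\<close> costs
    \<open>r N\<close>, of order N^(-1/2), which is the summand \<open>C\<close>.\<close>
  define K' where "K' = sqrt ((real D + 1) * K) + C"
  have "\<bar>x 0 N - c\<bar> \<le> K' * real N powr (- (l / 2))" if N: "N \<ge> 1" for N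
  proof -
    have "(x D N - c)\<^sup>2 / (real D + 1) \<le> E N" unfolding E_def using D by (intro member_le_sum) auto
    then have "(x D N - c)\<^sup>2 \<le> (real D + 1) * (K * real N powr (- l))"
      using mult_left_mono[OF K(4)[OF N], of "real D + 1"] by (simp add: divide_le_eq algebra_simps)
    then have "sqrt ((x D N - c)\<^sup>2) \<le> sqrt ((real D + 1) * K * real N powr (- l))"
      by (intro real_sqrt_le_mono) (simp add: mult.assoc)
    also have "\<dots> = sqrt ((real D + 1) * K) * real N powr (- (l / 2))"
      by (simp add: real_sqrt_mult powr_half_sqrt[symmetric] powr_powr)
    finally have 1: "\<bar>x D N - c\<bar> \<le> sqrt ((real D + 1) * K) * real N powr (- (l / 2))" by simp
    have "r N \<le> C * real N powr (- (1/2))"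
      using rC[OF N] N by (simp add: powr_minus powr_half_sqrt field_simps)
    also have "\<dots> \<le> C * real N powr (- (l/2))" using N K C by (intro mult_left_mono powr_mono) auto
    finally show ?thesis using 1 r0[of N] cyc[OF N] by (simp add: K'_def algebra_simps)
  qed
  moreover have "c > 0" if "x 1 N > 0" for N
  proof -
    have "0 < x 1 N / (real 1 + 1)" using that by simp
    also have "\<dots> \<le> m N" unfolding m_def using D x0
      by (intro member_le_sum[where f = "\<lambda>J. x J N / (real J + 1)"]) auto
    finally show ?thesis using mL[of N] h by (simp add: c_def)
  qed
  moreover have "K' \<ge> 0" using K C by (auto simp: K'_def)
  ultimately show ?thesis using c0 K
    by (intro exI[of _ c] exI[of _ K'] exI[of _ "l/2"]) auto
qed

section \<open>Iterated partial sums and the recursion for the means\<close>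

primrec isum :: "nat \<Rightarrow> (nat \<Rightarrow> real) \<Rightarrow> nat \<Rightarrow> real" where
  "isum 0 g n = g n"
| "isum (Suc j) g n = (\<Sum>k\<le>n. isum j g k)"

lemma isum_Suc_Suc: "isum (Suc j) g (Suc n) = isum (Suc j) g n + isum j g (Suc n)"
  by simp

declare isum.simps(2) [simp del]

text \<open>Pascal's rule, by an inner induction on \<open>n\<close>: iterated summation is
  convolution with the coefficients of (1 - z)^(-j-1). This is how the kernel of the recursion for
  the means is recognised as \<open>d - 1\<close> summations.\<close>

lemma isum_binomial: "isum (Suc j) g n = (\<Sum>k\<le>n. real ((n - k + j) choose j) * g k)"
proof (induction j arbitrary: n)
  case 0
  then show ?case by (simp add: isum.simps)
next
  case (Suc j)
  note IHj = Suc.IH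
  show ?case
  proof (induction n)
    case 0
    then show ?case using IHj[of 0] by (simp add: isum.simps(2)[of "Suc j"])
  next
    case (Suc n)
    have "(\<Sum>k\<le>n. real ((Suc n - k + Suc j) choose Suc j) * g k)
       = (\<Sum>k\<le>n. real ((n - k + Suc j) choose Suc j) * g k + real ((Suc n - k + j) choose j) * g k)"
      by (rule sum.cong) (auto simp: Suc_diff_le algebra_simps)
    then show ?case
      unfolding isum_Suc_Suc[of "Suc j"] Suc.IH IHj
      by (simp add: sum.distrib)
  qed
qed

lemma isum_nonneg: "(\<And>k. g k \<ge> 0) \<Longrightarrow> isum j g n \<ge> 0"
  by (induction j arbitrary: n) (auto simp: isum.simps intro!: sum_nonneg)

text \<open>The iterated partial sums of \<open>g\<close>, divided by those of the identity sequence, form an averaging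
  cascade; the recursion for \<open>g\<close> closes it into a cycle.\<close>

lemma uniform_composition_recursion:
  fixes g e :: "nat \<Rightarrow> real"
  assumes d: "d \<ge> 2"
    and rec: "\<And>n. n \<ge> 1 \<Longrightarrow>
       g n = (\<Sum>k\<le>n. real d * real ((n - k + (d - 2)) choose (d - 2)) / real ((n + d - 1) choose (d - 1)) * g k) + e n"
    and g0: "g 0 = 0" and g: "\<And>n. g n \<ge> 0"
    and e: "\<And>n. e n \<ge> 0" and eC: "\<And>n. n \<ge> 1 \<Longrightarrow> e n \<le> C * sqrt (real n)"
  shows "\<exists>c K l. c \<ge> 0 \<and> l > 0 \<and> l \<le> 1/4 \<and> K \<ge> 0 \<and> (\<forall>n\<ge>1. \<bar>g n - c * real n\<bar> \<le> K * real n powr (1 - l))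
     \<and> ((\<exists>n. g n > 0) \<longrightarrow> c > 0)"
proof -
  \<comment> \<open>The index is shifted by one because the normalising binomial coefficient
    vanishes at \<open>n = 0\<close>.\<close>
  define x where "x = (\<lambda>J N. isum J g (Suc N) / real ((Suc N + J) choose (Suc J)))"
  define r where "r = (\<lambda>N. e (Suc N) / real (Suc N))"
  have C: "C \<ge> 0" using e[of 1] eC[of 1] by simp
  have "\<exists>c K l. c \<ge> 0 \<and> l > 0 \<and> l \<le> 1/4 \<and> K \<ge> 0 \<and> (\<forall>N\<ge>1. \<bar>x 0 N - c\<bar> \<le> K * real N powr (- l))
     \<and> ((\<exists>N. x 1 N > 0) \<longrightarrow> c > 0)"
  proof (rule averaging_cascade_converges)
    show "d - 1 \<ge> 1" using d by simp
    show "real N * (x J N - x J (N - 1)) = (real J + 1) * (x (J - 1) N - x J N)"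
      if N: "N \<ge> 1" and J: "J \<in> {1..d - 1}" for N J
    proof -
      obtain N' where N': "N = Suc N'" using N by (cases N) auto
      obtain J' where J': "J = Suc J'" using J by (cases J) auto
      define b where "b = real ((Suc N + J') choose (Suc J'))"
      have b: "b > 0" unfolding b_def of_nat_0_less_iff by (rule zero_less_binomial) simp
      \<comment> \<open>Absorption identities express the normalisations at \<open>N\<close> and at
        \<open>N - 1\<close> through the same number \<open>b\<close>; the addition rule
        \<open>i\<close> for partial sums then becomes the averaging relation.\<close>
      have b1: "real (Suc J) * real ((Suc N + J) choose (Suc J)) = real (Suc N + J) * b"
      proof -
        have "Suc J * (Suc (N + J) choose Suc J) = Suc (N + J) * ((N + J) choose J)"
          by (rule Suc_times_binomial)
        then have "real (Suc J) * real (Suc (N + J) choose Suc J) = real (Suc (N + J)) * real ((N + J) choose J)"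
          unfolding of_nat_mult[symmetric] by (rule arg_cong)
        then show ?thesis by (simp only: b_def J' add_Suc add_Suc_right)
      qed
      have b2: "real (Suc J) * real ((Suc N' + J) choose (Suc J)) = real N * b"
      proof -
        have "Suc J * (Suc (J + N') choose Suc J) = Suc N' * (Suc (J + N') choose J)"
          by (rule Suc_times_binomial_add)
        then have "real (Suc J) * real (Suc (J + N') choose Suc J) = real (Suc N') * real (Suc (J + N') choose J)"
          unfolding of_nat_mult[symmetric] by (rule arg_cong)
        then show ?thesis by (simp only: b_def J' N' add_Suc add_Suc_right add.commute)
      qed
      have i: "isum J g (Suc N) = isum J g (Suc N') + isum J' g (Suc N)"
        unfolding J' N' by (rule isum_Suc_Suc)
      have pos: "real ((Suc N + J) choose (Suc J)) > 0" "real ((Suc N' + J) choose (Suc J)) > 0"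
        unfolding of_nat_0_less_iff N' by (rule zero_less_binomial; simp)+
      have 1: "isum J g (Suc N) = x J N * (real (Suc N + J) * b / real (Suc J))"
        using pos unfolding b1[symmetric] x_def by (simp del: binomial_Suc_Suc)
      have 2: "isum J g (Suc N') = x J N' * (real N * b / real (Suc J))"
        using pos unfolding b2[symmetric] x_def by (simp del: binomial_Suc_Suc)
      have 3: "isum J' g (Suc N) = x J' N * b"
        using b unfolding x_def b_def by (simp del: binomial_Suc_Suc)
      have "x J N * (real (Suc N + J) * b / real (Suc J)) = x J N' * (real N * b / real (Suc J)) + x J' N * b"
        using i 1 2 3 by simp
      then have "b * (x J N * real (Suc N + J)) = b * (x J N' * real N + x J' N * real (Suc J))"
        by (simp add: field_simps)
      then have "x J N * real (Suc N + J) = x J N' * real N + x J' N * real (Suc J)"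
        using b by simp
      then show ?thesis by (simp add: N' J' algebra_simps)
    qed
    show "x 0 N = x (d - 1) N + r N" if N: "N \<ge> 1" for N
    proof -
      let ?n = "Suc N"
      obtain j where j: "d = Suc (Suc j)" using d by (metis add_2_eq_Suc le_Suc_ex)
      \<comment> \<open>\<open>B\<close> counts the compositions of \<open>?n\<close> into
        \<open>d\<close> parts. It equals \<open>d / ?n\<close> times the normalisation of
        \<open>x (d - 1)\<close>, which turns the recursion for \<open>g\<close>, divided by
        \<open>?n\<close>, into the relation that closes the cycle.\<close>
      define B where "B = real ((?n + d - 1) choose (d - 1))"
      have B: "B > 0" by (simp add: B_def)
      have "g ?n = (\<Sum>k\<le>?n. real d * real ((?n - k + (d - 2)) choose (d - 2)) / B * g k) + e ?n"
        using rec[of ?n] by (simp add: B_def)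
      also have "(\<Sum>k\<le>?n. real d * real ((?n - k + (d - 2)) choose (d - 2)) / B * g k) = real d / B * isum (d - 1) g ?n"
        using isum_binomial[of j g ?n] by (simp add: j sum_distrib_left mult.assoc del: sum.atMost_Suc)
      finally have 1: "g ?n = real d / B * isum (d - 1) g ?n + e ?n" .
      have "Suc (d - 1) * (Suc ((d - 1) + N) choose Suc (d - 1)) = Suc N * (Suc ((d - 1) + N) choose (d - 1))"
        by (rule Suc_times_binomial_add)
      then have "real (Suc (d - 1)) * real (Suc ((d - 1) + N) choose Suc (d - 1))
          = real (Suc N) * real (Suc ((d - 1) + N) choose (d - 1))"
        unfolding of_nat_mult[symmetric] by (rule arg_cong)
      then have "real d * real ((?n + (d - 1)) choose d) = real ?n * B"
        unfolding B_def j by (simp only: add_Suc add_Suc_right add.commute diff_Suc_1)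
      then have 2: "real ((?n + (d - 1)) choose d) = real ?n * B / real d" using d by (simp add: field_simps)
      have "x (d - 1) N = isum (d - 1) g ?n / (real ?n * B / real d)"
        unfolding x_def 2[symmetric] using d by simp
      also have "\<dots> = real d / B * isum (d - 1) g ?n / real ?n"
        using B d by (simp add: field_simps del: of_nat_Suc)
      finally have "x (d - 1) N + r N = (real d / B * isum (d - 1) g ?n + e ?n) / real ?n"
        by (simp only: r_def add_divide_distrib)
      also have "\<dots> = x 0 N" unfolding 1[symmetric] by (simp add: x_def)
      finally show ?thesis by simp
    qed
    show "r N \<ge> 0" for N using e by (simp add: r_def)
    show "r N \<le> C / sqrt (real N)" if "N \<ge> 1" for N
    proof -
      have "r N \<le> C * sqrt (real (Suc N)) / real (Suc N)"
        unfolding r_def by (intro divide_right_mono eC) auto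
      also have "\<dots> = C / sqrt (real (Suc N))" by (simp add: real_div_sqrt divide_divide_eq_right flip: divide_divide_eq_right)
      also have "\<dots> \<le> C / sqrt (real N)" using that C by (intro divide_left_mono) auto
      finally show ?thesis .
    qed
    show "x J N \<ge> 0" for J N unfolding x_def using isum_nonneg[OF g] by simp
  qed
  then obtain c K l where c: "c \<ge> 0" "l > 0" "l \<le> 1/4" "K \<ge> 0" "\<And>N. N \<ge> 1 \<Longrightarrow> \<bar>x 0 N - c\<bar> \<le> K * real N powr (- l)"
    "(\<exists>N. x 1 N > 0) \<longrightarrow> c > 0" by blast
  \<comment> \<open>The shifted estimate starts at \<open>n = 2\<close>, so \<open>n = 1\<close>
    enters the constant separately; the factor 2 absorbs the passage from \<open>N = n - 1\<close>
    to \<open>n\<close>, as N is at least n / 2.\<close>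
  define K' where "K' = max (2 * K) \<bar>g 1 - c\<bar>"
  have "\<bar>g n - c * real n\<bar> \<le> K' * real n powr (1 - l)" if n: "n \<ge> 1" for n
  proof (cases "n = 1")
    case True then show ?thesis by (simp add: K'_def)
  next
    case False
    then obtain N where N: "n = Suc N" "N \<ge> 1" using n by (cases n) auto
    have "\<bar>g n - c * real n\<bar> = real n * \<bar>x 0 N - c\<bar>" unfolding x_def N
      by (simp add: abs_mult[symmetric] field_simps del: of_nat_Suc)
    also have "\<dots> \<le> real n * (K * real N powr (- l))" using c(5)[OF N(2)] by (intro mult_left_mono) auto
    also have "real N powr (- l) \<le> (real n / 2) powr (- l)"
      using N c by (intro powr_mono2') auto
    also have "(real n / 2) powr (- l) = real n powr (- l) * 2 powr l"
      by (simp add: powr_divide powr_minus field_simps)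
    also have "\<dots> \<le> real n powr (- l) * 2 powr 1" using c by (intro mult_left_mono powr_mono) auto
    also have "real n * (K * (real n powr (- l) * 2 powr 1)) = 2 * K * real n powr (1 - l)"
      using n by (simp add: powr_diff powr_minus field_simps)
    also have "\<dots> \<le> K' * real n powr (1 - l)" by (intro mult_right_mono) (auto simp: K'_def)
    finally show ?thesis using c by (simp add: mult_left_mono)
  qed
  moreover have "c > 0" if "g n > 0" for n
  proof -
    have "n \<noteq> 0" using that g0 by (metis less_irrefl)
    then obtain N where N: "n = Suc N" using not0_implies_Suc by blast
    have "isum 1 g n \<ge> g n" 
      using isum_nonneg[of g "Suc 0" N, OF g] by (simp add: N isum_Suc_Suc)
    then have "x 1 N > 0" using that by (simp add: x_def N)
    then show ?thesis using c(6) by blast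
  qed
  moreover have "K' \<ge> 0" using c by (simp add: K'_def)
  ultimately show ?thesis using c(1-3)
    by (intro exI[of _ c] exI[of _ K'] exI[of _ l]) auto
qed

section \<open>Uniform spacings\<close>

lemma cut_0 [simp]: "cut d v 0 = 0"
  by (simp add: cut_def)

lemma cut_last: "d \<ge> 1 \<Longrightarrow> cut d v d = 1"
  by (cases d) (auto simp: cut_def nth_append)

lemma sum_gap: "(\<Sum>j<k. gap d v j) = cut d v k"
  by (induction k) (auto simp: gap_def)

lemma sum_gap_all: "d \<ge> 1 \<Longrightarrow> (\<Sum>j<d. gap d v j) = 1"
  by (simp add: sum_gap cut_last)

lemma cut_cong: "(\<And>j. j < d - 1 \<Longrightarrow> v j = w j) \<Longrightarrow> cut d v = cut d w"
  unfolding cut_def by (intro ext arg_cong2[of _ _ _ _ nth] arg_cong2[of _ _ _ _ "(#)"] arg_cong2[of _ _ _ _ "(@)"] arg_cong[of _ _ sort] map_cong) auto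

lemma gap_cong: "(\<And>j. j < d - 1 \<Longrightarrow> v j = w j) \<Longrightarrow> gap d v = gap d w"
  using cut_cong[of d v w] by (simp add: gap_def fun_eq_iff)

text \<open>Order statistics become counts of points below a level, which is how their measurability
  is obtained.\<close>

lemma sort_nth_le_iff:
  fixes xs :: "real list"
  assumes "k < length xs"
  shows "sort xs ! k \<le> y \<longleftrightarrow> k < card {j. j < length xs \<and> xs ! j \<le> y}"
proof -
  let ?ys = "sort xs"
  have "card {j. j < length xs \<and> xs ! j \<le> y} = length (filter (\<lambda>x. x \<le> y) xs)"
    by (simp add: length_filter_conv_card)
  also have "\<dots> = length (filter (\<lambda>x. x \<le> y) ?ys)"
    by (metis mset_filter mset_sort size_mset)
  also have "\<dots> = card {j. j < length ?ys \<and> ?ys ! j \<le> y}"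
    by (simp add: length_filter_conv_card)
  finally have c: "card {j. j < length xs \<and> xs ! j \<le> y} = card {j. j < length ?ys \<and> ?ys ! j \<le> y}" .
  show ?thesis
  proof
    assume le: "?ys ! k \<le> y"
    have "{..k} \<subseteq> {j. j < length ?ys \<and> ?ys ! j \<le> y}"
    proof
      fix j assume "j \<in> {..k}"
      then have "?ys ! j \<le> ?ys ! k" using assms by (intro sorted_nth_mono) auto
      then show "j \<in> {j. j < length ?ys \<and> ?ys ! j \<le> y}" using le assms \<open>j \<in> {..k}\<close> by auto
    qed
    then have "card {..k} \<le> card {j. j < length ?ys \<and> ?ys ! j \<le> y}" by (rule card_mono[rotated]) simp
    then show "k < card {j. j < length xs \<and> xs ! j \<le> y}" unfolding c by simp
  next
    assume lt: "k < card {j. j < length xs \<and> xs ! j \<le> y}"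
    show "?ys ! k \<le> y"
    proof (rule ccontr)
      assume "\<not> ?ys ! k \<le> y"
      then have "{j. j < length ?ys \<and> ?ys ! j \<le> y} \<subseteq> {..<k}"
        using sorted_nth_mono[of ?ys k] by (force simp: not_less[symmetric])
      then have "card {j. j < length ?ys \<and> ?ys ! j \<le> y} \<le> k"
        using card_mono[of "{..<k}"] by fastforce
      then show False using lt unfolding c by simp
    qed
  qed
qed

lemma measurable_cut:
  assumes v: "\<And>j. j < d - 1 \<Longrightarrow> (\<lambda>\<omega>. V \<omega> j) \<in> borel_measurable N" and k: "k \<le> d"
  shows "(\<lambda>\<omega>. cut d (V \<omega>) k) \<in> borel_measurable N"
proof -
  consider "k = 0" | "k = d" "d \<ge> 1" | k' where "k = Suc k'" "k' < d - 1" using k by (cases k; force)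
  then show ?thesis
  proof cases
    case 1 then show ?thesis by simp
  next
    case 2 then show ?thesis by (simp add: cut_last)
  next
    case 3
    have "cut d (V \<omega>) k \<le> y \<longleftrightarrow> k' < card {j\<in>{..<d - 1}. V \<omega> j \<le> y}" for \<omega> y
    proof -
      have "cut d (V \<omega>) k = sort (map (V \<omega>) [0..<d - 1]) ! k'"
        using 3 by (simp add: cut_def nth_append)
      moreover have "{j. j < d - 1 \<and> map (V \<omega>) [0..<d - 1] ! j \<le> y} = {j\<in>{..<d - 1}. V \<omega> j \<le> y}" by auto
      ultimately show ?thesis using sort_nth_le_iff[of k' "map (V \<omega>) [0..<d - 1]" y] 3 by simp
    qed
    moreover have "card {j\<in>{..<d - 1}. V \<omega> j \<le> y} = (\<Sum>j<d - 1. if V \<omega> j \<le> y then 1 else 0)" for \<omega> y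
      by (simp add: sum.If_cases Int_def)
    moreover have "{\<omega> \<in> space N. k' < (\<Sum>j<d - 1. if V \<omega> j \<le> y then 1 else 0)} \<in> sets N" for y
    proof -
      have "(\<lambda>\<omega>. \<Sum>j<d - 1. if V \<omega> j \<le> y then 1 else 0 :: real) \<in> borel_measurable N"
        using v by (intro borel_measurable_sum measurable_If borel_measurable_const borel_measurable_le) auto
      then have "{\<omega> \<in> space N. real k' < (\<Sum>j<d - 1. if V \<omega> j \<le> y then 1 else 0)} \<in> sets N"
        by measurable
      moreover have "real k' < (\<Sum>j<d - 1. if V \<omega> j \<le> y then 1 else 0) \<longleftrightarrow> k' < (\<Sum>j<d - 1. if V \<omega> j \<le> y then 1 else 0)" for \<omega>
        by (simp only: of_nat_less_iff[symmetric, where 'a = real] of_nat_sum if_distrib[of real] of_nat_0 of_nat_1)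
      ultimately show ?thesis by (simp only:)
    qed
    ultimately show ?thesis by (intro borel_measurableI_le) simp
  qed
qed

lemma measurable_gap:
  assumes "\<And>j. j < d - 1 \<Longrightarrow> (\<lambda>\<omega>. V \<omega> j) \<in> borel_measurable N" and "k < d"
  shows "(\<lambda>\<omega>. gap d (V \<omega>) k) \<in> borel_measurable N"
  unfolding gap_def using assms by (intro borel_measurable_diff measurable_cut) auto

definition generic_cuts :: "nat \<Rightarrow> (nat \<Rightarrow> real) \<Rightarrow> bool" where
  "generic_cuts d v \<longleftrightarrow> inj_on v {..<d - 1} \<and> (\<forall>j<d - 1. 0 < v j \<and> v j < 1)"

lemma cut_strict_mono:
  assumes "d \<ge> 1" "generic_cuts d v" "j < k" "k \<le> d"
  shows "cut d v j < cut d v k"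
proof -
  let ?xs = "0 # sort (map v [0..<d - 1]) @ [1]"
  have "distinct (sort (map v [0..<d - 1]))"
    using assms(2) by (simp add: generic_cuts_def distinct_map atLeast0LessThan)
  then have "sorted_wrt (<) (sort (map v [0..<d - 1]))"
    by (simp add: strict_sorted_iff)
  then have "sorted_wrt (<) ?xs" using assms(2)
    by (auto simp: sorted_wrt_append generic_cuts_def)
  then show ?thesis unfolding cut_def by (rule sorted_wrt_nth_less) (use assms in auto)
qed

lemma gap_pos: "\<lbrakk>d \<ge> 1; generic_cuts d v; k < d\<rbrakk> \<Longrightarrow> gap d v k > 0"
  using cut_strict_mono[of d v k "Suc k"] by (simp add: gap_def)

lemma cut_image:
  assumes "d \<ge> 1"
  shows "cut d v ` {..<d} = insert 0 (v ` {..<d - 1})"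
proof -
  let ?ys = "0 # sort (map v [0..<d - 1])"
  have "cut d v ` {..<d} = (\<lambda>k. ?ys ! k) ` {..<length ?ys}"
    using assms by (intro image_cong) (auto simp: cut_def nth_append nth_Cons split: nat.split)
  also have "\<dots> = set ?ys" by (auto simp: set_conv_nth simp del: length_Cons)
  finally show ?thesis by (simp add: atLeast0LessThan)
qed

text \<open>A long gap is identified by its left end, which is 0 or one of the points, and which
  must see no further point within distance \<open>t\<close> to its right. The count of long gaps is
  thereby expressed through the unsorted points, which are independent.\<close>

lemma count_gaps_greater:
  assumes d: "d \<ge> 2" and v: "generic_cuts d v" and t: "0 \<le> t" "t < 1"
  shows "(\<Sum>k<d. of_bool (gap d v k > t)) = (of_bool (\<forall>j<d - 1. v j > t) :: real)
     + (\<Sum>j<d - 1. of_bool (v j + t < 1 \<and> (\<forall>m<d - 1. m \<noteq> j \<longrightarrow> \<not> (v j < v m \<and> v m \<le> v j + t))))"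
proof -
  \<comment> \<open>The condition that \<open>x\<close> is followed by a gap longer than
    \<open>t\<close>; the first conjunct takes care of the end point 1.\<close>
  define P where "P = (\<lambda>x. x + t < 1 \<and> (\<forall>y\<in>v ` {..<d - 1}. \<not> (x < y \<and> y \<le> x + t)))"
  have inj: "inj_on (cut d v) {..<d}"
    using cut_strict_mono[OF _ v] d by (intro linorder_inj_onI) (auto, fastforce)
  have 1: "gap d v k > t \<longleftrightarrow> P (cut d v k)" if k: "k < d" for k
  proof
    assume g: "gap d v k > t"
    have *: "x \<le> cut d v k \<or> x > cut d v k + t" if x: "x \<in> insert 1 (v ` {..<d - 1})" for x
    proof -
      have "x \<in> cut d v ` {..d}"
        using x cut_image[of d v] cut_last[of d v] d by (auto simp: image_iff) (metis atMost_iff image_iff insertI2 lessThan_iff less_imp_le order_refl)+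
      then obtain m where m: "m \<le> d" "x = cut d v m" by auto
      show ?thesis
      proof (cases "m \<le> k")
        case True
        then show ?thesis using cut_strict_mono[OF _ v, of m k] m k d by (cases "m = k") auto
      next
        case False
        then have "cut d v (Suc k) \<le> x" using cut_strict_mono[OF _ v, of "Suc k" m] m d by (cases "m = Suc k") auto
        then show ?thesis using g by (simp add: gap_def)
      qed
    qed
    have "cut d v k < 1" using cut_strict_mono[OF _ v, of k d] cut_last[of d v] k d by simp
    then show "P (cut d v k)" unfolding P_def using *[of 1] * by force
  next
    assume P: "P (cut d v k)"
    show "gap d v k > t"
    proof (cases "Suc k = d")
      case True then show ?thesis using P cut_last[of d v] d by (simp add: P_def gap_def)
    next
      case False
      then have "Suc k < d" using k by simp
      then have "cut d v (Suc k) \<in> insert 0 (v ` {..<d - 1})" using cut_image[of d v] d by (metis (no_types) One_nat_def Suc_1 Suc_leD image_eqI lessThan_iff)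
      moreover have "cut d v (Suc k) > 0" using cut_strict_mono[OF _ v, of 0 "Suc k"] k d by simp
      ultimately have "cut d v (Suc k) \<in> v ` {..<d - 1}" by auto
      moreover have "cut d v k < cut d v (Suc k)" using cut_strict_mono[OF _ v, of k "Suc k"] k d by simp
      ultimately have "\<not> cut d v (Suc k) \<le> cut d v k + t" using P unfolding P_def by blast
      then show ?thesis by (simp add: gap_def)
    qed
  qed
  have "(\<Sum>k<d. of_bool (gap d v k > t)) = (\<Sum>k<d. (of_bool (P (cut d v k)) :: real))"
    using 1 by (intro sum.cong) auto
  also have "\<dots> = (\<Sum>x\<in>cut d v ` {..<d}. of_bool (P x))" by (simp add: sum.reindex[OF inj])
  also have "\<dots> = of_bool (P 0) + (\<Sum>x\<in>v ` {..<d - 1}. of_bool (P x))"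
  proof -
    have "0 \<notin> v ` {..<d - 1}" using v by (force simp: generic_cuts_def)
    then show ?thesis using d by (subst cut_image) auto
  qed
  also have "(\<Sum>x\<in>v ` {..<d - 1}. of_bool (P x)) = (\<Sum>j<d - 1. (of_bool (P (v j)) :: real))"
    using v by (subst sum.reindex) (auto simp: generic_cuts_def)
  also have "\<dots> = (\<Sum>j<d - 1. of_bool (v j + t < 1 \<and> (\<forall>m<d - 1. m \<noteq> j \<longrightarrow> \<not> (v j < v m \<and> v m \<le> v j + t))))"
    by (intro sum.cong refl arg_cong[of _ _ of_bool]) (auto simp: P_def)
  also have "P 0 \<longleftrightarrow> (\<forall>j<d - 1. v j > t)"
    using v t by (auto simp: P_def generic_cuts_def not_le)
  finally show ?thesis .
qed

section \<open>Independent uniform points\<close>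

lemma prob_space_unif01: "prob_space unif01"
  unfolding unif01_def by (intro prob_space_uniform_measure) auto

lemma sets_unif01 [simp, measurable_cong]: "sets unif01 = sets borel"
  by (simp add: unif01_def)

lemma space_unif01 [simp]: "space unif01 = UNIV"
  by (simp add: unif01_def)

lemma emeasure_unif01: "A \<in> sets borel \<Longrightarrow> emeasure unif01 A = emeasure lborel ({0..1} \<inter> A)"
  by (simp add: unif01_def emeasure_uniform_measure divide_ennreal_def)

lemma unif01_eq_density: "unif01 = density lborel (indicator {0..1})"
  unfolding unif01_def uniform_measure_def by (intro density_cong) (auto simp: divide_ennreal_def)

interpretation unif01: prob_space unif01 by (rule prob_space_unif01)

lemma AE_unif01: "AE x in unif01. 0 < x \<and> x < 1"
proof -
  have "AE x in lborel. x \<noteq> (0::real)" "AE x in lborel. x \<noteq> (1::real)" by (rule AE_lborel_singleton)+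
  then have "AE x in lborel. x \<in> {0..1} \<longrightarrow> 0 < x \<and> x < (1::real)" by eventually_elim auto
  then show ?thesis unfolding unif01_eq_density by (subst AE_density) (auto elim!: eventually_mono split: split_indicator)
qed

lemma AE_unif01_neq: "AE x in unif01. x \<noteq> y"
proof -
  have "AE x in lborel. x \<noteq> y" by (rule AE_lborel_singleton)
  then show ?thesis unfolding unif01_eq_density by (subst AE_density) (auto elim!: eventually_mono)
qed

abbreviation cut_points :: "nat \<Rightarrow> (nat \<Rightarrow> real) measure" where
  "cut_points D \<equiv> PiM {..<D} (\<lambda>_. unif01)"

interpretation unif01s: product_sigma_finite "\<lambda>_ :: nat. unif01" by unfold_locales

lemma prob_space_cut_points: "prob_space (cut_points D)"
  by (rule prob_space_PiM) (rule prob_space_unif01)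

lemma AE_cut_points_component:
  assumes "j < D" "AE x in unif01. P x"
  shows "AE v in cut_points D. P (v j)"
proof -
  have "distr (cut_points D) unif01 (\<lambda>v. v j) = unif01"
    using assms(1) by (intro distr_PiM_component prob_space_unif01) auto
  moreover have "(\<lambda>v. v j) \<in> cut_points D \<rightarrow>\<^sub>M unif01" using assms(1) by simp
  ultimately show ?thesis using assms(2) by (metis AE_distrD)
qed

text \<open>A tie is a null event because, with the other points fixed, a uniform point almost
  surely avoids a given value.\<close>

lemma AE_generic_cuts: "AE v in cut_points (d - 1). generic_cuts d v"
proof -
  let ?D = "d - 1"
  have 1: "AE v in cut_points ?D. \<forall>j\<in>{..<?D}. 0 < v j \<and> v j < 1"
    by (intro AE_ball_countable' AE_cut_points_component[OF _ AE_unif01]) auto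
  have 2: "AE v in cut_points ?D. \<forall>p\<in>{..<?D} \<times> {..<?D}. fst p \<noteq> snd p \<longrightarrow> v (fst p) \<noteq> v (snd p)"
  proof (intro AE_ball_countable' countable_finite)
    fix p :: "nat \<times> nat" assume p: "p \<in> {..<?D} \<times> {..<?D}"
    show "AE v in cut_points ?D. fst p \<noteq> snd p \<longrightarrow> v (fst p) \<noteq> v (snd p)"
    proof (cases "fst p = snd p")
      case False
      define i j I where "i = fst p" and "j = snd p" and "I = {..<?D} - {i}"
      have ij: "i < ?D" "j \<in> I" "{..<?D} = insert i I" "finite I" "i \<notin> I" using False p by (auto simp: i_def j_def I_def)
      have m: "(\<lambda>v. indicator {v. v i = v j} v :: ennreal) \<in> borel_measurable (PiM (insert i I) (\<lambda>_. unif01))"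
      proof -
        have [measurable]: "(\<lambda>v. v i) \<in> borel_measurable (PiM (insert i I) (\<lambda>_. unif01))"
          "(\<lambda>v. v j) \<in> borel_measurable (PiM (insert i I) (\<lambda>_. unif01))"
          using ij by (measurable, simp)+
        have "(\<lambda>v. if v i = v j then 1 else 0 :: ennreal) \<in> borel_measurable (PiM (insert i I) (\<lambda>_. unif01))"
          by measurable
        then show ?thesis by (simp add: indicator_def of_bool_def)
      qed
      have "(\<integral>\<^sup>+v. indicator {v. v i = v j} v \<partial>PiM (insert i I) (\<lambda>_. unif01))
         = (\<integral>\<^sup>+v. \<integral>\<^sup>+y. indicator {v. v i = v j} (v(i := y)) \<partial>unif01 \<partial>PiM I (\<lambda>_. unif01))"
        by (rule unif01s.product_nn_integral_insert[OF ij(4,5) m])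
      also have "\<dots> = (\<integral>\<^sup>+v. 0 \<partial>PiM I (\<lambda>_. unif01))"
      proof (intro nn_integral_cong)
        fix v
        have "(\<integral>\<^sup>+y. indicator {v. v i = v j} (v(i := y)) \<partial>unif01) = (\<integral>\<^sup>+y. 0 \<partial>unif01)"
        proof (rule nn_integral_cong_AE, use AE_unif01_neq[of "v j"] in eventually_elim)
          case (elim y)
          have "i \<noteq> j" using ij by auto
          then show ?case using elim by simp
        qed
        then show "(\<integral>\<^sup>+y. indicator {v. v i = v j} (v(i := y)) \<partial>unif01) = 0" by simp
      qed
      finally have "(\<integral>\<^sup>+v. indicator {v. v i = v j} v \<partial>cut_points ?D) = 0" using ij by simp
      then have "AE v in cut_points ?D. indicator {v. v i = v j} v = (0::ennreal)"
        using m ij by (subst (asm) nn_integral_0_iff_AE) auto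
      then show ?thesis by eventually_elim (auto simp: i_def j_def indicator_def split: if_splits)
    qed auto
  qed auto
  from 1 2 show ?thesis by eventually_elim (auto simp: generic_cuts_def inj_on_def)
qed

section \<open>Tails and moments of the gaps\<close>

lemma emeasure_cut_points_all:
  fixes I :: "nat set"
  assumes "A \<in> sets borel" "finite I"
  shows "emeasure (PiM I (\<lambda>_. unif01)) (PiE I (\<lambda>_. A)) = emeasure unif01 A ^ card I"
  using assms by (simp add: unif01s.emeasure_PiM)

lemma emeasure_unif01_Ioi: "0 \<le> t \<Longrightarrow> t < 1 \<Longrightarrow> emeasure unif01 {t<..} = ennreal (1 - t)"
proof -
  assume t: "0 \<le> t" "t < 1"
  have "{0..1} \<inter> {t<..} = {t<..1}" using t by auto
  then show ?thesis using t by (simp add: emeasure_unif01)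
qed

lemma emeasure_unif01_compl:
  assumes "0 \<le> x" "0 \<le> t" "x + t < 1"
  shows "emeasure unif01 (- {x<..x + t}) = ennreal (1 - t)"
proof -
  have "emeasure unif01 {x<..x + t} = ennreal t"
  proof -
    have "{0..1} \<inter> {x<..x + t} = {x<..x + t}" using assms by auto
    then show ?thesis using assms by (simp add: emeasure_unif01)
  qed
  then have "measure unif01 {x<..x + t} = t" using assms by (simp add: measure_def)
  then have "measure unif01 (- {x<..x + t}) = 1 - t"
    using unif01.prob_compl[of "{x<..x + t}"] by (simp add: Compl_eq_Diff_UNIV)
  then show ?thesis by (simp add: unif01.emeasure_eq_measure)
qed

lemma pred_le:
  fixes f g :: "'a \<Rightarrow> real"
  assumes "f \<in> borel_measurable M" "g \<in> borel_measurable M"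
  shows "Measurable.pred M (\<lambda>w. f w \<le> g w)"
  unfolding Measurable.pred_def using assms by (rule borel_measurable_le)

text \<open>There are \<open>d\<close> candidates for the left end of a long gap, and each
  contributes (1 - t)^(d - 1): for the candidate 0 all points must exceed \<open>t\<close>; for the
  point \<open>j\<close>, it must lie below 1 - t while the other d - 2 points avoid an interval of
  length \<open>t\<close>.\<close>

lemma tail_of_gaps:
  assumes d: "d \<ge> 2" and t: "0 \<le> t" "t < 1"
  shows "(\<integral>\<^sup>+v. (\<Sum>k<d. of_bool (gap d v k > t)) \<partial>cut_points (d - 1)) = ennreal (real d * (1 - t) ^ (d - 1))"
proof -
  let ?D = "d - 1"
  let ?A = "\<lambda>v. \<forall>j<?D. v j > t"
  let ?B = "\<lambda>v j. v j + t < 1 \<and> (\<forall>m<?D. m \<noteq> j \<longrightarrow> \<not> (v j < v m \<and> v m \<le> v j + t))"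
  have component[measurable]: "(\<lambda>v. v j) \<in> borel_measurable (cut_points ?D)" if "j \<in> {..<?D}" for j
    using that by measurable
  have mA: "(\<lambda>v. of_bool (?A v) :: ennreal) \<in> borel_measurable (cut_points ?D)"
  proof -
    have "(\<lambda>v. if \<forall>j\<in>{..<?D}. v j > t then 1 else 0 :: ennreal) \<in> borel_measurable (cut_points ?D)"
      by measurable
    also have "(\<lambda>v. if \<forall>j\<in>{..<?D}. v j > t then 1 else 0 :: ennreal) = (\<lambda>v. of_bool (?A v))" by (auto simp: fun_eq_iff)
    finally show ?thesis .
  qed
  have mB: "(\<lambda>v. of_bool (?B v j) :: ennreal) \<in> borel_measurable (cut_points ?D)" if j: "j < ?D" for j
  proof -
    have vj: "(\<lambda>v. v j) \<in> borel_measurable (cut_points ?D)"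
      using j by (intro component) simp
    have 1: "Measurable.pred (cut_points ?D) (\<lambda>v. v j < v m \<and> v m \<le> v j + t)" if "m \<in> {..<?D} - {j}" for m
    proof -
      have "(\<lambda>v. v m) \<in> borel_measurable (cut_points ?D)" using that by (intro component) simp
      then show ?thesis using vj
        by (intro pred_intros_logic borel_measurable_pred_less pred_le borel_measurable_add borel_measurable_const)
    qed
    have 2: "Measurable.pred (cut_points ?D) (\<lambda>v. v j + t < 1)"
      using vj by (intro borel_measurable_pred_less borel_measurable_add borel_measurable_const)
    have "Measurable.pred (cut_points ?D) (\<lambda>v. v j + t < 1 \<and> (\<forall>m\<in>{..<?D} - {j}. \<not> (v j < v m \<and> v m \<le> v j + t)))"
      by (rule pred_intros_logic(3)[OF 2 pred_intros_finite(3)[OF _ pred_intros_logic(2)[OF 1]]]) simp_all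
    then have "(\<lambda>v. if v j + t < 1 \<and> (\<forall>m\<in>{..<?D} - {j}. \<not> (v j < v m \<and> v m \<le> v j + t)) then 1 else 0 :: ennreal)
        \<in> borel_measurable (cut_points ?D)"
      unfolding Measurable.pred_def by (intro measurable_If borel_measurable_const)
    also have "(\<lambda>v. if v j + t < 1 \<and> (\<forall>m\<in>{..<?D} - {j}. \<not> (v j < v m \<and> v m \<le> v j + t)) then 1 else 0 :: ennreal)
       = (\<lambda>v. of_bool (?B v j))" by (auto simp: fun_eq_iff)
    finally show ?thesis .
  qed
  have "(\<integral>\<^sup>+v. (\<Sum>k<d. of_bool (gap d v k > t)) \<partial>cut_points ?D)
     = (\<integral>\<^sup>+v. of_bool (?A v) + (\<Sum>j<?D. of_bool (?B v j)) \<partial>cut_points ?D)"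
  proof (rule nn_integral_cong_AE, use AE_generic_cuts[of d] in eventually_elim)
    case (elim v)
    have e: "of_bool b = ennreal (of_bool b)" for b by simp
    have es: "(\<Sum>k\<in>A. of_bool (Q k)) = ennreal (\<Sum>k\<in>A. of_bool (Q k))" for A :: "nat set" and Q
      unfolding e by (rule sum_ennreal) simp
    have "(\<Sum>k<d. of_bool (gap d v k > t)) = ennreal (\<Sum>k<d. of_bool (gap d v k > t))"
      by (rule es)
    also have "\<dots> = ennreal (of_bool (?A v)) + ennreal (\<Sum>j<?D. of_bool (?B v j))"
      unfolding count_gaps_greater[OF d elim t] by (rule ennreal_plus) (simp_all add: sum_nonneg)
    also have "\<dots> = of_bool (?A v) + (\<Sum>j<?D. of_bool (?B v j))"
      by (subst es, subst e, rule refl)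
    finally show ?case .
  qed
  also have "\<dots> = (\<integral>\<^sup>+v. of_bool (?A v) \<partial>cut_points ?D) + (\<Sum>j<?D. \<integral>\<^sup>+v. of_bool (?B v j) \<partial>cut_points ?D)"
  proof -
    have S: "(\<lambda>v. \<Sum>j<?D. of_bool (?B v j) :: ennreal) \<in> borel_measurable (cut_points ?D)"
      by (rule borel_measurable_sum, rule mB) simp
    have "(\<integral>\<^sup>+v. (\<Sum>j<?D. of_bool (?B v j)) \<partial>cut_points ?D) = (\<Sum>j<?D. \<integral>\<^sup>+v. of_bool (?B v j) \<partial>cut_points ?D)"
      by (rule nn_integral_sum, rule mB) simp
    then show ?thesis unfolding nn_integral_add[OF mA S] by (rule arg_cong)
  qed
  also have "(\<integral>\<^sup>+v. of_bool (?A v) \<partial>cut_points ?D) = ennreal ((1 - t) ^ ?D)"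
  proof -
    have "(\<integral>\<^sup>+v. of_bool (?A v) \<partial>cut_points ?D) = (\<integral>\<^sup>+v. indicator (PiE {..<?D} (\<lambda>_. {t<..})) v \<partial>cut_points ?D)"
      by (intro nn_integral_cong) (auto simp: space_PiM PiE_iff indicator_def)
    also have "\<dots> = ennreal (1 - t) ^ ?D"
      using emeasure_cut_points_all[of "{t<..}" "{..<?D}"] emeasure_unif01_Ioi[OF t]
      by (subst nn_integral_indicator) (auto intro!: sets_PiM_I_finite)
    finally show ?thesis using t by (simp add: ennreal_power)
  qed
  also have "(\<Sum>j<?D. \<integral>\<^sup>+v. of_bool (?B v j) \<partial>cut_points ?D) = (\<Sum>j<?D. ennreal ((1 - t) ^ ?D))"
  proof (rule sum.cong[OF refl])
    fix j assume "j \<in> {..<?D}"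
    then have j: "j < ?D" by simp
    define I where "I = {..<?D} - {j}"
    have I: "finite I" "j \<notin> I" "{..<?D} = insert j I" "card I = ?D - 1" using j by (auto simp: I_def)
    have "(\<integral>\<^sup>+v. of_bool (?B v j) \<partial>PiM (insert j I) (\<lambda>_. unif01))
        = (\<integral>\<^sup>+y. \<integral>\<^sup>+v. of_bool (?B (v(j := y)) j) \<partial>PiM I (\<lambda>_. unif01) \<partial>unif01)"
      by (rule unif01s.product_nn_integral_insert_rev[OF I(1,2)]) (use mB[OF j] I in simp)
    also have "\<dots> = (\<integral>\<^sup>+y. ennreal ((1 - t) ^ (?D - 1)) * indicator {..<1 - t} y \<partial>unif01)"
    proof (rule nn_integral_cong_AE, use AE_unif01 in eventually_elim)
      case (elim y)
      show ?case
      proof (cases "y + t < 1")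
        case True
        have "(\<integral>\<^sup>+v. of_bool (?B (v(j := y)) j) \<partial>PiM I (\<lambda>_. unif01))
           = (\<integral>\<^sup>+v. indicator (PiE I (\<lambda>_. - {y<..y + t})) v \<partial>PiM I (\<lambda>_. unif01))"
          by (intro nn_integral_cong) (use True in \<open>auto simp: space_PiM PiE_iff indicator_def I_def\<close>)
        also have "\<dots> = ennreal (1 - t) ^ (?D - 1)"
          using emeasure_cut_points_all[of "- {y<..y + t}" I] emeasure_unif01_compl[of y t] I elim t True
          by (subst nn_integral_indicator) (auto intro!: sets_PiM_I_finite)
        finally show ?thesis using t True by (simp add: ennreal_power)
      qed simp
    qed
    also have "\<dots> = ennreal ((1 - t) ^ (?D - 1)) * emeasure unif01 {..<1 - t}"
      by (subst nn_integral_cmult_indicator) auto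
    also have "emeasure unif01 {..<1 - t} = ennreal (1 - t)"
    proof -
      have "{0..1} \<inter> {..<1 - t} = {0..<1 - t}" using t by auto
      then show ?thesis using t by (simp add: emeasure_unif01)
    qed
    also have "ennreal ((1 - t) ^ (?D - 1)) * ennreal (1 - t) = ennreal ((1 - t) ^ ?D)"
      using t j power_minus_mult[of ?D "1 - t"] by (simp flip: ennreal_mult)
    finally show "(\<integral>\<^sup>+v. of_bool (?B v j) \<partial>cut_points ?D) = ennreal ((1 - t) ^ ?D)" using I by simp
  qed
  also have "ennreal ((1 - t) ^ ?D) + (\<Sum>j<?D. ennreal ((1 - t) ^ ?D)) = ennreal ((1 - t) ^ ?D + (\<Sum>j<?D. (1 - t) ^ ?D))"
  proof -
    have "(1 - t) ^ ?D \<ge> 0" using t by simp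
    then show ?thesis by (subst sum_ennreal, simp, subst ennreal_plus[symmetric]) (auto intro!: sum_nonneg simp del: sum_constant)
  qed
  also have "(1 - t) ^ ?D + (\<Sum>j<?D. (1 - t) ^ ?D) = real d * (1 - t) ^ ?D"
    using d by (simp add: of_nat_diff algebra_simps)
  finally show ?thesis .
qed

lemma has_integral_beta_nat:
  "((\<lambda>t::real. t ^ a * (1 - t) ^ b) has_integral (fact a * fact b / fact (a + b + 1))) {0..1}"
proof -
  have "((\<lambda>t. t powr (real (a + 1) - 1) * (1 - t) powr (real (b + 1) - 1)) has_integral Beta (real (a + 1)) (real (b + 1))) {0..1}"
    by (rule has_integral_Beta_real) auto
  moreover have "Beta (real (a + 1)) (real (b + 1)) = fact a * fact b / fact (a + b + 1)"
    using Gamma_fact[of a, where 'a = real] Gamma_fact[of b, where 'a = real] Gamma_fact[of "a + b + 1", where 'a = real]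
    by (simp add: Beta_def add_ac)
  ultimately have "((\<lambda>t. t powr (real (a + 1) - 1) * (1 - t) powr (real (b + 1) - 1)) has_integral (fact a * fact b / fact (a + b + 1))) {0..1}"
    by simp
  \<comment> \<open>At the end points \<open>powr\<close> and powers with exponent zero may
    disagree, so these two points are removed as a null set.\<close>
  then show ?thesis
    by (rule has_integral_spike[of "{0, 1}", rotated 2]) (auto simp: powr_realpow)
qed

lemma gap_bounds:
  assumes "d \<ge> 1" "generic_cuts d v" "k < d"
  shows "0 < gap d v k" "gap d v k \<le> 1"
proof -
  show "0 < gap d v k" using gap_pos[OF assms] .
  have "gap d v k \<le> (\<Sum>j<d. gap d v j)"
    using assms gap_pos[OF assms(1,2)] by (intro member_le_sum) (auto intro: less_imp_le)
  then show "gap d v k \<le> 1" using assms by (simp add: sum_gap_all)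
qed

text \<open>The layer-cake formula: x^(p + 1) is the integral of (p + 1) t^p over t < x. Exchanging
  the integrals reduces the moments to \<open>tail_of_gaps\<close> and a beta integral.\<close>

lemma nn_moment_of_gaps:
  assumes d: "d \<ge> 2"
  shows "(\<integral>\<^sup>+v. (\<Sum>k<d. ennreal (gap d v k ^ Suc p)) \<partial>cut_points (d - 1)) = ennreal (fact d * fact (Suc p) / fact (Suc p + d - 1))"
proof -
  let ?P = "cut_points (d - 1)"
  let ?w = "\<lambda>t::real. ennreal (real (Suc p) * t ^ p) * indicator {0..1} t"
  have mg[measurable]: "(\<lambda>v. gap d v k) \<in> borel_measurable ?P" if "k \<in> {..<d}" for k
    using that by (intro measurable_gap) auto
  have layer: "(\<integral>\<^sup>+t. ?w t * of_bool (y > t) \<partial>lborel) = ennreal (y ^ Suc p)" if y: "0 < y" "y \<le> 1" for y :: real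
  proof -
    have "(\<integral>\<^sup>+t. ?w t * of_bool (y > t) \<partial>lborel) = (\<integral>\<^sup>+t. ennreal (real (Suc p) * t ^ p) * indicator {0..y} t \<partial>lborel)"
    proof (rule nn_integral_cong_AE, use AE_lborel_singleton[of y] in eventually_elim)
      case (elim t)
      then show ?case using y by (auto simp: indicator_def)
    qed
    also have "\<dots> = ennreal (y ^ Suc p - 0 ^ Suc p)"
    proof (rule nn_integral_FTC_Icc[where F = "\<lambda>t. t ^ Suc p"])
      show "((\<lambda>t. t ^ Suc p) has_real_derivative real (Suc p) * x ^ p) (at x)" for x
        using DERIV_pow[of "Suc p" x UNIV] by simp
    qed (use y in auto)
    finally show ?thesis by simp
  qed
  interpret C: prob_space ?P by (rule prob_space_cut_points)
  interpret pair_sigma_finite lborel ?P by unfold_locales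
  have "(\<integral>\<^sup>+v. (\<Sum>k<d. ennreal (gap d v k ^ Suc p)) \<partial>?P)
    = (\<integral>\<^sup>+v. (\<integral>\<^sup>+t. ?w t * (\<Sum>k<d. of_bool (gap d v k > t)) \<partial>lborel) \<partial>?P)"
  proof (rule nn_integral_cong_AE, use AE_generic_cuts[of d] in eventually_elim)
    case (elim v)
    have "(\<Sum>k<d. ennreal (gap d v k ^ Suc p)) = (\<Sum>k<d. \<integral>\<^sup>+t. ?w t * of_bool (gap d v k > t) \<partial>lborel)"
      using layer gap_bounds[OF _ elim] d by (intro sum.cong) auto
    also have "\<dots> = (\<integral>\<^sup>+t. (\<Sum>k<d. ?w t * of_bool (gap d v k > t)) \<partial>lborel)"
    proof (rule nn_integral_sum[symmetric])
      fix k
      have "(\<lambda>t. ?w t * indicator {..<gap d v k} t) \<in> borel_measurable lborel" by measurable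
      then show "(\<lambda>t. ?w t * of_bool (gap d v k > t)) \<in> borel_measurable lborel" by (simp add: indicator_def of_bool_def)
    qed
    finally show ?case unfolding sum_distrib_left .
  qed
  also have "\<dots> = (\<integral>\<^sup>+t. (\<integral>\<^sup>+v. ?w t * (\<Sum>k<d. of_bool (gap d v k > t)) \<partial>?P) \<partial>lborel)"
  proof (rule Fubini')
    have "(\<lambda>(t, v). ?w t * (\<Sum>k<d. if gap d v k > t then 1 else 0)) \<in> borel_measurable (lborel \<Otimes>\<^sub>M ?P)"
      by measurable
    then show "(\<lambda>(t, v). ?w t * (\<Sum>k<d. of_bool (gap d v k > t))) \<in> borel_measurable (lborel \<Otimes>\<^sub>M ?P)"
      by (simp add: of_bool_def)
  qed
  also have "\<dots> = (\<integral>\<^sup>+t. indicator {0..1} t * ennreal (real d * real (Suc p) * (t ^ p * (1 - t) ^ (d - 1))) \<partial>lborel)"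
  proof (rule nn_integral_cong_AE, use AE_lborel_singleton[of "1::real"] in eventually_elim)
    case (elim t)
    have m: "(\<lambda>v. (\<Sum>k<d. of_bool (gap d v k > t)) :: ennreal) \<in> borel_measurable ?P"
    proof -
      have "(\<lambda>v. (\<Sum>k<d. if gap d v k > t then 1 else 0) :: ennreal) \<in> borel_measurable ?P" by measurable
      then show ?thesis by (simp add: of_bool_def)
    qed
    show ?case
    proof (cases "0 \<le> t \<and> t < 1")
      case True
      have "(\<integral>\<^sup>+v. ?w t * (\<Sum>k<d. of_bool (gap d v k > t)) \<partial>?P) = ?w t * ennreal (real d * (1 - t) ^ (d - 1))"
        using tail_of_gaps[OF d, of t] True by (subst nn_integral_cmult[OF m]) auto
      then show ?thesis using True by (simp add: ennreal_mult[symmetric] mult_ac del: of_nat_Suc)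
    qed (use elim in \<open>auto simp: indicator_def\<close>)
  qed
  also have "\<dots> = (\<integral>\<^sup>+t. ennreal (if t \<in> {0..1} then real d * real (Suc p) * (t ^ p * (1 - t) ^ (d - 1)) else 0) \<partial>lborel)"
    by (intro nn_integral_cong) (auto simp: indicator_def)
  also have "\<dots> = ennreal (real d * real (Suc p) * (fact p * fact (d - 1) / fact (p + (d - 1) + 1)))"
  proof (rule nn_integral_has_integral_lborel)
    have "((\<lambda>t. real d * real (Suc p) * (t ^ p * (1 - t) ^ (d - 1))) has_integral real d * real (Suc p) * (fact p * fact (d - 1) / fact (p + (d - 1) + 1))) {0..1}"
      by (intro has_integral_mult_right has_integral_beta_nat)
    then show "((\<lambda>t. if t \<in> {0..1} then real d * real (Suc p) * (t ^ p * (1 - t) ^ (d - 1)) else 0) has_integral real d * real (Suc p) * (fact p * fact (d - 1) / fact (p + (d - 1) + 1))) UNIV"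
      by (subst has_integral_restrict_UNIV)
  qed auto
  also have "real d * real (Suc p) * (fact p * fact (d - 1) / fact (p + (d - 1) + 1)) = fact d * fact (Suc p) / fact (Suc p + d - 1)"
    using d by (simp add: fact_reduce[of d] mult_ac)
  finally show ?thesis .
qed

lemma integrable_gap_fun:
  assumes "d \<ge> 1" "k < d" "f \<in> borel_measurable borel" "\<And>x. 0 \<le> x \<Longrightarrow> x \<le> 1 \<Longrightarrow> \<bar>f x\<bar> \<le> (B::real)"
  shows "integrable (cut_points (d - 1)) (\<lambda>v. f (gap d v k))"
proof -
  interpret prob_space "cut_points (d - 1)" by (rule prob_space_cut_points)
  have [measurable]: "(\<lambda>v. gap d v k) \<in> borel_measurable (cut_points (d - 1))"
    using assms by (intro measurable_gap) auto
  show ?thesis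
  proof (rule integrable_const_bound[where B = B])
    show "AE v in cut_points (d - 1). norm (f (gap d v k)) \<le> B"
      using AE_generic_cuts[of d]
      by eventually_elim (use assms gap_bounds[of d _ k] in \<open>auto simp: less_imp_le\<close>)
  qed (use assms in measurable)
qed

text \<open>Power sums are the base case; factors 1 - x are then added one at a time by (1 - x)^(m +
  1) = (1 - x)^m - x (1 - x)^m. The value is that of \<open>d\<close> gaps which each have the beta
  distribution with parameters 1 and d - 1.\<close>

lemma beta_moment_of_gaps:
  assumes d: "d \<ge> 2"
  shows "(\<integral>v. (\<Sum>i<d. gap d v i ^ k * (1 - gap d v i) ^ m) \<partial>cut_points (d - 1))
     = real d * real (d - 1) * fact k * fact (m + d - 2) / fact (k + m + d - 1)"
proof (induction m arbitrary: k)
  case 0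
  interpret prob_space "cut_points (d - 1)" by (rule prob_space_cut_points)
  show ?case
  proof (cases k)
    case 0
    have "fact (d - 1) = real (d - 1) * fact (d - 2)" using d fact_reduce[of "d - 1", where 'a = real] by (simp add: numeral_2_eq_2)
    then have "real d * real (d - 1) * fact (d - 2) / fact (d - 1) = real d" using d by simp
    then show ?thesis using prob_space by (simp add: 0)
  next
    case (Suc p)
    have i: "integrable (cut_points (d - 1)) (\<lambda>v. \<Sum>i<d. gap d v i ^ k)"
      using d by (intro Bochner_Integration.integrable_sum integrable_gap_fun[where B = 1]) (auto intro: power_le_one)
    have "(\<integral>\<^sup>+v. (\<Sum>i<d. ennreal (gap d v i ^ k)) \<partial>cut_points (d - 1)) = ennreal (\<integral>v. (\<Sum>i<d. gap d v i ^ k) \<partial>cut_points (d - 1))"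
    proof (subst nn_integral_eq_integral[OF i, symmetric])
      show "AE v in cut_points (d - 1). 0 \<le> (\<Sum>i<d. gap d v i ^ k)"
        using AE_generic_cuts[of d] by eventually_elim (use d in \<open>auto intro!: sum_nonneg zero_le_power less_imp_le[OF gap_pos]\<close>)
      show "(\<integral>\<^sup>+v. (\<Sum>i<d. ennreal (gap d v i ^ k)) \<partial>cut_points (d - 1)) = (\<integral>\<^sup>+v. ennreal (\<Sum>i<d. gap d v i ^ k) \<partial>cut_points (d - 1))"
      proof (rule nn_integral_cong_AE, use AE_generic_cuts[of d] in eventually_elim)
        case (elim v)
        show ?case by (rule sum_ennreal) (use gap_pos[OF _ elim] d in \<open>auto intro!: zero_le_power less_imp_le\<close>)
      qed
    qed
    then have "ennreal (\<integral>v. (\<Sum>i<d. gap d v i ^ k) \<partial>cut_points (d - 1)) = ennreal (fact d * fact k / fact (k + d - 1))"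
      using nn_moment_of_gaps[OF d, of p] Suc by simp
    moreover have "(\<integral>v. (\<Sum>i<d. gap d v i ^ k) \<partial>cut_points (d - 1)) \<ge> 0"
      by (rule integral_nonneg_AE, use AE_generic_cuts[of d] in eventually_elim)
         (use d in \<open>auto intro!: sum_nonneg zero_le_power less_imp_le[OF gap_pos]\<close>)
    ultimately have "(\<integral>v. (\<Sum>i<d. gap d v i ^ k) \<partial>cut_points (d - 1)) = fact d * fact k / fact (k + d - 1)"
      by (subst (asm) ennreal_inj) auto
    moreover have "fact d = real d * (real (d - 1) * fact (d - 2))"
      using d fact_reduce[of "d - 1", where 'a = real] fact_reduce[of d, where 'a = real] by (simp add: numeral_2_eq_2)
    ultimately show ?thesis by (simp add: mult_ac)
  qed
next
  case (Suc m)
  have i: "integrable (cut_points (d - 1)) (\<lambda>v. \<Sum>i<d. gap d v i ^ a * (1 - gap d v i) ^ b)" for a b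
    using d by (intro Bochner_Integration.integrable_sum integrable_gap_fun[where B = 1 and f = "\<lambda>x. x ^ a * (1 - x) ^ b"])
       (auto simp: abs_mult intro!: mult_le_one power_le_one)
  have "(\<integral>v. (\<Sum>i<d. gap d v i ^ k * (1 - gap d v i) ^ Suc m) \<partial>cut_points (d - 1))
    = (\<integral>v. (\<Sum>i<d. gap d v i ^ k * (1 - gap d v i) ^ m) - (\<Sum>i<d. gap d v i ^ Suc k * (1 - gap d v i) ^ m) \<partial>cut_points (d - 1))"
    by (intro Bochner_Integration.integral_cong refl) (simp add: sum_subtractf[symmetric] algebra_simps)
  also have "\<dots> = real d * real (d - 1) * fact k * fact (m + d - 2) / fact (k + m + d - 1)
     - real d * real (d - 1) * fact (Suc k) * fact (m + d - 2) / fact (Suc k + m + d - 1)"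
    by (simp only: Bochner_Integration.integral_diff[OF i i] Suc.IH)
  also have "fact (Suc k + m + d - 1) = real (k + m + d) * fact (k + m + d - 1)"
    using d fact_reduce[of "k + m + d", where 'a = real] by simp
  also have "real d * real (d - 1) * fact k * fact (m + d - 2) / fact (k + m + d - 1)
     - real d * real (d - 1) * fact (Suc k) * fact (m + d - 2) / (real (k + m + d) * fact (k + m + d - 1))
     = real d * real (d - 1) * fact k * (real (m + d - 1) * fact (m + d - 2)) / (real (k + m + d) * fact (k + m + d - 1))"
  proof -
    have gen: "X * K * f / G - X * (S * K) * f / (A * G) = X * K * ((A - S) * f) / (A * G)"
      if "A \<noteq> 0" "G \<noteq> 0" for X K f G S A :: real
      using that by (simp add: field_simps)
    have "real (m + d - 1) = real (k + m + d) - real (Suc k)" using d by (simp add: of_nat_diff)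
    moreover have "real (k + m + d) \<noteq> 0" using d by simp
    ultimately show ?thesis unfolding fact_Suc of_nat_mult using gen by simp
  qed
  also have "real (m + d - 1) * fact (m + d - 2) = (fact (Suc m + d - 2) :: real)"
  proof -
    have "Suc m + d - 2 = m + d - 1" "m + d - 1 - 1 = m + d - 2" "m + d - 1 > 0" using d by auto
    then show ?thesis using fact_reduce[of "m + d - 1", where 'a = real] by simp
  qed
  also have "real (k + m + d) * fact (k + m + d - 1) = (fact (k + Suc m + d - 1) :: real)"
    using d fact_reduce[of "k + m + d", where 'a = real] by simp
  finally show ?case .
qed

section \<open>Nested squares and the limit permuton\<close>

definition words :: "nat \<Rightarrow> nat \<Rightarrow> nat list set" where
  "words d k = {s \<in> lists {..<d}. length s = k}"

lemma finite_words [simp]: "finite (words d k)"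
  using finite_lists_length_eq[of "{..<d}" k] by (simp add: words_def lists_eq_set conj_commute)

lemma words_0 [simp]: "words d 0 = {[]}"
  by (auto simp: words_def)

lemma words_Suc: "words d (Suc k) = (\<lambda>(s, i). i # s) ` (words d k \<times> {..<d})"
  by (auto simp: words_def length_Suc_conv image_iff)

text \<open>The last letter is the one chosen at the root. This decomposition picks a subsquare of
  the root and a word inside it, whereas \<open>words_Suc\<close> appends a generation at the
  bottom.\<close>

lemma words_Suc': "words d (Suc k) = (\<lambda>(s, i). s @ [i]) ` (words d k \<times> {..<d})"
proof (intro set_eqI iffI)
  fix w assume w: "w \<in> words d (Suc k)"
  then have "w \<noteq> []" by (auto simp: words_def)
  then have "w = butlast w @ [last w]" by simp
  moreover have "butlast w \<in> words d k" "last w < d"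
    using w \<open>w \<noteq> []\<close> by (auto simp: words_def in_lists_conv_set dest: in_set_butlastD)
  ultimately show "w \<in> (\<lambda>(s, i). s @ [i]) ` (words d k \<times> {..<d})" by (auto simp: image_iff)
qed (auto simp: words_def)

lemma sum_words_Suc: "(\<Sum>s\<in>words d (Suc k). F s) = (\<Sum>s\<in>words d k. \<Sum>i<d. F (i # s))"
proof -
  have "inj_on (\<lambda>(s, i). i # s) (words d k \<times> {..<d})" by (auto simp: inj_on_def)
  then show ?thesis unfolding words_Suc
    by (subst sum.reindex) (auto simp: sum.cartesian_product case_prod_unfold)
qed

lemma sum_words_Suc': "(\<Sum>s\<in>words d (Suc k). F s) = (\<Sum>i<d. \<Sum>s\<in>words d k. F (s @ [i]))"
proof -
  have "inj_on (\<lambda>(s, i). s @ [i]) (words d k \<times> {..<d})" by (auto simp: inj_on_def)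
  then show ?thesis unfolding words_Suc'
    by (subst sum.reindex, simp, subst sum.swap) (auto simp: sum.cartesian_product case_prod_unfold)
qed

lemma words_append: "\<lbrakk>r \<in> words d m; s \<in> words d k\<rbrakk> \<Longrightarrow> r @ s \<in> words d (m + k)"
  by (auto simp: words_def)

text \<open>The projections of the nested squares to either axis.\<close>

locale tiling =
  fixes d :: nat and T e :: "nat list \<Rightarrow> real"
  assumes T_Nil: "T [] = 1" and e_Nil: "e [] = 0"
    and T_pos: "s \<in> lists {..<d} \<Longrightarrow> T s > 0"
    and T_split: "s \<in> lists {..<d} \<Longrightarrow> (\<Sum>i<d. T (i # s)) = T s"
    and lower: "\<lbrakk>s \<in> lists {..<d}; i < d\<rbrakk> \<Longrightarrow> e s \<le> e (i # s)"
    and upper: "\<lbrakk>s \<in> lists {..<d}; i < d\<rbrakk> \<Longrightarrow> e (i # s) + T (i # s) \<le> e s + T s"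
    and siblings: "\<lbrakk>s \<in> lists {..<d}; i < d; j < d; i \<noteq> j\<rbrakk> \<Longrightarrow>
      e (i # s) + T (i # s) \<le> e (j # s) \<or> e (j # s) + T (j # s) \<le> e (i # s)"
begin

lemma sum_T_extension: "s \<in> lists {..<d} \<Longrightarrow> (\<Sum>r\<in>words d m. T (r @ s)) = T s"
proof (induction m)
  case (Suc m)
  have "(\<Sum>r\<in>words d (Suc m). T (r @ s)) = (\<Sum>r\<in>words d m. T (r @ s))"
    unfolding sum_words_Suc using Suc.prems by (intro sum.cong refl) (use T_split in \<open>auto simp: words_def\<close>)
  then show ?case using Suc by simp
qed simp

lemma sum_T: "(\<Sum>s\<in>words d k. T s) = 1"
  using sum_T_extension[of "[]" k] by (simp add: T_Nil)

lemma extension_bounds: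
  assumes "s \<in> lists {..<d}" "r \<in> lists {..<d}"
  shows "e s \<le> e (r @ s)" "e (r @ s) + T (r @ s) \<le> e s + T s"
proof -
  have "e s \<le> e (r @ s) \<and> e (r @ s) + T (r @ s) \<le> e s + T s"
    using assms(2)
  proof (induction rule: lists.induct)
    case (Cons i r)
    then have "r @ s \<in> lists {..<d}" "i < d" using assms(1) by auto
    then show ?case using lower[of "r @ s" i] upper[of "r @ s" i] Cons.IH by auto
  qed simp
  then show "e s \<le> e (r @ s)" "e (r @ s) + T (r @ s) \<le> e s + T s" by auto
qed

lemma unit_bounds: "s \<in> lists {..<d} \<Longrightarrow> 0 \<le> e s" "s \<in> lists {..<d} \<Longrightarrow> e s + T s \<le> 1"
  using extension_bounds[of "[]" s] by (simp_all add: T_Nil e_Nil)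

text \<open>Either the two words have the same parent and differ in their first letter, or the
  intervals of their parents are already separated.\<close>

lemma separated:
  "\<lbrakk>s \<in> words d k; s' \<in> words d k; s \<noteq> s'\<rbrakk> \<Longrightarrow> e s + T s \<le> e s' \<or> e s' + T s' \<le> e s"
proof (induction k arbitrary: s s')
  case (Suc k)
  obtain i r j r' where s: "s = i # r" "r \<in> words d k" "i < d" "s' = j # r'" "r' \<in> words d k" "j < d"
    using Suc.prems(1,2) unfolding words_Suc by auto
  have l: "r \<in> lists {..<d}" "r' \<in> lists {..<d}" using s by (auto simp: words_def)
  show ?case
  proof (cases "r = r'")
    case True
    then show ?thesis using siblings[OF l(1) s(3,6)] s Suc.prems(3) by auto
  next
    case False
    then show ?thesis using Suc.IH[OF s(2,5) False] lower[OF l(1) s(3)] upper[OF l(1) s(3)]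
        lower[OF l(2) s(6)] upper[OF l(2) s(6)] s by auto
  qed
qed simp

lemma separated_by_edge:
  assumes "s \<in> words d k" "s' \<in> words d k"
  shows "e s < e s' \<longleftrightarrow> s \<noteq> s' \<and> e s + T s \<le> e s'"
proof (cases "s = s'")
  case False
  then show ?thesis using separated[OF assms False] T_pos[of s] T_pos[of s'] assms unfolding words_def by auto
qed simp

lemma edge_inj: "inj_on e (words d k)"
proof (rule inj_onI)
  fix s s' assume s: "s \<in> words d k" "s' \<in> words d k" "e s = e s'"
  then show "s = s'" using separated[OF s(1,2)] T_pos[of s] T_pos[of s'] by (force simp: words_def)
qed

abbreviation cell :: "nat list \<Rightarrow> real set" where
  "cell s \<equiv> {e s<..<e s + T s}"

lemma disjoint_cells: "disjoint_family_on cell (words d k)"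
  unfolding disjoint_family_on_def using separated by fastforce

lemma emeasure_cells:
  assumes "S \<subseteq> words d k"
  shows "emeasure lborel (\<Union>s\<in>S. cell s) = ennreal (\<Sum>s\<in>S. T s)"
proof -
  have S: "finite S" using assms finite_subset by (metis finite_words)
  have T0: "T s \<ge> 0" if "s \<in> S" for s using that assms T_pos[of s] by (force simp: words_def)
  have "emeasure lborel (\<Union>s\<in>S. cell s) = (\<Sum>s\<in>S. emeasure lborel (cell s))"
    using S disjoint_family_on_mono[OF assms disjoint_cells] by (intro sum_emeasure[symmetric]) auto
  also have "\<dots> = (\<Sum>s\<in>S. ennreal (T s))" by (intro sum.cong refl) (use T0 in auto)
  finally show ?thesis using T0 by simp
qed

lemma emeasure_unif01_cells:
  assumes "S \<subseteq> words d k"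
  shows "emeasure unif01 (\<Union>s\<in>S. cell s) = ennreal (\<Sum>s\<in>S. T s)"
proof -
  have "{0..1} \<inter> (\<Union>s\<in>S. cell s) = (\<Union>s\<in>S. cell s)"
  proof -
    have "cell s \<subseteq> {0..1}" if "s \<in> S" for s
    proof -
      have "s \<in> lists {..<d}" using that assms by (auto simp: words_def)
      then show ?thesis using unit_bounds[of s] by auto
    qed
    then show ?thesis by blast
  qed
  moreover have "(\<Union>s\<in>S. cell s) \<in> sets borel" by (intro borel_open) auto
  ultimately show ?thesis using emeasure_cells[OF assms] by (simp add: emeasure_unif01)
qed

lemma sum_T_le:
  assumes "S \<subseteq> words d k" "p \<le> q" "\<And>s. s \<in> S \<Longrightarrow> p \<le> e s" "\<And>s. s \<in> S \<Longrightarrow> e s + T s \<le> q"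
  shows "(\<Sum>s\<in>S. T s) \<le> q - p"
proof -
  have "ennreal (\<Sum>s\<in>S. T s) = emeasure lborel (\<Union>s\<in>S. cell s)" using emeasure_cells[OF assms(1)] ..
  also have "\<dots> \<le> emeasure lborel {p..q}" 
  proof (intro emeasure_mono UN_least)
    fix s assume "s \<in> S"
    then show "cell s \<subseteq> {p..q}" using assms(3,4)[of s] by auto
  qed simp
  also have "\<dots> = ennreal (q - p)" using assms by simp
  finally show ?thesis using assms by (subst (asm) ennreal_le_iff) auto
qed

lemma AE_in_cell: "AE x in unif01. \<forall>k. \<exists>s\<in>words d k. x \<in> cell s"
proof (subst AE_all_countable, intro allI)
  fix k
  have "emeasure unif01 (\<Union>s\<in>words d k. cell s) = 1"
    using emeasure_unif01_cells[of "words d k" k] sum_T[of k] by simp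
  then have "measure unif01 (\<Union>s\<in>words d k. cell s) = 1" by (simp add: measure_def)
  moreover have "(\<Union>s\<in>words d k. cell s) \<in> sets unif01" unfolding sets_unif01 by (intro borel_open) auto
  ultimately have "AE x in unif01. x \<in> (\<Union>s\<in>words d k. cell s)"
    by (subst unif01.AE_in_set_eq_1) auto
  then show "AE x in unif01. \<exists>s\<in>words d k. x \<in> cell s" by simp
qed

text \<open>At most one interval of a level contains \<open>y\<close> in its interior.\<close>

lemma sum_T_side:
  assumes m: "\<And>s. s \<in> words d k \<Longrightarrow> T s \<le> m" and m0: "m \<ge> 0" and y: "0 \<le> y" "y \<le> 1"
  shows "(\<Sum>s\<in>{s\<in>words d k. e s + T s \<le> y}. T s) \<ge> y - m"
    and "(\<Sum>s\<in>{s\<in>words d k. y \<le> e s}. T s) \<ge> 1 - y - m"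
proof -
  let ?A = "{s\<in>words d k. e s + T s \<le> y}" and ?B = "{s\<in>words d k. y \<le> e s}"
  let ?C = "words d k - ?A - ?B"
  have T0: "T s > 0" if "s \<in> words d k" for s using that T_pos by (auto simp: words_def)
  have "(\<Sum>s\<in>?A. T s) \<le> y - 0"
    by (rule sum_T_le[of ?A k], blast, rule y, rule unit_bounds(1), auto simp: words_def)
  then have A: "(\<Sum>s\<in>?A. T s) \<le> y" by simp
  have B: "(\<Sum>s\<in>?B. T s) \<le> 1 - y"
    by (rule sum_T_le[of ?B k], blast, rule y, blast, rule unit_bounds(2), auto simp: words_def)
  have C: "(\<Sum>s\<in>?C. T s) \<le> m"
  proof (cases "?C = {}")
    case False
    then obtain s where s: "s \<in> ?C" by blast
    have "s' = s" if "s' \<in> ?C" for s'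
    proof (rule ccontr)
      assume "s' \<noteq> s"
      moreover have "s \<in> words d k" "s' \<in> words d k" using s that by auto
      ultimately have "e s' + T s' \<le> e s \<or> e s + T s \<le> e s'" using separated by blast
      moreover have "e s < y" "y < e s + T s" "e s' < y" "y < e s' + T s'" using s that by auto
      ultimately show False by linarith
    qed
    then have "?C = {s}" using s by blast
    then show ?thesis using s m by auto
  qed (use m0 in \<open>simp only: sum.empty\<close>)
  have "1 = (\<Sum>s\<in>?A \<union> (?B \<union> ?C). T s)"
    unfolding sum_T[of k, symmetric] by (rule sum.cong) auto
  also have "\<dots> = (\<Sum>s\<in>?A. T s) + ((\<Sum>s\<in>?B. T s) + (\<Sum>s\<in>?C. T s))"
  proof -
    have "?A \<inter> ?B = {}" using T0 by force
    then have "?A \<inter> (?B \<union> ?C) = {}" "?B \<inter> ?C = {}" by blast+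
    then show ?thesis by (subst sum.union_disjoint, simp, simp, simp, subst sum.union_disjoint) auto
  qed
  finally have "1 = (\<Sum>s\<in>?A. T s) + ((\<Sum>s\<in>?B. T s) + (\<Sum>s\<in>?C. T s))" .
  then show "(\<Sum>s\<in>?A. T s) \<ge> y - m" "(\<Sum>s\<in>?B. T s) \<ge> 1 - y - m" using A B C by linarith+
qed

end

text \<open>The almost sure event on which the deterministic geometry takes place. The sum of
  squares is the probability that two points fall into the same square of level \<open>k\<close>; it
  is used as a measure of the mesh because its mean can be computed exactly.\<close>

definition good :: "nat \<Rightarrow> (nat list \<Rightarrow> nat \<Rightarrow> nat) \<Rightarrow> (nat list \<Rightarrow> nat \<Rightarrow> real) \<Rightarrow> bool" where
  "good d a u \<longleftrightarrow> (\<forall>s\<in>lists {..<d}. a s \<in> Sym d \<and> (\<forall>i<d. gap d (u s) i > 0)) \<and>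
     (\<lambda>k. \<Sum>s\<in>words d k. (side d u s)\<^sup>2) \<longlonglongrightarrow> 0"

section \<open>Geometry of a good realization\<close>

lemma side_pos:
  assumes "\<And>s i. s \<in> lists {..<d} \<Longrightarrow> i < d \<Longrightarrow> gap d (u s) i > 0" "s \<in> lists {..<d}"
  shows "side d u s > 0"
  using assms(2) by (induction s) (auto intro!: mult_pos_pos assms(1))

locale good_squares =
  fixes d :: nat and a :: "nat list \<Rightarrow> nat \<Rightarrow> nat" and u :: "nat list \<Rightarrow> nat \<Rightarrow> real"
  assumes d: "d \<ge> 2" and good: "good d a u"
begin

lemma gap_pos': "\<lbrakk>s \<in> lists {..<d}; i < d\<rbrakk> \<Longrightarrow> gap d (u s) i > 0"
  using good by (simp add: good_def)

lemma a_inj: "\<lbrakk>s \<in> lists {..<d}; i < d; j < d; a s (Suc i) = a s (Suc j)\<rbrakk> \<Longrightarrow> i = j"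
  using good permutes_inj[of "a s" "{1..d}"] by (auto simp: good_def Sym_def inj_def)

lemma side_pos': "s \<in> lists {..<d} \<Longrightarrow> side d u s > 0"
  using side_pos gap_pos' by blast

lemma side_split: "(\<Sum>i<d. side d u (i # s)) = side d u s"
  using d by (simp add: sum_distrib_left[symmetric] sum_gap_all)

lemma partial_gaps:
  assumes s: "s \<in> lists {..<d}" and J: "J \<subseteq> {..<d}" "i < d" "i \<notin> J"
  shows "0 \<le> (\<Sum>j\<in>J. gap d (u s) j)" "(\<Sum>j\<in>J. gap d (u s) j) + gap d (u s) i \<le> 1"
proof -
  have fin: "finite J" using J finite_subset by blast
  show "0 \<le> (\<Sum>j\<in>J. gap d (u s) j)" using gap_pos'[OF s] J by (intro sum_nonneg) (auto intro: less_imp_le)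
  have "(\<Sum>j\<in>J. gap d (u s) j) + gap d (u s) i = (\<Sum>j\<in>insert i J. gap d (u s) j)" using fin J by simp
  also have "\<dots> \<le> (\<Sum>j<d. gap d (u s) j)" using gap_pos'[OF s] J by (intro sum_mono2) (auto intro: less_imp_le)
  finally show "(\<Sum>j\<in>J. gap d (u s) j) + gap d (u s) i \<le> 1" using d by (simp add: sum_gap_all)
qed

lemma partial_gaps_mono:
  assumes s: "s \<in> lists {..<d}" and J: "insert i J \<subseteq> J'" "J' \<subseteq> {..<d}" "i \<notin> J"
  shows "(\<Sum>j\<in>J. gap d (u s) j) + gap d (u s) i \<le> (\<Sum>j\<in>J'. gap d (u s) j)"
proof -
  have fin: "finite J" "finite J'" using J finite_subset[of _ "{..<d}"] by auto
  have "(\<Sum>j\<in>J. gap d (u s) j) + gap d (u s) i = (\<Sum>j\<in>insert i J. gap d (u s) j)" using fin J by simp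
  also have "\<dots> \<le> (\<Sum>j\<in>J'. gap d (u s) j)" using fin J gap_pos'[OF s] by (intro sum_mono2) (auto intro: less_imp_le)
  finally show ?thesis .
qed

lemma scale:
  fixes T x y :: real
  shows "T > 0 \<Longrightarrow> 0 \<le> x \<Longrightarrow> e \<le> e + T * x"
    and "T > 0 \<Longrightarrow> x + y \<le> 1 \<Longrightarrow> e + T * x + T * y \<le> e + T"
    and "T > 0 \<Longrightarrow> x + y \<le> z \<Longrightarrow> e + T * x + T * y \<le> e + T * z"
  by (auto simp: distrib_left[symmetric] mult_le_cancel_left1 mult_left_le add.assoc)

sublocale horizontal: tiling d "side d u" "left_edge d u"
proof
  fix s i j assume s: "s \<in> lists {..<d}"
  show "side d u s > 0" using side_pos'[OF s] .
  show "(\<Sum>i<d. side d u (i # s)) = side d u s" by (rule side_split)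
  show "left_edge d u s \<le> left_edge d u (i # s)" if "i < d"
    using that partial_gaps(1)[OF s, of "{..<i}" i] side_pos'[OF s] by (simp add: scale)
  show "left_edge d u (i # s) + side d u (i # s) \<le> left_edge d u s + side d u s" if "i < d"
    using that partial_gaps(2)[OF s, of "{..<i}" i] side_pos'[OF s] by (simp add: scale)
  have *: "left_edge d u (i # s) + side d u (i # s) \<le> left_edge d u (j # s)" if "i < j" "j < d" for i j
    using that partial_gaps_mono[OF s, of i "{..<i}" "{..<j}"] side_pos'[OF s] by (simp add: scale)
  show "left_edge d u (i # s) + side d u (i # s) \<le> left_edge d u (j # s) \<or>
     left_edge d u (j # s) + side d u (j # s) \<le> left_edge d u (i # s)" if "i < d" "j < d" "i \<noteq> j"
    using *[of i j] *[of j i] that by (cases "i < j") auto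
qed simp_all

sublocale vertical: tiling d "side d u" "bottom_edge d a u"
proof
  fix s i j assume s: "s \<in> lists {..<d}"
  let ?J = "\<lambda>i. {j. j < d \<and> a s (Suc j) < a s (Suc i)}"
  show "side d u s > 0" using side_pos'[OF s] .
  show "(\<Sum>i<d. side d u (i # s)) = side d u s" by (rule side_split)
  have J: "?J i \<subseteq> {..<d}" "i \<notin> ?J i" for i by auto
  show "bottom_edge d a u s \<le> bottom_edge d a u (i # s)" if "i < d"
    using partial_gaps(1)[OF s J(1) that J(2)] side_pos'[OF s] by (simp add: scale)
  show "bottom_edge d a u (i # s) + side d u (i # s) \<le> bottom_edge d a u s + side d u s" if "i < d"
    using partial_gaps(2)[OF s J(1) that J(2)] side_pos'[OF s] by (simp add: scale)
  have *: "bottom_edge d a u (i # s) + side d u (i # s) \<le> bottom_edge d a u (j # s)"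
    if "a s (Suc i) < a s (Suc j)" "i < d" for i j
  proof -
    have "insert i (?J i) \<subseteq> ?J j" using that by auto
    from partial_gaps_mono[OF s this J(1) J(2)] show ?thesis using side_pos'[OF s] by (simp add: scale)
  qed
  show "bottom_edge d a u (i # s) + side d u (i # s) \<le> bottom_edge d a u (j # s) \<or>
     bottom_edge d a u (j # s) + side d u (j # s) \<le> bottom_edge d a u (i # s)" if "i < d" "j < d" "i \<noteq> j"
    using *[of i j] *[of j i] that a_inj[OF s, of i j] by (cases "a s (Suc i) < a s (Suc j)") force+
qed simp_all

text \<open>The square of the largest side is at most the sum of all squared sides.\<close>

lemma mesh:
  assumes "\<epsilon> > 0"
  shows "\<exists>K. \<forall>k\<ge>K. \<forall>s\<in>words d k. side d u s < \<epsilon>"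
proof -
  have "(\<lambda>k. \<Sum>s\<in>words d k. (side d u s)\<^sup>2) \<longlonglongrightarrow> 0" using good by (simp add: good_def)
  then have "\<forall>\<^sub>F k in sequentially. (\<Sum>s\<in>words d k. (side d u s)\<^sup>2) < \<epsilon>\<^sup>2"
    using assms by (intro order_tendstoD) auto
  then obtain K where K: "\<And>k. k \<ge> K \<Longrightarrow> (\<Sum>s\<in>words d k. (side d u s)\<^sup>2) < \<epsilon>\<^sup>2"
    unfolding eventually_sequentially by blast
  show ?thesis
  proof (intro exI[of _ K] allI impI ballI)
    fix k s assume k: "k \<ge> K" and s: "s \<in> words d k"
    have "(side d u s)\<^sup>2 \<le> (\<Sum>s\<in>words d k. (side d u s)\<^sup>2)" using s by (intro member_le_sum) auto
    then have "(side d u s)\<^sup>2 < \<epsilon>\<^sup>2" using K[OF k] by linarith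
    then show "side d u s < \<epsilon>" using assms by (intro power_less_imp_less_base[of _ 2 \<epsilon>]) auto
  qed
qed

end

section \<open>Existence of the limit as a measure on a graph\<close>

context good_squares
begin

text \<open>The limit permuton is carried by the graph of a measure-preserving function.\<close>

definition height_at :: "nat \<Rightarrow> real \<Rightarrow> real" where
  "height_at k x = (\<Sum>s\<in>words d k. bottom_edge d a u s * indicator (horizontal.cell s) x)"

definition height :: "real \<Rightarrow> real" where
  "height x = lim (\<lambda>k. height_at k x)"

definition addressed :: "real \<Rightarrow> bool" where
  "addressed x \<longleftrightarrow> (\<forall>k. \<exists>s\<in>words d k. x \<in> horizontal.cell s)"

lemma AE_addressed: "AE x in unif01. addressed x"
  unfolding addressed_def by (rule horizontal.AE_in_cell)

lemma cell_unique: "\<lbrakk>s \<in> words d k; s' \<in> words d k; x \<in> horizontal.cell s; x \<in> horizontal.cell s'\<rbrakk> \<Longrightarrow> s = s'"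
  using horizontal.disjoint_cells[of k] unfolding disjoint_family_on_def by blast

lemma sum_indicator_cell:
  assumes "s \<in> words d k" "x \<in> horizontal.cell s"
  shows "(\<Sum>s'\<in>words d k. F s' * indicator (horizontal.cell s') x) = (F s :: real)"
proof -
  have "(\<Sum>s'\<in>words d k. F s' * indicator (horizontal.cell s') x) = (\<Sum>s'\<in>words d k. if s' = s then F s else 0)"
  proof (rule sum.cong[OF refl])
    fix s' assume "s' \<in> words d k"
    then have "x \<in> horizontal.cell s' \<longleftrightarrow> s' = s" using cell_unique[OF _ assms(1) _ assms(2)] assms(2) by blast
    then show "F s' * indicator (horizontal.cell s') x = (if s' = s then F s else 0)"
      by (simp only: indicator_def if_distrib[of "(*) _"] mult_1_right mult_zero_right split: if_split) simp
  qed
  then show ?thesis using assms by simp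
qed

lemma height_at_measurable [measurable]: "height_at k \<in> borel_measurable borel"
  unfolding height_at_def by measurable

lemma height_measurable [measurable]: "height \<in> borel_measurable borel"
  unfolding height_def by measurable

lemma height_at_bounds:
  assumes x: "addressed x" and s: "s \<in> words d k" "x \<in> horizontal.cell s" and k: "k' \<ge> k"
  shows "bottom_edge d a u s \<le> height_at k' x" "height_at k' x \<le> bottom_edge d a u s + side d u s"
proof -
  obtain s' where s': "s' \<in> words d k'" "x \<in> horizontal.cell s'" using x unfolding addressed_def by blast
  define r s0 where "r = take (k' - k) s'" and "s0 = drop (k' - k) s'"
  have rs: "s' = r @ s0" "s0 \<in> words d k" "r \<in> lists {..<d}" "s0 \<in> lists {..<d}"
    using s' k unfolding r_def s0_def words_def
    by (auto simp: in_lists_conv_set dest: in_set_dropD in_set_takeD)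
  have "x \<in> horizontal.cell s0"
    using s'(2) horizontal.extension_bounds[OF rs(4,3)] by (auto simp: rs(1))
  then have "s0 = s" using cell_unique[OF rs(2) s(1) _ s(2)] by blast
  moreover have "height_at k' x = bottom_edge d a u s'"
    unfolding height_at_def by (rule sum_indicator_cell[OF s'])
  moreover have "side d u s' > 0" using side_pos'[of s'] s'(1) by (simp add: words_def)
  ultimately show "bottom_edge d a u s \<le> height_at k' x" "height_at k' x \<le> bottom_edge d a u s + side d u s"
    using vertical.extension_bounds[OF rs(4,3)] rs(1) by auto
qed

lemma height_at_tendsto:
  assumes x: "addressed x"
  shows "(\<lambda>k. height_at k x) \<longlonglongrightarrow> height x"
proof -
  have "Cauchy (\<lambda>k. height_at k x)"
  proof (rule metric_CauchyI)
    fix \<epsilon> :: real assume "\<epsilon> > 0"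
    then obtain K where K: "\<forall>k\<ge>K. \<forall>s\<in>words d k. side d u s < \<epsilon>" using mesh by blast
    obtain s where s: "s \<in> words d K" "x \<in> horizontal.cell s" using x unfolding addressed_def by blast
    show "\<exists>K. \<forall>m\<ge>K. \<forall>n\<ge>K. dist (height_at m x) (height_at n x) < \<epsilon>"
    proof (intro exI[of _ K] allI impI)
      fix m n assume "m \<ge> K" "n \<ge> K"
      then have "\<bar>height_at m x - height_at n x\<bar> \<le> side d u s"
        using height_at_bounds[OF x s, of m] height_at_bounds[OF x s, of n] by linarith
      then show "dist (height_at m x) (height_at n x) < \<epsilon>" using order.strict_trans1[OF _ K[rule_format, OF order_refl s(1)]] by (simp add: dist_real_def)
    qed
  qed
  then show ?thesis unfolding height_def by (simp add: Cauchy_convergent_iff convergent_LIMSEQ_iff)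
qed

lemma height_bounds:
  assumes x: "addressed x" and s: "s \<in> words d k" "x \<in> horizontal.cell s"
  shows "bottom_edge d a u s \<le> height x" "height x \<le> bottom_edge d a u s + side d u s"
  using height_at_bounds[OF x s] height_at_tendsto[OF x]
  by (auto intro: LIMSEQ_le_const LIMSEQ_le_const2)

definition graph_measure :: "(real \<times> real) measure" where
  "graph_measure = distr unif01 borel (\<lambda>x. (x, height x))"

text \<open>At level \<open>k\<close> the heights are known up to the mesh. The squares entirely
  below \<open>z\<close> have total side at least z minus the mesh, and their horizontal projections
  have the same total length. Lower bounds of this kind on both sides of \<open>z\<close> leave no
  room and force equality.\<close>

lemma height_cdf:
  assumes y: "0 \<le> y" "y \<le> 1"
  shows "measure unif01 {x. height x \<le> y} = y" "measure unif01 {x. height x < y} = y"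
proof -
  have le: "measure unif01 {x. height x \<le> z} \<ge> z - \<epsilon> \<and> measure unif01 {x. height x \<ge> z} \<ge> 1 - z - \<epsilon>"
    if z: "0 \<le> z" "z \<le> 1" and e: "\<epsilon> > 0" for z \<epsilon>
  proof -
    obtain k where k: "\<forall>s\<in>words d k. side d u s < \<epsilon>" using mesh[OF e] by blast
    have m: "measure unif01 (\<Union>s\<in>S. horizontal.cell s) = (\<Sum>s\<in>S. side d u s)" if S: "S \<subseteq> words d k" for S
    proof -
      have "(\<Sum>s\<in>S. side d u s) \<ge> 0" using S side_pos' by (intro sum_nonneg) (force simp: words_def intro: less_imp_le)
      then show ?thesis using horizontal.emeasure_unif01_cells[OF S] by (simp add: measure_def)
    qed
    let ?A = "{s\<in>words d k. bottom_edge d a u s + side d u s \<le> z}" and ?B = "{s\<in>words d k. z \<le> bottom_edge d a u s}"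
    have "(\<Sum>s\<in>?A. side d u s) = measure unif01 (\<Union>s\<in>?A. horizontal.cell s)" by (rule m[symmetric]) auto
    also have "\<dots> \<le> measure unif01 {x. height x \<le> z}"
    proof (rule unif01.finite_measure_mono_AE)
      show "AE x in unif01. x \<in> (\<Union>s\<in>?A. horizontal.cell s) \<longrightarrow> x \<in> {x. height x \<le> z}"
      proof (use AE_addressed in eventually_elim, intro impI)
        fix x assume x: "addressed x" "x \<in> (\<Union>s\<in>?A. horizontal.cell s)"
        then obtain s where s: "s \<in> words d k" "bottom_edge d a u s + side d u s \<le> z" "x \<in> horizontal.cell s" by blast
        show "x \<in> {x. height x \<le> z}" using height_bounds(2)[OF x(1) s(1,3)] s(2) by simp
      qed
    qed measurable
    finally have 1: "measure unif01 {x. height x \<le> z} \<ge> (\<Sum>s\<in>?A. side d u s)" .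
    have "(\<Sum>s\<in>?B. side d u s) = measure unif01 (\<Union>s\<in>?B. horizontal.cell s)" by (rule m[symmetric]) auto
    also have "\<dots> \<le> measure unif01 {x. height x \<ge> z}"
    proof (rule unif01.finite_measure_mono_AE)
      show "AE x in unif01. x \<in> (\<Union>s\<in>?B. horizontal.cell s) \<longrightarrow> x \<in> {x. height x \<ge> z}"
      proof (use AE_addressed in eventually_elim, intro impI)
        fix x assume x: "addressed x" "x \<in> (\<Union>s\<in>?B. horizontal.cell s)"
        then obtain s where s: "s \<in> words d k" "z \<le> bottom_edge d a u s" "x \<in> horizontal.cell s" by blast
        show "x \<in> {x. height x \<ge> z}" using height_bounds(1)[OF x(1) s(1,3)] s(2) by simp
      qed
    qed measurable
    finally have 2: "measure unif01 {x. height x \<ge> z} \<ge> (\<Sum>s\<in>?B. side d u s)" .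
    have "side d u s \<le> \<epsilon>" if "s \<in> words d k" for s using k that by (simp add: less_imp_le)
    note side = vertical.sum_T_side[of k \<epsilon> z, OF this less_imp_le[OF e] z]
    show ?thesis using order.trans[OF side(1) 1] order.trans[OF side(2) 2] by blast
  qed
  have limit: "A \<ge> B" if "\<And>\<epsilon>. \<epsilon> > 0 \<Longrightarrow> A \<ge> B - \<epsilon>" for A B :: real
  proof (rule field_le_epsilon)
    show "B \<le> A + \<epsilon>" if "\<epsilon> > 0" for \<epsilon> using \<open>\<And>\<epsilon>. \<epsilon> > 0 \<Longrightarrow> A \<ge> B - \<epsilon>\<close>[OF that] by linarith
  qed
  have a: "measure unif01 {x. height x \<le> z} \<ge> z" "measure unif01 {x. height x \<ge> z} \<ge> 1 - z"
    if "0 \<le> z" "z \<le> 1" for z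
    by (rule limit, use le[OF that] in blast)+
  have compl: "measure unif01 {x. height x < z} = 1 - measure unif01 {x. height x \<ge> z}" for z
  proof -
    have "{x. height x \<ge> z} \<in> unif01.events" by measurable
    from unif01.prob_compl[OF this] have "measure unif01 (space unif01 - {x. height x \<ge> z}) = 1 - measure unif01 {x. height x \<ge> z}" .
    moreover have "space unif01 - {x. height x \<ge> z} = {x. height x < z}" by auto
    ultimately show ?thesis by simp
  qed
  have b: "measure unif01 {x. height x < z} \<le> z" if "0 \<le> z" "z \<le> 1" for z
    using a(2)[OF that] compl[of z] by simp
  \<comment> \<open>An atom of the height at \<open>y\<close> is excluded by comparison with the
    strict inequality at a slightly larger level.\<close>
  have c: "measure unif01 {x. height x \<le> y} \<le> y"
  proof (cases "y = 1")
    case False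
    show ?thesis
    proof (rule field_le_epsilon)
      fix \<epsilon> :: real assume e: "\<epsilon> > 0"
      define z where "z = min 1 (y + \<epsilon>)"
      have z: "y < z" "0 \<le> z" "z \<le> 1" "z \<le> y + \<epsilon>" using False y e by (auto simp: z_def)
      have "measure unif01 {x. height x \<le> y} \<le> measure unif01 {x. height x < z}"
        by (rule unif01.finite_measure_mono) (use z in auto)
      then show "measure unif01 {x. height x \<le> y} \<le> y + \<epsilon>" using b[OF z(2,3)] z by linarith
    qed
  qed simp
  show 1: "measure unif01 {x. height x \<le> y} = y" using c a(1)[OF y] by linarith
  have "measure unif01 {x. height x < y} \<ge> y"
  proof (rule field_le_epsilon)
    fix \<epsilon> :: real assume e: "\<epsilon> > 0"
    show "y \<le> measure unif01 {x. height x < y} + \<epsilon>"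
    proof (cases "y - \<epsilon> < 0")
      case False
      have "measure unif01 {x. height x \<le> y - \<epsilon>} \<le> measure unif01 {x. height x < y}"
        by (rule unif01.finite_measure_mono) (use e in auto)
      then show ?thesis using a(1)[of "y - \<epsilon>"] False y e by simp
    qed (use measure_nonneg[of unif01 "{x. height x < y}"] in linarith)
  qed
  then show "measure unif01 {x. height x < y} = y" using b[OF y] by linarith
qed

lemma distr_height: "distr unif01 borel height = unif01"
proof (rule cdf_unique)
  interpret D: prob_space "distr unif01 borel height" by (rule unif01.prob_space_distr) simp
  show "real_distribution (distr unif01 borel height)" by unfold_locales auto
  show "real_distribution unif01" by unfold_locales auto
  show "cdf (distr unif01 borel height) = cdf unif01"
  proof
    fix y
    have l: "cdf (distr unif01 borel height) y = measure unif01 {x. height x \<le> y}"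
      by (simp add: cdf_def measure_distr vimage_def)
    have r: "cdf unif01 y = measure lborel ({0..1} \<inter> {..y})"
      by (simp add: cdf_def measure_def emeasure_unif01)
    consider "y < 0" | "0 \<le> y" "y \<le> 1" | "y > 1" by linarith
    then show "cdf (distr unif01 borel height) y = cdf unif01 y"
    proof cases
      case 1
      have "measure unif01 {x. height x \<le> y} \<le> measure unif01 {x. height x \<le> 0}"
        by (rule unif01.finite_measure_mono) (use 1 in auto)
      then have "measure unif01 {x. height x \<le> y} = 0"
        using height_cdf(1)[of 0] measure_nonneg[of unif01 "{x. height x \<le> y}"] by simp
      moreover have "{0..1} \<inter> {..y} = {}" using 1 by auto
      ultimately show ?thesis using l r by simp
    next
      case 2
      have "{0..1} \<inter> {..y} = {0..y}" using 2 by auto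
      then show ?thesis using l r 2 height_cdf(1)[OF 2] by simp
    next
      case 3
      have "measure unif01 {x. height x \<le> 1} \<le> measure unif01 {x. height x \<le> y}"
        by (rule unif01.finite_measure_mono) (use 3 in auto)
      then have "measure unif01 {x. height x \<le> y} = 1"
        using height_cdf(1)[of 1] unif01.prob_le_1[of "{x. height x \<le> y}"] by simp
      moreover have "{0..1} \<inter> {..y} = {0..1::real}" using 3 by auto
      ultimately show ?thesis using l r by simp
    qed
  qed
qed

lemma permuton_graph_measure: "permuton graph_measure"
  unfolding permuton_def
proof (intro conjI)
  show "prob_space graph_measure" unfolding graph_measure_def by (rule unif01.prob_space_distr) simp
  show "sets graph_measure = sets borel" by (simp add: graph_measure_def)
  have "distr graph_measure borel fst = distr unif01 borel (\<lambda>x. x)"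
    unfolding graph_measure_def by (subst distr_distr) (auto simp: comp_def borel_prod[symmetric])
  also have "\<dots> = unif01" by (rule distr_id2) simp
  finally show "distr graph_measure borel fst = unif01" .
  have "distr graph_measure borel snd = distr unif01 borel height"
    unfolding graph_measure_def by (subst distr_distr) (auto simp: comp_def borel_prod[symmetric])
  then show "distr graph_measure borel snd = unif01" using distr_height by simp
qed

end

section \<open>Weak convergence and the mass of the squares\<close>

context good_squares
begin

abbreviation corner :: "nat list \<Rightarrow> real \<times> real" where
  "corner s \<equiv> (left_edge d u s, bottom_edge d a u s)"

lemma square_eq_cbox: "square d a u s = cbox (corner s) (left_edge d u s + side d u s, bottom_edge d a u s + side d u s)"
  by (simp add: square_def cbox_Pair_eq)

lemma emeasure_square: "s \<in> lists {..<d} \<Longrightarrow> emeasure lborel (square d a u s) = ennreal ((side d u s)\<^sup>2)"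
proof -
  assume s: "s \<in> lists {..<d}"
  have "emeasure (lborel :: (real \<times> real) measure) (square d a u s)
     = emeasure (lborel \<Otimes>\<^sub>M lborel) ({left_edge d u s .. left_edge d u s + side d u s}
                  \<times> {bottom_edge d a u s .. bottom_edge d a u s + side d u s})"
    by (simp add: square_def lborel_prod)
  also have "\<dots> = ennreal (side d u s) * ennreal (side d u s)"
    using side_pos'[OF s] by (subst lborel.emeasure_pair_measure_Times) auto
  finally show ?thesis using side_pos'[OF s] by (simp add: power2_eq_square ennreal_mult)
qed

lemma square_borel [measurable]: "square d a u s \<in> sets borel"
  unfolding square_eq_cbox by simp

lemma words_lists: "s \<in> words d k \<Longrightarrow> s \<in> lists {..<d}"
  by (simp add: words_def)

lemma level_permuton_eq:
  "level_permuton d a u k = density lborel (\<lambda>z. ennreal (\<Sum>s\<in>words d k. indicator (square d a u s) z / side d u s))"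
proof -
  have "ennreal (side d u s) * indicator (square d a u s) z / emeasure lborel (square d a u s)
     = ennreal (indicator (square d a u s) z / side d u s)" if "s \<in> words d k" for s z
  proof -
    have "s \<in> lists {..<d}" using that by (rule words_lists)
    then show ?thesis unfolding emeasure_square[OF \<open>s \<in> lists {..<d}\<close>] using side_pos'[of s]
      by (auto simp: indicator_def divide_ennreal power2_eq_square)
  qed
  moreover have "{s. s \<in> lists {..<d} \<and> length s = k} = words d k" by (simp add: words_def)
  moreover have "(\<Sum>s\<in>words d k. ennreal (indicator (square d a u s) z / side d u s)) = ennreal (\<Sum>s\<in>words d k. indicator (square d a u s) z / side d u s)" for z
    by (rule sum_ennreal) (use side_pos' words_lists in \<open>auto intro!: divide_nonneg_pos\<close>)
  ultimately show ?thesis unfolding level_permuton_def by (simp cong: sum.cong)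
qed

lemma integrable_square:
  fixes f :: "real \<times> real \<Rightarrow> real"
  assumes "continuous_on UNIV f"
  shows "integrable lborel (\<lambda>z. indicator (square d a u s) z * f z)"
  using borel_integrable_compact[of "square d a u s" f] continuous_on_subset[OF assms subset_UNIV]
  by (simp add: square_eq_cbox compact_cbox if_distrib indicator_def)

lemma integral_level_permuton:
  fixes f :: "real \<times> real \<Rightarrow> real"
  assumes f: "continuous_on UNIV f"
  shows "(\<integral>z. f z \<partial>level_permuton d a u k)
    = (\<Sum>s\<in>words d k. (\<integral>z. indicator (square d a u s) z * f z \<partial>lborel) / side d u s)"
proof -
  have [measurable]: "f \<in> borel_measurable borel" using f by (rule borel_measurable_continuous_onI)
  have "(\<integral>z. f z \<partial>level_permuton d a u k) = (\<integral>z. (\<Sum>s\<in>words d k. indicator (square d a u s) z / side d u s) * f z \<partial>lborel)"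
    unfolding level_permuton_eq
    by (subst integral_density) (auto intro!: sum_nonneg divide_nonneg_pos side_pos' dest: words_lists)
  also have "\<dots> = (\<integral>z. (\<Sum>s\<in>words d k. (indicator (square d a u s) z * f z) / side d u s) \<partial>lborel)"
    by (simp add: sum_distrib_right)
  also have "\<dots> = (\<Sum>s\<in>words d k. (\<integral>z. (indicator (square d a u s) z * f z) / side d u s \<partial>lborel))"
    by (intro Bochner_Integration.integral_sum integrable_divide integrable_square f)
  finally show ?thesis by simp
qed

lemma integral_square_const:
  assumes "s \<in> lists {..<d}"
  shows "(\<integral>z. indicator (square d a u s) z * (c::real) \<partial>lborel) = (side d u s)\<^sup>2 * c"
  using emeasure_square[OF assms] by (simp add: measure_def)

lemma dist_corner:
  assumes "s \<in> lists {..<d}" "z \<in> square d a u s"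
  shows "dist z (corner s) \<le> 2 * side d u s"
proof -
  have "dist z (corner s) \<le> \<bar>fst z - left_edge d u s\<bar> + \<bar>snd z - bottom_edge d a u s\<bar>"
    by (cases z) (auto simp: dist_Pair_Pair dist_real_def intro: sqrt_sum_squares_le_sum_abs[THEN order.trans])
  then show ?thesis using assms(2) by (auto simp: square_def)
qed

lemma square_subset_unit: "s \<in> lists {..<d} \<Longrightarrow> square d a u s \<subseteq> {0..1} \<times> {0..1}"
  using horizontal.unit_bounds[of s] vertical.unit_bounds[of s] by (auto simp: square_def)

text \<open>Both measures give mass \<open>side d u s\<close> to the square at \<open>s\<close>, and
  a continuous function hardly varies on a small square. Both integrals are therefore close to the
  same sum over the corners, with weights the sides.\<close>

lemma weakly_converges_graph_measure: "weakly_converges (level_permuton d a u) graph_measure"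
  unfolding weakly_converges_def
proof (intro allI impI, elim conjE)
  fix f :: "real \<times> real \<Rightarrow> real" assume f: "continuous_on UNIV f" and bd: "bounded (range f)"
  have [measurable]: "f \<in> borel_measurable borel" using f by (rule borel_measurable_continuous_onI)
  obtain B where B: "\<And>z. \<bar>f z\<bar> \<le> B" using bd by (auto simp: bounded_iff)
  have "uniformly_continuous_on ({0..1} \<times> {0..1}) f"
    by (rule compact_uniformly_continuous[OF continuous_on_subset[OF f]]) (auto intro: compact_Times)
  note uc = this[unfolded uniformly_continuous_on_def, rule_format]
  have i: "integrable unif01 (\<lambda>x. indicator (horizontal.cell s) x * f (x, height x))" for s
    by (rule unif01.integrable_const_bound[where B = B])
       (use B in \<open>auto simp: indicator_def intro: order.trans[OF abs_ge_zero] intro!: AE_I2\<close>)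
  have I: "(\<integral>z. f z \<partial>graph_measure) = (\<Sum>s\<in>words d k. \<integral>x. indicator (horizontal.cell s) x * f (x, height x) \<partial>unif01)" for k
  proof -
    have "(\<integral>z. f z \<partial>graph_measure) = (\<integral>x. f (x, height x) \<partial>unif01)"
      unfolding graph_measure_def by (subst integral_distr) auto
    also have "\<dots> = (\<integral>x. (\<Sum>s\<in>words d k. indicator (horizontal.cell s) x * f (x, height x)) \<partial>unif01)"
    proof (rule integral_cong_AE)
      show "AE x in unif01. f (x, height x) = (\<Sum>s\<in>words d k. indicator (horizontal.cell s) x * f (x, height x))"
      proof (use AE_addressed in eventually_elim)
        fix x assume "addressed x"
        then obtain s where s: "s \<in> words d k" "x \<in> horizontal.cell s" unfolding addressed_def by blast
        show "f (x, height x) = (\<Sum>s\<in>words d k. indicator (horizontal.cell s) x * f (x, height x))"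
          using sum_indicator_cell[OF s, of "\<lambda>_. f (x, height x)"] by (simp only: mult.commute)
      qed
    qed measurable
    also have "\<dots> = (\<Sum>s\<in>words d k. \<integral>x. indicator (horizontal.cell s) x * f (x, height x) \<partial>unif01)"
      by (rule Bochner_Integration.integral_sum) (rule i)
    finally show ?thesis .
  qed
  show "(\<lambda>k. \<integral>z. f z \<partial>level_permuton d a u k) \<longlonglongrightarrow> (\<integral>z. f z \<partial>graph_measure)"
  proof (rule LIMSEQ_I)
    fix r :: real assume r: "r > 0"
    define \<epsilon> where "\<epsilon> = r / 3"
    have e: "\<epsilon> > 0" using r by (simp add: \<epsilon>_def)
    obtain \<delta> where \<delta>: "\<delta> > 0" "\<And>z z'. z \<in> {0..1} \<times> {0..1} \<Longrightarrow> z' \<in> {0..1} \<times> {0..1} \<Longrightarrow> dist z' z < \<delta> \<Longrightarrow> dist (f z') (f z) < \<epsilon>"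
      using uc[OF e] by metis
    obtain K where K: "\<forall>k\<ge>K. \<forall>s\<in>words d k. side d u s < \<delta> / 2" using mesh[of "\<delta> / 2"] \<delta> by auto
    show "\<exists>K. \<forall>k\<ge>K. norm ((\<integral>z. f z \<partial>level_permuton d a u k) - (\<integral>z. f z \<partial>graph_measure)) < r"
    proof (intro exI[of _ K] allI impI)
      fix k assume k: "k \<ge> K"
      have near: "\<bar>f z - f (corner s)\<bar> \<le> \<epsilon>" if s: "s \<in> words d k" and z: "z \<in> square d a u s" for s z
      proof -
        have sl: "s \<in> lists {..<d}" using s by (rule words_lists)
        have "corner s \<in> square d a u s" using side_pos'[OF sl] by (simp add: square_def)
        moreover have "2 * side d u s < \<delta>" using K[rule_format, OF k s] by linarith
        ultimately show ?thesis
          using \<delta>(2)[of "corner s" z] square_subset_unit[OF sl] dist_corner[OF sl z] z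
          by (force simp: dist_real_def)
      qed
      have 1: "\<bar>(\<integral>z. indicator (square d a u s) z * f z \<partial>lborel) / side d u s - side d u s * f (corner s)\<bar> \<le> \<epsilon> * side d u s"
        if s: "s \<in> words d k" for s
      proof -
        have sl: "s \<in> lists {..<d}" using s by (rule words_lists)
        have T: "side d u s > 0" using side_pos'[OF sl] .
        have "(\<integral>z. indicator (square d a u s) z * f z \<partial>lborel) - (side d u s)\<^sup>2 * f (corner s)
           = (\<integral>z. indicator (square d a u s) z * f z - indicator (square d a u s) z * f (corner s) \<partial>lborel)"
          unfolding integral_square_const[OF sl, symmetric]
          by (rule Bochner_Integration.integral_diff[symmetric]; rule integrable_square[OF f] integrable_square[OF continuous_on_const])
        then have "\<bar>(\<integral>z. indicator (square d a u s) z * f z \<partial>lborel) - (side d u s)\<^sup>2 * f (corner s)\<bar>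
           \<le> (\<integral>z. \<bar>indicator (square d a u s) z * f z - indicator (square d a u s) z * f (corner s)\<bar> \<partial>lborel)"
          by (simp add: integral_abs_bound)
        also have "\<dots> \<le> (\<integral>z. indicator (square d a u s) z * \<epsilon> \<partial>lborel)"
          by (intro integral_mono integrable_abs Bochner_Integration.integrable_diff integrable_square[OF f] integrable_square[OF continuous_on_const])
             (use near[OF s] e in \<open>auto simp: indicator_def\<close>)
        also have "\<dots> = (side d u s)\<^sup>2 * \<epsilon>" by (rule integral_square_const[OF sl])
        finally have "\<bar>(\<integral>z. indicator (square d a u s) z * f z \<partial>lborel) - (side d u s)\<^sup>2 * f (corner s)\<bar> / side d u s \<le> (side d u s)\<^sup>2 * \<epsilon> / side d u s"
          using T by (intro divide_right_mono) auto
        also have "\<bar>(\<integral>z. indicator (square d a u s) z * f z \<partial>lborel) - (side d u s)\<^sup>2 * f (corner s)\<bar> / side d u s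
          = \<bar>((\<integral>z. indicator (square d a u s) z * f z \<partial>lborel) - (side d u s)\<^sup>2 * f (corner s)) / side d u s\<bar>"
          using T by simp
        finally show ?thesis using T by (simp add: diff_divide_distrib power2_eq_square mult_ac)
      qed
      have 2: "\<bar>(\<integral>x. indicator (horizontal.cell s) x * f (x, height x) \<partial>unif01) - side d u s * f (corner s)\<bar> \<le> \<epsilon> * side d u s"
        if s: "s \<in> words d k" for s
      proof -
        have sl: "s \<in> lists {..<d}" using s by (rule words_lists)
        have T: "side d u s > 0" using side_pos'[OF sl] .
        have m: "measure unif01 (horizontal.cell s) = side d u s"
          using horizontal.emeasure_unif01_cells[of "{s}" k] s T by (simp add: measure_def)
        have ic: "integrable unif01 (\<lambda>x. indicator (horizontal.cell s) x * c)" "(\<integral>x. indicator (horizontal.cell s) x * c \<partial>unif01) = side d u s * c" for c :: real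
          using m unif01.emeasure_finite[of "horizontal.cell s"] by (auto simp: integrable_indicator_iff less_top[symmetric])
        have "(\<integral>x. indicator (horizontal.cell s) x * f (x, height x) \<partial>unif01) - side d u s * f (corner s)
          = (\<integral>x. indicator (horizontal.cell s) x * f (x, height x) - indicator (horizontal.cell s) x * f (corner s) \<partial>unif01)"
          unfolding ic(2)[symmetric] by (rule Bochner_Integration.integral_diff[symmetric, OF i ic(1)])
        then have "\<bar>(\<integral>x. indicator (horizontal.cell s) x * f (x, height x) \<partial>unif01) - side d u s * f (corner s)\<bar>
          \<le> (\<integral>x. \<bar>indicator (horizontal.cell s) x * f (x, height x) - indicator (horizontal.cell s) x * f (corner s)\<bar> \<partial>unif01)"
          by (simp add: integral_abs_bound)
        also have "\<dots> \<le> (\<integral>x. indicator (horizontal.cell s) x * \<epsilon> \<partial>unif01)"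
        proof (intro integral_mono_AE integrable_abs Bochner_Integration.integrable_diff i ic)
          show "AE x in unif01. \<bar>indicator (horizontal.cell s) x * f (x, height x) - indicator (horizontal.cell s) x * f (corner s)\<bar> \<le> indicator (horizontal.cell s) x * \<epsilon>"
          proof (use AE_addressed in eventually_elim)
            fix x assume x: "addressed x"
            show "\<bar>indicator (horizontal.cell s) x * f (x, height x) - indicator (horizontal.cell s) x * f (corner s)\<bar> \<le> indicator (horizontal.cell s) x * \<epsilon>"
            proof (cases "x \<in> horizontal.cell s")
              case True
              then have "(x, height x) \<in> square d a u s" using height_bounds[OF x s True] by (auto simp: square_def)
              from near[OF s this] True show ?thesis by simp
            qed simp
          qed
        qed
        also have "\<dots> = side d u s * \<epsilon>" by (rule ic(2))
        finally show ?thesis by (simp add: mult.commute)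
      qed
      have "\<bar>(\<integral>z. f z \<partial>level_permuton d a u k) - (\<integral>z. f z \<partial>graph_measure)\<bar>
        = \<bar>\<Sum>s\<in>words d k. (\<integral>z. indicator (square d a u s) z * f z \<partial>lborel) / side d u s - (\<integral>x. indicator (horizontal.cell s) x * f (x, height x) \<partial>unif01)\<bar>"
        unfolding integral_level_permuton[OF f] I[of k] sum_subtractf ..
      also have "\<dots> \<le> (\<Sum>s\<in>words d k. 2 * \<epsilon> * side d u s)"
      proof (rule order.trans[OF sum_abs sum_mono])
        fix s assume s: "s \<in> words d k"
        show "\<bar>(\<integral>z. indicator (square d a u s) z * f z \<partial>lborel) / side d u s - (\<integral>x. indicator (horizontal.cell s) x * f (x, height x) \<partial>unif01)\<bar> \<le> 2 * \<epsilon> * side d u s"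
          using 1[OF s] 2[OF s] by linarith
      qed
      also have "\<dots> = 2 * \<epsilon>" using horizontal.sum_T[of k] by (simp add: sum_distrib_left[symmetric])
      also have "\<dots> < r" using r by (simp add: \<epsilon>_def)
      finally show "norm ((\<integral>z. f z \<partial>level_permuton d a u k) - (\<integral>z. f z \<partial>graph_measure)) < r" by simp
    qed
  qed
qed

text \<open>Existence of one weak limit makes the choice operator return a weak limit. The estimates
  of masses below hold for every permuton that is a weak limit, so they apply to the chosen
  one.\<close>

lemma limit_permuton_works:
  "permuton (limit_permuton d a u)" "weakly_converges (level_permuton d a u) (limit_permuton d a u)"
  using someI[of "\<lambda>\<mu>. permuton \<mu> \<and> weakly_converges (level_permuton d a u) \<mu>" graph_measure]
    permuton_graph_measure weakly_converges_graph_measure unfolding limit_permuton_def by blast+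

text \<open>Open, so that points in different squares of one level are strictly ordered in both
  coordinates.\<close>

definition open_square :: "nat list \<Rightarrow> (real \<times> real) set" where
  "open_square s = horizontal.cell s \<times> vertical.cell s"

lemma unif01_singleton: "measure unif01 {c} = 0"
proof -
  have "emeasure lborel ({0..1} \<inter> {c}) \<le> emeasure lborel {c}" by (intro emeasure_mono) auto
  then show ?thesis by (simp add: measure_def emeasure_unif01)
qed

text \<open>The portmanteau inequality for the closed square: every level from \<open>k\<close> on
  puts mass at least \<open>side d u s\<close> on it. Only a lower bound is asked for, since
  equality of the pattern probabilities will follow from their total mass.\<close>

lemma measure_open_square_ge:
  assumes \<nu>: "permuton \<nu>" "weakly_converges (level_permuton d a u) \<nu>" and s: "s \<in> words d k"
  shows "measure \<nu> (open_square s) \<ge> side d u s"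
proof -
  interpret \<nu>: prob_space \<nu> using \<nu> by (simp add: permuton_def)
  have sets\<nu>: "sets \<nu> = sets borel" using \<nu> by (simp add: permuton_def)
  have space\<nu>: "space \<nu> = UNIV" using sets_eq_imp_space_eq[OF sets\<nu>] by simp
  note [measurable_cong] = sets\<nu>
  have sl: "s \<in> lists {..<d}" using s by (rule words_lists)
  have T: "side d u s > 0" using side_pos'[OF sl] .
  let ?Q = "square d a u s"
  \<comment> \<open>Continuous functions that equal 1 on the square and decrease pointwise to its
    indicator.\<close>
  define f where "f = (\<lambda>m z. max 0 (1 - real m * infdist z ?Q))"
  have cont: "continuous_on UNIV (f m)" for m unfolding f_def by (intro continuous_intros)
  have f01: "0 \<le> f m z" "f m z \<le> 1" for m z by (auto simp: f_def infdist_nonneg)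
  have fQ: "f m z = 1" if "z \<in> ?Q" for m z using that by (simp add: f_def)
  have bd: "bounded (range (f m))" for m by (intro boundedI[of _ 1]) (use f01 in auto)
  \<comment> \<open>The descendants of \<open>s\<close> lie in its square, where \<open>f m\<close>
    is 1, and their sides add up to that of \<open>s\<close>.\<close>
  have level: "(\<integral>z. f m z \<partial>level_permuton d a u (n + k)) \<ge> side d u s" for m n
  proof -
    have "side d u s = (\<Sum>r\<in>words d n. side d u (r @ s))" using horizontal.sum_T_extension[OF sl] ..
    also have "\<dots> = (\<Sum>s'\<in>(\<lambda>r. r @ s) ` words d n. side d u s')" by (subst sum.reindex) (auto simp: inj_on_def)
    also have "\<dots> \<le> (\<Sum>s'\<in>(\<lambda>r. r @ s) ` words d n. (\<integral>z. indicator (square d a u s') z * f m z \<partial>lborel) / side d u s')"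
    proof (rule sum_mono)
      fix s' assume "s' \<in> (\<lambda>r. r @ s) ` words d n"
      then obtain r where r: "s' = r @ s" "r \<in> lists {..<d}" by (auto dest: words_lists)
      have s'l: "s' \<in> lists {..<d}" using r sl by simp
      have "square d a u s' \<subseteq> ?Q"
        using horizontal.extension_bounds[OF sl r(2)] vertical.extension_bounds[OF sl r(2)] r(1)
        by (auto simp: square_def)
      then have "(\<integral>z. indicator (square d a u s') z * f m z \<partial>lborel) = (\<integral>z. indicator (square d a u s') z * 1 \<partial>lborel)"
        using fQ by (intro Bochner_Integration.integral_cong refl) (auto simp: indicator_def)
      also have "\<dots> = (side d u s')\<^sup>2" using integral_square_const[OF s'l, of 1] by simp
      finally show "side d u s' \<le> (\<integral>z. indicator (square d a u s') z * f m z \<partial>lborel) / side d u s'"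
        using side_pos'[OF s'l] by (simp add: power2_eq_square)
    qed
    also have "\<dots> \<le> (\<Sum>s'\<in>words d (n + k). (\<integral>z. indicator (square d a u s') z * f m z \<partial>lborel) / side d u s')"
    proof (rule sum_mono2)
      fix s' assume "s' \<in> words d (n + k) - (\<lambda>r. r @ s) ` words d n"
      then show "0 \<le> (\<integral>z. indicator (square d a u s') z * f m z \<partial>lborel) / side d u s'"
        using f01 side_pos'[of s'] by (intro divide_nonneg_nonneg integral_nonneg) (auto simp: words_def intro: less_imp_le)
    qed (use s words_append in auto)
    finally show ?thesis unfolding integral_level_permuton[OF cont] .
  qed
  have lim1: "(\<integral>z. f m z \<partial>\<nu>) \<ge> side d u s" for m
  proof (rule LIMSEQ_le_const)
    show "(\<lambda>n. \<integral>z. f m z \<partial>level_permuton d a u n) \<longlonglongrightarrow> (\<integral>z. f m z \<partial>\<nu>)"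
      using \<nu>(2) cont bd unfolding weakly_converges_def by blast
    show "\<exists>N. \<forall>n\<ge>N. side d u s \<le> (\<integral>z. f m z \<partial>level_permuton d a u n)"
    proof (intro exI[of _ k] allI impI)
      fix n assume "n \<ge> k"
      then show "side d u s \<le> (\<integral>z. f m z \<partial>level_permuton d a u n)" using level[of "n - k" m] by simp
    qed
  qed
  have "(\<lambda>m. \<integral>z. f m z \<partial>\<nu>) \<longlonglongrightarrow> (\<integral>z. indicator ?Q z \<partial>\<nu>)"
  proof (rule integral_dominated_convergence[where w = "\<lambda>_. 1"])
    show "AE z in \<nu>. (\<lambda>m. f m z) \<longlonglongrightarrow> indicator ?Q z"
    proof (rule AE_I2)
      fix z
      show "(\<lambda>m. f m z) \<longlonglongrightarrow> indicator ?Q z"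
      proof (cases "z \<in> ?Q")
        case False
        have cl: "closed ?Q" by (simp add: square_eq_cbox closed_cbox)
        have "corner s \<in> ?Q" using T by (simp add: square_def)
        then have ne: "?Q \<noteq> {}" by blast
        have "infdist z ?Q \<noteq> 0" using False in_closed_iff_infdist_zero[OF cl ne] by blast
        then have pos: "infdist z ?Q > 0" using infdist_nonneg[of z ?Q] by linarith
        obtain N where N: "real N * infdist z ?Q > 1" using pos ex_less_of_nat_mult by blast
        have "f m z = 0" if "m \<ge> N" for m
        proof -
          have "real m * infdist z ?Q \<ge> real N * infdist z ?Q" using that pos by (intro mult_right_mono) auto
          then show ?thesis using N by (simp add: f_def)
        qed
        then have "\<forall>\<^sub>F m in sequentially. f m z = 0" unfolding eventually_sequentially by blast
        then show ?thesis using False by (simp add: tendsto_eventually)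
      qed (simp add: fQ)
    qed
    show "f m \<in> borel_measurable \<nu>" for m using borel_measurable_continuous_onI[OF cont] by measurable
    show "AE z in \<nu>. norm (f m z) \<le> 1" for m using f01 by (intro AE_I2) simp
  qed auto
  then have "(\<lambda>m. \<integral>z. f m z \<partial>\<nu>) \<longlonglongrightarrow> (\<integral>z. indicator ?Q z \<partial>\<nu>)" .
  have Q: "measure \<nu> ?Q \<ge> side d u s"
  proof (rule LIMSEQ_le_const[where x = "measure \<nu> ?Q"])
    show "(\<lambda>m. \<integral>z. f m z \<partial>\<nu>) \<longlonglongrightarrow> measure \<nu> ?Q"
      using \<open>(\<lambda>m. \<integral>z. f m z \<partial>\<nu>) \<longlonglongrightarrow> (\<integral>z. indicator ?Q z \<partial>\<nu>)\<close> by (simp add: space\<nu>)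
  qed (use lim1 in blast)
  have [measurable]: "fst \<in> borel_measurable \<nu>" "snd \<in> borel_measurable \<nu>"
    unfolding measurable_cong_sets[OF sets\<nu> refl]
    by (intro borel_measurable_continuous_onI continuous_intros)+
  have line1: "measure \<nu> {z. fst z = c} = 0" for c
  proof -
    have "measure \<nu> {z. fst z = c} = measure (distr \<nu> borel fst) {c}"
      by (subst measure_distr) (auto simp: space\<nu> vimage_def)
    also have "\<dots> = 0" using \<nu>(1) unif01_singleton[of c] by (simp add: permuton_def)
    finally show ?thesis .
  qed
  have line2: "measure \<nu> {z. snd z = c} = 0" for c
  proof -
    have "measure \<nu> {z. snd z = c} = measure (distr \<nu> borel snd) {c}"
      by (subst measure_distr) (auto simp: space\<nu> vimage_def)
    also have "\<dots> = 0" using \<nu>(1) unif01_singleton[of c] by (simp add: permuton_def)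
    finally show ?thesis .
  qed
  \<comment> \<open>The boundary of the square lies on four lines, which are null because the
    marginals have no atoms.\<close>
  let ?L = "{z. fst z = left_edge d u s} \<union> {z. fst z = left_edge d u s + side d u s}
    \<union> {z. snd z = bottom_edge d a u s} \<union> {z. snd z = bottom_edge d a u s + side d u s}"
  have [measurable]: "{z. fst z = c} \<in> sets \<nu>" "{z. snd z = c} \<in> sets \<nu>" for c :: real
    by (auto simp: sets\<nu> intro!: borel_closed closed_Collect_eq continuous_intros)
  have os: "open_square s \<in> sets \<nu>" unfolding sets\<nu> open_square_def by (intro borel_open open_Times) auto
  have "measure \<nu> ?Q \<le> measure \<nu> (open_square s \<union> ?L)"
    by (rule \<nu>.finite_measure_mono) (use os in \<open>auto simp: square_def open_square_def\<close>)
  also have "\<dots> \<le> measure \<nu> (open_square s) + measure \<nu> ?L"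
    by (rule measure_Un_le) (use os in auto)
  also have "measure \<nu> ?L \<le> 0"
  proof -
    have un: "measure \<nu> (A \<union> B) \<le> 0" if "A \<in> sets \<nu>" "B \<in> sets \<nu>" "measure \<nu> A \<le> 0" "measure \<nu> B \<le> 0" for A B
      using measure_Un_le[OF that(1,2)] that(3,4) by linarith
    show ?thesis
      by (intro un sets.Un) (simp_all only: line1 line2 order_refl \<open>\<And>c. {z. fst z = c} \<in> sets \<nu>\<close> \<open>\<And>c. {z. snd z = c} \<in> sets \<nu>\<close>)
  qed
  finally show ?thesis using Q by simp
qed

end

section \<open>Patterns of squares\<close>

type_synonym tree = "nat list \<Rightarrow> (nat \<Rightarrow> nat) \<times> (nat \<Rightarrow> real)"

text \<open>The children of \<open>s\<close> are \<open>i # s\<close>, so the letter chosen at the root is the last one.\<close>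

definition subtree :: "tree \<Rightarrow> nat \<Rightarrow> tree" where
  "subtree t i = (\<lambda>s. t (s @ [i]))"

abbreviation perms :: "tree \<Rightarrow> nat list \<Rightarrow> nat \<Rightarrow> nat" where "perms t \<equiv> \<lambda>s. fst (t s)"
abbreviation cuts :: "tree \<Rightarrow> nat list \<Rightarrow> nat \<Rightarrow> real" where "cuts t \<equiv> \<lambda>s. snd (t s)"

definition good_tree :: "nat \<Rightarrow> tree \<Rightarrow> bool" where
  "good_tree d t \<longleftrightarrow> good d (perms t) (cuts t)"

lemma side_subtree: "side d (cuts t) (s @ [i]) = gap d (cuts t []) i * side d (cuts (subtree t i)) s"
  by (induction s) (auto simp: subtree_def)

lemma left_edge_subtree: "left_edge d (cuts t) (s @ [i])
    = (\<Sum>j<i. gap d (cuts t []) j) + gap d (cuts t []) i * left_edge d (cuts (subtree t i)) s"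
  by (induction s) (auto simp: side_subtree algebra_simps, auto simp: subtree_def)

lemma bottom_edge_subtree: "bottom_edge d (perms t) (cuts t) (s @ [i])
    = (\<Sum>j | j < d \<and> perms t [] (Suc j) < perms t [] (Suc i). gap d (cuts t []) j)
      + gap d (cuts t []) i * bottom_edge d (perms (subtree t i)) (cuts (subtree t i)) s"
  by (induction s) (auto simp: side_subtree algebra_simps, auto simp: subtree_def)

text \<open>The collision sum of a subtree is at most that of the whole tree one level deeper,
  divided by the square of the root gap.\<close>

lemma good_subtree:
  assumes "good_tree d t" "i < d"
  shows "good_tree d (subtree t i)"
  unfolding good_tree_def good_def
proof (intro conjI ballI allI impI)
  fix s assume "s \<in> lists {..<d}"
  then have s: "s @ [i] \<in> lists {..<d}" using assms(2) by simp
  have "\<forall>s\<in>lists {..<d}. perms t s \<in> Sym d \<and> (\<forall>j<d. 0 < gap d (cuts t s) j)"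
    using assms(1) unfolding good_tree_def good_def by (rule conjunct1)
  note * = bspec[OF this s]
  from * show "perms (subtree t i) s \<in> Sym d" by (simp add: subtree_def)
  from * show "gap d (cuts (subtree t i) s) j > 0" if "j < d" for j using that by (simp add: subtree_def)
next
  let ?g = "gap d (cuts t []) i"
  have g: "?g > 0" using assms unfolding good_tree_def good_def by simp
  have lim: "(\<lambda>k. (\<Sum>s\<in>words d (Suc k). (side d (cuts t) s)\<^sup>2) / ?g\<^sup>2) \<longlonglongrightarrow> 0 / ?g\<^sup>2"
  proof (rule tendsto_divide[OF LIMSEQ_Suc tendsto_const])
    show "(\<lambda>k. \<Sum>s\<in>words d k. (side d (cuts t) s)\<^sup>2) \<longlonglongrightarrow> 0"
      using assms(1) unfolding good_tree_def good_def by (rule conjunct2)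
  qed (use g in simp)
  show "(\<lambda>k. \<Sum>s\<in>words d k. (side d (cuts (subtree t i)) s)\<^sup>2) \<longlonglongrightarrow> 0"
  proof (rule tendsto_sandwich[OF _ _ tendsto_const])
    show "\<forall>\<^sub>F k in sequentially. (\<Sum>s\<in>words d k. (side d (cuts (subtree t i)) s)\<^sup>2) \<le> (\<Sum>s\<in>words d (Suc k). (side d (cuts t) s)\<^sup>2) / ?g\<^sup>2"
    proof (rule always_eventually, rule allI)
      fix k
      have "?g\<^sup>2 * (\<Sum>s\<in>words d k. (side d (cuts (subtree t i)) s)\<^sup>2) = (\<Sum>s\<in>words d k. (side d (cuts t) (s @ [i]))\<^sup>2)"
        by (simp add: side_subtree power_mult_distrib sum_distrib_left)
      also have "\<dots> \<le> (\<Sum>i<d. \<Sum>s\<in>words d k. (side d (cuts t) (s @ [i]))\<^sup>2)"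
        using assms(2) by (intro member_le_sum[where f = "\<lambda>i. \<Sum>s\<in>words d k. (side d (cuts t) (s @ [i]))\<^sup>2"] sum_nonneg) auto
      finally show "(\<Sum>s\<in>words d k. (side d (cuts (subtree t i)) s)\<^sup>2) \<le> (\<Sum>s\<in>words d (Suc k). (side d (cuts t) s)\<^sup>2) / ?g\<^sup>2"
        using g by (simp add: sum_words_Suc' pos_le_divide_eq mult.commute)
    qed
  qed (use lim in \<open>auto intro!: sum_nonneg always_eventually\<close>)
qed

section \<open>Order patterns, their inflation, and pattern probabilities\<close>

definition rk :: "'a set \<Rightarrow> ('a \<Rightarrow> real) \<Rightarrow> 'a \<Rightarrow> nat" where
  "rk A x a = card {c \<in> A. x c < x a}"

text \<open>The unlabelled order pattern of planar points: \<open>(p, q)\<close> records that the point of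
  horizontal rank \<open>p\<close> lies below the one of rank \<open>q\<close>.\<close>

definition Pat :: "'a set \<Rightarrow> ('a \<Rightarrow> real) \<Rightarrow> ('a \<Rightarrow> real) \<Rightarrow> (nat \<times> nat) set" where
  "Pat A x y = {(rk A x a, rk A x b) | a b. a \<in> A \<and> b \<in> A \<and> y a < y b}"

lemma bij_rk:
  assumes "finite A" "inj_on x A"
  shows "bij_betw (rk A x) A {..<card A}"
proof -
  have less: "rk A x a < rk A x b" if "a \<in> A" "b \<in> A" "x a < x b" for a b
    unfolding rk_def using assms(1) that by (intro psubset_card_mono) auto
  have inj: "inj_on (rk A x) A"
  proof (rule inj_onI)
    fix a b assume ab: "a \<in> A" "b \<in> A" "rk A x a = rk A x b"
    then have "x a = x b" using less[of a b] less[of b a] by (metis less_irrefl linorder_neqE)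
    then show "a = b" using assms(2) ab by (simp add: inj_onD)
  qed
  have "rk A x ` A \<subseteq> {..<card A}"
    unfolding rk_def using assms(1) by (auto intro!: psubset_card_mono)
  then have "rk A x ` A = {..<card A}" using card_image[OF inj] by (intro card_subset_eq) auto
  then show ?thesis using inj by (simp add: bij_betw_def)
qed

lemma Pat_subset: "finite A \<Longrightarrow> Pat A x y \<subseteq> {..<card A} \<times> {..<card A}"
  unfolding Pat_def rk_def by (auto intro!: psubset_card_mono)

definition cnt :: "('a \<Rightarrow> nat) \<Rightarrow> 'a set \<Rightarrow> nat \<Rightarrow> nat" where
  "cnt l A i = card {j \<in> A. l j = i}"

text \<open>If \<open>N\<close> lists the numbers of points in the subsquares, the points of
  subsquare \<open>i\<close> have the horizontal ranks \<open>offs N i\<close>, ...,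
  \<open>offs N i + N i - 1\<close>.\<close>

definition offs :: "(nat \<Rightarrow> nat) \<Rightarrow> nat \<Rightarrow> nat" where
  "offs N i = (\<Sum>i'<i. N i')"

text \<open>Inflation of a permutation by patterns, in the language of order relations: the first
  set compares points of one block, the second set compares points of different blocks as
  \<open>p\<close> prescribes. Empty blocks leave no trace.\<close>

definition inflate :: "nat \<Rightarrow> (nat \<Rightarrow> nat) \<Rightarrow> (nat \<Rightarrow> nat) \<Rightarrow> (nat \<Rightarrow> (nat \<times> nat) set) \<Rightarrow> (nat \<times> nat) set" where
  "inflate d p N Rs = {(offs N i + b, offs N i + c) | i b c. i < d \<and> (b, c) \<in> Rs i}
     \<union> {(offs N i + b, offs N j + c) | i j b c. i < d \<and> j < d \<and> p (Suc i) < p (Suc j) \<and> b < N i \<and> c < N j}"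

lemma inflate_cong:
  "(\<And>i. i < d \<Longrightarrow> Rs i = Rs' i) \<Longrightarrow> inflate d p N Rs = inflate d p N Rs'"
  unfolding inflate_def by auto

definition patterns :: "nat \<Rightarrow> (nat \<times> nat) set set" where
  "patterns n = Pow ({..<n} \<times> {..<n})"

lemma finite_patterns [simp]: "finite (patterns n)"
  by (simp add: patterns_def)

text \<open>The probability that \<open>n\<close> points fall into different squares of level \<open>k\<close> and have pattern \<open>R\<close>,
  computed by splitting at the root; \<open>W\<close> below sums over the addresses of the squares instead.\<close>

primrec Q :: "nat \<Rightarrow> nat \<Rightarrow> tree \<Rightarrow> nat \<Rightarrow> (nat \<times> nat) set \<Rightarrow> real" where
  "Q d 0 t n R = (if n \<le> 1 \<and> R = {} then 1 else 0)"
| "Q d (Suc k) t n R = (\<Sum>l\<in>{..<n} \<rightarrow>\<^sub>E {..<d}. (\<Prod>j<n. gap d (cuts t []) (l j)) *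
     (\<Sum>Rs\<in>(\<Pi>\<^sub>E i\<in>{..<d}. patterns (cnt l {..<n} i)).
       if inflate d (perms t []) (cnt l {..<n}) Rs = R
       then \<Prod>i<d. Q d k (subtree t i) (cnt l {..<n} i) (Rs i) else 0))"

definition W :: "nat \<Rightarrow> nat \<Rightarrow> tree \<Rightarrow> nat set \<Rightarrow> (nat \<times> nat) set \<Rightarrow> real" where
  "W d k t A R = (\<Sum>w\<in>A \<rightarrow>\<^sub>E words d k.
     if inj_on w A \<and> Pat A (\<lambda>j. left_edge d (cuts t) (w j)) (\<lambda>j. bottom_edge d (perms t) (cuts t) (w j)) = R
     then \<Prod>j\<in>A. side d (cuts t) (w j) else 0)"

text \<open>Only the occupation numbers enter, so the points may be renamed. This is needed because
  the points in a subsquare are an arbitrary set of indices, while \<open>Q\<close> numbers them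
  from 0.\<close>

lemma sum_letters_bij:
  fixes A :: "nat set"
  assumes "finite A"
  shows "(\<Sum>l\<in>{..<card A} \<rightarrow>\<^sub>E {..<d}. (\<Prod>j<card A. g (l j)) * F (cnt l {..<card A}))
     = (\<Sum>l\<in>A \<rightarrow>\<^sub>E {..<d}. (\<Prod>j\<in>A. g (l j)) * (F (cnt l A) :: real))"
proof -
  obtain h where h: "bij_betw h {..<card A} A"
    using ex_bij_betw_nat_finite[OF assms] by (auto simp: atLeast0LessThan)
  define h' where "h' = the_inv_into {..<card A} h"
  have h': "bij_betw h' A {..<card A}" unfolding h'_def by (rule bij_betw_the_inv_into[OF h])
  have hh': "h (h' a) = a" "h' a < card A" if "a \<in> A" for a
    using that h h' f_the_inv_into_f_bij_betw[OF h] by (auto simp: h'_def dest: bij_betw_apply)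
  have h'h: "h' (h j) = j" "h j \<in> A" if "j < card A" for j
    using that h by (auto simp: h'_def the_inv_into_f_f bij_betw_def)
  show ?thesis
  proof (rule sum.reindex_bij_witness[of _ "\<lambda>l. \<lambda>j\<in>{..<card A}. l (h j)" "\<lambda>l. \<lambda>a\<in>A. l (h' a)"], goal_cases)
    case (1 l) then show ?case using h'h hh' by (auto simp: PiE_iff extensional_def restrict_def fun_eq_iff)
  next
    case (2 l) then show ?case using hh' by (auto simp: PiE_iff)
  next
    case (3 l) then show ?case using h'h hh' by (auto simp: PiE_iff extensional_def restrict_def fun_eq_iff)
  next
    case (4 l) then show ?case using h'h by (auto simp: PiE_iff)
  next
    case (5 l)
    have "(\<Prod>a\<in>A. g ((\<lambda>a\<in>A. l (h' a)) a)) = (\<Prod>j<card A. g (l j))"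
      using h'h by (subst prod.reindex_bij_betw[OF h, symmetric]) auto
    moreover have "cnt (\<lambda>a\<in>A. l (h' a)) A = cnt l {..<card A}"
    proof
      fix i
      have "bij_betw h {j\<in>{..<card A}. l j = i} {a\<in>A. l (h' a) = i}"
        by (rule bij_betw_byWitness[of _ h']) (use h'h hh' in auto)
      then have "card {j\<in>{..<card A}. l j = i} = card {a\<in>A. l (h' a) = i}" by (rule bij_betw_same_card)
      moreover have "{a\<in>A. (\<lambda>a\<in>A. l (h' a)) a = i} = {a\<in>A. l (h' a) = i}" by auto
      ultimately show "cnt (\<lambda>a\<in>A. l (h' a)) A i = cnt l {..<card A} i" by (simp only: cnt_def)
    qed
    ultimately show ?case by simp
  qed
qed

text \<open>Choosing an address of level k + 1 for every point amounts to choosing a root letter for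
  every point and then, for each subsquare, addresses of level k for the points in it.\<close>

lemma sum_words_functions:
  fixes A :: "nat set" and F :: "(nat \<Rightarrow> nat list) \<Rightarrow> real"
  assumes "finite A"
  shows "(\<Sum>w\<in>A \<rightarrow>\<^sub>E words d (Suc k). F w)
    = (\<Sum>l\<in>A \<rightarrow>\<^sub>E {..<d}. \<Sum>ws\<in>(\<Pi>\<^sub>E i\<in>{..<d}. {j\<in>A. l j = i} \<rightarrow>\<^sub>E words d k). F (\<lambda>j\<in>A. ws (l j) j @ [l j]))"
proof -
  let ?S = "\<lambda>l. \<Pi>\<^sub>E i\<in>{..<d}. {j\<in>A. l j = i} \<rightarrow>\<^sub>E words d k"
  have fin: "finite (A \<rightarrow>\<^sub>E {..<d})" "\<And>l. finite (?S l)"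
    using assms by (auto intro!: finite_PiE)
  have wsD: "ws (l j) j \<in> words d k" if "l \<in> A \<rightarrow>\<^sub>E {..<d}" "ws \<in> ?S l" "j \<in> A" for l ws j
    using that by (auto simp: PiE_iff)
  have wD: "w j \<noteq> [] \<and> last (w j) < d \<and> butlast (w j) \<in> words d k \<and> butlast (w j) @ [last (w j)] = w j"
    if "w \<in> A \<rightarrow>\<^sub>E words d (Suc k)" "j \<in> A" for w j
  proof -
    have "w j \<in> words d (Suc k)" using that by auto
    then show ?thesis unfolding words_Suc' by auto
  qed
  have "(\<Sum>w\<in>A \<rightarrow>\<^sub>E words d (Suc k). F w) = (\<Sum>p\<in>(SIGMA l:A \<rightarrow>\<^sub>E {..<d}. ?S l). F (\<lambda>j\<in>A. snd p (fst p j) j @ [fst p j]))"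
  proof (rule sum.reindex_bij_witness[of _ "\<lambda>p. \<lambda>j\<in>A. snd p (fst p j) j @ [fst p j]"
        "\<lambda>w. (\<lambda>j\<in>A. last (w j), \<lambda>i\<in>{..<d}. \<lambda>j\<in>{j\<in>A. last (w j) = i}. butlast (w j))"], goal_cases)
    case (1 w)
    show ?case
    proof
      fix j show "(\<lambda>j\<in>A. snd (\<lambda>j\<in>A. last (w j), \<lambda>i\<in>{..<d}. \<lambda>j\<in>{j\<in>A. last (w j) = i}. butlast (w j))
          (fst (\<lambda>j\<in>A. last (w j), \<lambda>i\<in>{..<d}. \<lambda>j\<in>{j\<in>A. last (w j) = i}. butlast (w j)) j) j @
          [fst (\<lambda>j\<in>A. last (w j), \<lambda>i\<in>{..<d}. \<lambda>j\<in>{j\<in>A. last (w j) = i}. butlast (w j)) j]) j = w j"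
        using wD[OF 1, of j] 1 by (cases "j \<in> A") (auto simp: PiE_iff extensional_def)
    qed
  next
    case (2 w)
    have "{j\<in>A. (\<lambda>j\<in>A. last (w j)) j = i} = {j\<in>A. last (w j) = i}" for i by auto
    then show ?case using wD[OF 2] by (auto simp: PiE_iff simp del: restrict_apply cong: restrict_cong) (auto)
  next
    case (3 p)
    obtain l ws where p: "p = (l, ws)" "l \<in> A \<rightarrow>\<^sub>E {..<d}" "ws \<in> ?S l" using 3 by auto
    have 1: "(\<lambda>j\<in>A. last ((\<lambda>j\<in>A. ws (l j) j @ [l j]) j)) = l"
      using p(2) by (auto simp: fun_eq_iff PiE_iff extensional_def restrict_def)
    have 2: "{j\<in>A. last ((\<lambda>j\<in>A. ws (l j) j @ [l j]) j) = i} = {j\<in>A. l j = i}" for i by auto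
    have "(\<lambda>j\<in>{j\<in>A. l j = i}. butlast ((\<lambda>j\<in>A. ws (l j) j @ [l j]) j)) = ws i" if "i < d" for i
    proof
      fix j
      have "ws i \<in> {j\<in>A. l j = i} \<rightarrow>\<^sub>E words d k" using p(3) that by auto
      then show "(\<lambda>j\<in>{j\<in>A. l j = i}. butlast ((\<lambda>j\<in>A. ws (l j) j @ [l j]) j)) j = ws i j"
        by (cases "j \<in> A \<and> l j = i") (auto simp: PiE_iff extensional_def)
    qed
    then have "(\<lambda>i\<in>{..<d}. \<lambda>j\<in>{j\<in>A. l j = i}. butlast ((\<lambda>j\<in>A. ws (l j) j @ [l j]) j)) = ws"
      using p(3) by (auto simp: fun_eq_iff PiE_iff extensional_def restrict_def)
    then show ?case using 1 unfolding p(1) fst_conv snd_conv 2 by simp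
  next
    case (4 p)
    then show ?case using wsD unfolding words_Suc' by (auto simp: PiE_iff image_iff)
  next
    case (5 w)
    show ?case by (rule arg_cong[of _ _ F], rule ext) (use wD[OF 5] 5 in \<open>auto simp: PiE_iff extensional_def\<close>)
  qed
  also have "\<dots> = (\<Sum>l\<in>A \<rightarrow>\<^sub>E {..<d}. \<Sum>ws\<in>?S l. F (\<lambda>j\<in>A. ws (l j) j @ [l j]))"
    using fin by (subst sum.Sigma) (auto simp: case_prod_unfold)
  finally show ?thesis .
qed

lemma good_squares_tree: "d \<ge> 2 \<Longrightarrow> good_tree d t \<Longrightarrow> good_squares d (perms t) (cuts t)"
  by (simp add: good_squares_def good_tree_def)

lemma card_lower_letters:
  assumes "finite A"
  shows "card {c\<in>A. l c < i} = offs (cnt l A) i"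
proof (induction i)
  case (Suc i)
  have "{c\<in>A. l c < Suc i} = {c\<in>A. l c < i} \<union> {c\<in>A. l c = i}" by auto
  moreover have "card ({c\<in>A. l c < i} \<union> {c\<in>A. l c = i}) = card {c\<in>A. l c < i} + card {c\<in>A. l c = i}"
    using assms by (intro card_Un_disjoint) auto
  ultimately show ?case using Suc by (simp add: offs_def cnt_def)
qed (simp add: offs_def)

text \<open>A subsquare is placed by an increasing rescaling, so order inside it is inherited.
  Between subsquares, order is decided horizontally by the letters and vertically by the root
  permutation. Horizontal ranks are thus shifted by \<open>offs\<close>, and the pattern is an
  inflation.\<close>

lemma compose_pattern:
  fixes A :: "nat set"
  assumes d: "d \<ge> 2" and t: "good_tree d t" and A: "finite A"
    and l: "l \<in> A \<rightarrow>\<^sub>E {..<d}"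
    and ws: "ws \<in> (\<Pi>\<^sub>E i\<in>{..<d}. {j\<in>A. l j = i} \<rightarrow>\<^sub>E words d k)"
  defines "w \<equiv> \<lambda>j\<in>A. ws (l j) j @ [l j]"
    and "P \<equiv> \<lambda>i. Pat {j\<in>A. l j = i} (\<lambda>j. left_edge d (cuts (subtree t i)) (ws i j))
         (\<lambda>j. bottom_edge d (perms (subtree t i)) (cuts (subtree t i)) (ws i j))"
  shows "inj_on w A \<longleftrightarrow> (\<forall>i<d. inj_on (ws i) {j\<in>A. l j = i})"
    and "inj_on w A \<Longrightarrow> Pat A (\<lambda>j. left_edge d (cuts t) (w j)) (\<lambda>j. bottom_edge d (perms t) (cuts t) (w j))
        = inflate d (perms t []) (cnt l A) P"
proof -
  interpret G: good_squares d "perms t" "cuts t" using good_squares_tree[OF d t] .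
  have ld: "l j < d" if "j \<in> A" for j using l that by auto
  have ww: "ws (l j) j \<in> words d k" if "j \<in> A" for j
    using ws that ld[OF that] by (auto simp: PiE_iff)
  have wA: "w j = ws (l j) j @ [l j]" if "j \<in> A" for j using that by (simp add: w_def)
  show inj: "inj_on w A \<longleftrightarrow> (\<forall>i<d. inj_on (ws i) {j\<in>A. l j = i})"
  proof
    assume i: "inj_on w A"
    show "\<forall>i<d. inj_on (ws i) {j\<in>A. l j = i}"
      by (intro allI impI inj_onI, rule inj_onD[OF i]) (auto simp: wA)
  next
    assume i: "\<forall>i<d. inj_on (ws i) {j\<in>A. l j = i}"
    show "inj_on w A"
    proof (rule inj_onI)
      fix a b assume ab: "a \<in> A" "b \<in> A" "w a = w b"
      then have "l a = l b" "ws (l a) a = ws (l a) b" by (auto simp: wA)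
      then show "a = b" using i ld[OF ab(1)] ab by (auto dest: inj_onD)
    qed
  qed
  assume "inj_on w A"
  then have inji: "inj_on (ws i) {j\<in>A. l j = i}" if "i < d" for i using inj that by blast
  define x where "x = (\<lambda>i j. left_edge d (cuts (subtree t i)) (ws i j))"
  define y where "y = (\<lambda>i j. bottom_edge d (perms (subtree t i)) (cuts (subtree t i)) (ws i j))"
  define X where "X = (\<lambda>j. left_edge d (cuts t) (w j))"
  define Y where "Y = (\<lambda>j. bottom_edge d (perms t) (cuts t) (w j))"
  define g where "g = gap d (cuts t [])"
  define p where "p = perms t []"
  define o1 where "o1 = (\<lambda>i. \<Sum>j<i. g j)"
  define o2 where "o2 = (\<lambda>i. \<Sum>j | j < d \<and> p (Suc j) < p (Suc i). g j)"
  let ?A = "\<lambda>i. {j\<in>A. l j = i}"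
  have gpos: "g i > 0" if "i < d" for i using G.gap_pos'[of "[]" i] that by (simp add: g_def)
  have X: "X j = o1 (l j) + g (l j) * x (l j) j" if "j \<in> A" for j
    by (simp add: X_def wA[OF that] left_edge_subtree o1_def g_def x_def)
  have Y: "Y j = o2 (l j) + g (l j) * y (l j) j" if "j \<in> A" for j
    by (simp add: Y_def wA[OF that] bottom_edge_subtree o2_def g_def y_def p_def)
  \<comment> \<open>Lower left corners of squares of positive side have coordinates strictly below
    1; this strictness is what makes \<open>block\<close> a strict inequality between
    subsquares.\<close>
  have xy: "0 \<le> x (l j) j" "x (l j) j < 1" "0 \<le> y (l j) j" "y (l j) j < 1" if j: "j \<in> A" for j
  proof -
    interpret S: good_squares d "perms (subtree t (l j))" "cuts (subtree t (l j))"
      by (rule good_squares_tree[OF d good_subtree[OF t ld[OF j]]])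
    have s: "ws (l j) j \<in> lists {..<d}" using ww[OF j] by (simp add: words_def)
    show "0 \<le> x (l j) j" "x (l j) j < 1" "0 \<le> y (l j) j" "y (l j) j < 1"
      using S.horizontal.unit_bounds[OF s] S.vertical.unit_bounds[OF s] S.side_pos'[OF s]
      unfolding x_def y_def by linarith+
  qed
  have o1: "o1 i + g i \<le> o1 j" if "i < j" "j < d" for i j
    using G.partial_gaps_mono[of "[]" i "{..<i}" "{..<j}"] that by (auto simp: o1_def g_def)
  have o2: "o2 i + g i \<le> o2 j" if "p (Suc i) < p (Suc j)" "i < d" for i j
    using G.partial_gaps_mono[of "[]" i "{j. j < d \<and> p (Suc j) < p (Suc i)}" "{i. i < d \<and> p (Suc i) < p (Suc j)}"] that
    by (force simp: o2_def g_def)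
  have block: "b + g i * z < b' + g j * z'"
    if "b + g i \<le> b'" "z < 1" "0 \<le> z'" "i < d" "j < d" for b b' z z' i j
  proof -
    have "b + g i * z < b + g i" using gpos[OF that(4)] that(2) by simp
    moreover have "0 \<le> g j * z'" using gpos[OF that(5)] that(3) by simp
    ultimately show ?thesis using that(1) by linarith
  qed
  have Xless: "X a < X b \<longleftrightarrow> l a < l b \<or> l a = l b \<and> x (l b) a < x (l b) b" if ab: "a \<in> A" "b \<in> A" for a b
  proof -
    consider "l a < l b" | "l b < l a" | "l a = l b" by linarith
    then show ?thesis
    proof cases
      case 1
      then have "X a < X b" unfolding X[OF ab(1)] X[OF ab(2)]
        by (intro block o1 xy ld ab)
      then show ?thesis using 1 by simp
    next
      case 2
      then have "X b < X a" unfolding X[OF ab(1)] X[OF ab(2)]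
        by (intro block o1 xy ld ab)
      then show ?thesis using 2 by simp
    next
      case 3
      then show ?thesis using gpos[OF ld[OF ab(2)]] by (simp add: X ab)
    qed
  qed
  have pneq: "p (Suc (l a)) \<noteq> p (Suc (l b))" if "a \<in> A" "b \<in> A" "l a \<noteq> l b" for a b
    using G.a_inj[of "[]" "l a" "l b"] ld that by (auto simp: p_def)
  have Yless: "Y a < Y b \<longleftrightarrow> l a \<noteq> l b \<and> p (Suc (l a)) < p (Suc (l b)) \<or> l a = l b \<and> y (l b) a < y (l b) b"
    if ab: "a \<in> A" "b \<in> A" for a b
  proof (cases "l a = l b")
    case True
    then show ?thesis using gpos[OF ld[OF ab(2)]] by (simp add: Y ab)
  next
    case False
    show ?thesis
    proof (cases "p (Suc (l a)) < p (Suc (l b))")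
      case True
      then have "Y a < Y b" unfolding Y[OF ab(1)] Y[OF ab(2)] by (intro block o2 xy ld ab)
      then show ?thesis using True False by simp
    next
      case pF: False
      then have "p (Suc (l b)) < p (Suc (l a))" using pneq[OF ab False] by simp
      then have "Y b < Y a" unfolding Y[OF ab(1)] Y[OF ab(2)] by (intro block o2 xy ld ab)
      then show ?thesis using pF False by simp
    qed
  qed
  have rk: "rk A X a = offs (cnt l A) (l a) + rk (?A (l a)) (x (l a)) a" if a: "a \<in> A" for a
  proof -
    have "{c\<in>A. X c < X a} = {c\<in>A. l c < l a} \<union> {c\<in>?A (l a). x (l a) c < x (l a) a}"
      using Xless[OF _ a] by blast
    moreover have "{c\<in>A. l c < l a} \<inter> {c\<in>?A (l a). x (l a) c < x (l a) a} = {}"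
      by (rule equals0I) (elim IntE CollectE conjE, linarith)
    moreover have "finite {c\<in>A. l c < l a}" "finite {c\<in>?A (l a). x (l a) c < x (l a) a}" using A by simp_all
    ultimately have "card {c\<in>A. X c < X a} = card {c\<in>A. l c < l a} + card {c\<in>?A (l a). x (l a) c < x (l a) a}"
      by (simp only: card_Un_disjoint)
    then show ?thesis by (simp only: rk_def card_lower_letters[OF A])
  qed
  have bij: "bij_betw (rk (?A i) (x i)) (?A i) {..<cnt l A i}" if i: "i < d" for i
    unfolding cnt_def
  proof (rule bij_rk)
    interpret S: good_squares d "perms (subtree t i)" "cuts (subtree t i)"
      by (rule good_squares_tree[OF d good_subtree[OF t i]])
    have "inj_on (left_edge d (cuts (subtree t i))) (ws i ` ?A i)"
      by (rule inj_on_subset[OF S.horizontal.edge_inj[of k]]) (use ww in auto)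
    then show "inj_on (x i) (?A i)" using comp_inj_on[OF inji[OF i]] by (simp add: x_def comp_def)
  qed (use A in auto)
  have Pi: "P i = Pat (?A i) (x i) (y i)" for i by (simp add: P_def x_def y_def)
  have "Pat A X Y = inflate d p (cnt l A) P"
  proof (intro set_eqI iffI)
    fix z assume "z \<in> Pat A X Y"
    then obtain a b where ab: "a \<in> A" "b \<in> A" "Y a < Y b" "z = (rk A X a, rk A X b)" unfolding Pat_def by blast
    show "z \<in> inflate d p (cnt l A) P"
    proof (cases "l a = l b")
      case True
      have "y (l b) a < y (l b) b" using Yless[OF ab(1,2)] ab(3) True by simp
      then have "(rk (?A (l b)) (x (l b)) a, rk (?A (l b)) (x (l b)) b) \<in> P (l b)"
        unfolding Pi Pat_def using ab True by blast
      then show ?thesis unfolding inflate_def ab(4) rk[OF ab(1)] rk[OF ab(2)] True using ld[OF ab(2)] by blast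
    next
      case False
      have "p (Suc (l a)) < p (Suc (l b))" using Yless[OF ab(1,2)] ab(3) False by simp
      moreover have "rk (?A (l a)) (x (l a)) a < cnt l A (l a)" "rk (?A (l b)) (x (l b)) b < cnt l A (l b)"
        using bij_betw_apply[OF bij[OF ld[OF ab(1)]], of a] bij_betw_apply[OF bij[OF ld[OF ab(2)]], of b] ab by auto
      ultimately show ?thesis unfolding inflate_def ab(4) rk[OF ab(1)] rk[OF ab(2)]
        using ld[OF ab(1)] ld[OF ab(2)] by blast
    qed
  next
    fix z assume "z \<in> inflate d p (cnt l A) P"
    then consider i b c where "i < d" "(b, c) \<in> P i" "z = (offs (cnt l A) i + b, offs (cnt l A) i + c)"
      | i j b c where "i < d" "j < d" "p (Suc i) < p (Suc j)" "b < cnt l A i" "c < cnt l A j"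
          "z = (offs (cnt l A) i + b, offs (cnt l A) j + c)"
      unfolding inflate_def by blast
    then show "z \<in> Pat A X Y"
    proof cases
      case (1 i b c)
      then obtain a' b' where ab: "a' \<in> ?A i" "b' \<in> ?A i" "y i a' < y i b'" "b = rk (?A i) (x i) a'" "c = rk (?A i) (x i) b'"
        unfolding Pi Pat_def by blast
      then have l: "a' \<in> A" "b' \<in> A" "l a' = i" "l b' = i" by auto
      have "Y a' < Y b'" using Yless[OF l(1,2)] l ab(3) by simp
      moreover have "z = (rk A X a', rk A X b')" using 1 ab(4,5) rk[OF l(1)] rk[OF l(2)] l by simp
      ultimately show ?thesis unfolding Pat_def mem_Collect_eq using l(1,2) by (intro exI conjI)
    next
      case (2 i j b c)
      have "b \<in> rk (?A i) (x i) ` ?A i" "c \<in> rk (?A j) (x j) ` ?A j"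
        unfolding bij_betw_imp_surj_on[OF bij[OF 2(1)]] bij_betw_imp_surj_on[OF bij[OF 2(2)]]
        using 2(4,5) by (simp_all only: lessThan_iff)
      then obtain a' b' where a': "a' \<in> ?A i" "b = rk (?A i) (x i) a'"
        and b': "b' \<in> ?A j" "c = rk (?A j) (x j) b'" by (elim imageE)
      have l: "a' \<in> A" "b' \<in> A" "l a' = i" "l b' = j" using a' b' by auto
      have "i \<noteq> j" using 2(3) by auto
      then have "Y a' < Y b'" using Yless[OF l(1,2)] l 2(3) by simp
      moreover have "z = (rk A X a', rk A X b')" using 2(6) a'(2) b'(2) rk[OF l(1)] rk[OF l(2)] l by simp
      ultimately show ?thesis unfolding Pat_def mem_Collect_eq using l(1,2) by (intro exI conjI)
    qed
  qed
  then show "Pat A (\<lambda>j. left_edge d (cuts t) (w j)) (\<lambda>j. bottom_edge d (perms t) (cuts t) (w j))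
        = inflate d (perms t []) (cnt l A) P"
    unfolding X_def Y_def p_def .
qed

lemma prod_by_letter:
  fixes A :: "nat set" and l :: "nat \<Rightarrow> nat"
  assumes "finite A" "l \<in> A \<rightarrow>\<^sub>E {..<d}"
  shows "(\<Prod>j\<in>A. f (l j) j) = (\<Prod>i<d. \<Prod>j\<in>{j\<in>A. l j = i}. (f i j :: real))"
proof -
  have "(\<Prod>i<d. \<Prod>j\<in>{j\<in>A. l j = i}. f (l j) j) = (\<Prod>j\<in>A. f (l j) j)"
    by (rule prod.group) (use assms in auto)
  moreover have "(\<Prod>j\<in>{j\<in>A. l j = i}. f (l j) j) = (\<Prod>j\<in>{j\<in>A. l j = i}. f i j)" for i
    by (intro prod.cong) auto
  ultimately show ?thesis by simp
qed

text \<open>The sum over addresses can be compared with boxes in the plane, and the recursion at the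
  root with the entropies of the subtrees; both uses need the same number. Induction on the level:
  addresses are split by root letter and the pattern is composed by
  \<open>compose_pattern\<close>.\<close>

lemma W_eq_Q:
  assumes d: "d \<ge> 2"
  shows "\<lbrakk>good_tree d t; finite A\<rbrakk> \<Longrightarrow> W d k t A R = Q d k t (card A) R"
proof (induction k arbitrary: t A R)
  case 0
  have "A \<rightarrow>\<^sub>E words d 0 = {\<lambda>j\<in>A. []}" by (auto simp: PiE_iff extensional_def fun_eq_iff)
  moreover have "inj_on (\<lambda>j\<in>A. []) A \<longleftrightarrow> card A \<le> 1"
    using 0(2) by (auto simp: inj_on_def card_le_Suc0_iff_eq)
  moreover have "Pat A (\<lambda>j. left_edge d (cuts t) ((\<lambda>j\<in>A. []) j)) (\<lambda>j. bottom_edge d (perms t) (cuts t) ((\<lambda>j\<in>A. []) j)) = {}"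
    by (auto simp: Pat_def)
  moreover have "(\<Prod>j\<in>A. side d (cuts t) ((\<lambda>j\<in>A. []) j)) = 1" by (intro prod.neutral) auto
  ultimately show ?case unfolding W_def by (simp only: sum.insert[OF finite.emptyI] sum.empty Q.simps) auto
next
  case (Suc k)
  let ?A = "\<lambda>l i. {j\<in>A. l j = i}"
  let ?S = "\<lambda>l. \<Pi>\<^sub>E i\<in>{..<d}. ?A l i \<rightarrow>\<^sub>E words d k"
  let ?V = "\<lambda>i w B. \<Prod>j\<in>B. side d (cuts (subtree t i)) (w j)"
  define P where "P = (\<lambda>l ws i. Pat (?A l i) (\<lambda>j. left_edge d (cuts (subtree t i)) (ws i j))
         (\<lambda>j. bottom_edge d (perms (subtree t i)) (cuts (subtree t i)) (ws i j)))"
  have fin: "finite (A \<rightarrow>\<^sub>E {..<d})" "\<And>l. finite (?S l)" using Suc.prems(2) by (auto intro!: finite_PiE)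
  have inner: "(\<Sum>ws\<in>?S l. if (\<forall>i<d. inj_on (ws i) (?A l i)) \<and> inflate d (perms t []) (cnt l A) (P l ws) = R
        then \<Prod>i<d. ?V i (ws i) (?A l i) else 0)
      = (\<Sum>Rs\<in>(\<Pi>\<^sub>E i\<in>{..<d}. patterns (cnt l A i)). if inflate d (perms t []) (cnt l A) Rs = R
         then \<Prod>i<d. Q d k (subtree t i) (cnt l A i) (Rs i) else 0)" (is "?L = ?R")
    if l: "l \<in> A \<rightarrow>\<^sub>E {..<d}" for l
  proof -
    let ?PP = "\<Pi>\<^sub>E i\<in>{..<d}. patterns (cnt l A i)"
    have finP: "finite ?PP" by (auto intro!: finite_PiE)
    have "?R = (\<Sum>Rs\<in>?PP. if inflate d (perms t []) (cnt l A) Rs = R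
         then \<Prod>i<d. W d k (subtree t i) (?A l i) (Rs i) else 0)"
    proof (intro sum.cong refl if_cong prod.cong)
      fix Rs i assume "i \<in> {..<d}"
      then show "Q d k (subtree t i) (cnt l A i) (Rs i) = W d k (subtree t i) (?A l i) (Rs i)"
        using Suc.IH[OF good_subtree[OF Suc.prems(1)], of i "?A l i" "Rs i"] Suc.prems(2) by (simp add: cnt_def)
    qed
    also have "\<dots> = (\<Sum>Rs\<in>?PP. \<Sum>ws\<in>?S l. if inflate d (perms t []) (cnt l A) Rs = R
         then \<Prod>i<d. (if inj_on (ws i) (?A l i) \<and> P l ws i = Rs i then ?V i (ws i) (?A l i) else 0) else 0)"
    proof (rule sum.cong[OF refl])
      fix Rs
      have "(\<Prod>i<d. W d k (subtree t i) (?A l i) (Rs i))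
        = (\<Sum>ws\<in>?S l. \<Prod>i<d. (if inj_on (ws i) (?A l i) \<and> P l ws i = Rs i then ?V i (ws i) (?A l i) else 0))"
        unfolding W_def P_def using Suc.prems(2) by (subst prod_sum_PiE) (auto intro!: finite_PiE)
      then show "(if inflate d (perms t []) (cnt l A) Rs = R then \<Prod>i<d. W d k (subtree t i) (?A l i) (Rs i) else 0)
        = (\<Sum>ws\<in>?S l. if inflate d (perms t []) (cnt l A) Rs = R
         then \<Prod>i<d. (if inj_on (ws i) (?A l i) \<and> P l ws i = Rs i then ?V i (ws i) (?A l i) else 0) else 0)"
        by simp
    qed
    also have "\<dots> = (\<Sum>ws\<in>?S l. \<Sum>Rs\<in>?PP. if inflate d (perms t []) (cnt l A) Rs = R
         then \<Prod>i<d. (if inj_on (ws i) (?A l i) \<and> P l ws i = Rs i then ?V i (ws i) (?A l i) else 0) else 0)"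
      by (rule sum.swap)
    also have "\<dots> = ?L"
    proof (rule sum.cong[OF refl])
      fix ws assume ws: "ws \<in> ?S l"
      \<comment> \<open>For fixed addresses exactly one tuple of block patterns is realised, so the
        sum over \<open>Rs\<close> collapses to this term.\<close>
      define Rs0 where "Rs0 = (\<lambda>i\<in>{..<d}. P l ws i)"
      have Rs0: "Rs0 \<in> ?PP" unfolding Rs0_def P_def patterns_def
        using Suc.prems(2) Pat_subset[of "?A l _"] by (auto simp: cnt_def PiE_iff)
      have "(\<Sum>Rs\<in>?PP. if inflate d (perms t []) (cnt l A) Rs = R
         then \<Prod>i<d. (if inj_on (ws i) (?A l i) \<and> P l ws i = Rs i then ?V i (ws i) (?A l i) else 0) else 0)
        = (\<Sum>Rs\<in>?PP. if Rs = Rs0 then (if inflate d (perms t []) (cnt l A) Rs0 = R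
         then \<Prod>i<d. (if inj_on (ws i) (?A l i) then ?V i (ws i) (?A l i) else 0) else 0) else 0)"
      proof (rule sum.cong[OF refl])
        fix Rs assume Rs: "Rs \<in> ?PP"
        show "(if inflate d (perms t []) (cnt l A) Rs = R
         then \<Prod>i<d. (if inj_on (ws i) (?A l i) \<and> P l ws i = Rs i then ?V i (ws i) (?A l i) else 0) else 0)
         = (if Rs = Rs0 then (if inflate d (perms t []) (cnt l A) Rs0 = R
         then \<Prod>i<d. (if inj_on (ws i) (?A l i) then ?V i (ws i) (?A l i) else 0) else 0) else 0)"
        proof (cases "Rs = Rs0")
          case True then show ?thesis by (auto simp: Rs0_def intro!: prod.cong)
        next
          case False
          have "\<exists>i<d. Rs i \<noteq> P l ws i"
          proof (rule ccontr)
            assume "\<not> (\<exists>i<d. Rs i \<noteq> P l ws i)"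
            then have "Rs = Rs0" by (intro PiE_ext[OF Rs Rs0]) (simp add: Rs0_def)
            then show False using False by simp
          qed
          then obtain i where "i < d" "Rs i \<noteq> P l ws i" by blast
          then have "(\<Prod>i<d. (if inj_on (ws i) (?A l i) \<and> P l ws i = Rs i then ?V i (ws i) (?A l i) else 0)) = 0"
            by (intro prod_zero) auto
          then show ?thesis using False by simp
        qed
      qed
      also have "\<dots> = (if inflate d (perms t []) (cnt l A) Rs0 = R
         then \<Prod>i<d. (if inj_on (ws i) (?A l i) then ?V i (ws i) (?A l i) else 0) else 0)"
        using Rs0 finP by simp
      also have "inflate d (perms t []) (cnt l A) Rs0 = inflate d (perms t []) (cnt l A) (P l ws)"
        by (rule inflate_cong) (simp add: Rs0_def)
      also have "(\<Prod>i<d. (if inj_on (ws i) (?A l i) then ?V i (ws i) (?A l i) else 0))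
        = (if \<forall>i<d. inj_on (ws i) (?A l i) then \<Prod>i<d. ?V i (ws i) (?A l i) else 0)"
      proof (cases "\<forall>i<d. inj_on (ws i) (?A l i)")
        case False
        then have "(\<Prod>i<d. (if inj_on (ws i) (?A l i) then ?V i (ws i) (?A l i) else 0)) = 0"
          by (intro prod_zero) auto
        then show ?thesis using False by simp
      qed simp
      finally show "(\<Sum>Rs\<in>?PP. if inflate d (perms t []) (cnt l A) Rs = R
         then \<Prod>i<d. (if inj_on (ws i) (?A l i) \<and> P l ws i = Rs i then ?V i (ws i) (?A l i) else 0) else 0)
        = (if (\<forall>i<d. inj_on (ws i) (?A l i)) \<and> inflate d (perms t []) (cnt l A) (P l ws) = R
        then \<Prod>i<d. ?V i (ws i) (?A l i) else 0)" by auto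
    qed
    finally show ?thesis ..
  qed
  have "W d (Suc k) t A R = (\<Sum>l\<in>A \<rightarrow>\<^sub>E {..<d}. \<Sum>ws\<in>?S l.
      (\<Prod>j\<in>A. gap d (cuts t []) (l j)) * (if (\<forall>i<d. inj_on (ws i) (?A l i)) \<and> inflate d (perms t []) (cnt l A) (P l ws) = R
        then \<Prod>i<d. ?V i (ws i) (?A l i) else 0))"
    unfolding W_def sum_words_functions[OF Suc.prems(2)]
  proof (intro sum.cong refl)
    fix l ws assume l: "l \<in> A \<rightarrow>\<^sub>E {..<d}" and ws: "ws \<in> ?S l"
    let ?w = "\<lambda>j\<in>A. ws (l j) j @ [l j]"
    note cp = compose_pattern[OF d Suc.prems l ws]
    have "(\<Prod>j\<in>A. side d (cuts t) (?w j)) = (\<Prod>j\<in>A. gap d (cuts t []) (l j) * side d (cuts (subtree t (l j))) (ws (l j) j))"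
      by (intro prod.cong refl) (simp add: side_subtree)
    also have "\<dots> = (\<Prod>j\<in>A. gap d (cuts t []) (l j)) * (\<Prod>i<d. ?V i (ws i) (?A l i))"
      by (simp add: prod.distrib prod_by_letter[OF Suc.prems(2) l, of "\<lambda>i j. side d (cuts (subtree t i)) (ws i j)"])
    finally have v: "(\<Prod>j\<in>A. side d (cuts t) (?w j)) = \<dots>" .
    show "(if inj_on ?w A \<and> Pat A (\<lambda>j. left_edge d (cuts t) (?w j)) (\<lambda>j. bottom_edge d (perms t) (cuts t) (?w j)) = R
       then \<Prod>j\<in>A. side d (cuts t) (?w j) else 0)
     = (\<Prod>j\<in>A. gap d (cuts t []) (l j)) * (if (\<forall>i<d. inj_on (ws i) (?A l i)) \<and> inflate d (perms t []) (cnt l A) (P l ws) = R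
        then \<Prod>i<d. ?V i (ws i) (?A l i) else 0)"
    proof (cases "inj_on ?w A")
      case True
      show ?thesis unfolding cp(2)[OF True] v using True cp(1) by (simp add: P_def)
    next
      case False
      then have "\<not> (\<forall>i<d. inj_on (ws i) (?A l i))" using cp(1) by blast
      with False show ?thesis by (simp only: simp_thms if_False mult_zero_right)
    qed
  qed
  also have "\<dots> = (\<Sum>l\<in>A \<rightarrow>\<^sub>E {..<d}. (\<Prod>j\<in>A. gap d (cuts t []) (l j)) *
     (\<Sum>Rs\<in>(\<Pi>\<^sub>E i\<in>{..<d}. patterns (cnt l A i)). if inflate d (perms t []) (cnt l A) Rs = R
         then \<Prod>i<d. Q d k (subtree t i) (cnt l A i) (Rs i) else 0))"
    using inner by (intro sum.cong refl) (simp add: sum_distrib_left[symmetric])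
  also have "\<dots> = Q d (Suc k) t (card A) R"
    unfolding Q.simps
    by (rule sum_letters_bij[OF Suc.prems(2), symmetric, where g = "gap d (cuts t [])" and F = "\<lambda>N. \<Sum>Rs\<in>(\<Pi>\<^sub>E i\<in>{..<d}. patterns (N i)). if inflate d (perms t []) N Rs = R
         then \<Prod>i<d. Q d k (subtree t i) (N i) (Rs i) else 0"])
  finally show ?case .
qed

section \<open>From order relations to permutations of a sample\<close>

definition rel_of :: "nat \<Rightarrow> (nat \<Rightarrow> nat) \<Rightarrow> (nat \<times> nat) set" where
  "rel_of n \<pi> = {(p, q). p < n \<and> q < n \<and> \<pi> (Suc p) < \<pi> (Suc q)}"

lemma rel_of_in_patterns: "rel_of n \<pi> \<in> patterns n"
  by (auto simp: rel_of_def patterns_def)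

lemma finite_Sym [simp]: "finite (Sym n)"
  by (simp add: Sym_def finite_permutations)

text \<open>The value at a position is one more than the number of positions that are related to
  it.\<close>

lemma inj_rel_of: "inj_on (rel_of n) (Sym n)"
proof (rule inj_onI)
  fix \<pi> \<sigma> assume \<pi>: "\<pi> \<in> Sym n" and \<sigma>: "\<sigma> \<in> Sym n" and eq: "rel_of n \<pi> = rel_of n \<sigma>"
  have *: "card {q. (q, p) \<in> rel_of n \<tau>} = \<tau> (Suc p) - 1" if \<tau>: "\<tau> \<in> Sym n" and p: "p < n" for \<tau> p
  proof -
    have per: "\<tau> permutes {1..n}" using \<tau> by (simp add: Sym_def)
    have r: "\<tau> (Suc p) \<in> {1..n}" using per p by (subst permutes_in_image) auto
    have "bij_betw (\<lambda>q. \<tau> (Suc q)) {q. (q, p) \<in> rel_of n \<tau>} {1..<\<tau> (Suc p)}"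
    proof (rule bij_betw_imageI)
      show "inj_on (\<lambda>q. \<tau> (Suc q)) {q. (q, p) \<in> rel_of n \<tau>}"
        using permutes_inj[OF per] by (auto simp: inj_on_def inj_def)
      show "(\<lambda>q. \<tau> (Suc q)) ` {q. (q, p) \<in> rel_of n \<tau>} = {1..<\<tau> (Suc p)}"
      proof (intro set_eqI iffI)
        fix m assume "m \<in> (\<lambda>q. \<tau> (Suc q)) ` {q. (q, p) \<in> rel_of n \<tau>}"
        then obtain q where q: "m = \<tau> (Suc q)" "q < n" "\<tau> (Suc q) < \<tau> (Suc p)" by (auto simp: rel_of_def)
        have "\<tau> (Suc q) \<in> {1..n}" using per q by (subst permutes_in_image) auto
        then show "m \<in> {1..<\<tau> (Suc p)}" using q by auto
      next
        fix m assume m: "m \<in> {1..<\<tau> (Suc p)}"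
        then have "m \<in> {1..n}" using r by auto
        then obtain j where j: "j \<in> {1..n}" "m = \<tau> j" using permutes_image[OF per] by (metis imageE)
        then have "j = Suc (j - 1)" "j - 1 < n" by auto
        then show "m \<in> (\<lambda>q. \<tau> (Suc q)) ` {q. (q, p) \<in> rel_of n \<tau>}"
          using m j p by (intro image_eqI[of _ _ "j - 1"]) (auto simp: rel_of_def)
      qed
    qed
    then show ?thesis by (simp add: bij_betw_same_card)
  qed
  show "\<pi> = \<sigma>"
  proof
    fix j
    show "\<pi> j = \<sigma> j"
    proof (cases "j \<in> {1..n}")
      case True
      then obtain p where p: "j = Suc p" "p < n" by (cases j) auto
      have "\<pi> j \<in> {1..n}" using True \<pi> permutes_in_image[of \<pi> "{1..n}" j] unfolding Sym_def by blast
      moreover have "\<sigma> j \<in> {1..n}" using True \<sigma> permutes_in_image[of \<sigma> "{1..n}" j] unfolding Sym_def by blast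
      ultimately have "\<pi> j \<ge> 1" "\<sigma> j \<ge> 1" by auto
      moreover have "\<pi> j - 1 = \<sigma> j - 1" using *[OF \<pi> p(2)] *[OF \<sigma> p(2)] eq by (simp add: p)
      ultimately show ?thesis by linarith
    next
      case False
      then show ?thesis using \<pi> \<sigma> by (simp add: Sym_def permutes_not_in)
    qed
  qed
qed

lemma bij_rank_of: "bij_betw (rank_of n f) {1..n} {1..n}"
proof -
  let ?B = "\<lambda>i. {j \<in> {1..n}. f j < f i \<or> (f j = f i \<and> j \<le> i)}"
  have less: "rank_of n f i < rank_of n f j" if "i \<in> {1..n}" "j \<in> {1..n}" "f i < f j \<or> (f i = f j \<and> i < j)" for i j
    unfolding rank_of_def
  proof (rule psubset_card_mono)
    have "?B i \<subseteq> ?B j" using that by auto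
    moreover have "j \<in> ?B j" "j \<notin> ?B i" using that by auto
    ultimately show "?B i \<subset> ?B j" by blast
  qed simp
  have inj: "inj_on (rank_of n f) {1..n}"
  proof (rule inj_onI)
    fix i j assume ij: "i \<in> {1..n}" "j \<in> {1..n}" "rank_of n f i = rank_of n f j"
    show "i = j"
    proof (rule ccontr)
      assume "i \<noteq> j"
      then have "(f i < f j \<or> (f i = f j \<and> i < j)) \<or> (f j < f i \<or> (f j = f i \<and> j < i))" by linarith
      then show False using less[OF ij(1,2)] less[OF ij(2,1)] ij(3) by auto
    qed
  qed
  have "rank_of n f i \<in> {1..n}" if "i \<in> {1..n}" for i
  proof -
    have "card (?B i) \<le> card {1..n}" by (intro card_mono) auto
    moreover have "card (?B i) > 0" using that by (auto simp: card_gt_0_iff)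
    ultimately show ?thesis by (simp add: rank_of_def)
  qed
  then have "rank_of n f ` {1..n} = {1..n}" using card_image[OF inj] by (intro card_subset_eq) auto
  then show ?thesis using inj by (simp add: bij_betw_def)
qed

lemma pattern_rank:
  assumes "j \<in> {1..n}"
  shows "pattern n z (rank_of n (\<lambda>i. fst (z i)) j) = rank_of n (\<lambda>i. snd (z i)) j"
proof -
  have b: "bij_betw (rank_of n (\<lambda>i. fst (z i))) {1..n} {1..n}" by (rule bij_rank_of)
  show ?thesis using bij_betw_apply[OF b assms] the_inv_into_f_f[OF bij_betw_imp_inj_on[OF b] assms]
    by (simp add: pattern_def)
qed

lemma pattern_in_Sym: "pattern n z \<in> Sym n"
  unfolding Sym_def mem_Collect_eq
proof (rule bij_imp_permutes)
  let ?rx = "rank_of n (\<lambda>i. fst (z i))" and ?ry = "rank_of n (\<lambda>i. snd (z i))"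
  have "bij_betw (?ry \<circ> the_inv_into {1..n} ?rx) {1..n} {1..n}"
    by (rule bij_betw_trans[OF bij_betw_the_inv_into[OF bij_rank_of] bij_rank_of])
  then show "bij_betw (pattern n z) {1..n} {1..n}"
    by (rule bij_betw_cong[THEN iffD1, rotated]) (simp add: pattern_def)
qed (simp only: pattern_def if_False)

text \<open>This removes the inverse function from \<open>pattern\<close>, so that measurability of
  patterns reduces to that of ranks.\<close>

lemma pattern_eq_iff:
  assumes "\<pi> \<in> Sym n"
  shows "pattern n z = \<pi> \<longleftrightarrow> (\<forall>j\<in>{1..n}. rank_of n (\<lambda>i. snd (z i)) j = \<pi> (rank_of n (\<lambda>i. fst (z i)) j))"
proof
  assume *: "\<forall>j\<in>{1..n}. rank_of n (\<lambda>i. snd (z i)) j = \<pi> (rank_of n (\<lambda>i. fst (z i)) j)"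
  show "pattern n z = \<pi>"
  proof
    fix i
    show "pattern n z i = \<pi> i"
    proof (cases "i \<in> {1..n}")
      case True
      then have "i \<in> rank_of n (\<lambda>i. fst (z i)) ` {1..n}" using bij_betw_imp_surj_on[OF bij_rank_of] by metis
      then obtain j where "j \<in> {1..n}" "i = rank_of n (\<lambda>i. fst (z i)) j" by (elim imageE)
      then show ?thesis using pattern_rank * by simp
    next
      case False
      then show ?thesis using assms pattern_in_Sym[of n z] by (simp add: Sym_def permutes_not_in)
    qed
  qed
qed (use pattern_rank in auto)

text \<open>\<open>rk\<close> starts at 0 and counts strictly smaller values, while
  \<open>rank_of\<close> starts at 1 and breaks ties by index.\<close>

lemma rank_of_tiefree:
  assumes "inj_on f {1..n}" "i \<in> {1..n}"
  shows "rank_of n f i = Suc (rk {1..n} f i)"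
proof -
  have "{j \<in> {1..n}. f j < f i \<or> (f j = f i \<and> j \<le> i)} = insert i {c \<in> {1..n}. f c < f i}"
    using assms by (auto dest: inj_onD)
  then show ?thesis by (simp add: rank_of_def rk_def)
qed

lemma rk_less_iff:
  assumes "finite A" "a \<in> A" "b \<in> A"
  shows "rk A x a < rk A x b \<longleftrightarrow> x a < x b"
proof
  assume "x a < x b"
  then show "rk A x a < rk A x b"
    unfolding rk_def using assms by (intro psubset_card_mono) auto
next
  assume *: "rk A x a < rk A x b"
  show "x a < x b"
  proof (rule ccontr)
    assume "\<not> x a < x b"
    then have "rk A x b \<le> rk A x a" unfolding rk_def using assms by (intro card_mono) auto
    then show False using * by simp
  qed
qed

lemma Pat_eq_rel_of_pattern:
  assumes x: "inj_on (\<lambda>j. fst (z j)) {1..n}" and y: "inj_on (\<lambda>j. snd (z j)) {1..n}"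
  shows "Pat {1..n} (\<lambda>j. fst (z j)) (\<lambda>j. snd (z j)) = rel_of n (pattern n z)"
proof -
  let ?r = "rk {1..n} (\<lambda>j. fst (z j))"
  have surj: "?r ` {1..n} = {..<n}" using bij_rk[OF _ x] by (simp add: bij_betw_def)
  have pat: "pattern n z (Suc (?r a)) = Suc (rk {1..n} (\<lambda>j. snd (z j)) a)" if "a \<in> {1..n}" for a
    using pattern_rank[OF that, of z] rank_of_tiefree[OF x that] rank_of_tiefree[OF y that] by simp
  have "(\<exists>a b. z' = (?r a, ?r b) \<and> a \<in> {1..n} \<and> b \<in> {1..n} \<and> snd (z a) < snd (z b)) \<longleftrightarrow> z' \<in> rel_of n (pattern n z)" for z'
  proof
    assume "\<exists>a b. z' = (?r a, ?r b) \<and> a \<in> {1..n} \<and> b \<in> {1..n} \<and> snd (z a) < snd (z b)"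
    then obtain a b where ab: "z' = (?r a, ?r b)" "a \<in> {1..n}" "b \<in> {1..n}" "snd (z a) < snd (z b)" by blast
    have "?r a \<in> {..<n}" "?r b \<in> {..<n}" using surj ab by blast+
    moreover have "rk {1..n} (\<lambda>j. snd (z j)) a < rk {1..n} (\<lambda>j. snd (z j)) b"
      using rk_less_iff[OF _ ab(2,3), of "\<lambda>j. snd (z j)"] ab(4) by simp
    ultimately show "z' \<in> rel_of n (pattern n z)" using pat[OF ab(2)] pat[OF ab(3)] by (simp add: rel_of_def ab(1))
  next
    assume "z' \<in> rel_of n (pattern n z)"
    then obtain p q where pq: "z' = (p, q)" "p < n" "q < n" "pattern n z (Suc p) < pattern n z (Suc q)" by (auto simp: rel_of_def)
    have "p \<in> ?r ` {1..n}" "q \<in> ?r ` {1..n}" using pq surj by simp_all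
    then obtain a b where ab: "a \<in> {1..n}" "p = ?r a" "b \<in> {1..n}" "q = ?r b" by (elim imageE)
    have "rk {1..n} (\<lambda>j. snd (z j)) a < rk {1..n} (\<lambda>j. snd (z j)) b" using pq(4) pat ab by simp
    then have "snd (z a) < snd (z b)" using rk_less_iff[OF _ ab(1,3), of "\<lambda>j. snd (z j)"] by simp
    then show "\<exists>a b. z' = (?r a, ?r b) \<and> a \<in> {1..n} \<and> b \<in> {1..n} \<and> snd (z a) < snd (z b)"
      using ab pq(1) by (intro exI[of _ a] exI[of _ b]) simp
  qed
  then show ?thesis unfolding Pat_def by blast
qed

lemma measurable_rank_of:
  assumes f: "\<And>j. j \<in> {1..n} \<Longrightarrow> (\<lambda>z. f z j) \<in> borel_measurable N" and i: "i \<in> {1..n}"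
  shows "{z \<in> space N. rank_of n (f z) i = m} \<in> sets N"
proof -
  have "real (rank_of n (f z) i) = (\<Sum>j\<in>{1..n}. if f z j < f z i \<or> (f z j = f z i \<and> j \<le> i) then 1 else 0)" for z
    by (simp add: rank_of_def sum.If_cases Int_def)
  moreover have "(\<lambda>z. \<Sum>j\<in>{1..n}. if f z j < f z i \<or> (f z j = f z i \<and> j \<le> i) then 1 else 0 :: real) \<in> borel_measurable N"
  proof (intro borel_measurable_sum measurable_If borel_measurable_const)
    fix j assume "j \<in> {1..n}"
    note [measurable] = f[OF this] f[OF i]
    show "{z \<in> space N. f z j < f z i \<or> (f z j = f z i \<and> j \<le> i)} \<in> sets N" by measurable
  qed
  ultimately have "(\<lambda>z. real (rank_of n (f z) i)) \<in> borel_measurable N" by (simp only:)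
  then have "{z \<in> space N. real (rank_of n (f z) i) = real m} \<in> sets N" by measurable
  then show ?thesis by simp
qed

lemma measurable_pattern:
  assumes "sets \<nu> = sets (borel :: (real \<times> real) measure)"
  shows "pattern n \<in> PiM {1..n} (\<lambda>_. \<nu>) \<rightarrow>\<^sub>M count_space (Sym n)"
proof (rule measurable_count_space_eq2[THEN iffD2], simp, intro conjI ballI)
  let ?N = "PiM {1..n} (\<lambda>_. \<nu>)"
  show "pattern n \<in> space ?N \<rightarrow> Sym n" using pattern_in_Sym by blast
  fix \<pi> assume \<pi>: "\<pi> \<in> Sym n"
  have c: "(\<lambda>z. z j) \<in> ?N \<rightarrow>\<^sub>M borel" if "j \<in> {1..n}" for j
    using measurable_component_singleton[OF that, of "\<lambda>_. \<nu>"] by (simp add: measurable_cong_sets[OF refl assms])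
  have f: "(\<lambda>z. fst (z j)) \<in> borel_measurable ?N" "(\<lambda>z. snd (z j)) \<in> borel_measurable ?N" if "j \<in> {1..n}" for j
    by (rule measurable_compose[OF c[OF that] borel_measurable_continuous_onI]; intro continuous_intros)+
  \<comment> \<open>The permutation is applied to a random rank; fixing its value \<open>m\<close>
    separates the conditions on the two coordinates.\<close>
  let ?E = "\<lambda>j m. {z\<in>space ?N. rank_of n (\<lambda>i. fst (z i)) j = m} \<inter> {z\<in>space ?N. rank_of n (\<lambda>i. snd (z i)) j = \<pi> m}"
  have "z \<in> (\<Union>m\<in>{1..n}. ?E j m) \<longleftrightarrow> rank_of n (\<lambda>i. snd (z i)) j = \<pi> (rank_of n (\<lambda>i. fst (z i)) j)"
    if "z \<in> space ?N" "j \<in> {1..n}" for z j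
    using that bij_betw_apply[OF bij_rank_of that(2), of "\<lambda>i. fst (z i)"] by auto
  then have "pattern n -` {\<pi>} \<inter> space ?N = {z\<in>space ?N. \<forall>j\<in>{1..n}. z \<in> (\<Union>m\<in>{1..n}. ?E j m)}"
    using pattern_eq_iff[OF \<pi>] by blast
  also have "\<dots> \<in> sets ?N"
  proof (rule sets.sets_Collect_finite_All)
    fix j assume j: "j \<in> {1..n}"
    have E: "?E j m \<in> sets ?N" for m
      using measurable_rank_of[where f = "\<lambda>z i. fst (z i)" and N = ?N, OF f(1) j]
        measurable_rank_of[where f = "\<lambda>z i. snd (z i)" and N = ?N, OF f(2) j] by (intro sets.Int)
    have "(\<Union>m\<in>{1..n}. ?E j m) \<in> sets ?N" by (intro sets.finite_UN E) simp
    moreover have "{z\<in>space ?N. z \<in> (\<Union>m\<in>{1..n}. ?E j m)} = (\<Union>m\<in>{1..n}. ?E j m)" by blast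
    ultimately show "{z\<in>space ?N. z \<in> (\<Union>m\<in>{1..n}. ?E j m)} \<in> sets ?N" by (simp only:)
  qed simp
  finally show "pattern n -` {\<pi>} \<inter> space ?N \<in> sets ?N" .
qed

lemma sum_UN_le:
  fixes f :: "'a \<Rightarrow> real"
  assumes "finite I" "\<And>i. i \<in> I \<Longrightarrow> finite (B i)" "\<And>i x. i \<in> I \<Longrightarrow> x \<in> B i \<Longrightarrow> f x \<ge> 0"
  shows "(\<Sum>x\<in>(\<Union>i\<in>I. B i). f x) \<le> (\<Sum>i\<in>I. \<Sum>x\<in>B i. f x)"
  using assms
proof (induction I rule: finite_induct)
  case (insert i I)
  have "(\<Sum>x\<in>B i \<union> (\<Union>i\<in>I. B i). f x) \<le> (\<Sum>x\<in>B i. f x) + (\<Sum>x\<in>(\<Union>i\<in>I. B i). f x)"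
    using insert.prems insert.hyps by (subst sum.union_inter[symmetric]) (auto intro!: sum_nonneg)
  also have "(\<Sum>x\<in>(\<Union>i\<in>I. B i). f x) \<le> (\<Sum>i\<in>I. \<Sum>x\<in>B i. f x)"
    using insert.prems by (intro insert.IH) auto
  finally show ?case using insert.hyps by simp
qed simp

text \<open>Two given points share a cell with probability equal to the sum of the squared weights,
  and a union bound over the pairs of points controls all collisions.\<close>

lemma sum_inj_words_ge:
  assumes T0: "\<And>s. s \<in> S \<Longrightarrow> (T s :: real) \<ge> 0" and S: "finite S" and T1: "(\<Sum>s\<in>S. T s) = 1" and A: "finite A"
  shows "(\<Sum>w\<in>{w\<in>A \<rightarrow>\<^sub>E S. inj_on w A}. \<Prod>j\<in>A. T (w j)) \<ge> 1 - (real (card A))\<^sup>2 * (\<Sum>s\<in>S. (T s)\<^sup>2)"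
    and "(\<Sum>w\<in>{w\<in>A \<rightarrow>\<^sub>E S. inj_on w A}. \<Prod>j\<in>A. T (w j)) \<le> 1"
proof -
  have fin: "finite (A \<rightarrow>\<^sub>E S)" using A S by (auto intro!: finite_PiE)
  have P0: "(\<Prod>j\<in>A. T (w j)) \<ge> 0" if "w \<in> A \<rightarrow>\<^sub>E S" for w using that T0 by (intro prod_nonneg) auto
  have all: "(\<Sum>w\<in>A \<rightarrow>\<^sub>E S. \<Prod>j\<in>A. T (w j)) = 1"
    using prod_sum_PiE[of A "\<lambda>_. S" "\<lambda>_. T"] A S T1 by simp
  let ?I = "{w\<in>A \<rightarrow>\<^sub>E S. inj_on w A}"
  show "(\<Sum>w\<in>?I. \<Prod>j\<in>A. T (w j)) \<le> 1"
    unfolding all[symmetric] using fin P0 by (intro sum_mono2) auto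
  let ?C = "\<lambda>i j. {w\<in>A \<rightarrow>\<^sub>E S. w i = w j}"
  have coll: "(\<Sum>w\<in>?C i j. \<Prod>m\<in>A. T (w m)) = (\<Sum>s\<in>S. (T s)\<^sup>2)" if ij: "i \<in> A" "j \<in> A" "i \<noteq> j" for i j
  proof -
    have "(\<Sum>w\<in>?C i j. \<Prod>m\<in>A. T (w m)) = (\<Sum>w\<in>A \<rightarrow>\<^sub>E S. \<Sum>s\<in>S. if w i = s \<and> w j = s then \<Prod>m\<in>A. T (w m) else 0)"
    proof -
      have "(\<Sum>s\<in>S. if w i = s \<and> w j = s then \<Prod>m\<in>A. T (w m) else 0) = (if w i = w j then \<Prod>m\<in>A. T (w m) else 0)"
        if w: "w \<in> A \<rightarrow>\<^sub>E S" for w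
      proof (cases "w i = w j")
        case True
        then have "(\<Sum>s\<in>S. if w i = s \<and> w j = s then \<Prod>m\<in>A. T (w m) else 0) = (\<Sum>s\<in>S. if w i = s then \<Prod>m\<in>A. T (w m) else 0)"
          by (intro sum.cong refl if_cong) auto
        moreover have "w i \<in> S" using w ij by auto
        ultimately show ?thesis using True S by simp
      qed (auto intro!: sum.neutral)
      then show ?thesis using fin by (simp add: sum.inter_filter cong: sum.cong)
    qed
    also have "\<dots> = (\<Sum>s\<in>S. \<Sum>w\<in>A \<rightarrow>\<^sub>E S. if w i = s \<and> w j = s then \<Prod>m\<in>A. T (w m) else 0)"
      by (rule sum.swap)
    also have "\<dots> = (\<Sum>s\<in>S. (T s)\<^sup>2)"
    proof (rule sum.cong[OF refl])
      fix s assume s: "s \<in> S"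
      \<comment> \<open>Points \<open>i\<close> and \<open>j\<close> are forced into cell
        \<open>s\<close> and the others are free, so the sum over assignments becomes a product over
        the points.\<close>
      let ?f = "\<lambda>m x. if m \<in> {i, j} then (if x = s then T x else 0) else T x"
      have "(if w i = s \<and> w j = s then \<Prod>m\<in>A. T (w m) else 0) = (\<Prod>m\<in>A. ?f m (w m))" for w
      proof (cases "w i = s \<and> w j = s")
        case True
        then have "(\<Prod>m\<in>A. ?f m (w m)) = (\<Prod>m\<in>A. T (w m))" by (intro prod.cong) auto
        then show ?thesis using True by simp
      next
        case False
        then have "?f i (w i) = 0 \<or> ?f j (w j) = 0" by simp
        then have "(\<Prod>m\<in>A. ?f m (w m)) = 0" using prod_zero[OF A, of "\<lambda>m. ?f m (w m)"] ij by blast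
        then show ?thesis by (simp only: False if_False)
      qed
      then have "(\<Sum>w\<in>A \<rightarrow>\<^sub>E S. if w i = s \<and> w j = s then \<Prod>m\<in>A. T (w m) else 0) = (\<Prod>m\<in>A. \<Sum>x\<in>S. ?f m x)"
        using prod_sum_PiE[of A "\<lambda>_. S" ?f] A S by simp
      also have "\<dots> = (\<Prod>m\<in>A. if m \<in> {i, j} then T s else 1)"
        using S s T1 by (intro prod.cong refl) auto
      also have "\<dots> = (\<Prod>m\<in>{i, j}. T s)"
      proof -
        have "A \<inter> {i, j} = {i, j}" using ij by auto
        then show ?thesis using prod.inter_restrict[OF A, of "\<lambda>_. T s" "{i, j}"] by simp
      qed
      finally show "(\<Sum>w\<in>A \<rightarrow>\<^sub>E S. if w i = s \<and> w j = s then \<Prod>m\<in>A. T (w m) else 0) = (T s)\<^sup>2"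
        using ij by (simp add: power2_eq_square)
    qed
    finally show ?thesis .
  qed
  let ?J = "{p\<in>A \<times> A. fst p \<noteq> snd p}"
  have "1 = (\<Sum>w\<in>?I. \<Prod>j\<in>A. T (w j)) + (\<Sum>w\<in>(A \<rightarrow>\<^sub>E S) - ?I. \<Prod>j\<in>A. T (w j))"
    unfolding all[symmetric] using fin by (subst sum.subset_diff[of ?I]) auto
  also have "(\<Sum>w\<in>(A \<rightarrow>\<^sub>E S) - ?I. \<Prod>j\<in>A. T (w j)) \<le> (\<Sum>w\<in>(\<Union>p\<in>?J. ?C (fst p) (snd p)). \<Prod>j\<in>A. T (w j))"
    using A fin P0 by (intro sum_mono2 finite_UN_I) (auto simp: inj_on_def)
  also have "\<dots> \<le> (\<Sum>p\<in>?J. \<Sum>w\<in>?C (fst p) (snd p). \<Prod>j\<in>A. T (w j))"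
    using A fin P0 by (intro sum_UN_le) auto
  also have "\<dots> = real (card ?J) * (\<Sum>s\<in>S. (T s)\<^sup>2)" using coll by (subst sum.cong[OF refl, of _ _ "\<lambda>_. \<Sum>s\<in>S. (T s)\<^sup>2"]) auto
  also have "\<dots> \<le> (real (card A))\<^sup>2 * (\<Sum>s\<in>S. (T s)\<^sup>2)"
  proof (rule mult_right_mono)
    have "card ?J \<le> card (A \<times> A)" using A by (intro card_mono) auto
    then show "real (card ?J) \<le> (real (card A))\<^sup>2"
      by (simp add: card_cartesian_product power2_eq_square flip: of_nat_mult)
  qed (auto intro: sum_nonneg)
  finally show "(\<Sum>w\<in>?I. \<Prod>j\<in>A. T (w j)) \<ge> 1 - (real (card A))\<^sup>2 * (\<Sum>s\<in>S. (T s)\<^sup>2)" by simp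
qed

section \<open>Pattern probabilities under a weak limit\<close>

context
  fixes d :: nat and t :: tree
  assumes d: "d \<ge> 2" and t: "good_tree d t"
begin

interpretation G: good_squares d "perms t" "cuts t" by (rule good_squares_tree[OF d t])

abbreviation corner_of :: "(nat \<Rightarrow> nat list) \<Rightarrow> nat \<Rightarrow> real \<times> real" where
  "corner_of w j \<equiv> (left_edge d (cuts t) (w j), bottom_edge d (perms t) (cuts t) (w j))"

lemma corners_tiefree:
  assumes "w \<in> {1..n} \<rightarrow>\<^sub>E words d k" "inj_on w {1..n}"
  shows "inj_on (\<lambda>j. fst (corner_of w j)) {1..n}" "inj_on (\<lambda>j. snd (corner_of w j)) {1..n}"
proof -
  have "w ` {1..n} \<subseteq> words d k" using assms by auto
  then show "inj_on (\<lambda>j. fst (corner_of w j)) {1..n}" "inj_on (\<lambda>j. snd (corner_of w j)) {1..n}"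
    using comp_inj_on[OF assms(2) inj_on_subset[OF G.horizontal.edge_inj]] comp_inj_on[OF assms(2) inj_on_subset[OF G.vertical.edge_inj]]
    by (auto simp: comp_def)
qed

lemma Pat_corners:
  assumes "w \<in> {1..n} \<rightarrow>\<^sub>E words d k" "inj_on w {1..n}"
  shows "Pat {1..n} (\<lambda>j. left_edge d (cuts t) (w j)) (\<lambda>j. bottom_edge d (perms t) (cuts t) (w j)) = rel_of n (pattern n (corner_of w))"
  using Pat_eq_rel_of_pattern[of "corner_of w" n] corners_tiefree[OF assms] by simp

text \<open>Distinct squares of one level differ in both edges, so the pattern of their corners is
  always the order relation of a permutation.\<close>

lemma Q_eq_0:
  assumes "R \<notin> rel_of n ` Sym n"
  shows "Q d k t n R = 0"
proof -
  have "W d k t {1..n} R = 0" unfolding W_def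
  proof (rule sum.neutral, intro ballI if_not_P notI, elim conjE)
    fix w assume w: "w \<in> {1..n} \<rightarrow>\<^sub>E words d k" "inj_on w {1..n}"
      "Pat {1..n} (\<lambda>j. left_edge d (cuts t) (w j)) (\<lambda>j. bottom_edge d (perms t) (cuts t) (w j)) = R"
    then show False using assms Pat_corners[OF w(1,2)] pattern_in_Sym[of n "corner_of w"] by blast
  qed
  then show ?thesis using W_eq_Q[OF d t, of "{1..n}" k R] by simp
qed

lemma sum_Q: "(\<Sum>\<pi>\<in>Sym n. Q d k t n (rel_of n \<pi>)) = (\<Sum>w\<in>{w\<in>{1..n} \<rightarrow>\<^sub>E words d k. inj_on w {1..n}}. \<Prod>j\<in>{1..n}. side d (cuts t) (w j))"
proof -
  let ?P = "\<lambda>w. Pat {1..n} (\<lambda>j. left_edge d (cuts t) (w j)) (\<lambda>j. bottom_edge d (perms t) (cuts t) (w j))"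
  let ?v = "\<lambda>w. \<Prod>j\<in>{1..n}. side d (cuts t) (w j)"
  have fin: "finite ({1..n} \<rightarrow>\<^sub>E words d k)" by (auto intro!: finite_PiE)
  have "(\<Sum>\<pi>\<in>Sym n. Q d k t n (rel_of n \<pi>)) = (\<Sum>\<pi>\<in>Sym n. W d k t {1..n} (rel_of n \<pi>))"
    using W_eq_Q[OF d t, of "{1..n}" k] by simp
  also have "\<dots> = (\<Sum>w\<in>{1..n} \<rightarrow>\<^sub>E words d k. \<Sum>\<pi>\<in>Sym n. if inj_on w {1..n} \<and> ?P w = rel_of n \<pi> then ?v w else 0)"
    unfolding W_def by (rule sum.swap)
  also have "\<dots> = (\<Sum>w\<in>{1..n} \<rightarrow>\<^sub>E words d k. if inj_on w {1..n} then ?v w else 0)"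
  proof (rule sum.cong[OF refl])
    fix w assume w: "w \<in> {1..n} \<rightarrow>\<^sub>E words d k"
    show "(\<Sum>\<pi>\<in>Sym n. if inj_on w {1..n} \<and> ?P w = rel_of n \<pi> then ?v w else 0) = (if inj_on w {1..n} then ?v w else 0)"
    proof (cases "inj_on w {1..n}")
      case True
      have "(\<Sum>\<pi>\<in>Sym n. if inj_on w {1..n} \<and> ?P w = rel_of n \<pi> then ?v w else 0) = (\<Sum>\<pi>\<in>Sym n. if \<pi> = pattern n (corner_of w) then ?v w else 0)"
      proof (rule sum.cong[OF refl])
        fix \<pi> assume \<pi>: "\<pi> \<in> Sym n"
        have "?P w = rel_of n \<pi> \<longleftrightarrow> \<pi> = pattern n (corner_of w)"
          unfolding Pat_corners[OF w True] inj_on_eq_iff[OF inj_rel_of pattern_in_Sym \<pi>] by (rule eq_commute)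
        then show "(if inj_on w {1..n} \<and> ?P w = rel_of n \<pi> then ?v w else 0) = (if \<pi> = pattern n (corner_of w) then ?v w else 0)"
          using True by (simp only: simp_thms)
      qed
      then show ?thesis using True pattern_in_Sym by (simp only: sum.delta[OF finite_Sym] if_True)
    qed simp
  qed
  also have "\<dots> = (\<Sum>w\<in>{w\<in>{1..n} \<rightarrow>\<^sub>E words d k. inj_on w {1..n}}. ?v w)"
    using fin by (simp only: sum.inter_filter)
  finally show ?thesis .
qed

text \<open>The missing mass is the probability of a collision, at most n^2 times the sum of squared
  sides, which vanishes on a good tree.\<close>

lemma sum_Q_tendsto: "(\<lambda>k. \<Sum>\<pi>\<in>Sym n. Q d k t n (rel_of n \<pi>)) \<longlonglongrightarrow> 1"
proof (rule tendsto_sandwich)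
  have T0: "side d (cuts t) s \<ge> 0" if "s \<in> words d k" for s k
    using G.side_pos'[of s] that by (simp add: words_def)
  show "\<forall>\<^sub>F k in sequentially. 1 - (real n)\<^sup>2 * (\<Sum>s\<in>words d k. (side d (cuts t) s)\<^sup>2) \<le> (\<Sum>\<pi>\<in>Sym n. Q d k t n (rel_of n \<pi>))"
    unfolding sum_Q using sum_inj_words_ge(1)[of "words d _" "side d (cuts t)" "{1..n}"] T0 G.horizontal.sum_T
    by (intro always_eventually allI) simp
  show "\<forall>\<^sub>F k in sequentially. (\<Sum>\<pi>\<in>Sym n. Q d k t n (rel_of n \<pi>)) \<le> 1"
    unfolding sum_Q using sum_inj_words_ge(2)[of "words d _" "side d (cuts t)" "{1..n}"] T0 G.horizontal.sum_T
    by (intro always_eventually allI) simp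
  have "(\<lambda>k. \<Sum>s\<in>words d k. (side d (cuts t) s)\<^sup>2) \<longlonglongrightarrow> 0"
    using t unfolding good_tree_def good_def by (rule conjunct2)
  then have "(\<lambda>k. 1 - (real n)\<^sup>2 * (\<Sum>s\<in>words d k. (side d (cuts t) s)\<^sup>2)) \<longlonglongrightarrow> 1 - (real n)\<^sup>2 * 0"
    by (intro tendsto_intros)
  then show "(\<lambda>k. 1 - (real n)\<^sup>2 * (\<Sum>s\<in>words d k. (side d (cuts t) s)\<^sup>2)) \<longlonglongrightarrow> 1" by simp
qed simp

text \<open>If every point falls into its own open square, the sample has the pattern of the
  corners. These events are disjoint boxes, and the product measure of a box is at least the product
  of the sides.\<close>

lemma measure_boxes:
  fixes \<nu> :: "(real \<times> real) measure"
  assumes \<nu>: "permuton \<nu>" "weakly_converges (level_permuton d (perms t) (cuts t)) \<nu>" and \<pi>: "\<pi> \<in> Sym n"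
  shows "measure (sample_law \<nu> n) {\<pi>} \<ge> Q d k t n (rel_of n \<pi>)"
proof -
  interpret \<nu>: prob_space \<nu> using \<nu> by (simp add: permuton_def)
  have sets\<nu>: "sets \<nu> = sets borel" using \<nu> by (simp add: permuton_def)
  let ?N = "PiM {1..n} (\<lambda>_. \<nu>)"
  interpret N: prob_space ?N by (rule prob_space_PiM) (rule \<nu>.prob_space_axioms)
  interpret P: product_sigma_finite "\<lambda>_::nat. \<nu>" by unfold_locales
  let ?P = "\<lambda>w. Pat {1..n} (\<lambda>j. left_edge d (cuts t) (w j)) (\<lambda>j. bottom_edge d (perms t) (cuts t) (w j))"
  define S where "S = {w\<in>{1..n} \<rightarrow>\<^sub>E words d k. inj_on w {1..n} \<and> ?P w = rel_of n \<pi>}"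
  define box where "box = (\<lambda>w. PiE {1..n} (\<lambda>j. G.open_square (w j)))"
  have fin: "finite S" unfolding S_def by (auto intro!: finite_subset[OF _ finite_PiE[of "{1..n}" "\<lambda>_. words d k"]])
  have os: "G.open_square s \<in> sets \<nu>" for s unfolding sets\<nu> G.open_square_def by (intro borel_open open_Times) auto
  have boxm: "box w \<in> sets ?N" for w unfolding box_def by (rule sets_PiM_I_finite) (use os in auto)
  have mbox: "measure ?N (box w) = (\<Prod>j\<in>{1..n}. measure \<nu> (G.open_square (w j)))" for w
    unfolding box_def measure_def by (subst P.emeasure_PiM) (use os in \<open>auto simp: \<nu>.emeasure_eq_measure prod_ennreal prod_nonneg\<close>)
  have sq: "s = s'" if "z \<in> G.open_square s" "z \<in> G.open_square s'" "s \<in> words d k" "s' \<in> words d k" for z s s'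
    using that(1,2) G.cell_unique[OF that(3,4), of "fst z"] unfolding G.open_square_def by (auto simp del: greaterThanLessThan_iff)
  have disj: "disjoint_family_on box S"
    unfolding disjoint_family_on_def
  proof (intro ballI impI equals0I)
    fix w w' z assume w: "w \<in> S" "w' \<in> S" "w \<noteq> w'" "z \<in> box w \<inter> box w'"
    have "w = w'"
    proof (rule PiE_ext[of _ "{1..n}" "\<lambda>_. words d k"])
      show W: "w \<in> {1..n} \<rightarrow>\<^sub>E words d k" "w' \<in> {1..n} \<rightarrow>\<^sub>E words d k" using w by (auto simp: S_def)
      fix j assume j: "j \<in> {1..n}"
      have "z j \<in> G.open_square (w j)" "z j \<in> G.open_square (w' j)" using w(4) j by (auto simp: box_def PiE_iff)
      then show "w j = w' j" by (rule sq) (use W j in auto)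
    qed
    then show False using w(3) by simp
  qed
  have sub: "box w \<subseteq> pattern n -` {\<pi>} \<inter> space ?N" if w: "w \<in> S" for w
  proof
    fix z assume z: "z \<in> box w"
    have wS: "w \<in> {1..n} \<rightarrow>\<^sub>E words d k" "inj_on w {1..n}" "?P w = rel_of n \<pi>" using w by (auto simp: S_def)
    have ww: "w j \<in> words d k" if "j \<in> {1..n}" for j using wS(1) that by auto
    have zj: "z j \<in> G.open_square (w j)" if "j \<in> {1..n}" for j using z that by (auto simp: box_def)
    \<comment> \<open>Distinct squares of one level have separated projections, so points in them
      are ordered as the corners are.\<close>
    have fl: "fst (z i) < fst (z j) \<longleftrightarrow> left_edge d (cuts t) (w i) < left_edge d (cuts t) (w j)" if ij: "i \<in> {1..n}" "j \<in> {1..n}" "i \<noteq> j" for i j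
    proof -
      have "w i \<noteq> w j" using wS(2) ij by (auto dest: inj_onD)
      then show ?thesis
        using G.horizontal.separated_by_edge[OF ww[OF ij(1)] ww[OF ij(2)]] G.horizontal.separated[OF ww[OF ij(1)] ww[OF ij(2)]]
          zj[OF ij(1)] zj[OF ij(2)] unfolding G.open_square_def by (auto simp: mem_Times_iff)
    qed
    have sl: "snd (z i) < snd (z j) \<longleftrightarrow> bottom_edge d (perms t) (cuts t) (w i) < bottom_edge d (perms t) (cuts t) (w j)" if ij: "i \<in> {1..n}" "j \<in> {1..n}" "i \<noteq> j" for i j
    proof -
      have "w i \<noteq> w j" using wS(2) ij by (auto dest: inj_onD)
      then show ?thesis
        using G.vertical.separated_by_edge[OF ww[OF ij(1)] ww[OF ij(2)]] G.vertical.separated[OF ww[OF ij(1)] ww[OF ij(2)]]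
          zj[OF ij(1)] zj[OF ij(2)] unfolding G.open_square_def by (auto simp: mem_Times_iff)
    qed
    have fl': "fst (z i) < fst (z j) \<longleftrightarrow> left_edge d (cuts t) (w i) < left_edge d (cuts t) (w j)"
      and sl': "snd (z i) < snd (z j) \<longleftrightarrow> bottom_edge d (perms t) (cuts t) (w i) < bottom_edge d (perms t) (cuts t) (w j)"
      if "i \<in> {1..n}" "j \<in> {1..n}" for i j
      using fl[OF that] sl[OF that] by (cases "i = j", simp_all)+
    have "rk {1..n} (\<lambda>j. fst (z j)) a = rk {1..n} (\<lambda>j. left_edge d (cuts t) (w j)) a" if "a \<in> {1..n}" for a
      unfolding rk_def using fl'[OF _ that] by (intro arg_cong[of _ _ card]) blast
    then have "Pat {1..n} (\<lambda>j. fst (z j)) (\<lambda>j. snd (z j)) = ?P w"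
      unfolding Pat_def using sl' by (intro Collect_cong) metis
    moreover have "inj_on (\<lambda>j. fst (z j)) {1..n}"
    proof (rule inj_onI, rule ccontr)
      fix i j assume ij: "i \<in> {1..n}" "j \<in> {1..n}" "fst (z i) = fst (z j)" "i \<noteq> j"
      then have "left_edge d (cuts t) (w i) = left_edge d (cuts t) (w j)" using fl[of i j] fl[of j i] by auto
      then show False using corners_tiefree(1)[OF wS(1,2)] ij by (auto dest: inj_onD)
    qed
    moreover have "inj_on (\<lambda>j. snd (z j)) {1..n}"
    proof (rule inj_onI, rule ccontr)
      fix i j assume ij: "i \<in> {1..n}" "j \<in> {1..n}" "snd (z i) = snd (z j)" "i \<noteq> j"
      then have "bottom_edge d (perms t) (cuts t) (w i) = bottom_edge d (perms t) (cuts t) (w j)" using sl[of i j] sl[of j i] by auto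
      then show False using corners_tiefree(2)[OF wS(1,2)] ij by (auto dest: inj_onD)
    qed
    ultimately have "rel_of n (pattern n z) = rel_of n \<pi>" using Pat_eq_rel_of_pattern[of z n] wS(3) by simp
    then have "pattern n z = \<pi>" using inj_onD[OF inj_rel_of _ pattern_in_Sym \<pi>] by blast
    moreover have "z \<in> space ?N" using sets.sets_into_space[OF boxm[of w]] z by blast
    ultimately show "z \<in> pattern n -` {\<pi>} \<inter> space ?N" by simp
  qed
  have mp: "pattern n \<in> ?N \<rightarrow>\<^sub>M count_space (Sym n)" by (rule measurable_pattern[OF sets\<nu>])
  have "Q d k t n (rel_of n \<pi>) = W d k t {1..n} (rel_of n \<pi>)" using W_eq_Q[OF d t, of "{1..n}" k] by simp
  also have "\<dots> = (\<Sum>w\<in>S. \<Prod>j\<in>{1..n}. side d (cuts t) (w j))"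
    unfolding W_def S_def by (rule sum.inter_filter[symmetric]) (auto intro!: finite_PiE)
  also have "\<dots> \<le> (\<Sum>w\<in>S. measure ?N (box w))"
  proof (rule sum_mono)
    fix w assume "w \<in> S"
    then have ww: "w j \<in> words d k" if "j \<in> {1..n}" for j using that by (auto simp: S_def)
    show "(\<Prod>j\<in>{1..n}. side d (cuts t) (w j)) \<le> measure ?N (box w)"
      unfolding mbox using G.measure_open_square_ge[OF \<nu> ww] G.side_pos' ww
      by (intro prod_mono) (auto simp: words_def intro: less_imp_le)
  qed
  also have "\<dots> = measure ?N (\<Union>w\<in>S. box w)"
    using boxm disj fin by (intro N.finite_measure_finite_Union[symmetric]) auto
  also have "\<dots> \<le> measure ?N (pattern n -` {\<pi>} \<inter> space ?N)"
    using sub \<pi> by (intro N.finite_measure_mono UN_least measurable_sets[OF mp]) auto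
  also have "\<dots> = measure (sample_law \<nu> n) {\<pi>}"
    unfolding sample_law_def using mp \<pi> by (simp add: measure_distr)
  finally show ?thesis .
qed

end

text \<open>The truncation keeps the entropy bounded on trees for which the limit does not exist.\<close>

definition qlim :: "nat \<Rightarrow> tree \<Rightarrow> nat \<Rightarrow> (nat \<times> nat) set \<Rightarrow> real" where
  "qlim d t n R = max 0 (min 1 (lim (\<lambda>k. Q d k t n R)))"

definition pattern_entropy :: "nat \<Rightarrow> tree \<Rightarrow> nat \<Rightarrow> real" where
  "pattern_entropy d t n = ent (patterns n) (qlim d t n)"

lemma prob_space_sample_law:
  assumes "permuton \<nu>"
  shows "prob_space (sample_law \<nu> n)"
proof -
  interpret \<nu>: prob_space \<nu> using assms by (simp add: permuton_def)
  interpret N: prob_space "PiM {1..n} (\<lambda>_. \<nu>)" by (rule prob_space_PiM) (rule \<nu>.prob_space_axioms)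
  have "sets \<nu> = sets borel" using assms by (simp add: permuton_def)
  then show ?thesis unfolding sample_law_def by (intro N.prob_space_distr measurable_pattern)
qed

lemma sum_sample_law:
  assumes "permuton \<nu>"
  shows "(\<Sum>\<pi>\<in>Sym n. measure (sample_law \<nu> n) {\<pi>}) = 1"
proof -
  interpret S: prob_space "sample_law \<nu> n" by (rule prob_space_sample_law[OF assms])
  have sp: "space (sample_law \<nu> n) = Sym n" "sets (sample_law \<nu> n) = Pow (Sym n)" by (simp_all add: sample_law_def)
  have "measure (sample_law \<nu> n) (Sym n) = (\<Sum>\<pi>\<in>Sym n. measure (sample_law \<nu> n) {\<pi>})"
    by (rule S.finite_measure_eq_sum_singleton) (auto simp: sp)
  then show ?thesis using S.prob_space by (simp add: sp)
qed

context
  fixes d :: nat and t :: tree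
  assumes d: "d \<ge> 2" and t: "good_tree d t"
begin

abbreviation (input) the_limit :: "(real \<times> real) measure" where
  "the_limit \<equiv> limit_permuton d (perms t) (cuts t)"

lemma permuton_the_limit: "permuton the_limit"
  using good_squares.limit_permuton_works(1)[OF good_squares_tree[OF d t]] .

text \<open>The \<open>Q\<close> are lower bounds for probabilities of total mass one, and their own
  sum tends to one. The total deficit tends to zero and dominates each individual deficit.\<close>

lemma Q_tendsto_sample_law:
  assumes \<pi>: "\<pi> \<in> Sym n"
  shows "(\<lambda>k. Q d k t n (rel_of n \<pi>)) \<longlonglongrightarrow> measure (sample_law the_limit n) {\<pi>}"
proof -
  let ?m = "\<lambda>\<pi>. measure (sample_law the_limit n) {\<pi>}"
  have le: "Q d k t n (rel_of n \<sigma>) \<le> ?m \<sigma>" if "\<sigma> \<in> Sym n" for \<sigma> k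
    using measure_boxes[OF d t good_squares.limit_permuton_works[OF good_squares_tree[OF d t]] that] .
  have "(\<lambda>k. ?m \<pi> - Q d k t n (rel_of n \<pi>)) \<longlonglongrightarrow> 0"
  proof (rule tendsto_sandwich)
    show "\<forall>\<^sub>F k in sequentially. 0 \<le> ?m \<pi> - Q d k t n (rel_of n \<pi>)"
      using le[OF \<pi>] by (intro always_eventually allI) simp
    show "\<forall>\<^sub>F k in sequentially. ?m \<pi> - Q d k t n (rel_of n \<pi>) \<le> 1 - (\<Sum>\<sigma>\<in>Sym n. Q d k t n (rel_of n \<sigma>))"
    proof (intro always_eventually allI)
      fix k
      have "?m \<pi> - Q d k t n (rel_of n \<pi>) \<le> (\<Sum>\<sigma>\<in>Sym n. ?m \<sigma> - Q d k t n (rel_of n \<sigma>))"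
        using \<pi> le by (intro member_le_sum[where f = "\<lambda>\<sigma>. ?m \<sigma> - Q d k t n (rel_of n \<sigma>)"]) auto
      then show "?m \<pi> - Q d k t n (rel_of n \<pi>) \<le> 1 - (\<Sum>\<sigma>\<in>Sym n. Q d k t n (rel_of n \<sigma>))"
        using sum_sample_law[OF permuton_the_limit, of n] by (simp add: sum_subtractf)
    qed
    show "(\<lambda>k. 1 - (\<Sum>\<sigma>\<in>Sym n. Q d k t n (rel_of n \<sigma>))) \<longlonglongrightarrow> 0"
      using tendsto_diff[OF tendsto_const[of 1] sum_Q_tendsto[OF d t, of n]] by simp
  qed simp
  from tendsto_diff[OF tendsto_const[of "?m \<pi>"] this] show ?thesis by simp
qed

lemma qlim_rel_of: "\<pi> \<in> Sym n \<Longrightarrow> qlim d t n (rel_of n \<pi>) = measure (sample_law the_limit n) {\<pi>}"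
proof -
  assume \<pi>: "\<pi> \<in> Sym n"
  interpret S: prob_space "sample_law the_limit n" by (rule prob_space_sample_law[OF permuton_the_limit])
  show ?thesis unfolding qlim_def limI[OF Q_tendsto_sample_law[OF \<pi>]] using S.prob_le_1[of "{\<pi>}"] by simp
qed

lemma qlim_eq_0: "R \<notin> rel_of n ` Sym n \<Longrightarrow> qlim d t n R = 0"
  unfolding qlim_def using Q_eq_0[OF d t, of R n] by simp

lemma Q_tendsto_qlim: "(\<lambda>k. Q d k t n R) \<longlonglongrightarrow> qlim d t n R"
proof (cases "R \<in> rel_of n ` Sym n")
  case True
  then show ?thesis using Q_tendsto_sample_law qlim_rel_of by auto
next
  case False
  then show ?thesis using Q_eq_0[OF d t False] qlim_eq_0[OF False] by simp
qed

lemma sum_rel_of: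
  assumes "F 0 = 0"
  shows "(\<Sum>R\<in>patterns n. F (qlim d t n R)) = (\<Sum>\<pi>\<in>Sym n. (F (measure (sample_law the_limit n) {\<pi>}) :: real))"
proof -
  have "(\<Sum>R\<in>patterns n. F (qlim d t n R)) = (\<Sum>R\<in>rel_of n ` Sym n. F (qlim d t n R))"
    using rel_of_in_patterns qlim_eq_0 assms by (intro sum.mono_neutral_right) auto
  also have "\<dots> = (\<Sum>\<pi>\<in>Sym n. F (measure (sample_law the_limit n) {\<pi>}))"
    by (subst sum.reindex[OF inj_rel_of]) (auto simp: qlim_rel_of intro!: sum.cong)
  finally show ?thesis .
qed

lemma sum_qlim: "(\<Sum>R\<in>patterns n. qlim d t n R) = 1"
  using sum_rel_of[of "\<lambda>x. x"] sum_sample_law[OF permuton_the_limit, of n] by simp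

text \<open>The entropy of a permuton obtained by choice becomes a function of the tree, whose
  measurability can be read off the recursion for \<open>Q\<close>.\<close>

lemma sampling_entropy_eq: "sampling_entropy n the_limit = pattern_entropy d t n"
  unfolding sampling_entropy_def pattern_entropy_def ent_def using sum_rel_of[of "\<lambda>x. x * ln x" n] by simp

end

lemma qlim_bounds: "0 \<le> qlim d t n R" "qlim d t n R \<le> 1"
  by (auto simp: qlim_def)

lemma pattern_entropy_nonneg: "pattern_entropy d t n \<ge> 0"
  unfolding pattern_entropy_def by (rule ent_nonneg) (simp add: qlim_bounds)

lemma minus_xlnx_le_1: "0 \<le> x \<Longrightarrow> x \<le> 1 \<Longrightarrow> - (x * ln x) \<le> (1::real)"
  using xlnx_tangent[of x 1] by simp

text \<open>A crude bound for every tree, including those outside \<open>good_tree\<close>, where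
  \<open>qlim\<close> need not be a probability vector. Boundedness provides all integrability
  below.\<close>

lemma pattern_entropy_le: "pattern_entropy d t n \<le> real (card (patterns n))"
proof -
  have "pattern_entropy d t n = (\<Sum>R\<in>patterns n. - (qlim d t n R * ln (qlim d t n R)))"
    by (simp add: pattern_entropy_def ent_def sum_negf)
  also have "\<dots> \<le> (\<Sum>R\<in>patterns n. 1)" by (intro sum_mono minus_xlnx_le_1 qlim_bounds)
  finally show ?thesis by simp
qed

section \<open>Decoding an inflation and the recursion for the entropy\<close>

lemma offs_le: "i < j \<Longrightarrow> offs N i + N i \<le> offs N j"
proof -
  assume "i < j"
  then have "insert i {..<i} \<subseteq> {..<j}" by auto
  then have "(\<Sum>i'\<in>insert i {..<i}. N i') \<le> (\<Sum>i'<j. N i')" by (intro sum_mono2) auto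
  then show ?thesis by (simp add: offs_def add.commute)
qed

lemma offs_decode:
  assumes "offs N i + b = offs N j + c" "b < N i" "c < N j"
  shows "i = j" "b = c"
proof -
  show "i = j" using offs_le[of i j N] offs_le[of j i N] assms by (cases i j rule: linorder_cases) auto
  then show "b = c" using assms by simp
qed

lemma inflate_decode:
  assumes Rs: "\<And>i. i < d \<Longrightarrow> Rs i \<in> patterns (N i)" and i: "i < d" "b < N i" "c < N i"
  shows "(offs N i + b, offs N i + c) \<in> inflate d p N Rs \<longleftrightarrow> (b, c) \<in> Rs i"
proof
  assume "(offs N i + b, offs N i + c) \<in> inflate d p N Rs"
  then consider j b' c' where "offs N i + b = offs N j + b'" "offs N i + c = offs N j + c'" "j < d" "(b', c') \<in> Rs j"
    | j j' b' c' where "offs N i + b = offs N j + b'" "offs N i + c = offs N j' + c'" "p (Suc j) < p (Suc j')" "b' < N j" "c' < N j'"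
    unfolding inflate_def by blast
  then show "(b, c) \<in> Rs i"
  proof cases
    case (1 j b' c')
    have "b' < N j" "c' < N j" using Rs[OF 1(3)] 1(4) by (auto simp: patterns_def)
    then have "i = j" "b = b'" "c = c'" using offs_decode[OF 1(1) i(2)] offs_decode[OF 1(2) i(3)] by auto
    then show ?thesis using 1(4) by simp
  next
    case (2 j j' b' c')
    then have "i = j" "i = j'" using offs_decode[OF 2(1) i(2)] offs_decode[OF 2(2) i(3)] by auto
    then show ?thesis using 2(3) by simp
  qed
qed (use i in \<open>auto simp: inflate_def\<close>)

text \<open>The offsets separate the blocks, so each \<open>Rs i\<close> can be read off the
  inflation on its own block. Hence no entropy is lost once the occupation numbers are
  known.\<close>

lemma inj_inflate: "inj_on (inflate d p N) (\<Pi>\<^sub>E i\<in>{..<d}. patterns (N i))"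
proof (rule inj_onI)
  fix Rs Rs' assume R: "Rs \<in> (\<Pi>\<^sub>E i\<in>{..<d}. patterns (N i))" "Rs' \<in> (\<Pi>\<^sub>E i\<in>{..<d}. patterns (N i))"
    and eq: "inflate d p N Rs = inflate d p N Rs'"
  show "Rs = Rs'"
  proof (rule PiE_ext[OF R])
    fix i assume "i \<in> {..<d}"
    then have i: "i < d" by simp
    have P: "Rs j \<in> patterns (N j)" "Rs' j \<in> patterns (N j)" if "j < d" for j using R that by auto
    have "(b, c) \<in> Rs i \<longleftrightarrow> (b, c) \<in> Rs' i" for b c
    proof (cases "b < N i \<and> c < N i")
      case True
      then show ?thesis using inflate_decode[of d Rs N i b c p] inflate_decode[of d Rs' N i b c p] P i eq by simp
    next
      case False
      then show ?thesis using P[OF i] by (auto simp: patterns_def)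
    qed
    then show "Rs i = Rs' i" by auto
  qed
qed

lemma inflate_in_patterns:
  assumes "(\<Sum>i<d. N i) = n" "Rs \<in> (\<Pi>\<^sub>E i\<in>{..<d}. patterns (N i))"
  shows "inflate d p N Rs \<in> patterns n"
proof -
  have *: "offs N i + b < n" if "i < d" "b < N i" for i b
    using offs_le[OF that(1), of N] that(2) assms(1) by (simp add: offs_def)
  have "(b, c) \<in> Rs i \<Longrightarrow> i < d \<Longrightarrow> b < N i \<and> c < N i" for i b c using assms(2) by (fastforce simp: patterns_def PiE_iff)
  then show ?thesis using * by (auto simp: inflate_def patterns_def)
qed

lemma sum_cnt:
  assumes "finite A" "l \<in> A \<rightarrow>\<^sub>E {..<d}"
  shows "(\<Sum>i<d. cnt l A i) = card A"
proof -
  have "(\<Sum>i<d. \<Sum>j\<in>{j\<in>A. l j = i}. 1) = (\<Sum>j\<in>A. (1::nat))"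
    by (rule sum.group) (use assms in auto)
  then show ?thesis by (simp add: cnt_def)
qed

lemma cnt_le: "finite A \<Longrightarrow> cnt l A i \<le> card A"
  unfolding cnt_def by (intro card_mono) auto

text \<open>An occupation vector is determined by its first \<open>d\<close> entries, each between 0
  and \<open>n\<close>, because letters from \<open>d\<close> on never occur.\<close>

lemma card_cnt_image: "card ((\<lambda>l. cnt l {..<n}) ` ({..<n} \<rightarrow>\<^sub>E {..<d})) \<le> (n + 1) ^ d"
proof -
  let ?C = "(\<lambda>l. cnt l {..<n}) ` ({..<n} \<rightarrow>\<^sub>E {..<d})"
  have "inj_on (\<lambda>N. restrict N {..<d}) ?C"
  proof (rule inj_onI)
    fix N N' assume N: "N \<in> ?C" "N' \<in> ?C" and eq: "restrict N {..<d} = restrict N' {..<d}"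
    have z: "M i = 0" if M: "M \<in> ?C" and i: "i \<ge> d" for M i
    proof -
      obtain l where l: "M = cnt l {..<n}" "l \<in> {..<n} \<rightarrow>\<^sub>E {..<d}" using M by blast
      have "l j < d" if "j < n" for j using l(2) that by auto
      then have "{j\<in>{..<n}. l j = i} = {}" using \<open>i \<ge> d\<close> by force
      then show "M i = 0" unfolding l(1) cnt_def by (simp only: card.empty)
    qed
    show "N = N'"
    proof
      fix i show "N i = N' i"
        using fun_cong[OF eq, of i] z[OF N(1), of i] z[OF N(2), of i] by (cases "i < d") auto
    qed
  qed
  then have "card ?C = card ((\<lambda>N. restrict N {..<d}) ` ?C)" by (simp add: card_image)
  also have "\<dots> \<le> card ({..<d} \<rightarrow>\<^sub>E {..n})"
    using cnt_le[of "{..<n}"] by (intro card_mono) (auto intro!: finite_PiE)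
  also have "\<dots> = (n + 1) ^ d" by (simp add: card_PiE)
  finally show ?thesis .
qed

text \<open>The points are indexed by \<open>{..<n}\<close>, and point \<open>j\<close> falls into the subsquare \<open>l j\<close> of the root.\<close>

definition letter_prob :: "nat \<Rightarrow> (nat \<Rightarrow> real) \<Rightarrow> nat \<Rightarrow> (nat \<Rightarrow> nat) \<Rightarrow> real" where
  "letter_prob d v n l = (\<Prod>j<n. gap d v (l j))"

lemma sum_letter_prob: "d \<ge> 1 \<Longrightarrow> (\<Sum>l\<in>{..<n} \<rightarrow>\<^sub>E {..<d}. letter_prob d v n l) = 1"
  using prod_sum_PiE[of "{..<n}" "\<lambda>_. {..<d}" "\<lambda>_. gap d v"] by (simp add: letter_prob_def sum_gap_all)

context
  fixes d :: nat and t :: tree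
  assumes d: "d \<ge> 2" and t: "good_tree d t"
begin

lemma root_gap_pos: "i < d \<Longrightarrow> gap d (cuts t []) i > 0"
  using t by (simp add: good_tree_def good_def)

lemma letter_prob_nonneg: "l \<in> {..<n} \<rightarrow>\<^sub>E {..<d} \<Longrightarrow> letter_prob d (cuts t []) n l \<ge> 0"
  unfolding letter_prob_def by (intro prod_nonneg ballI less_imp_le[OF root_gap_pos]) auto

text \<open>The conditional law of the pattern, given that the subsquares of the root contain the
  numbers \<open>N\<close> of points.\<close>

definition mixture_part :: "nat \<Rightarrow> (nat \<Rightarrow> nat) \<Rightarrow> (nat \<times> nat) set \<Rightarrow> real" where
  "mixture_part n N R = (\<Sum>Rs\<in>(\<Pi>\<^sub>E i\<in>{..<d}. patterns (N i)).
       if inflate d (perms t []) N Rs = R then \<Prod>i<d. qlim d (subtree t i) (N i) (Rs i) else 0)"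

text \<open>All sums and products in the recursion for \<open>Q\<close> are finite, so it passes to
  the limit in the level.\<close>

lemma qlim_recursion:
  "qlim d t n R = (\<Sum>l\<in>{..<n} \<rightarrow>\<^sub>E {..<d}. letter_prob d (cuts t []) n l * mixture_part n (cnt l {..<n}) R)"
proof (rule LIMSEQ_unique)
  show "(\<lambda>k. Q d (Suc k) t n R) \<longlonglongrightarrow> qlim d t n R"
    by (rule LIMSEQ_Suc[OF Q_tendsto_qlim[OF d t]])
  have "(\<lambda>k. if b then \<Prod>i<d. Q d k (subtree t i) (N i) (Rs i) else 0) \<longlonglongrightarrow> (if b then \<Prod>i<d. qlim d (subtree t i) (N i) (Rs i) else 0)" for b N Rs
  proof (cases b)
    case True
    have "(\<lambda>k. \<Prod>i<d. Q d k (subtree t i) (N i) (Rs i)) \<longlonglongrightarrow> (\<Prod>i<d. qlim d (subtree t i) (N i) (Rs i))"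
      by (rule tendsto_prod) (simp add: Q_tendsto_qlim[OF d good_subtree[OF t]])
    then show ?thesis using True by simp
  qed simp
  then show "(\<lambda>k. Q d (Suc k) t n R) \<longlonglongrightarrow> (\<Sum>l\<in>{..<n} \<rightarrow>\<^sub>E {..<d}. letter_prob d (cuts t []) n l * mixture_part n (cnt l {..<n}) R)"
    unfolding Q.simps letter_prob_def mixture_part_def by (intro tendsto_sum tendsto_mult tendsto_const)
qed

lemma mixture_part_nonneg: "mixture_part n N R \<ge> 0"
  unfolding mixture_part_def by (intro sum_nonneg) (auto intro!: prod_nonneg qlim_bounds)

lemma qlim_ge_term:
  assumes l: "l \<in> {..<n} \<rightarrow>\<^sub>E {..<d}" and Rs: "Rs \<in> (\<Pi>\<^sub>E i\<in>{..<d}. patterns (cnt l {..<n} i))"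
    and R: "inflate d (perms t []) (cnt l {..<n}) Rs = R"
    and pos: "\<And>i. i < d \<Longrightarrow> qlim d (subtree t i) (cnt l {..<n} i) (Rs i) > 0"
  shows "qlim d t n R > 0"
proof -
  let ?N = "cnt l {..<n}"
  have "0 < (\<Prod>i<d. qlim d (subtree t i) (?N i) (Rs i))" using pos by (intro prod_pos) auto
  also have "\<dots> = (if inflate d (perms t []) ?N Rs = R then \<Prod>i<d. qlim d (subtree t i) (?N i) (Rs i) else 0)" using R by simp
  also have "\<dots> \<le> mixture_part n ?N R" unfolding mixture_part_def
    using Rs by (intro member_le_sum[where f = "\<lambda>Rs. if inflate d (perms t []) ?N Rs = R then \<Prod>i<d. qlim d (subtree t i) (?N i) (Rs i) else 0"])
      (auto intro!: prod_nonneg qlim_bounds finite_PiE)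
  finally have 1: "mixture_part n ?N R > 0" .
  have "letter_prob d (cuts t []) n l > 0" unfolding letter_prob_def
    by (rule prod_pos) (use l root_gap_pos in auto)
  then have "0 < letter_prob d (cuts t []) n l * mixture_part n ?N R" using 1 by simp
  also have "\<dots> \<le> qlim d t n R" unfolding qlim_recursion
    using l by (intro member_le_sum[where f = "\<lambda>l. letter_prob d (cuts t []) n l * mixture_part n (cnt l {..<n}) R"])
      (auto intro!: mult_nonneg_nonneg letter_prob_nonneg mixture_part_nonneg finite_PiE)
  finally show ?thesis .
qed

text \<open>Given the occupation numbers, the pattern is an injective image of independent patterns
  of the subtrees, whose entropies add.\<close>

lemma entropy_mixture_part:
  assumes "(\<Sum>i<d. N i) = n"
  shows "ent (patterns n) (mixture_part n N) = (\<Sum>i<d. pattern_entropy d (subtree t i) (N i))"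
    and "(\<Sum>R\<in>patterns n. mixture_part n N R) = 1"
proof -
  let ?P = "\<Pi>\<^sub>E i\<in>{..<d}. patterns (N i)"
  have im: "inflate d (perms t []) N ` ?P \<subseteq> patterns n" using inflate_in_patterns[OF assms] by blast
  have "ent (patterns n) (mixture_part n N) = ent ?P (\<lambda>Rs. \<Prod>i<d. qlim d (subtree t i) (N i) (Rs i))"
    unfolding mixture_part_def by (rule ent_inj_image[OF finite_patterns inj_inflate im])
  also have "\<dots> = (\<Sum>i<d. ent (patterns (N i)) (qlim d (subtree t i) (N i)))"
    by (rule ent_product) (auto simp: sum_qlim[OF d good_subtree[OF t]] qlim_bounds)
  finally show "ent (patterns n) (mixture_part n N) = (\<Sum>i<d. pattern_entropy d (subtree t i) (N i))"
    by (simp add: pattern_entropy_def)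
  have "(\<Sum>R\<in>patterns n. mixture_part n N R) = (\<Sum>Rs\<in>?P. \<Sum>R\<in>patterns n. if inflate d (perms t []) N Rs = R then \<Prod>i<d. qlim d (subtree t i) (N i) (Rs i) else 0)"
    unfolding mixture_part_def by (rule sum.swap)
  also have "\<dots> = (\<Sum>Rs\<in>?P. \<Prod>i<d. qlim d (subtree t i) (N i) (Rs i))"
  proof (rule sum.cong[OF refl])
    fix Rs assume "Rs \<in> ?P"
    then have "inflate d (perms t []) N Rs \<in> patterns n" using im by blast
    then show "(\<Sum>R\<in>patterns n. if inflate d (perms t []) N Rs = R then \<Prod>i<d. qlim d (subtree t i) (N i) (Rs i) else 0) = (\<Prod>i<d. qlim d (subtree t i) (N i) (Rs i))"
      by (simp only: sum.delta'[OF finite_patterns] if_True)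
  qed
  also have "\<dots> = (\<Prod>i<d. \<Sum>R\<in>patterns (N i). qlim d (subtree t i) (N i) R)"
    by (rule prod_sum_PiE[symmetric]) auto
  also have "\<dots> = 1" using sum_qlim[OF d good_subtree[OF t]] by (intro prod.neutral) auto
  finally show "(\<Sum>R\<in>patterns n. mixture_part n N R) = 1" .
qed

text \<open>The lower bound is concavity of entropy, the upper bound counts occupation vectors. The
  missing lower error term is important: it gives the errors in the recursion for the means a
  sign.\<close>

lemma entropy_recursion:
  defines "S n \<equiv> (\<Sum>l\<in>{..<n} \<rightarrow>\<^sub>E {..<d}. letter_prob d (cuts t []) n l * (\<Sum>i<d. pattern_entropy d (subtree t i) (cnt l {..<n} i)))"
  shows "S n \<le> pattern_entropy d t n" "pattern_entropy d t n \<le> S n + real d * ln (real n + 1)"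
proof -
  let ?L = "{..<n} \<rightarrow>\<^sub>E {..<d}" and ?p = "letter_prob d (cuts t []) n" and ?r = "\<lambda>l. mixture_part n (cnt l {..<n})"
  have fin: "finite ?L" by (auto intro!: finite_PiE)
  have N: "(\<Sum>i<d. cnt l {..<n} i) = n" if "l \<in> ?L" for l using sum_cnt[OF _ that] by simp
  have q: "qlim d t n = (\<lambda>R. \<Sum>l\<in>?L. ?p l * ?r l R)" using qlim_recursion by blast
  have Seq: "S n = (\<Sum>l\<in>?L. ?p l * ent (patterns n) (?r l))"
    unfolding S_def using entropy_mixture_part(1)[OF N] by (intro sum.cong refl) simp
  have p1: "(\<Sum>l\<in>?L. ?p l) = 1" using sum_letter_prob[of d "cuts t []" n] d by simp
  show "S n \<le> pattern_entropy d t n"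
    unfolding Seq pattern_entropy_def q using letter_prob_nonneg mixture_part_nonneg p1 fin
    by (intro ent_mixture_ge) auto
  have "ent (patterns n) (\<lambda>R. \<Sum>l\<in>?L. ?p l * mixture_part n (cnt l {..<n}) R)
     \<le> (\<Sum>l\<in>?L. ?p l * ent (patterns n) (mixture_part n (cnt l {..<n}))) + ln (real ((n + 1) ^ d))"
    by (rule ent_mixture_le[where r = "mixture_part n" and \<kappa> = "\<lambda>l. cnt l {..<n}"])
       (use letter_prob_nonneg mixture_part_nonneg p1 fin entropy_mixture_part(2)[OF N] card_cnt_image in \<open>auto simp del: of_nat_power\<close>)
  also have "ln (real ((n + 1) ^ d)) = real d * ln (real n + 1)" by (simp add: ln_realpow)
  finally show "pattern_entropy d t n \<le> S n + real d * ln (real n + 1)" unfolding Seq pattern_entropy_def q by simp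
qed

text \<open>The flag \<open>inc\<close> treats the increasing and the decreasing case together. The
  vertical order of the squares is a function of the horizontal one, so a single relation carries
  all the mass.\<close>

lemma monotone_tree_entropy_0:
  assumes y: "\<And>k s s'. s \<in> words d k \<Longrightarrow> s' \<in> words d k \<Longrightarrow>
     bottom_edge d (perms t) (cuts t) s < bottom_edge d (perms t) (cuts t) s' \<longleftrightarrow>
     (if inc then left_edge d (cuts t) s < left_edge d (cuts t) s' else left_edge d (cuts t) s' < left_edge d (cuts t) s)"
  shows "pattern_entropy d t n = 0"
proof -
  let ?R = "{(p, q). p < n \<and> q < n \<and> (if inc then p < q else q < p)}"
  have Q0: "Q d k t n R = 0" if R: "R \<noteq> ?R" for k R
  proof -
    have "W d k t {..<n} R = 0" unfolding W_def
    proof (rule sum.neutral, intro ballI if_not_P notI, elim conjE)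
      fix w assume w: "w \<in> {..<n} \<rightarrow>\<^sub>E words d k" "inj_on w {..<n}"
      let ?x = "\<lambda>j. left_edge d (cuts t) (w j)"
      interpret G: good_squares d "perms t" "cuts t" by (rule good_squares_tree[OF d t])
      assume P: "Pat {..<n} ?x (\<lambda>j. bottom_edge d (perms t) (cuts t) (w j)) = R"
      have ww: "w j \<in> words d k" if "j < n" for j using w(1) that by auto
      have "w ` {..<n} \<subseteq> words d k" using ww by auto
      then have "inj_on ?x {..<n}" using comp_inj_on[OF w(2) inj_on_subset[OF G.horizontal.edge_inj]] by (auto simp: comp_def)
      then have surj: "rk {..<n} ?x ` {..<n} = {..<n}" using bij_rk[of "{..<n}" ?x] by (simp add: bij_betw_def)
      have rk: "rk {..<n} ?x a < rk {..<n} ?x b \<longleftrightarrow> ?x a < ?x b" if "a < n" "b < n" for a b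
        using rk_less_iff[of "{..<n}" a b ?x] that by simp
      have "R = ?R"
      proof (intro set_eqI iffI)
        fix z assume "z \<in> R"
        then obtain a b where ab: "z = (rk {..<n} ?x a, rk {..<n} ?x b)" "a < n" "b < n"
          "bottom_edge d (perms t) (cuts t) (w a) < bottom_edge d (perms t) (cuts t) (w b)"
          unfolding P[symmetric] Pat_def by blast
        have "rk {..<n} ?x a < n" "rk {..<n} ?x b < n" using surj ab(2,3) by blast+
        then show "z \<in> ?R" using y[OF ww[OF ab(2)] ww[OF ab(3)]] ab rk by (cases inc) simp_all
      next
        fix z assume "z \<in> ?R"
        then obtain p q where pq: "z = (p, q)" "p < n" "q < n" "if inc then p < q else q < p" by blast
        have "p \<in> rk {..<n} ?x ` {..<n}" "q \<in> rk {..<n} ?x ` {..<n}" using pq(2,3) surj by simp_all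
        then obtain a b where ab: "a < n" "p = rk {..<n} ?x a" "b < n" "q = rk {..<n} ?x b" by blast
        have "bottom_edge d (perms t) (cuts t) (w a) < bottom_edge d (perms t) (cuts t) (w b)"
          using y[OF ww[OF ab(1)] ww[OF ab(3)]] pq(4) ab rk by (cases inc) simp_all
        then show "z \<in> R" unfolding P[symmetric] Pat_def pq(1) ab(2,4) using ab(1,3) by blast
      qed
      then show False using R by blast
    qed
    then show ?thesis using W_eq_Q[OF d t, of "{..<n}" k R] by simp
  qed
  have q0: "qlim d t n R = 0" if "R \<noteq> ?R" for R unfolding qlim_def using Q0[OF that] by simp
  have "(\<Sum>R\<in>patterns n. qlim d t n R) = (\<Sum>R\<in>patterns n. if R = ?R then qlim d t n ?R else 0)"
    using q0 by (intro sum.cong) auto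
  also have "?R \<in> patterns n" by (auto simp: patterns_def)
  then have "(\<Sum>R\<in>patterns n. if R = ?R then qlim d t n ?R else 0) = qlim d t n ?R" by (simp only: sum.delta[OF finite_patterns] if_True)
  finally have "qlim d t n ?R = 1" using sum_qlim[OF d t, of n] by simp
  then have "qlim d t n R * ln (qlim d t n R) = 0" for R using q0[of R] by (cases "R = ?R") auto
  then have "(\<Sum>R\<in>patterns n. qlim d t n R * ln (qlim d t n R)) = 0" by (rule sum.neutral[rule_format])
  then show ?thesis unfolding pattern_entropy_def ent_def by simp
qed

end

section \<open>Binomial marginals of the letters\<close>

lemma binomial_sum_Suc:
  fixes F :: "nat \<Rightarrow> real"
  shows "(\<Sum>k\<le>Suc n. real (Suc n choose k) * x ^ k * y ^ (Suc n - k) * F k)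
    = x * (\<Sum>k\<le>n. real (n choose k) * x ^ k * y ^ (n - k) * F (Suc k)) + y * (\<Sum>k\<le>n. real (n choose k) * x ^ k * y ^ (n - k) * F k)"
proof -
  have "(\<Sum>k\<le>Suc n. real (Suc n choose k) * x ^ k * y ^ (Suc n - k) * F k)
     = y ^ Suc n * F 0 + (\<Sum>k\<le>n. real (Suc n choose Suc k) * x ^ Suc k * y ^ (n - k) * F (Suc k))"
    by (subst sum.atMost_Suc_shift) (simp del: binomial_Suc_Suc)
  also have "(\<Sum>k\<le>n. real (Suc n choose Suc k) * x ^ Suc k * y ^ (n - k) * F (Suc k))
     = (\<Sum>k\<le>n. x * (real (n choose k) * x ^ k * y ^ (n - k) * F (Suc k)) + real (n choose Suc k) * x ^ Suc k * y ^ (n - k) * F (Suc k))"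
    by (intro sum.cong refl) (simp add: algebra_simps)
  also have "y ^ Suc n * F 0 + \<dots> = x * (\<Sum>k\<le>n. real (n choose k) * x ^ k * y ^ (n - k) * F (Suc k))
     + (y ^ Suc n * F 0 + (\<Sum>k\<le>n. real (n choose Suc k) * x ^ Suc k * y ^ (n - k) * F (Suc k)))"
    by (simp add: sum.distrib sum_distrib_left)
  also have "y ^ Suc n * F 0 + (\<Sum>k\<le>n. real (n choose Suc k) * x ^ Suc k * y ^ (n - k) * F (Suc k))
    = (\<Sum>k\<le>Suc n. real (n choose k) * x ^ k * y ^ (Suc n - k) * F k)"
    by (subst sum.atMost_Suc_shift) simp
  also have "\<dots> = y * (\<Sum>k\<le>n. real (n choose k) * x ^ k * y ^ (n - k) * F k)"
    by (auto simp: sum_distrib_left Suc_diff_le binomial_eq_0 mult_ac intro!: sum.cong)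
  finally show ?thesis .
qed

text \<open>Each point falls into subsquare \<open>i\<close> with probability
  \<open>\<tau> i\<close>, so their number is binomial. Induction on the number of points,
  conditioning on the letter of the last one.\<close>

lemma binomial_marginal:
  fixes \<tau> :: "nat \<Rightarrow> real"
  assumes \<tau>: "(\<Sum>i<d. \<tau> i) = 1" and i: "i < d"
  shows "(\<Sum>l\<in>{..<n} \<rightarrow>\<^sub>E {..<d}. (\<Prod>j<n. \<tau> (l j)) * F (cnt l {..<n} i))
     = (\<Sum>k\<le>n. real (n choose k) * \<tau> i ^ k * (1 - \<tau> i) ^ (n - k) * F k)"
proof (induction n arbitrary: F)
  case 0
  then show ?case by (simp add: cnt_def)
next
  case (Suc n)
  let ?L = "{..<n} \<rightarrow>\<^sub>E {..<d}"
  have c: "cnt (f(n := y)) {..<Suc n} i = cnt f {..<n} i + of_bool (y = i)" for f y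
  proof -
    have "{j\<in>{..<Suc n}. (f(n := y)) j = i} = (if y = i then insert n {j\<in>{..<n}. f j = i} else {j\<in>{..<n}. f j = i})"
      by (auto simp: less_Suc_eq)
    then show ?thesis by (simp add: cnt_def)
  qed
  have pr: "(\<Prod>j<Suc n. \<tau> ((f(n := y)) j)) = \<tau> y * (\<Prod>j<n. \<tau> (f j))" for f y
    by (simp add: mult.commute)
  have "(\<Sum>l\<in>{..<Suc n} \<rightarrow>\<^sub>E {..<d}. (\<Prod>j<Suc n. \<tau> (l j)) * F (cnt l {..<Suc n} i))
     = (\<Sum>p\<in>{..<d} \<times> ?L. (\<Prod>j<Suc n. \<tau> (((snd p)(n := fst p)) j)) * F (cnt ((snd p)(n := fst p)) {..<Suc n} i))"
  proof -
    have inj: "inj_on (\<lambda>(y, g). g(n := y)) ({..<d} \<times> ?L)" by (rule inj_combinator) simp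
    show ?thesis unfolding lessThan_Suc PiE_insert_eq sum.reindex[OF inj]
      by (simp add: case_prod_unfold)
  qed
  also have "\<dots> = (\<Sum>y<d. \<Sum>f\<in>?L. \<tau> y * (\<Prod>j<n. \<tau> (f j)) * F (cnt f {..<n} i + of_bool (y = i)))"
    unfolding c pr by (simp add: sum.cartesian_product case_prod_unfold)
  also have "\<dots> = (\<Sum>y<d. \<tau> y * (if y = i then \<Sum>f\<in>?L. (\<Prod>j<n. \<tau> (f j)) * F (Suc (cnt f {..<n} i)) else \<Sum>f\<in>?L. (\<Prod>j<n. \<tau> (f j)) * F (cnt f {..<n} i)))"
    by (intro sum.cong refl) (simp add: sum_distrib_left mult.assoc)
  \<comment> \<open>The last letter is first treated as if it never counted, and
    \<open>y = i\<close> is corrected afterwards; the weights then collect to \<tau> i and 1 -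
    \<tau> i.\<close>
  also have "\<dots> = (\<Sum>y<d. \<tau> y * (\<Sum>f\<in>?L. (\<Prod>j<n. \<tau> (f j)) * F (cnt f {..<n} i))
       + (if y = i then \<tau> i * ((\<Sum>f\<in>?L. (\<Prod>j<n. \<tau> (f j)) * F (Suc (cnt f {..<n} i))) - (\<Sum>f\<in>?L. (\<Prod>j<n. \<tau> (f j)) * F (cnt f {..<n} i))) else 0))"
    by (intro sum.cong refl) (simp add: algebra_simps)
  also have "\<dots> = \<tau> i * (\<Sum>f\<in>?L. (\<Prod>j<n. \<tau> (f j)) * F (Suc (cnt f {..<n} i))) + (1 - \<tau> i) * (\<Sum>f\<in>?L. (\<Prod>j<n. \<tau> (f j)) * F (cnt f {..<n} i))"
    using \<tau> i by (simp add: sum.distrib sum_distrib_right[symmetric] algebra_simps)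
  also have "\<dots> = (\<Sum>k\<le>Suc n. real (Suc n choose k) * \<tau> i ^ k * (1 - \<tau> i) ^ (Suc n - k) * F k)"
    unfolding binomial_sum_Suc Suc.IH[of F] Suc.IH[of "\<lambda>k. F (Suc k)"] ..
  finally show ?case .
qed

lemma qlim_small_any:
  assumes d: "d \<ge> 2" and t: "good_tree d t" and n: "n \<le> 1"
  shows "qlim d t n {} = 1"
proof -
  have "rel_of n \<pi> = {}" for \<pi> using n by (cases n) (auto simp: rel_of_def less_Suc_eq)
  then have "qlim d t n R = 0" if "R \<noteq> {}" for R using qlim_eq_0[OF d t, of R n] that by auto
  then have "(\<Sum>R\<in>patterns n. qlim d t n R) = (\<Sum>R\<in>patterns n. if R = {} then qlim d t n {} else 0)"
    by (intro sum.cong) auto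
  then show ?thesis using sum_qlim[OF d t, of n] by (simp add: patterns_def)
qed

section \<open>Patterns of two points, and trees of entropy zero\<close>

context
  fixes d :: nat and t :: tree
  assumes d: "d \<ge> 2" and t: "good_tree d t"
begin

text \<open>One point in subsquare \<open>i\<close> and one in subsquare \<open>j\<close>: the
  blocks are single points, so the inflation is the one pair dictated by the root
  permutation.\<close>

lemma pos_pair:
  assumes ij: "i < j" "j < d"
  shows "qlim d t 2 (if perms t [] (Suc i) < perms t [] (Suc j) then {(0, 1)} else {(1, 0)}) > 0"
proof -
  define l where "l = (\<lambda>x\<in>{..<2::nat}. if x = 0 then i else j)"
  let ?N = "cnt l {..<2}" and ?p = "perms t []"
  have two: "{..<2::nat} = {0, 1}" by auto
  have c: "{x\<in>{..<2}. l x = m} = (if m = i then {0} else if m = j then {1} else {})" for m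
    using ij by (auto simp: l_def two)
  have N: "?N m = (if m = i \<or> m = j then 1 else 0)" for m unfolding cnt_def c by simp
  have o: "offs ?N i = 0" "offs ?N j = 1"
  proof -
    show "offs ?N i = 0" using ij by (simp add: offs_def N)
    have "offs ?N j = (\<Sum>m<j. if m = i then 1 else 0)" unfolding offs_def N by (intro sum.cong) auto
    then show "offs ?N j = 1" using ij by simp
  qed
  have "?p (Suc i) \<noteq> ?p (Suc j)"
    using good_squares.a_inj[OF good_squares_tree[OF d t], of "[]" i j] ij by auto
  then obtain m1 m2 where m: "?p (Suc m1) < ?p (Suc m2)" "(m1 = i \<and> m2 = j \<and> ?p (Suc i) < ?p (Suc j)) \<or> (m1 = j \<and> m2 = i \<and> \<not> ?p (Suc i) < ?p (Suc j))"
    by (metis linorder_neqE_nat)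
  have "inflate d ?p ?N (\<lambda>i\<in>{..<d}. {}) = {(offs ?N m1, offs ?N m2)}"
  proof (intro set_eqI iffI)
    fix z assume "z \<in> inflate d ?p ?N (\<lambda>i\<in>{..<d}. {})"
    then obtain i' j' b c where z: "z = (offs ?N i' + b, offs ?N j' + c)" "?p (Suc i') < ?p (Suc j')" "b < ?N i'" "c < ?N j'"
      unfolding inflate_def by auto
    have "i' = i \<or> i' = j" "b = 0" "j' = i \<or> j' = j" "c = 0" using z(3,4) by (auto simp: N split: if_splits)
    then have "i' = m1" "j' = m2" using z(2) m by auto
    then show "z \<in> {(offs ?N m1, offs ?N m2)}" using z(1) \<open>b = 0\<close> \<open>c = 0\<close> by simp
  next
    fix z assume "z \<in> {(offs ?N m1, offs ?N m2)}"
    then have "z = (offs ?N m1 + 0, offs ?N m2 + 0)" by simp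
    moreover have "m1 < d" "m2 < d" "0 < ?N m1" "0 < ?N m2" using m(2) ij by (auto simp: N)
    ultimately show "z \<in> inflate d ?p ?N (\<lambda>i\<in>{..<d}. {})" unfolding inflate_def using m(1) by blast
  qed
  then have inf: "inflate d ?p ?N (\<lambda>i\<in>{..<d}. {}) = (if ?p (Suc i) < ?p (Suc j) then {(0, 1)} else {(1, 0)})"
    using m(2) o by auto
  show ?thesis
  proof (rule qlim_ge_term[OF d t, where l = l and Rs = "\<lambda>i\<in>{..<d}. {}"])
    show "l \<in> {..<2} \<rightarrow>\<^sub>E {..<d}" using ij by (auto simp: l_def)
    show "(\<lambda>i\<in>{..<d}. {}) \<in> (\<Pi>\<^sub>E i\<in>{..<d}. patterns (?N i))" by (auto simp: patterns_def)
    show "qlim d (subtree t m) (?N m) ((\<lambda>i\<in>{..<d}. {}) m) > 0" if "m < d" for m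
    proof -
      have "?N m \<le> 1" by (simp add: N)
      then have "qlim d (subtree t m) (?N m) {} = 1" using qlim_small_any[OF d good_subtree[OF t that]] by blast
      then show ?thesis using that by simp
    qed
  qed (rule inf)
qed

text \<open>Both points fall into subsquare \<open>i\<close>, where the root permutation is
  invisible: inflating a single nonempty block returns the block.\<close>

lemma nested_pos:
  assumes i: "i < d" and R: "R \<in> patterns 2" "qlim d (subtree t i) 2 R > 0"
  shows "qlim d t 2 R > 0"
proof -
  define l where "l = (\<lambda>x\<in>{..<2::nat}. i)"
  let ?N = "cnt l {..<2}" and ?p = "perms t []" and ?Rs = "\<lambda>k\<in>{..<d}. if k = i then R else {}"
  have c: "{x\<in>{..<2}. l x = m} = (if m = i then {..<2} else {})" for m by (auto simp: l_def)
  have N: "?N m = (if m = i then 2 else 0)" for m unfolding cnt_def c by simp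
  have o: "offs ?N i = 0" by (simp add: offs_def N)
  have inf: "inflate d ?p ?N ?Rs = R"
    using i o unfolding inflate_def N by (auto split: if_splits)
  show ?thesis
  proof (rule qlim_ge_term[OF d t, where l = l and Rs = ?Rs])
    show "l \<in> {..<2} \<rightarrow>\<^sub>E {..<d}" using i by (auto simp: l_def)
    show "?Rs \<in> (\<Pi>\<^sub>E i\<in>{..<d}. patterns (?N i))" using R(1) by (auto simp: N) (auto simp: patterns_def)
    show "qlim d (subtree t m) (?N m) (?Rs m) > 0" if "m < d" for m
      using R(2) qlim_small_any[OF d good_subtree[OF t that], of 0] that by (simp add: N)
  qed (rule inf)
qed

lemma pattern_entropy_2_pos:
  assumes "qlim d t 2 {(0, 1)} > 0" "qlim d t 2 {(1, 0)} > 0"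
  shows "pattern_entropy d t 2 > 0"
proof -
  let ?q = "qlim d t 2" and ?a = "{(0::nat, 1::nat)}" and ?b = "{(1::nat, 0::nat)}"
  have P: "?a \<in> patterns 2" "?b \<in> patterns 2" "?a \<noteq> ?b" by (auto simp: patterns_def)
  have "(\<Sum>R\<in>{?a, ?b}. ?q R) \<le> (\<Sum>R\<in>patterns 2. ?q R)" using P by (intro sum_mono2) (auto simp: qlim_bounds)
  then have "?q ?a < 1" using sum_qlim[OF d t, of 2] P assms by simp
  then have "?q ?a * ln (?q ?a) < 0" using assms by (intro mult_pos_neg) auto
  then have "0 < - (?q ?a * ln (?q ?a))" by simp
  also have "\<dots> \<le> (\<Sum>R\<in>patterns 2. - (?q R * ln (?q R)))"
  proof (rule member_le_sum[OF P(1)])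
    fix R
    show "0 \<le> - (?q R * ln (?q R))" using ent_nonneg[of "{R}" ?q] qlim_bounds by (simp add: ent_def)
  qed simp
  finally show ?thesis by (simp add: pattern_entropy_def ent_def sum_negf)
qed

text \<open>The squares line up along the diagonal, so bottom edges equal left edges.\<close>

lemma entropy_0_if_id:
  assumes "\<And>s. s \<in> lists {..<d} \<Longrightarrow> perms t s = id"
  shows "pattern_entropy d t n = 0"
proof (rule monotone_tree_entropy_0[OF d t, where inc = True])
  fix k s s' assume s: "s \<in> words d k" "s' \<in> words d k"
  have "bottom_edge d (perms t) (cuts t) r = left_edge d (cuts t) r" if "r \<in> lists {..<d}" for r
    using that
  proof (induction rule: lists.induct)
    case (Cons i r)
    have "{j. j < d \<and> perms t r (Suc j) < perms t r (Suc i)} = {..<i}" using assms[OF Cons(2)] Cons(1) by auto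
    then show ?case using Cons.IH by simp
  qed simp
  then show "bottom_edge d (perms t) (cuts t) s < bottom_edge d (perms t) (cuts t) s' \<longleftrightarrow>
     (if True then left_edge d (cuts t) s < left_edge d (cuts t) s' else left_edge d (cuts t) s' < left_edge d (cuts t) s)"
    using s by (simp add: words_def)
qed

text \<open>The squares line up along the antidiagonal: the top edge of each is 1 minus its left
  edge.\<close>

lemma entropy_0_if_reversal:
  assumes "\<And>s. s \<in> lists {..<d} \<Longrightarrow> perms t s = reversal d"
  shows "pattern_entropy d t n = 0"
proof (rule monotone_tree_entropy_0[OF d t, where inc = False])
  interpret G: good_squares d "perms t" "cuts t" by (rule good_squares_tree[OF d t])
  fix k s s' assume s: "s \<in> words d k" "s' \<in> words d k"
  have b: "bottom_edge d (perms t) (cuts t) r = 1 - left_edge d (cuts t) r - side d (cuts t) r" if "r \<in> lists {..<d}" for r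
    using that
  proof (induction rule: lists.induct)
    case (Cons i r)
    have i: "i < d" using Cons(1) by simp
    have "{j. j < d \<and> perms t r (Suc j) < perms t r (Suc i)} = {..<d} - {..i}"
      using assms[OF Cons(2)] i by (auto simp: reversal_def)
    moreover have "(\<Sum>j\<in>{..<d} - {..i}. gap d (cuts t r) j) = 1 - ((\<Sum>j<i. gap d (cuts t r) j) + gap d (cuts t r) i)"
      using i d sum_gap_all[of d "cuts t r"] by (subst sum_diff) (auto simp: lessThan_Suc_atMost[symmetric])
    ultimately have "bottom_edge d (perms t) (cuts t) (i # r) = bottom_edge d (perms t) (cuts t) r
        + side d (cuts t) r * (1 - ((\<Sum>j<i. gap d (cuts t r) j) + gap d (cuts t r) i))"
      by (simp only: bottom_edge.simps)
    then show ?case unfolding Cons.IH left_edge.simps side.simps by (simp add: algebra_simps)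
  qed simp
  have l: "s \<in> lists {..<d}" "s' \<in> lists {..<d}" using s by (auto simp: words_def)
  have "bottom_edge d (perms t) (cuts t) s < bottom_edge d (perms t) (cuts t) s' \<longleftrightarrow> left_edge d (cuts t) s' < left_edge d (cuts t) s"
    using G.horizontal.separated[OF s] G.side_pos'[OF l(1)] G.side_pos'[OF l(2)] b[OF l(1)] b[OF l(2)]
    by (cases "s = s'") auto
  then show "bottom_edge d (perms t) (cuts t) s < bottom_edge d (perms t) (cuts t) s' \<longleftrightarrow>
     (if False then left_edge d (cuts t) s < left_edge d (cuts t) s' else left_edge d (cuts t) s' < left_edge d (cuts t) s)" by simp
qed

end

section \<open>Monotone permutations, and deletion of a sample point\<close>

lemma rank_by_values:
  assumes "p permutes {1..d}" "i \<in> {1..d}"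
  shows "card {k\<in>{1..d}. p k \<le> p i} = p i"
proof -
  have pi: "p i \<in> {1..d}" using assms permutes_in_image by metis
  have "p ` {k\<in>{1..d}. p k \<le> p i} = {1..p i}"
  proof (intro set_eqI iffI)
    fix m assume "m \<in> {1..p i}"
    then have "m \<in> p ` {1..d}" using pi permutes_image[OF assms(1)] by auto
    then show "m \<in> p ` {k\<in>{1..d}. p k \<le> p i}" using \<open>m \<in> {1..p i}\<close> by auto
  next
    fix m assume "m \<in> p ` {k\<in>{1..d}. p k \<le> p i}"
    then obtain k where "m = p k" "k \<in> {1..d}" "p k \<le> p i" by blast
    moreover have "p k \<in> {1..d}" using calculation(2) permutes_in_image[OF assms(1)] by metis
    ultimately show "m \<in> {1..p i}" by simp
  qed
  moreover have "inj_on p {k\<in>{1..d}. p k \<le> p i}" using permutes_inj[OF assms(1)] by (rule inj_on_subset) simp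
  ultimately show ?thesis using card_image by fastforce
qed

text \<open>A value is the number of positions whose value is not larger, and monotonicity
  identifies these positions.\<close>

lemma increasing_permutation:
  assumes p: "p \<in> Sym d" and inc: "\<And>i j. i < j \<Longrightarrow> j < d \<Longrightarrow> p (Suc i) < p (Suc j)"
  shows "p = id"
proof
  fix i
  have per: "p permutes {1..d}" using p by (simp add: Sym_def)
  show "p i = id i"
  proof (cases "i \<in> {1..d}")
    case True
    have mono: "p a < p b" if "a \<in> {1..d}" "b \<in> {1..d}" "a < b" for a b
      using inc[of "a - 1" "b - 1"] that by auto
    have "p k \<le> p i \<longleftrightarrow> k \<le> i" if "k \<in> {1..d}" for k
      using mono[OF that True] mono[OF True that] by (cases k i rule: linorder_cases) auto
    then have "{k\<in>{1..d}. p k \<le> p i} = {1..i}" using True by auto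
    then show ?thesis using rank_by_values[OF per True] by simp
  qed (use permutes_not_in[OF per] in simp)
qed

lemma decreasing_permutation:
  assumes p: "p \<in> Sym d" and dec: "\<And>i j. i < j \<Longrightarrow> j < d \<Longrightarrow> p (Suc j) < p (Suc i)"
  shows "p = reversal d"
proof
  fix i
  have per: "p permutes {1..d}" using p by (simp add: Sym_def)
  show "p i = reversal d i"
  proof (cases "i \<in> {1..d}")
    case True
    have mono: "p b < p a" if "a \<in> {1..d}" "b \<in> {1..d}" "a < b" for a b
      using dec[of "a - 1" "b - 1"] that by auto
    have "p k \<le> p i \<longleftrightarrow> i \<le> k" if "k \<in> {1..d}" for k
      using mono[OF that True] mono[OF True that] by (cases k i rule: linorder_cases) auto
    then have "{k\<in>{1..d}. p k \<le> p i} = {i..d}" using True by auto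
    then show ?thesis using rank_by_values[OF per True] True by (simp add: reversal_def)
  qed (use permutes_not_in[OF per] in \<open>auto simp: reversal_def\<close>)
qed

text \<open>\<open>drop_rank b\<close> maps \<open>{1..n + 1} - {b}\<close> to \<open>{1..n}\<close>, and \<open>skip_rank b\<close> is its inverse.\<close>

definition drop_rank :: "nat \<Rightarrow> nat \<Rightarrow> nat" where
  "drop_rank b p = (if b < p then p - 1 else p)"

definition skip_rank :: "nat \<Rightarrow> nat \<Rightarrow> nat" where
  "skip_rank b i = (if i < b then i else Suc i)"

definition delete_at :: "nat \<Rightarrow> (nat \<Rightarrow> nat) \<Rightarrow> nat \<Rightarrow> nat \<Rightarrow> nat" where
  "delete_at n \<pi> b i = (if i \<in> {1..n} then drop_rank (\<pi> b) (\<pi> (skip_rank b i)) else i)"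

text \<open>The new index is the largest, so it loses every tie: it is counted in the rank of
  \<open>j\<close> only if its value is strictly smaller.\<close>

lemma rank_of_Suc:
  assumes j: "j \<in> {1..n}"
  shows "rank_of n f j = drop_rank (rank_of (Suc n) f (Suc n)) (rank_of (Suc n) f j)"
    "rank_of (Suc n) f j \<noteq> rank_of (Suc n) f (Suc n)"
proof -
  have jS: "j \<in> {1..Suc n}" "Suc n \<in> {1..Suc n}" "j \<noteq> Suc n" using j by auto
  have inj: "inj_on (rank_of (Suc n) f) {1..Suc n}" using bij_rank_of by (rule bij_betw_imp_inj_on)
  show ne: "rank_of (Suc n) f j \<noteq> rank_of (Suc n) f (Suc n)" using inj_onD[OF inj _ jS(1,2)] jS(3) by blast
  let ?B = "\<lambda>m i. {k \<in> {1..m}. f k < f i \<or> (f k = f i \<and> k \<le> i)}"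
  have lt: "rank_of (Suc n) f (Suc n) < rank_of (Suc n) f j \<longleftrightarrow> f (Suc n) < f j"
  proof
    assume "f (Suc n) < f j"
    then have "?B (Suc n) (Suc n) \<subseteq> ?B (Suc n) j" by auto
    then have "rank_of (Suc n) f (Suc n) \<le> rank_of (Suc n) f j" unfolding rank_of_def by (intro card_mono) auto
    then show "rank_of (Suc n) f (Suc n) < rank_of (Suc n) f j" using ne by simp
  next
    assume *: "rank_of (Suc n) f (Suc n) < rank_of (Suc n) f j"
    show "f (Suc n) < f j"
    proof (rule ccontr)
      assume "\<not> f (Suc n) < f j"
      then have "?B (Suc n) j \<subseteq> ?B (Suc n) (Suc n)" by auto
      then have "rank_of (Suc n) f j \<le> rank_of (Suc n) f (Suc n)" unfolding rank_of_def by (intro card_mono) auto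
      then show False using * by simp
    qed
  qed
  have "?B (Suc n) j = (if f (Suc n) < f j then insert (Suc n) (?B n j) else ?B n j)"
    using j by (auto simp: le_Suc_eq)
  then have "rank_of (Suc n) f j = (if f (Suc n) < f j then Suc (rank_of n f j) else rank_of n f j)"
    unfolding rank_of_def by simp
  then show "rank_of n f j = drop_rank (rank_of (Suc n) f (Suc n)) (rank_of (Suc n) f j)"
    using lt by (simp add: drop_rank_def)
qed

lemma pattern_delete:
  "pattern n z = delete_at n (pattern (Suc n) z) (rank_of (Suc n) (\<lambda>i. fst (z i)) (Suc n))"
proof
  fix i
  let ?x = "\<lambda>i. fst (z i)" and ?y = "\<lambda>i. snd (z i)"
  let ?b = "rank_of (Suc n) ?x (Suc n)" and ?\<pi> = "pattern (Suc n) z"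
  show "pattern n z i = delete_at n ?\<pi> ?b i"
  proof (cases "i \<in> {1..n}")
    case True
    then have "i \<in> rank_of n ?x ` {1..n}" using bij_betw_imp_surj_on[OF bij_rank_of] by metis
    then obtain j where j: "j \<in> {1..n}" "i = rank_of n ?x j" by blast
    have jS: "j \<in> {1..Suc n}" using j by simp
    have "i = drop_rank ?b (rank_of (Suc n) ?x j)" using rank_of_Suc(1)[OF j(1)] j(2) by simp
    then have p: "rank_of (Suc n) ?x j = skip_rank ?b i"
      using rank_of_Suc(2)[OF j(1), of ?x] by (auto simp: drop_rank_def skip_rank_def split: if_splits)
    have "pattern n z i = rank_of n ?y j" using pattern_rank[OF j(1), of z] j(2) by simp
    also have "\<dots> = drop_rank (rank_of (Suc n) ?y (Suc n)) (rank_of (Suc n) ?y j)" by (rule rank_of_Suc(1)[OF j(1)])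
    also have "rank_of (Suc n) ?y (Suc n) = ?\<pi> ?b" using pattern_rank[of "Suc n" "Suc n" z] by simp
    also have "rank_of (Suc n) ?y j = ?\<pi> (skip_rank ?b i)" using pattern_rank[OF jS, of z] p by simp
    finally show ?thesis using True by (simp add: delete_at_def)
  next
    case False
    have "pattern n z permutes {1..n}" using pattern_in_Sym[of n z] by (simp add: Sym_def)
    then show ?thesis using permutes_not_in[OF _ False] by (simp only: delete_at_def False if_False)
  qed
qed

lemma pattern_restrict: "pattern n (restrict z {1..n}) = pattern n z"
proof -
  have r: "rank_of n (\<lambda>j. g (restrict z {1..n} j)) j = rank_of n (\<lambda>j. g (z j)) j" if "j \<in> {1..n}" for g j
    unfolding rank_of_def using that by (intro arg_cong[of _ _ card] Collect_cong) auto
  show ?thesis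
  proof (subst pattern_eq_iff[OF pattern_in_Sym], intro ballI)
    fix j assume j: "j \<in> {1..n}"
    show "rank_of n (\<lambda>i. snd (restrict z {1..n} i)) j = pattern n z (rank_of n (\<lambda>i. fst (restrict z {1..n} i)) j)"
      unfolding r[OF j, of fst] r[OF j, of snd] pattern_rank[OF j] ..
  qed
qed

text \<open>The pattern of \<open>n\<close> points is a function of the pattern of n + 1 points and
  of the horizontal rank of the last one. That rank takes at most n + 1 values and therefore adds at
  most ln (n + 1) to the entropy.\<close>

lemma sampling_entropy_Suc:
  assumes \<nu>: "permuton \<nu>"
  shows "sampling_entropy n \<nu> \<le> sampling_entropy (Suc n) \<nu> + ln (real (Suc n))"
proof -
  interpret \<nu>: prob_space \<nu> using \<nu> by (simp add: permuton_def)
  have sets\<nu>: "sets \<nu> = sets borel" using \<nu> by (simp add: permuton_def)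
  let ?K = "{1..Suc n}"
  let ?N = "PiM ?K (\<lambda>_. \<nu>)"
  interpret N: prob_space ?N by (rule prob_space_PiM) (rule \<nu>.prob_space_axioms)
  let ?X = "pattern (Suc n)" and ?B = "\<lambda>z. rank_of (Suc n) (\<lambda>i. fst (z i)) (Suc n)"
  have comp: "(\<lambda>z. z j) \<in> ?N \<rightarrow>\<^sub>M borel" if "j \<in> ?K" for j
    using measurable_component_singleton[OF that, of "\<lambda>_. \<nu>"] by (simp add: measurable_cong_sets[OF refl sets\<nu>])
  have f: "(\<lambda>z. fst (z j)) \<in> borel_measurable ?N" if "j \<in> ?K" for j
    by (rule measurable_compose[OF comp[OF that] borel_measurable_continuous_onI]; intro continuous_intros)
  have mX: "?X \<in> ?N \<rightarrow>\<^sub>M count_space (Sym (Suc n))" by (rule measurable_pattern[OF sets\<nu>])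
  have mX': "pattern n \<in> PiM {1..n} (\<lambda>_. \<nu>) \<rightarrow>\<^sub>M count_space (Sym n)" by (rule measurable_pattern[OF sets\<nu>])
  have BK: "?B z \<in> ?K" for z using bij_betw_apply[OF bij_rank_of, of "Suc n"] by simp
  \<comment> \<open>The atoms of the joint law of the pattern of n + 1 points and the horizontal
    rank of the last point.\<close>
  define E where "E = (\<lambda>p. {z\<in>space ?N. ?X z = fst p \<and> ?B z = snd p})"
  have Em: "E p \<in> sets ?N" if "fst p \<in> Sym (Suc n)" for p
  proof -
    have "?X -` {fst p} \<inter> space ?N \<in> sets ?N" by (rule measurable_sets[OF mX]) (use that in simp)
    moreover have "{z\<in>space ?N. ?B z = snd p} \<in> sets ?N"
      by (rule measurable_rank_of[where f = "\<lambda>z i. fst (z i)", OF f]) auto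
    moreover have "E p = (?X -` {fst p} \<inter> space ?N) \<inter> {z\<in>space ?N. ?B z = snd p}" by (auto simp: E_def)
    ultimately show ?thesis by auto
  qed
  let ?S = "Sym (Suc n) \<times> ?K"
  have fibre: "measure ?N {z\<in>space ?N. \<phi> (?X z, ?B z)} = (\<Sum>p\<in>{p\<in>?S. \<phi> p}. measure ?N (E p))" for \<phi>
  proof -
    have "{z\<in>space ?N. \<phi> (?X z, ?B z)} = (\<Union>p\<in>{p\<in>?S. \<phi> p}. E p)"
    proof (intro set_eqI iffI)
      fix z assume z: "z \<in> {z\<in>space ?N. \<phi> (?X z, ?B z)}"
      then have "(?X z, ?B z) \<in> {p\<in>?S. \<phi> p}" using pattern_in_Sym BK by blast
      moreover have "z \<in> E (?X z, ?B z)" using z by (simp add: E_def)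
      ultimately show "z \<in> (\<Union>p\<in>{p\<in>?S. \<phi> p}. E p)" by blast
    qed (auto simp: E_def)
    moreover have "disjoint_family_on E {p\<in>?S. \<phi> p}" by (auto simp: disjoint_family_on_def E_def)
    ultimately show ?thesis using Em by (simp only:) (intro N.finite_measure_finite_Union, auto)
  qed
  have law1: "measure (sample_law \<nu> (Suc n)) {\<pi>} = (\<Sum>p\<in>{p\<in>?S. fst p = \<pi>}. measure ?N (E p))" if "\<pi> \<in> Sym (Suc n)" for \<pi>
  proof -
    have "measure (sample_law \<nu> (Suc n)) {\<pi>} = measure ?N {z\<in>space ?N. ?X z = \<pi>}"
      unfolding sample_law_def using mX that by (simp add: measure_distr vimage_def Int_def conj_commute)
    then show ?thesis using fibre[of "\<lambda>p. fst p = \<pi>"] by simp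
  qed
  have law0: "measure (sample_law \<nu> n) {\<sigma>} = (\<Sum>p\<in>{p\<in>?S. (\<lambda>(\<pi>, b). delete_at n \<pi> b) p = \<sigma>}. measure ?N (E p))" if \<sigma>: "\<sigma> \<in> Sym n" for \<sigma>
  proof -
    have r: "distr ?N (PiM {1..n} (\<lambda>_. \<nu>)) (\<lambda>z. restrict z {1..n}) = PiM {1..n} (\<lambda>_. \<nu>)"
      using distr_PiM_reindex[of ?K "\<lambda>_. \<nu>" "\<lambda>i. i" "{1..n}"] \<nu>.prob_space_axioms by (simp add: restrict_def inj_on_def)
    have mr: "(\<lambda>z. restrict z {1..n}) \<in> ?N \<rightarrow>\<^sub>M PiM {1..n} (\<lambda>_. \<nu>)" by (rule measurable_restrict_subset) auto
    have "sample_law \<nu> n = distr (distr ?N (PiM {1..n} (\<lambda>_. \<nu>)) (\<lambda>z. restrict z {1..n})) (count_space (Sym n)) (pattern n)"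
      unfolding sample_law_def r ..
    also have "\<dots> = distr ?N (count_space (Sym n)) (pattern n)"
      by (subst distr_distr[OF mX' mr]) (simp only: comp_def pattern_restrict)
    finally have s: "sample_law \<nu> n = distr ?N (count_space (Sym n)) (pattern n)" .
    have mX'': "pattern n \<in> ?N \<rightarrow>\<^sub>M count_space (Sym n)"
      using measurable_compose[OF mr mX'] by (simp only: pattern_restrict)
    have "measure (sample_law \<nu> n) {\<sigma>} = measure ?N {z\<in>space ?N. pattern n z = \<sigma>}"
      unfolding s using mX'' \<sigma> by (simp add: measure_distr vimage_def Int_def conj_commute)
    also have "\<dots> = measure ?N {z\<in>space ?N. (\<lambda>(\<pi>, b). delete_at n \<pi> b) (?X z, ?B z) = \<sigma>}"
      unfolding case_prod_conv using pattern_delete[of n] by simp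
    also have "\<dots> = (\<Sum>p\<in>{p\<in>?S. (\<lambda>(\<pi>, b). delete_at n \<pi> b) p = \<sigma>}. measure ?N (E p))" by (rule fibre)
    finally show ?thesis .
  qed
  let ?f = "\<lambda>p. measure ?N (E p)"
  \<comment> \<open>Pairs that never occur are sent to \<open>id\<close>, so that all values are
    permutations of the right size; these pairs have weight zero.\<close>
  let ?g = "\<lambda>p. if E p = {} then id else (\<lambda>(\<pi>, b). delete_at n \<pi> b) p"
  have g: "?g ` ?S \<subseteq> Sym n"
  proof (rule image_subsetI)
    fix p assume "p \<in> ?S"
    show "?g p \<in> Sym n"
    proof (cases "E p = {}")
      case True then show ?thesis by (simp add: Sym_def permutes_id)
    next
      case False
      then obtain z where "?X z = fst p" "?B z = snd p" by (auto simp: E_def)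
      then have "(\<lambda>(\<pi>, b). delete_at n \<pi> b) p = pattern n z" using pattern_delete[of n z] by (simp add: case_prod_unfold)
      then show ?thesis using False pattern_in_Sym by simp
    qed
  qed
  have law0': "measure (sample_law \<nu> n) {\<sigma>} = (\<Sum>p\<in>{p\<in>?S. ?g p = \<sigma>}. ?f p)" if "\<sigma> \<in> Sym n" for \<sigma>
  proof -
    have "(\<Sum>p\<in>{p\<in>?S. \<psi> p = \<sigma>}. ?f p) = (\<Sum>p\<in>{p\<in>?S. \<psi> p = \<sigma> \<and> E p \<noteq> {}}. ?f p)" for \<psi>
      by (rule sum.mono_neutral_right) auto
    moreover have "{p\<in>?S. ?g p = \<sigma> \<and> E p \<noteq> {}} = {p\<in>?S. (\<lambda>(\<pi>, b). delete_at n \<pi> b) p = \<sigma> \<and> E p \<noteq> {}}" by auto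
    ultimately show ?thesis using law0[OF that] by simp
  qed
  have ent_law: "sampling_entropy m \<nu> = ent (Sym m) (\<lambda>\<pi>. measure (sample_law \<nu> m) {\<pi>})" for m
    by (simp add: sampling_entropy_def ent_def)
  have tot: "(\<Sum>p\<in>?S. ?f p) = 1" using fibre[of "\<lambda>_. True"] N.prob_space by simp
  have "sampling_entropy n \<nu> = ent (Sym n) (\<lambda>\<sigma>. \<Sum>p\<in>{p\<in>?S. ?g p = \<sigma>}. ?f p)"
    unfolding ent_law unfolding ent_def using law0' by (intro arg_cong[of _ _ uminus] sum.cong refl) simp
  also have "\<dots> \<le> ent ?S ?f" using g by (intro ent_coarse_le) auto
  also have "\<dots> \<le> ent (Sym (Suc n)) (\<lambda>\<pi>. \<Sum>p\<in>{p\<in>?S. fst p = \<pi>}. ?f p) + ln (real (Suc n))"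
  proof (rule ent_coarse_ge)
    fix \<pi> assume "\<pi> \<in> Sym (Suc n)"
    then have "{p\<in>?S. fst p = \<pi>} = {\<pi>} \<times> ?K" by auto
    then show "real (card {p\<in>?S. fst p = \<pi>}) \<le> real (Suc n)" by (simp add: card_cartesian_product)
  qed (use tot in auto)
  also have "ent (Sym (Suc n)) (\<lambda>\<pi>. \<Sum>p\<in>{p\<in>?S. fst p = \<pi>}. ?f p) = sampling_entropy (Suc n) \<nu>"
    unfolding ent_law unfolding ent_def using law1 by (intro arg_cong[of _ _ uminus] sum.cong refl) simp
  finally show ?thesis .
qed

section \<open>Second moments and interpolation\<close>

text \<open>The expected number of subsquares of the root that receive exactly \<open>k\<close> of the \<open>n\<close> points: the
  occupation numbers of uniform spacings are a uniform random composition.\<close>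

definition split_mean :: "nat \<Rightarrow> nat \<Rightarrow> nat \<Rightarrow> real" where
  "split_mean d n k = real d * real ((n - k + (d - 2)) choose (d - 2)) / real ((n + d - 1) choose (d - 1))"

lemma split_mean_nonneg: "split_mean d n k \<ge> 0"
  by (simp add: split_mean_def)

text \<open>Uniform compositions arise from spacings by mixing binomials: the weight is a binomial
  coefficient times the moment in \<open>beta_moment_of_gaps\<close> with
  \<open>m = n - k\<close>.\<close>

lemma split_mean_fact:
  assumes d: "d \<ge> 2" and k: "k \<le> n"
  shows "split_mean d n k = real (n choose k) * (real d * real (d - 1) * fact k * fact (n - k + d - 2) / fact (k + (n - k) + d - 1))"
proof -
  obtain e where e: "d = Suc (Suc e)" using d by (metis add_2_eq_Suc le_Suc_ex)
  have 1: "real ((n - k + e) choose e) = fact (n - k + e) / (fact e * fact (n - k))"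
    by (subst binomial_fact) auto
  have 2: "real ((n + Suc e) choose Suc e) = fact (n + Suc e) / (fact (Suc e) * fact n)"
    by (subst binomial_fact) auto
  have 3: "real (n choose k) = fact n / (fact k * fact (n - k))"
    using k by (subst binomial_fact) auto
  have gen: "D * (A / (E * B)) / (G / ((S * E) * H)) = H / (J * B) * (D * S * J * A / G)"
    if "E \<noteq> 0" "B \<noteq> 0" "G \<noteq> 0" "J \<noteq> 0" "H \<noteq> 0" "S \<noteq> 0" for A B D E G H J S :: real
    using that by (simp add: field_simps)
  have "split_mean d n k = real d * (fact (n - k + e) / (fact e * fact (n - k))) / (fact (n + Suc e) / ((real (Suc e) * fact e) * fact n))"
    unfolding split_mean_def e using 1 2 by (simp add: fact_Suc del: binomial_Suc_Suc)
  also have "\<dots> = fact n / (fact k * fact (n - k)) * (real d * real (Suc e) * fact k * fact (n - k + e) / fact (n + Suc e))"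
    by (rule gen) auto
  finally show ?thesis unfolding 3 using k e by simp
qed

lemma mean_of_splits:
  assumes d: "d \<ge> 2"
  shows "(\<integral>v. (\<Sum>i<d. \<Sum>k\<le>n. real (n choose k) * gap d v i ^ k * (1 - gap d v i) ^ (n - k) * F k) \<partial>cut_points (d - 1))
     = (\<Sum>k\<le>n. split_mean d n k * F k)"
proof -
  have i: "integrable (cut_points (d - 1)) (\<lambda>v. \<Sum>i<d. gap d v i ^ a * (1 - gap d v i) ^ b)" for a b
    using d by (intro Bochner_Integration.integrable_sum integrable_gap_fun[where B = 1 and f = "\<lambda>x. x ^ a * (1 - x) ^ b"])
       (auto simp: abs_mult intro!: mult_le_one power_le_one)
  have "(\<integral>v. (\<Sum>i<d. \<Sum>k\<le>n. real (n choose k) * gap d v i ^ k * (1 - gap d v i) ^ (n - k) * F k) \<partial>cut_points (d - 1))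
    = (\<integral>v. (\<Sum>k\<le>n. (real (n choose k) * F k) * (\<Sum>i<d. gap d v i ^ k * (1 - gap d v i) ^ (n - k))) \<partial>cut_points (d - 1))"
    by (subst sum.swap) (simp add: sum_distrib_left mult_ac)
  also have "\<dots> = (\<Sum>k\<le>n. (real (n choose k) * F k) * (\<integral>v. (\<Sum>i<d. gap d v i ^ k * (1 - gap d v i) ^ (n - k)) \<partial>cut_points (d - 1)))"
    using i by (subst Bochner_Integration.integral_sum) auto
  also have "\<dots> = (\<Sum>k\<le>n. split_mean d n k * F k)"
  proof (rule sum.cong[OF refl])
    fix k assume "k \<in> {..n}"
    then have k: "k \<le> n" by simp
    show "real (n choose k) * F k * (\<integral>v. (\<Sum>i<d. gap d v i ^ k * (1 - gap d v i) ^ (n - k)) \<partial>cut_points (d - 1)) = split_mean d n k * F k"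
      unfolding beta_moment_of_gaps[OF d] split_mean_fact[OF d k] by (simp only: mult_ac)
  qed
  finally show ?thesis .
qed

lemma binomial_moments:
  fixes x :: real
  shows "(\<Sum>k\<le>n. real (n choose k) * x ^ k * (1 - x) ^ (n - k)) = 1"
    and "(\<Sum>k\<le>n. real (n choose k) * x ^ k * (1 - x) ^ (n - k) * real k) = real n * x"
    and "(\<Sum>k\<le>n. real (n choose k) * x ^ k * (1 - x) ^ (n - k) * (real k)\<^sup>2) = real n * (real n - 1) * x\<^sup>2 + real n * x"
proof -
  note B = sum_Bernstein[of n x] sum_k_Bernstein[of n x] sum_kk_Bernstein[of n x]
  show "(\<Sum>k\<le>n. real (n choose k) * x ^ k * (1 - x) ^ (n - k)) = 1"
    using B(1) by (simp add: Bernstein_def)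
  show 2: "(\<Sum>k\<le>n. real (n choose k) * x ^ k * (1 - x) ^ (n - k) * real k) = real n * x"
    using B(2) by (simp add: Bernstein_def mult_ac)
  have "(\<Sum>k\<le>n. real (n choose k) * x ^ k * (1 - x) ^ (n - k) * (real k)\<^sup>2)
    = (\<Sum>k\<le>n. real k * (real k - 1) * Bernstein n k x) + (\<Sum>k\<le>n. real (n choose k) * x ^ k * (1 - x) ^ (n - k) * real k)"
    unfolding sum.distrib[symmetric] by (intro sum.cong refl) (simp add: Bernstein_def algebra_simps power2_eq_square)
  then show "(\<Sum>k\<le>n. real (n choose k) * x ^ k * (1 - x) ^ (n - k) * (real k)\<^sup>2) = real n * (real n - 1) * x\<^sup>2 + real n * x"
    using B(3) 2 by simp
qed

lemma mean_sum_gap_square: "d \<ge> 2 \<Longrightarrow> (\<integral>v. (\<Sum>i<d. gap d v i ^ 2) \<partial>cut_points (d - 1)) = 2 / (real d + 1)"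
proof -
  assume d: "d \<ge> 2"
  obtain e where e: "d = Suc (Suc e)" using d by (metis add_2_eq_Suc le_Suc_ex)
  have "real d * real (d - 1) * fact 2 * fact (0 + d - 2) / fact (2 + 0 + d - 1) = (2 / (real d + 1) :: real)"
    unfolding e by (simp add: fact_numeral divide_simps)
  then show ?thesis using beta_moment_of_gaps[OF d, of 2 0] by simp
qed

text \<open>The parts of a composition add up to \<open>n\<close>, so the first moment is exact. In
  the second, the sum of squared gaps has mean 2 / (d + 1), which is largest for
  \<open>d = 2\<close>; this is the source of 2/3.\<close>

lemma split_mean_moments:
  assumes d: "d \<ge> 2"
  shows "(\<Sum>k\<le>n. split_mean d n k * real k) = real n"
    and "(\<Sum>k\<le>n. split_mean d n k * (real k)\<^sup>2) \<le> 2 / 3 * (real n)\<^sup>2 + real n"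
proof -
  interpret P: prob_space "cut_points (d - 1)" by (rule prob_space_cut_points)
  have s1: "(\<Sum>i<d. gap d v i) = 1" for v using d by (simp add: sum_gap_all)
  show "(\<Sum>k\<le>n. split_mean d n k * real k) = real n"
    unfolding mean_of_splits[OF d, symmetric] binomial_moments using s1 P.prob_space by (simp add: sum_distrib_left[symmetric])
  have "(\<Sum>k\<le>n. split_mean d n k * (real k)\<^sup>2) = (\<integral>v. real n * (real n - 1) * (\<Sum>i<d. gap d v i ^ 2) + real n \<partial>cut_points (d - 1))"
    unfolding mean_of_splits[OF d, symmetric] binomial_moments using s1 by (simp add: sum.distrib sum_distrib_left[symmetric])
  also have "\<dots> = real n * (real n - 1) * (2 / (real d + 1)) + real n"
  proof -
    have "integrable (cut_points (d - 1)) (\<lambda>v. \<Sum>i<d. gap d v i ^ 2)"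
      using d by (intro Bochner_Integration.integrable_sum integrable_gap_fun[where B = 1]) (auto intro: power_le_one)
    note i = Bochner_Integration.integral_add[OF integrable_mult_right[OF this] P.integrable_const]
    show ?thesis unfolding i integral_mult_right_zero mean_sum_gap_square[OF d] using P.prob_space by simp
  qed
  also have "real n * (real n - 1) * (2 / (real d + 1)) \<le> (real n)\<^sup>2 * (2 / 3)"
  proof (cases "n = 0")
    case False
    have "real n * (real n - 1) \<le> (real n)\<^sup>2" by (simp add: power2_eq_square algebra_simps)
    moreover have "2 / (real d + 1) \<le> 2 / 3" using d by (intro divide_left_mono) auto
    ultimately show ?thesis using False by (intro mult_mono) auto
  qed simp
  finally show "(\<Sum>k\<le>n. split_mean d n k * (real k)\<^sup>2) \<le> 2 / 3 * (real n)\<^sup>2 + real n" by (simp add: mult.commute)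
qed

lemma powr_tangent:
  fixes x a :: real
  assumes "0 \<le> x" "0 \<le> a" "a \<le> 1"
  shows "x powr a \<le> a * x + (1 - a)"
proof (cases "x = 0")
  case False
  then show ?thesis using Youngs_inequality_0[of a "1 - a" x 1] assms by simp
qed (use assms in simp)

text \<open>From \<open>n = 12\<close> on, the second moment is at most 3/4 n^2. The power 2 - e is
  interpolated between 1 and 2 with weights e and 1 - e, which gives (1 - e) 3/4 + e = 3/4 + e / 4,
  at most 5/6. The second claim is a single term of the second moment.\<close>

lemma split_mean_power:
  assumes d: "d \<ge> 2" and n: "n \<ge> 12" and e: "0 \<le> e" "e \<le> 1/4"
  shows "(\<Sum>k\<le>n. split_mean d n k * real k powr (2 - e)) \<le> 5/6 * real n powr (2 - e)"
    and "split_mean d n n \<le> 3/4"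
proof -
  have N: "real n \<ge> 12" using n by simp
  have sq: "(\<Sum>k\<le>n. split_mean d n k * (real k)\<^sup>2) \<le> 3/4 * (real n)\<^sup>2"
  proof -
    have "real n \<le> (real n)\<^sup>2 / 12" using N by (simp add: power2_eq_square)
    then show ?thesis using split_mean_moments(2)[OF d, of n] by simp
  qed
  \<comment> \<open>The concave function x^(1 - e), evaluated at x = k / n, lies below its tangent
    at 1.\<close>
  have b: "real k powr (2 - e) \<le> real n powr (2 - e) * ((1 - e) * (real k)\<^sup>2 / (real n)\<^sup>2 + e * real k / real n)" if k: "k \<le> n" for k
  proof (cases "k = 0")
    case False
    have "real k powr (2 - e) = real k * (real n * (real k / real n)) powr (1 - e)"
      using False N by (simp add: powr_diff powr_numeral power2_eq_square field_simps)
    also have "\<dots> = real k * (real n powr (1 - e) * (real k / real n) powr (1 - e))"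
      by (subst powr_mult) auto
    also have "\<dots> \<le> real k * (real n powr (1 - e) * ((1 - e) * (real k / real n) + (1 - (1 - e))))"
      using e by (intro mult_left_mono powr_tangent) auto
    also have "real n powr (1 - e) = real n powr (2 - e) / real n"
      using N by (simp add: powr_diff powr_numeral power2_eq_square)
    also have "real k * (real n powr (2 - e) / real n * ((1 - e) * (real k / real n) + (1 - (1 - e))))
       = real n powr (2 - e) * ((1 - e) * (real k)\<^sup>2 / (real n)\<^sup>2 + e * real k / real n)"
    proof -
      have "real n \<noteq> 0" using N by simp
      then show ?thesis by (simp add: field_simps power2_eq_square)
    qed
    finally show ?thesis .
  qed simp
  have "(\<Sum>k\<le>n. split_mean d n k * real k powr (2 - e))
    \<le> (\<Sum>k\<le>n. split_mean d n k * (real n powr (2 - e) * ((1 - e) * (real k)\<^sup>2 / (real n)\<^sup>2 + e * real k / real n)))"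
    using b by (intro sum_mono mult_left_mono split_mean_nonneg) auto
  also have "\<dots> = real n powr (2 - e) * ((1 - e) * (\<Sum>k\<le>n. split_mean d n k * (real k)\<^sup>2) / (real n)\<^sup>2 + e * (\<Sum>k\<le>n. split_mean d n k * real k) / real n)"
    by (simp add: sum_distrib_left sum.distrib sum_divide_distrib algebra_simps)
  also have "\<dots> \<le> real n powr (2 - e) * ((1 - e) * (3/4) + e)"
  proof (intro mult_left_mono add_mono)
    have "(1 - e) * (\<Sum>k\<le>n. split_mean d n k * (real k)\<^sup>2) \<le> (1 - e) * (3/4 * (real n)\<^sup>2)" using sq e by (intro mult_left_mono) auto
    then show "(1 - e) * (\<Sum>k\<le>n. split_mean d n k * (real k)\<^sup>2) / (real n)\<^sup>2 \<le> (1 - e) * (3/4)"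
      using divide_right_mono[of _ _ "(real n)\<^sup>2"] N by fastforce
    show "e * (\<Sum>k\<le>n. split_mean d n k * real k) / real n \<le> e"
      using split_mean_moments(1)[OF d, of n] N by simp
  qed simp
  also have "\<dots> \<le> real n powr (2 - e) * (5/6)"
  proof (intro mult_left_mono)
    have "(1 - e) * (3/4) + e = 3/4 + e / 4" by (simp add: field_simps)
    then show "(1 - e) * (3/4) + e \<le> 5/6" using e by linarith
  qed (use e in auto)
  finally show "(\<Sum>k\<le>n. split_mean d n k * real k powr (2 - e)) \<le> 5/6 * real n powr (2 - e)" by (simp add: mult.commute)
  have "split_mean d n n * (real n)\<^sup>2 \<le> (\<Sum>k\<le>n. split_mean d n k * (real k)\<^sup>2)"
    by (intro member_le_sum[where f = "\<lambda>k. split_mean d n k * (real k)\<^sup>2"]) (auto intro!: mult_nonneg_nonneg split_mean_nonneg)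
  also note sq
  finally show "split_mean d n n \<le> 3/4" using N by simp
qed

text \<open>The constants fit together: 21/20 times 5/6 is 7/8, which leaves 1/8 for the error term.
  The value \<open>v n\<close> itself occurs on the right with coefficient at most 21/20 times 3/4,
  below 1, so its excess over the bound can be absorbed.\<close>

lemma split_recursion_bound:
  fixes v :: "nat \<Rightarrow> real"
  assumes d: "d \<ge> 2" and e: "0 \<le> e" "e \<le> 1/4" and v: "\<And>n. v n \<ge> 0" "v 0 = 0"
    and rec: "\<And>n. n \<ge> 1 \<Longrightarrow> v n \<le> 21/20 * (\<Sum>k\<le>n. split_mean d n k * v k) + C * real n powr (2 - e)"
  shows "\<exists>K\<ge>0. \<forall>n. v n \<le> K * real n powr (2 - e)"
proof -
  define K where "K = max (8 * \<bar>C\<bar>) (\<Sum>k\<le>12. v k)"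
  have K: "K \<ge> 0" "K \<ge> 8 * C" "\<And>k. k \<le> 12 \<Longrightarrow> v k \<le> K"
  proof -
    show "v k \<le> K" if "k \<le> 12" for k
      using that v member_le_sum[of k "{..12}" v] unfolding K_def by fastforce
  qed (auto simp: K_def)
  have "v n \<le> K * real n powr (2 - e)" for n
  proof (induction n rule: less_induct)
    case (less n)
    consider "n = 0" | "n \<noteq> 0" "n \<le> 12" | "n > 12" by linarith
    then show ?case
    proof cases
      case 2
      have "real n powr (2 - e) \<ge> 1" using 2 e by (intro ge_one_powr_ge_zero) auto
      then have "K * 1 \<le> K * real n powr (2 - e)" using K by (intro mult_left_mono) auto
      then show ?thesis using K(3)[OF 2(2)] by simp
    next
      case 3
      define P where "P = real n powr (2 - e)"
      have n: "n \<ge> 12" using 3 by simp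
      show ?thesis
      proof (rule ccontr)
        assume "\<not> v n \<le> K * real n powr (2 - e)"
        then have x: "v n - K * P > 0" by (simp add: P_def)
        have "(\<Sum>k\<le>n. split_mean d n k * v k) = (\<Sum>k<n. split_mean d n k * v k) + split_mean d n n * v n"
          by (simp add: lessThan_Suc_atMost[symmetric])
        also have "(\<Sum>k<n. split_mean d n k * v k) \<le> (\<Sum>k<n. split_mean d n k * (K * real k powr (2 - e)))"
          using less by (intro sum_mono mult_left_mono split_mean_nonneg) auto
        also have "\<dots> = K * (\<Sum>k\<le>n. split_mean d n k * real k powr (2 - e)) - split_mean d n n * (K * P)"
          by (simp add: lessThan_Suc_atMost[symmetric] sum_distrib_left P_def algebra_simps)
        also have "K * (\<Sum>k\<le>n. split_mean d n k * real k powr (2 - e)) \<le> K * (5/6 * P)"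
          unfolding P_def using K by (intro mult_left_mono split_mean_power(1)[OF d n e]) auto
        finally have "(\<Sum>k\<le>n. split_mean d n k * v k) \<le> K * (5/6 * P) + split_mean d n n * (v n - K * P)"
          by (simp add: algebra_simps)
        moreover have "split_mean d n n * (v n - K * P) \<le> 3/4 * (v n - K * P)"
          using split_mean_power(2)[OF d n e] x by (intro mult_right_mono) auto
        moreover have "v n \<le> 21/20 * (\<Sum>k\<le>n. split_mean d n k * v k) + C * P"
          using rec[of n] n by (simp add: P_def)
        moreover have "C * P \<le> K / 8 * P" using K by (intro mult_right_mono) (auto simp: P_def)
        ultimately show False using x by (simp add: algebra_simps)
      qed
    qed (use v in simp)
  qed
  then show ?thesis using K by blast
qed

section \<open>Interpolation between powers\<close>

lemma power_minus_one_le: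
  fixes x :: real
  assumes "0 \<le> x" "x \<le> 1"
  shows "(1 + x) ^ p - 1 \<le> 2 ^ p * x"
proof (induction p)
  case (Suc p)
  have "(1 + x) ^ Suc p - 1 = ((1 + x) ^ p - 1) + x * (1 + x) ^ p" by (simp add: algebra_simps)
  also have "\<dots> \<le> 2 ^ p * x + x * 2 ^ p"
    using Suc assms by (intro add_mono mult_left_mono power_mono) auto
  finally show ?case by (simp add: mult_ac)
qed (use assms in simp)

text \<open>Consecutive powers m^p and (m + 1)^p have ratio tending to 1, and the logarithmic costs
  of the steps between them add up to O(ln m / m) relative to m^p. The one-sided step is used from
  m^p up to \<open>n\<close> for the lower bound, and from \<open>n\<close> up to (m + 1)^p for the
  upper one.\<close>

lemma convergence_from_powers:
  fixes a :: "nat \<Rightarrow> real"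
  assumes a0: "\<And>n. a n \<ge> 0" and step: "\<And>n. a n \<le> a (Suc n) + ln (real (Suc n))"
    and p: "p \<ge> 1" and lim: "(\<lambda>m. a (m ^ p) / real (m ^ p)) \<longlonglongrightarrow> c"
  shows "(\<lambda>n. a n / real n) \<longlonglongrightarrow> c"
proof -
  have steps: "a n \<le> a N + real (N - n) * ln (real N)" if "n \<le> N" for n N
    using that
  proof (induction N rule: dec_induct)
    case (step N)
    have "real (N - n) * ln (real N) \<le> real (N - n) * ln (real (Suc N))"
      by (cases "N = 0") (auto intro!: mult_left_mono)
    then show ?case using step assms(2)[of N] by (simp add: Suc_diff_le algebra_simps)
  qed simp
  define m where "m = (\<lambda>n. nat \<lfloor>root p (real n)\<rfloor>)"
  have m: "m n ^ p \<le> n" "n < Suc (m n) ^ p" for n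
  proof -
    have r: "root p (real n) \<ge> 0" by (rule real_root_ge_zero) simp
    have rp: "root p (real n) ^ p = real n" using p by (intro real_root_pow_pos2) auto
    have "real (m n) \<le> root p (real n)" using r unfolding m_def by linarith
    then have "real (m n) ^ p \<le> real n" using rp by (metis of_nat_0_le_iff power_mono)
    then show "m n ^ p \<le> n" by (simp flip: of_nat_power)
    have "root p (real n) < real (Suc (m n))" using r unfolding m_def by linarith
    then have "real n < real (Suc (m n)) ^ p" using rp r p by (metis power_strict_mono le_eq_less_or_eq less_le_trans zero_less_one not_gr_zero less_irrefl)
    then show "n < Suc (m n) ^ p" by (metis of_nat_less_iff of_nat_power)
  qed
  have m_top: "filterlim m at_top sequentially"
  proof -
    have "filterlim (\<lambda>n. root p (real n)) at_top sequentially"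
    proof (rule filterlim_compose[OF _ filterlim_real_sequentially], rule filterlim_at_top[THEN iffD2], intro allI)
      fix Z :: real
      have "Z \<le> root p x" if "x \<ge> max 0 Z ^ p" for x
      proof -
        have "Z \<le> root p (max 0 Z ^ p)" using p by (simp add: real_root_power_cancel)
        also have "\<dots> \<le> root p x" using p that by (intro real_root_le_mono) auto
        finally show ?thesis .
      qed
      then show "\<forall>\<^sub>F x in at_top. Z \<le> root p x" unfolding eventually_at_top_linorder by blast
    qed
    then show ?thesis unfolding m_def
      by (intro filterlim_compose[OF filterlim_nat_sequentially] filterlim_compose[OF filterlim_floor_sequentially])
  qed
  \<comment> \<open>Below, \<open>q m\<close> is the ratio of two consecutive powers and
    \<open>er m\<close> bounds the cost of all steps between them, relative to
    \<open>m ^ p\<close>.\<close>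
  define b where "b = (\<lambda>m. a (m ^ p) / real (m ^ p))"
  define q where "q = (\<lambda>m::nat. (1 + 1 / real m) ^ p)"
  define er where "er = (\<lambda>m::nat. (q m - 1) * (real p * ln (real (Suc m))))"
  have q1: "q \<longlonglongrightarrow> 1"
  proof -
    have "(\<lambda>m::nat. 1 + 1 / real m) \<longlonglongrightarrow> 1" by real_asymp
    from tendsto_power[OF this, of p] show ?thesis by (simp add: q_def)
  qed
  have er0: "er \<longlonglongrightarrow> 0"
  proof (rule tendsto_sandwich[OF _ _ tendsto_const])
    have "(\<lambda>m::nat. ln (real (Suc m)) / real m) \<longlonglongrightarrow> 0" by real_asymp
    from tendsto_mult_left[OF this, of "2 ^ p * real p"]
    show "(\<lambda>m. 2 ^ p * real p * (ln (real (Suc m)) / real m)) \<longlonglongrightarrow> 0" by simp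
    have "0 \<le> er m \<and> er m \<le> 2 ^ p * real p * (ln (real (Suc m)) / real m)" if "m \<ge> 1" for m
    proof -
      have q: "q m - 1 \<le> 2 ^ p * (1 / real m)" unfolding q_def using that by (intro power_minus_one_le) auto
      have q0: "q m - 1 \<ge> 0" unfolding q_def by simp
      have l0: "real p * ln (real (Suc m)) \<ge> 0" by simp
      have "0 \<le> er m" "er m \<le> 2 ^ p * (1 / real m) * (real p * ln (real (Suc m)))"
        unfolding er_def by (rule mult_nonneg_nonneg[OF q0 l0], rule mult_right_mono[OF q l0])
      then show ?thesis by (simp add: mult_ac)
    qed
    then show "\<forall>\<^sub>F m in sequentially. 0 \<le> er m" "\<forall>\<^sub>F m in sequentially. er m \<le> 2 ^ p * real p * (ln (real (Suc m)) / real m)"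
      unfolding eventually_sequentially by blast+
  qed
  have bounds: "b (m n) / q (m n) - er (m n) \<le> a n / real n \<and> a n / real n \<le> b (Suc (m n)) * q (m n) + er (m n)" if n1: "n \<ge> 1" for n
  proof -
    let ?m = "m n"
    have m1: "?m \<ge> 1" using m(2)[of n] n1 p by (cases "?m = 0") auto
    define A B where "A = real (?m ^ p)" and "B = real (Suc ?m ^ p)"
    have A: "A > 0" "B > 0" "A \<le> real n" "real n \<le> B"
      using m[of n] m1 by (auto simp: A_def B_def simp del: of_nat_power power_Suc intro: less_imp_le)
    have BA: "B = A * q ?m"
    proof -
      have "real (Suc ?m) = real ?m * (1 + 1 / real ?m)" using m1 by (simp add: field_simps)
      then show ?thesis unfolding A_def B_def q_def of_nat_power by (metis power_mult_distrib)
    qed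
    have q: "q ?m \<ge> 1" unfolding q_def by simp
    have lnB: "ln B = real p * ln (real (Suc ?m))" unfolding B_def of_nat_power by (rule ln_realpow)
    have diff: "(B - A) / A = q ?m - 1" using A BA by (simp add: field_simps)
    have lnB0: "ln B \<ge> 0" using lnB by simp
    have up: "a n \<le> a (Suc ?m ^ p) + (B - A) * ln B"
    proof -
      have "a n \<le> a (Suc ?m ^ p) + real (Suc ?m ^ p - n) * ln (real (Suc ?m ^ p))" using m(2)[of n] by (intro steps) simp
      also have "real (Suc ?m ^ p - n) * ln (real (Suc ?m ^ p)) \<le> (B - A) * ln B"
        using A m(2)[of n] lnB0 unfolding B_def[symmetric] by (intro mult_right_mono) (auto simp: of_nat_diff B_def)
      finally show ?thesis by simp
    qed
    have low: "a (?m ^ p) - (B - A) * ln B \<le> a n"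
    proof -
      have "a (?m ^ p) \<le> a n + real (n - ?m ^ p) * ln (real n)" using m(1)[of n] by (intro steps)
      also have "real (n - ?m ^ p) * ln (real n) \<le> (B - A) * ln B"
      proof (rule mult_mono)
        have "real (n - ?m ^ p) = real n - A" using m(1)[of n] by (simp add: A_def of_nat_diff)
        then show "real (n - ?m ^ p) \<le> B - A" using A by linarith
        show "ln (real n) \<le> ln B" using A n1 by simp
        show "0 \<le> B - A" using A by linarith
      qed (use n1 in simp)
      finally show ?thesis by simp
    qed
    have err: "(B - A) * ln B / real n \<le> er ?m"
    proof -
      have "(B - A) * ln B / real n \<le> (B - A) * ln B / A"
        using A lnB0 by (intro divide_left_mono mult_nonneg_nonneg) auto
      also have "\<dots> = (B - A) / A * ln B" by simp
      finally show ?thesis unfolding diff lnB er_def .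
    qed
    have "a n / real n \<le> (a (Suc ?m ^ p) + (B - A) * ln B) / real n" using up by (rule divide_right_mono) simp
    also have "\<dots> = a (Suc ?m ^ p) / real n + (B - A) * ln B / real n" by (rule add_divide_distrib)
    also have "a (Suc ?m ^ p) / real n \<le> a (Suc ?m ^ p) / A" using a0 A by (intro divide_left_mono) auto
    also have "\<dots> = b (Suc ?m) * q ?m" unfolding b_def B_def[symmetric] using BA A q by (simp add: field_simps)
    finally have 1: "a n / real n \<le> b (Suc ?m) * q ?m + er ?m" using err by simp
    have "b ?m / q ?m = a (?m ^ p) / B" unfolding b_def A_def[symmetric] BA by simp
    also have "\<dots> \<le> a (?m ^ p) / real n" using a0 A n1 by (intro divide_left_mono) auto
    finally have "b ?m / q ?m - er ?m \<le> a (?m ^ p) / real n - (B - A) * ln B / real n" using err by simp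
    also have "\<dots> \<le> a n / real n" using low by (simp add: diff_divide_distrib[symmetric] divide_right_mono)
    finally show ?thesis using 1 by simp
  qed
  have bl: "b \<longlonglongrightarrow> c" using lim by (simp add: b_def)
  have l1: "(\<lambda>m. b m / q m - er m) \<longlonglongrightarrow> c" using tendsto_diff[OF tendsto_divide[OF bl q1] er0] by simp
  have l2: "(\<lambda>m. b (Suc m) * q m + er m) \<longlonglongrightarrow> c" using tendsto_add[OF tendsto_mult[OF LIMSEQ_Suc[OF bl] q1] er0] by simp
  show ?thesis
  proof (rule tendsto_sandwich)
    show "(\<lambda>n. b (m n) / q (m n) - er (m n)) \<longlonglongrightarrow> c" by (rule filterlim_compose[OF l1 m_top])
    show "(\<lambda>n. b (Suc (m n)) * q (m n) + er (m n)) \<longlonglongrightarrow> c" by (rule filterlim_compose[OF l2 m_top])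
    show "\<forall>\<^sub>F n in sequentially. b (m n) / q (m n) - er (m n) \<le> a n / real n" "\<forall>\<^sub>F n in sequentially. a n / real n \<le> b (Suc (m n)) * q (m n) + er (m n)"
      unfolding eventually_sequentially using bounds by blast+
  qed
qed

section \<open>The random tree\<close>

text \<open>By monotone convergence the sum of the \<open>f k\<close> has finite mean; it is
  therefore almost surely finite, and its terms tend to zero.\<close>

lemma AE_tendsto_0_if_summable_means:
  fixes f :: "nat \<Rightarrow> 'a \<Rightarrow> real"
  assumes i: "\<And>k. integrable M (f k)" and nn: "\<And>k. AE \<omega> in M. f k \<omega> \<ge> 0" and s: "summable (\<lambda>k. \<integral>\<omega>. f k \<omega> \<partial>M)"
  shows "AE \<omega> in M. (\<lambda>k. f k \<omega>) \<longlonglongrightarrow> 0"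
proof -
  have [measurable]: "f k \<in> borel_measurable M" for k using i by (rule borel_measurable_integrable)
  have "(\<integral>\<^sup>+\<omega>. (\<Sum>k. ennreal (f k \<omega>)) \<partial>M) = (\<Sum>k. \<integral>\<^sup>+\<omega>. ennreal (f k \<omega>) \<partial>M)"
    by (rule nn_integral_suminf) measurable
  also have "\<dots> = (\<Sum>k. ennreal (\<integral>\<omega>. f k \<omega> \<partial>M))"
    using nn_integral_eq_integral[OF i nn] by simp
  also have "\<dots> = ennreal (\<Sum>k. \<integral>\<omega>. f k \<omega> \<partial>M)"
    using s by (intro suminf_ennreal2 integral_nonneg_AE nn)
  finally have "(\<integral>\<^sup>+\<omega>. (\<Sum>k. ennreal (f k \<omega>)) \<partial>M) \<noteq> \<infinity>" by simp
  then have "AE \<omega> in M. (\<Sum>k. ennreal (f k \<omega>)) \<noteq> \<infinity>" by (intro nn_integral_PInf_AE) measurable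
  moreover have "AE \<omega> in M. \<forall>k. f k \<omega> \<ge> 0" using nn by (subst AE_all_countable) blast
  ultimately show ?thesis
  proof eventually_elim
    case (elim \<omega>)
    then have "summable (\<lambda>k. f k \<omega>)" by (intro summable_suminf_not_top) auto
    then show ?case by (rule summable_LIMSEQ_zero)
  qed
qed

section \<open>Measurable functions of the tree\<close>

abbreviation node_space :: "nat \<Rightarrow> ((nat \<Rightarrow> nat) \<times> (nat \<Rightarrow> real)) measure" where
  "node_space d \<equiv> count_space UNIV \<Otimes>\<^sub>M PiM {..<d - 1} (\<lambda>_. borel)"

abbreviation tree_space :: "nat \<Rightarrow> tree measure" where
  "tree_space d \<equiv> PiM (lists {..<d}) (\<lambda>_. node_space d)"

text \<open>The random tree is a function on all strings, whereas the product space consists of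
  extensional functions on the strings over \<open>d\<close> letters. The second clause allows
  passing between the two by restriction.\<close>

definition tree_fun :: "nat \<Rightarrow> (tree \<Rightarrow> real) \<Rightarrow> bool" where
  "tree_fun d \<Phi> \<longleftrightarrow> \<Phi> \<in> borel_measurable (tree_space d) \<and> (\<forall>t t'. (\<forall>s\<in>lists {..<d}. t s = t' s) \<longrightarrow> \<Phi> t = \<Phi> t')"

lemma tree_fun_cong:
  assumes "tree_fun d \<Phi>" "\<And>s. s \<in> lists {..<d} \<Longrightarrow> t s = t' s"
  shows "\<Phi> t = \<Phi> t'"
proof -
  have "\<forall>t t'. (\<forall>s\<in>lists {..<d}. t s = t' s) \<longrightarrow> \<Phi> t = \<Phi> t'"
    using assms(1) unfolding tree_fun_def by (rule conjunct2)
  from this[rule_format, OF assms(2)] show ?thesis .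
qed

lemma tree_fun_measurable:
  assumes "tree_fun d \<Phi>" "\<And>s. s \<in> lists {..<d} \<Longrightarrow> (\<lambda>\<omega>. Y \<omega> s) \<in> N \<rightarrow>\<^sub>M node_space d"
  shows "(\<lambda>\<omega>. \<Phi> (Y \<omega>)) \<in> borel_measurable N"
proof -
  have "(\<lambda>\<omega>. \<lambda>s\<in>lists {..<d}. Y \<omega> s) \<in> N \<rightarrow>\<^sub>M tree_space d" by (rule measurable_restrict) (rule assms(2))
  then have "(\<lambda>\<omega>. \<Phi> (\<lambda>s\<in>lists {..<d}. Y \<omega> s)) \<in> borel_measurable N"
    by (rule measurable_compose) (use assms(1) in \<open>simp add: tree_fun_def\<close>)
  moreover have "\<Phi> (\<lambda>s\<in>lists {..<d}. Y \<omega> s) = \<Phi> (Y \<omega>)" for \<omega>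
    by (rule tree_fun_cong[OF assms(1)]) simp
  ultimately show ?thesis by simp
qed

lemma component_tree_space: "s \<in> lists {..<d} \<Longrightarrow> (\<lambda>t. t s) \<in> tree_space d \<rightarrow>\<^sub>M node_space d"
  by (rule measurable_component_singleton)

lemma tree_fun_subtree:
  assumes "tree_fun d \<Phi>" "i < d"
  shows "tree_fun d (\<lambda>t. \<Phi> (subtree t i))"
  unfolding tree_fun_def
proof (intro conjI allI impI)
  show "(\<lambda>t. \<Phi> (subtree t i)) \<in> borel_measurable (tree_space d)"
    using assms(2) unfolding subtree_def by (intro tree_fun_measurable[OF assms(1)] component_tree_space) simp
  fix t t' :: tree assume "\<forall>s\<in>lists {..<d}. t s = t' s"
  then show "\<Phi> (subtree t i) = \<Phi> (subtree t' i)"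
    using assms(2) by (intro tree_fun_cong[OF assms(1)]) (simp add: subtree_def)
qed

text \<open>Covers both clauses of \<open>tree_fun\<close> for a combination of the
  \<open>\<Phi> j\<close>: measurability may be shown assuming theirs, and equality of all
  \<open>\<Phi> j\<close> must force equality of the combination.\<close>

lemma tree_fun_lift:
  assumes "\<And>j. j \<in> J \<Longrightarrow> tree_fun d (\<Phi> j)"
    and "(\<And>j. j \<in> J \<Longrightarrow> \<Phi> j \<in> borel_measurable (tree_space d)) \<Longrightarrow> \<Psi> \<in> borel_measurable (tree_space d)"
    and "\<And>t t'. (\<And>j. j \<in> J \<Longrightarrow> \<Phi> j t = \<Phi> j t') \<Longrightarrow> \<Psi> t = \<Psi> t'"
  shows "tree_fun d \<Psi>"
  using assms unfolding tree_fun_def by blast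

lemma tree_fun_times:
  assumes "tree_fun d \<Phi>" "tree_fun d \<Psi>"
  shows "tree_fun d (\<lambda>t. \<Phi> t * \<Psi> t)"
  unfolding tree_fun_def
proof (intro conjI allI impI)
  show "(\<lambda>t. \<Phi> t * \<Psi> t) \<in> borel_measurable (tree_space d)"
    using assms unfolding tree_fun_def by (intro borel_measurable_times) blast+
  fix t t' :: tree assume "\<forall>s\<in>lists {..<d}. t s = t' s"
  then have "\<Phi> t = \<Phi> t'" "\<Psi> t = \<Psi> t'" by (auto intro: tree_fun_cong[OF assms(1)] tree_fun_cong[OF assms(2)])
  then show "\<Phi> t * \<Psi> t = \<Phi> t' * \<Psi> t'" by simp
qed

lemma measurable_node_cuts: "j < d - 1 \<Longrightarrow> (\<lambda>x. snd x j) \<in> borel_measurable (node_space d)"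
  by (rule measurable_compose[OF measurable_snd measurable_component_singleton]) simp

lemma measurable_node_gap: "i < d \<Longrightarrow> (\<lambda>x. gap d (snd x) i) \<in> borel_measurable (node_space d)"
  by (rule measurable_gap) (use measurable_node_cuts in auto)

lemma tree_fun_gap: "s \<in> lists {..<d} \<Longrightarrow> i < d \<Longrightarrow> tree_fun d (\<lambda>t. gap d (cuts t s) i)"
  unfolding tree_fun_def using measurable_compose[OF component_tree_space measurable_node_gap] by auto

lemma tree_fun_side: "s \<in> lists {..<d} \<Longrightarrow> tree_fun d (\<lambda>t. side d (cuts t) s)"
proof (induction rule: lists.induct)
  case Nil
  then show ?case by (simp add: tree_fun_def)
next
  case (Cons i s)
  have g: "tree_fun d (\<lambda>t. gap d (cuts t s) i)" using tree_fun_gap Cons by simp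
  show ?case using tree_fun_times[OF Cons.IH g] by simp
qed

text \<open>Its mean decays geometrically in \<open>k\<close>, so almost surely the mesh of the squares tends to \<open>0\<close>.\<close>

definition collision :: "nat \<Rightarrow> nat \<Rightarrow> tree \<Rightarrow> real" where
  "collision d k t = (\<Sum>s\<in>words d k. (side d (cuts t) s)\<^sup>2)"

lemma tree_fun_collision: "tree_fun d (collision d k)"
  unfolding collision_def
  by (rule tree_fun_lift[where J = "words d k" and \<Phi> = "\<lambda>s t. side d (cuts t) s"])
     (auto intro!: tree_fun_side borel_measurable_sum borel_measurable_power sum.cong simp: words_def)

lemma collision_Suc: "collision d (Suc k) t = (\<Sum>i<d. (gap d (cuts t []) i)\<^sup>2 * collision d k (subtree t i))"
  unfolding collision_def sum_words_Suc' by (simp add: side_subtree power_mult_distrib sum_distrib_left)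

lemma tree_fun_Q: "tree_fun d (\<lambda>t. Q d k t n R)"
proof (induction k arbitrary: n R)
  case 0
  then show ?case by (simp add: tree_fun_def)
next
  case (Suc k)
  show ?case unfolding tree_fun_def
  proof (intro conjI allI impI)
    fix t t' :: tree assume eq: "\<forall>s\<in>lists {..<d}. t s = t' s"
    then have r: "t [] = t' []" by simp
    have s: "Q d k (subtree t i) m S = Q d k (subtree t' i) m S" if "i < d" for i m S
      by (rule tree_fun_cong[OF tree_fun_subtree[OF Suc.IH that]]) (use eq in blast)
    show "Q d (Suc k) t n R = Q d (Suc k) t' n R" unfolding Q.simps r
      by (intro sum.cong refl arg_cong2[of _ _ _ _ "(*)"] if_cong prod.cong) (simp add: s)
  next
    let ?T = "tree_space d"
    have g: "(\<lambda>t. gap d (cuts t []) i) \<in> borel_measurable ?T" if "i < d" for i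
      using tree_fun_gap[of "[]" d i] that by (simp add: tree_fun_def)
    have q: "(\<lambda>t. Q d k (subtree t i) m S) \<in> borel_measurable ?T" if "i < d" for i m S
      using tree_fun_subtree[OF Suc.IH that] by (simp add: tree_fun_def)
    have p: "{t \<in> space ?T. inflate d (perms t []) N Rs = R} \<in> sets ?T" for N Rs
    proof -
      have "(\<lambda>t. inflate d (perms t []) N Rs) \<in> ?T \<rightarrow>\<^sub>M count_space UNIV"
        by (rule measurable_compose[OF measurable_compose[OF component_tree_space measurable_fst]]) simp_all
      then show ?thesis by measurable
    qed
    show "(\<lambda>t. Q d (Suc k) t n R) \<in> borel_measurable ?T"
      unfolding Q.simps
      by (intro borel_measurable_sum borel_measurable_times borel_measurable_prod measurable_If borel_measurable_const p q g) auto
  qed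
qed

lemma tree_fun_qlim: "tree_fun d (\<lambda>t. qlim d t n R)"
  unfolding qlim_def
  by (rule tree_fun_lift[where J = UNIV and \<Phi> = "\<lambda>k t. Q d k t n R"])
     (auto intro!: tree_fun_Q borel_measurable_max borel_measurable_min borel_measurable_lim_metric)

lemma tree_fun_pattern_entropy: "tree_fun d (\<lambda>t. pattern_entropy d t n)"
  unfolding pattern_entropy_def ent_def
  by (rule tree_fun_lift[where J = "patterns n" and \<Phi> = "\<lambda>R t. qlim d t n R"])
     (auto intro!: tree_fun_qlim borel_measurable_sum borel_measurable_times borel_measurable_uminus borel_measurable_ln sum.cong)

section \<open>Laws and independence of the root and its subtrees\<close>

locale random_tree = random_squares M d F \<alpha> U
  for M :: "'w measure" and d :: nat and F :: "(nat \<Rightarrow> nat) pmf"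
    and \<alpha> :: "nat list \<Rightarrow> 'w \<Rightarrow> nat \<Rightarrow> nat" and U :: "nat list \<Rightarrow> nat \<Rightarrow> 'w \<Rightarrow> real" +
  assumes d2: "d \<ge> 2" and support: "set_pmf F \<subseteq> Sym d"
begin

definition T :: "'w \<Rightarrow> tree" where
  "T \<omega> s = (\<alpha> s \<omega>, \<lambda>j\<in>{..<d - 1}. U s j \<omega>)"

abbreviation node_law :: "((nat \<Rightarrow> nat) \<times> (nat \<Rightarrow> real)) measure" where
  "node_law \<equiv> measure_pmf F \<Otimes>\<^sub>M cut_points (d - 1)"

lemma T_measurable: "s \<in> lists {..<d} \<Longrightarrow> (\<lambda>\<omega>. T \<omega> s) \<in> M \<rightarrow>\<^sub>M node_space d"
  using indep unfolding indep_vars_def T_def by simp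

lemma distr_T: "s \<in> lists {..<d} \<Longrightarrow> distr M (node_space d) (\<lambda>\<omega>. T \<omega> s) = node_law"
  using law unfolding T_def by simp

lemma indep_T: "indep_vars (\<lambda>_. node_space d) (\<lambda>s \<omega>. T \<omega> s) (lists {..<d})"
  using indep unfolding T_def .

lemma prob_space_node_law: "prob_space node_law"
  by (rule prob_space_pair) (auto intro: prob_space_cut_points measure_pmf.prob_space_axioms)

lemma sets_node_law: "sets node_law = sets (node_space d)"
  by (intro sets_pair_measure_cong sets_PiM_cong) auto

lemma sets_tree_law: "sets (PiM (lists {..<d}) (\<lambda>_. node_law)) = sets (tree_space d)"
  by (intro sets_PiM_cong refl sets_node_law)

lemma distr_tree: "distr M (tree_space d) (\<lambda>\<omega>. \<lambda>s\<in>lists {..<d}. T \<omega> s) = PiM (lists {..<d}) (\<lambda>_. node_law)"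
proof -
  have "[] \<in> lists {..<d}" by simp
  then have "lists {..<d} \<noteq> {}" by blast
  then have "distr M (tree_space d) (\<lambda>\<omega>. \<lambda>s\<in>lists {..<d}. T \<omega> s) = PiM (lists {..<d}) (\<lambda>s. distr M (node_space d) (\<lambda>\<omega>. T \<omega> s))"
    using indep_vars_iff_distr_eq_PiM'[where I = "lists {..<d}" and M' = "\<lambda>_. node_space d" and X = "\<lambda>s \<omega>. T \<omega> s"] indep_T T_measurable by simp
  also have "\<dots> = PiM (lists {..<d}) (\<lambda>_. node_law)" by (rule PiM_cong[OF refl distr_T])
  finally show ?thesis .
qed

text \<open>Appending the root letter \<open>i\<close> is an injection of the strings, and an i.i.d.
  family keeps its law under injective reindexing.\<close>

lemma distr_subtree:
  assumes i: "i < d"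
  shows "distr M (tree_space d) (\<lambda>\<omega>. \<lambda>s\<in>lists {..<d}. subtree (T \<omega>) i s) = PiM (lists {..<d}) (\<lambda>_. node_law)"
proof -
  let ?L = "lists {..<d}"
  have inL: "s @ [i] \<in> ?L" if "s \<in> ?L" for s using that i by simp
  have m1: "(\<lambda>\<omega>. \<lambda>s\<in>?L. T \<omega> s) \<in> M \<rightarrow>\<^sub>M tree_space d" by (rule measurable_restrict) (rule T_measurable)
  have m2: "(\<lambda>t. \<lambda>s\<in>?L. t (s @ [i])) \<in> tree_space d \<rightarrow>\<^sub>M tree_space d"
    by (rule measurable_restrict) (rule component_tree_space, rule inL)
  have "distr M (tree_space d) (\<lambda>\<omega>. \<lambda>s\<in>?L. subtree (T \<omega>) i s) = distr M (tree_space d) ((\<lambda>t. \<lambda>s\<in>?L. t (s @ [i])) \<circ> (\<lambda>\<omega>. \<lambda>s\<in>?L. T \<omega> s))"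
    using inL by (intro arg_cong[of _ _ "distr M (tree_space d)"] ext) (auto simp: subtree_def restrict_def)
  also have "\<dots> = distr (PiM ?L (\<lambda>_. node_law)) (tree_space d) (\<lambda>t. \<lambda>s\<in>?L. t (s @ [i]))"
    unfolding distr_tree[symmetric] by (rule distr_distr[OF m2 m1, symmetric])
  also have "\<dots> = distr (PiM ?L (\<lambda>_. node_law)) (PiM ?L (\<lambda>_. node_law)) (\<lambda>t. \<lambda>s\<in>?L. t (s @ [i]))"
    by (rule distr_cong[OF refl sets_tree_law[symmetric] refl])
  also have "\<dots> = PiM ?L (\<lambda>_. node_law)"
    using inL by (intro distr_PiM_reindex[where f = "\<lambda>s. s @ [i]"] prob_space_node_law) (auto simp: inj_on_def)
  finally show ?thesis .
qed

lemma subtree_measurable: "i < d \<Longrightarrow> s \<in> lists {..<d} \<Longrightarrow> (\<lambda>\<omega>. subtree (T \<omega>) i s) \<in> M \<rightarrow>\<^sub>M node_space d"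
  unfolding subtree_def by (rule T_measurable) simp

lemma tree_fun_restrict: "tree_fun d \<Phi> \<Longrightarrow> \<Phi> (\<lambda>s\<in>lists {..<d}. t s) = \<Phi> t"
  by (erule tree_fun_cong, rule restrict_apply')

lemma subtree_same_law:
  assumes \<Phi>: "tree_fun d \<Phi>" and i: "i < d"
  shows "integrable M (\<lambda>\<omega>. \<Phi> (subtree (T \<omega>) i)) \<longleftrightarrow> integrable M (\<lambda>\<omega>. \<Phi> (T \<omega>))"
    and "(\<integral>\<omega>. \<Phi> (subtree (T \<omega>) i) \<partial>M) = (\<integral>\<omega>. \<Phi> (T \<omega>) \<partial>M)"
proof -
  have m: "\<Phi> \<in> borel_measurable (tree_space d)" using \<Phi> by (simp add: tree_fun_def)
  have m1: "(\<lambda>\<omega>. \<lambda>s\<in>lists {..<d}. T \<omega> s) \<in> M \<rightarrow>\<^sub>M tree_space d" by (rule measurable_restrict) (rule T_measurable)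
  have m2: "(\<lambda>\<omega>. \<lambda>s\<in>lists {..<d}. subtree (T \<omega>) i s) \<in> M \<rightarrow>\<^sub>M tree_space d" by (rule measurable_restrict) (rule subtree_measurable[OF i])
  show "integrable M (\<lambda>\<omega>. \<Phi> (subtree (T \<omega>) i)) \<longleftrightarrow> integrable M (\<lambda>\<omega>. \<Phi> (T \<omega>))"
    using integrable_distr_eq[OF m1 m] integrable_distr_eq[OF m2 m] unfolding distr_tree distr_subtree[OF i] tree_fun_restrict[OF \<Phi>] by simp
  show "(\<integral>\<omega>. \<Phi> (subtree (T \<omega>) i) \<partial>M) = (\<integral>\<omega>. \<Phi> (T \<omega>) \<partial>M)"
    using integral_distr[OF m1 m] integral_distr[OF m2 m] unfolding distr_tree distr_subtree[OF i] tree_fun_restrict[OF \<Phi>] by simp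
qed

text \<open>The root and the subtrees involve disjoint sets of strings.\<close>

lemma indep_root_subtrees:
  assumes w: "w \<in> borel_measurable (node_space d)" and \<Phi>: "\<And>i. i < d \<Longrightarrow> tree_fun d (\<Phi> i)"
  shows "indep_vars (\<lambda>_. borel) (\<lambda>m \<omega>. case m of 0 \<Rightarrow> w (T \<omega> []) | Suc i \<Rightarrow> (\<Phi> i (subtree (T \<omega>) i) :: real)) {..d}"
proof -
  define K where "K = (\<lambda>m. case m of 0 \<Rightarrow> {[]} | Suc i \<Rightarrow> (\<lambda>s. s @ [i]) ` lists {..<d})"
  let ?Z = "\<lambda>m \<omega>. restrict (\<lambda>s. T \<omega> s) (K m)"
  let ?Y = "\<lambda>m r. case m of 0 \<Rightarrow> w (r []) | Suc i \<Rightarrow> \<Phi> i (\<lambda>s. r (s @ [i]))"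
  have "indep_vars (\<lambda>m. PiM (K m) (\<lambda>_. node_space d)) ?Z {..d}"
  proof (rule indep_vars_restrict[OF indep_T])
    show "K j \<subseteq> lists {..<d}" if "j \<in> {..d}" for j using that by (auto simp: K_def split: nat.splits)
    show "disjoint_family_on K {..d}" by (auto simp: disjoint_family_on_def K_def split: nat.splits)
  qed
  then have "indep_vars (\<lambda>_. borel) (\<lambda>m \<omega>. ?Y m (?Z m \<omega>)) {..d}"
  proof (rule indep_vars_compose2)
    fix m assume m: "m \<in> {..d}"
    show "?Y m \<in> PiM (K m) (\<lambda>_. node_space d) \<rightarrow>\<^sub>M borel"
    proof (cases m)
      case 0
      have "(\<lambda>r. r []) \<in> PiM (K m) (\<lambda>_. node_space d) \<rightarrow>\<^sub>M node_space d"
        by (rule measurable_component_singleton) (simp add: 0 K_def)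
      then show ?thesis unfolding 0 nat.case using measurable_compose[OF _ w] by (simp add: 0)
    next
      case (Suc i)
      have "(\<lambda>r. \<Phi> i (\<lambda>s. r (s @ [i]))) \<in> borel_measurable (PiM (K m) (\<lambda>_. node_space d))"
        by (rule tree_fun_measurable[OF \<Phi>], use m Suc in simp, rule measurable_component_singleton) (simp add: Suc K_def)
      then show ?thesis by (simp add: Suc)
    qed
  qed
  moreover have "?Y m (?Z m \<omega>) = (case m of 0 \<Rightarrow> w (T \<omega> []) | Suc i \<Rightarrow> \<Phi> i (subtree (T \<omega>) i))" if m: "m \<in> {..d}" for m \<omega>
  proof (cases m)
    case (Suc i)
    then have "i < d" using m by simp
    have "?Z m \<omega> (s @ [i]) = subtree (T \<omega>) i s" if "s \<in> lists {..<d}" for s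
      using that by (simp add: Suc K_def subtree_def)
    from tree_fun_cong[OF \<Phi>[OF \<open>i < d\<close>] this] show ?thesis by (simp add: Suc)
  qed (simp add: K_def)
  ultimately show ?thesis
    by (subst indep_vars_cong[OF refl _ refl, where Y = "\<lambda>m \<omega>. ?Y m (?Z m \<omega>)"]) (auto intro!: ext)
qed

lemma indep_root_subtree:
  assumes w: "w \<in> borel_measurable (node_space d)" "integrable M (\<lambda>\<omega>. w (T \<omega> []))"
    and \<Phi>: "tree_fun d \<Phi>" "integrable M (\<lambda>\<omega>. \<Phi> (T \<omega>))" and i: "i < d"
  shows "integrable M (\<lambda>\<omega>. w (T \<omega> []) * \<Phi> (subtree (T \<omega>) i))"
    and "(\<integral>\<omega>. w (T \<omega> []) * \<Phi> (subtree (T \<omega>) i) \<partial>M) = (\<integral>\<omega>. w (T \<omega> []) \<partial>M) * (\<integral>\<omega>. \<Phi> (T \<omega>) \<partial>M)"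
proof -
  let ?X = "\<lambda>m \<omega>. case m of 0 \<Rightarrow> w (T \<omega> []) | Suc i \<Rightarrow> \<Phi> (subtree (T \<omega>) i)"
  have ind: "indep_vars (\<lambda>_. borel) ?X {0, Suc i}"
    using i by (intro indep_vars_subset[OF indep_root_subtrees[OF w(1), of "\<lambda>_. \<Phi>"]] \<Phi>) auto
  have int: "integrable M (?X m)" if "m \<in> {0, Suc i}" for m
    using that w(2) subtree_same_law(1)[OF \<Phi>(1) i] \<Phi>(2) by auto
  show "integrable M (\<lambda>\<omega>. w (T \<omega> []) * \<Phi> (subtree (T \<omega>) i))"
    using indep_vars_integrable[OF _ ind int] by simp
  show "(\<integral>\<omega>. w (T \<omega> []) * \<Phi> (subtree (T \<omega>) i) \<partial>M) = (\<integral>\<omega>. w (T \<omega> []) \<partial>M) * (\<integral>\<omega>. \<Phi> (T \<omega>) \<partial>M)"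
    using indep_vars_lebesgue_integral[OF _ ind int] subtree_same_law(2)[OF \<Phi>(1) i] by simp
qed

text \<open>Serves the cross terms of the second moment, which become products of means.\<close>

lemma indep_root_two_subtrees:
  assumes w: "w \<in> borel_measurable (node_space d)" "integrable M (\<lambda>\<omega>. w (T \<omega> []))"
    and \<Phi>: "tree_fun d \<Phi>" "integrable M (\<lambda>\<omega>. \<Phi> (T \<omega>))" and \<Psi>: "tree_fun d \<Psi>" "integrable M (\<lambda>\<omega>. \<Psi> (T \<omega>))"
    and i: "i < d" "j < d" "i \<noteq> j"
  shows "integrable M (\<lambda>\<omega>. w (T \<omega> []) * (\<Phi> (subtree (T \<omega>) i) * \<Psi> (subtree (T \<omega>) j)))"
    and "(\<integral>\<omega>. w (T \<omega> []) * (\<Phi> (subtree (T \<omega>) i) * \<Psi> (subtree (T \<omega>) j)) \<partial>M)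
       = (\<integral>\<omega>. w (T \<omega> []) \<partial>M) * ((\<integral>\<omega>. \<Phi> (T \<omega>) \<partial>M) * (\<integral>\<omega>. \<Psi> (T \<omega>) \<partial>M))"
proof -
  let ?\<Phi> = "\<lambda>k. if k = i then \<Phi> else \<Psi>"
  let ?X = "\<lambda>m \<omega>. case m of 0 \<Rightarrow> w (T \<omega> []) | Suc k \<Rightarrow> ?\<Phi> k (subtree (T \<omega>) k)"
  have ind: "indep_vars (\<lambda>_. borel) ?X {0, Suc i, Suc j}"
    using i \<Phi> \<Psi> by (intro indep_vars_subset[OF indep_root_subtrees[OF w(1), of ?\<Phi>]]) auto
  have int: "integrable M (?X m)" if "m \<in> {0, Suc i, Suc j}" for m
    using that w(2) subtree_same_law(1)[OF \<Phi>(1) i(1)] subtree_same_law(1)[OF \<Psi>(1) i(2)] \<Phi>(2) \<Psi>(2) i(3) by auto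
  show "integrable M (\<lambda>\<omega>. w (T \<omega> []) * (\<Phi> (subtree (T \<omega>) i) * \<Psi> (subtree (T \<omega>) j)))"
    using indep_vars_integrable[OF _ ind int] i(3) by simp
  show "(\<integral>\<omega>. w (T \<omega> []) * (\<Phi> (subtree (T \<omega>) i) * \<Psi> (subtree (T \<omega>) j)) \<partial>M)
       = (\<integral>\<omega>. w (T \<omega> []) \<partial>M) * ((\<integral>\<omega>. \<Phi> (T \<omega>) \<partial>M) * (\<integral>\<omega>. \<Psi> (T \<omega>) \<partial>M))"
    using indep_vars_lebesgue_integral[OF _ ind int] subtree_same_law(2)[OF \<Phi>(1) i(1)] subtree_same_law(2)[OF \<Psi>(1) i(2)] i(3) by simp
qed

lemma distr_node_law_snd: "distr node_law (cut_points (d - 1)) snd = cut_points (d - 1)"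
proof (rule measure_eqI)
  fix A assume "A \<in> sets (distr node_law (cut_points (d - 1)) snd)"
  then have A: "A \<in> sets (cut_points (d - 1))" by simp
  interpret C: prob_space "cut_points (d - 1)" by (rule prob_space_cut_points)
  have "snd -` A \<inter> space node_law = UNIV \<times> A" using sets.sets_into_space[OF A] by (auto simp: space_pair_measure)
  moreover have "emeasure node_law (UNIV \<times> A) = emeasure (measure_pmf F) UNIV * emeasure (cut_points (d - 1)) A"
    using A by (intro C.emeasure_pair_measure_Times) auto
  moreover have "emeasure (measure_pmf F) UNIV = 1" using measure_pmf.emeasure_space_1[of F] by simp
  ultimately show "emeasure (distr node_law (cut_points (d - 1)) snd) A = emeasure (cut_points (d - 1)) A"
    using A by (simp add: emeasure_distr)
qed simp

lemma distr_node_law_fst: "distr node_law (measure_pmf F) fst = measure_pmf F"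
proof -
  interpret C: prob_space "cut_points (d - 1)" by (rule prob_space_cut_points)
  show ?thesis by (rule C.distr_pair_fst)
qed

lemma AE_node:
  assumes s: "s \<in> lists {..<d}" and P: "AE x in node_law. P x"
  shows "AE \<omega> in M. P (T \<omega> s)"
proof -
  have "AE x in distr M (node_space d) (\<lambda>\<omega>. T \<omega> s). P x" unfolding distr_T[OF s] by (rule P)
  then show ?thesis by (rule AE_distrD[OF T_measurable[OF s]])
qed

lemma AE_node_cuts: "s \<in> lists {..<d} \<Longrightarrow> AE v in cut_points (d - 1). P v \<Longrightarrow> AE \<omega> in M. P (cuts (T \<omega>) s)"
proof -
  assume s: "s \<in> lists {..<d}" and P: "AE v in cut_points (d - 1). P v"
  have "AE x in distr node_law (cut_points (d - 1)) snd. P x" unfolding distr_node_law_snd by (rule P)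
  then have "AE x in node_law. P (snd x)" by (rule AE_distrD[OF measurable_snd])
  then show "AE \<omega> in M. P (cuts (T \<omega>) s)" by (rule AE_node[OF s])
qed

lemma AE_node_perm: "s \<in> lists {..<d} \<Longrightarrow> AE p in measure_pmf F. P p \<Longrightarrow> AE \<omega> in M. P (perms (T \<omega>) s)"
proof -
  assume s: "s \<in> lists {..<d}" and P: "AE p in measure_pmf F. P p"
  have "AE x in distr node_law (measure_pmf F) fst. P x" unfolding distr_node_law_fst by (rule P)
  then have "AE x in node_law. P (fst x)" by (rule AE_distrD[OF measurable_fst])
  then show "AE \<omega> in M. P (perms (T \<omega>) s)" by (rule AE_node[OF s])
qed

lemma integral_root_cuts:
  fixes f :: "(nat \<Rightarrow> real) \<Rightarrow> real"
  assumes f: "f \<in> borel_measurable (PiM {..<d - 1} (\<lambda>_. borel))"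
  shows "(\<integral>\<omega>. f (cuts (T \<omega>) []) \<partial>M) = (\<integral>v. f v \<partial>cut_points (d - 1))"
proof -
  have fc: "f \<in> borel_measurable (cut_points (d - 1))"
    using f by (subst measurable_cong_sets[OF sets_PiM_cong[OF refl] refl]) auto
  have "(\<integral>\<omega>. f (cuts (T \<omega>) []) \<partial>M) = (\<integral>x. f (snd x) \<partial>distr M (node_space d) (\<lambda>\<omega>. T \<omega> []))"
    using T_measurable[of "[]"] measurable_compose[OF measurable_snd f] by (subst integral_distr) auto
  also have "\<dots> = (\<integral>x. f (snd x) \<partial>node_law)" by (simp only: distr_T lists.Nil)
  also have "\<dots> = (\<integral>v. f v \<partial>distr node_law (cut_points (d - 1)) snd)"
    by (rule integral_distr[OF measurable_snd fc, symmetric])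
  finally show ?thesis unfolding distr_node_law_snd .
qed

lemma AE_nodes: "AE \<omega> in M. \<forall>s\<in>lists {..<d}. perms (T \<omega>) s \<in> set_pmf F \<and> generic_cuts d (cuts (T \<omega>) s)"
proof (subst AE_ball_countable, simp, intro ballI)
  fix s assume s: "s \<in> lists {..<d}"
  have "AE \<omega> in M. perms (T \<omega>) s \<in> set_pmf F" by (rule AE_node_perm[OF s]) (simp add: AE_measure_pmf)
  moreover have "AE \<omega> in M. generic_cuts d (cuts (T \<omega>) s)" by (rule AE_node_cuts[OF s AE_generic_cuts])
  ultimately show "AE \<omega> in M. perms (T \<omega>) s \<in> set_pmf F \<and> generic_cuts d (cuts (T \<omega>) s)" by eventually_elim simp
qed

lemma root_bounded:
  fixes B :: real
  assumes m: "w \<in> borel_measurable (node_space d)" and b: "\<And>x. generic_cuts d (snd x) \<Longrightarrow> \<bar>w x\<bar> \<le> B"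
  shows "integrable M (\<lambda>\<omega>. w (T \<omega> []))"
proof (rule integrable_const_bound[where B = B])
  show "AE \<omega> in M. norm (w (T \<omega> [])) \<le> B" using AE_nodes by eventually_elim (use b in auto)
  show "(\<lambda>\<omega>. w (T \<omega> [])) \<in> borel_measurable M" using measurable_compose[OF T_measurable m, of "[]"] by simp
qed

lemma integrable_gap_square: "i < d \<Longrightarrow> integrable M (\<lambda>\<omega>. (gap d (cuts (T \<omega>) []) i)\<^sup>2)"
proof (rule root_bounded[where w = "\<lambda>x. (gap d (snd x) i)\<^sup>2" and B = 1])
  assume i: "i < d"
  show "(\<lambda>x. (gap d (snd x) i)\<^sup>2) \<in> borel_measurable (node_space d)"
    by (rule borel_measurable_power[OF measurable_node_gap[OF i]])
  fix x :: "(nat \<Rightarrow> nat) \<times> (nat \<Rightarrow> real)" assume "generic_cuts d (snd x)"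
  then have "0 < gap d (snd x) i" "gap d (snd x) i \<le> 1" using gap_bounds[of d "snd x" i] d2 i by auto
  then show "\<bar>(gap d (snd x) i)\<^sup>2\<bar> \<le> 1" by (simp add: power_le_one)
qed

text \<open>Root and subtrees are independent, so each level multiplies the mean by that of the sum
  of squared gaps, 2 / (d + 1). The means are then summable over the levels.\<close>

lemma mean_collision: "integrable M (\<lambda>\<omega>. collision d k (T \<omega>))" "(\<integral>\<omega>. collision d k (T \<omega>) \<partial>M) = (2 / (real d + 1)) ^ k"
proof (induction k)
  case 0
  case 1 show ?case by (simp add: collision_def)
next
  case 0
  case 2 show ?case by (simp add: collision_def prob_space)
next
  case (Suc k)
  have w: "(\<lambda>x. (gap d (snd x) i)\<^sup>2) \<in> borel_measurable (node_space d)" if "i < d" for i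
    using measurable_node_gap[OF that] by (rule borel_measurable_power)
  note ind = indep_root_subtree[OF w integrable_gap_square tree_fun_collision Suc(1)]
  case 1
  show ?case unfolding collision_Suc using ind(1) by (intro Bochner_Integration.integrable_sum) auto
next
  case (Suc k)
  have w: "(\<lambda>x. (gap d (snd x) i)\<^sup>2) \<in> borel_measurable (node_space d)" if "i < d" for i
    using measurable_node_gap[OF that] by (rule borel_measurable_power)
  note ind = indep_root_subtree[OF w integrable_gap_square tree_fun_collision Suc(1)]
  case 2
  have "(\<integral>\<omega>. collision d (Suc k) (T \<omega>) \<partial>M) = (\<Sum>i<d. (\<integral>\<omega>. (gap d (cuts (T \<omega>) []) i)\<^sup>2 \<partial>M) * (2 / (real d + 1)) ^ k)"
    unfolding collision_Suc using ind Suc(2) by (subst Bochner_Integration.integral_sum) auto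
  also have "\<dots> = (\<integral>\<omega>. (\<Sum>i<d. (gap d (cuts (T \<omega>) []) i)\<^sup>2) \<partial>M) * (2 / (real d + 1)) ^ k"
    using integrable_gap_square by (subst Bochner_Integration.integral_sum) (auto simp: sum_distrib_right)
  also have "(\<integral>\<omega>. (\<Sum>i<d. (gap d (cuts (T \<omega>) []) i)\<^sup>2) \<partial>M) = (\<integral>v. (\<Sum>i<d. gap d v i ^ 2) \<partial>cut_points (d - 1))"
    by (rule integral_root_cuts) (intro borel_measurable_sum borel_measurable_power measurable_gap; simp)
  finally show ?case unfolding mean_sum_gap_square[OF d2] by simp
qed

lemma AE_good: "AE \<omega> in M. good_tree d (T \<omega>)"
proof -
  have "AE \<omega> in M. (\<lambda>k. collision d k (T \<omega>)) \<longlonglongrightarrow> 0"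
  proof (rule AE_tendsto_0_if_summable_means)
    show "summable (\<lambda>k. \<integral>\<omega>. collision d k (T \<omega>) \<partial>M)"
      unfolding mean_collision(2) using d2 by (intro summable_geometric) simp
    show "AE \<omega> in M. 0 \<le> collision d k (T \<omega>)" for k by (simp add: collision_def sum_nonneg)
  qed (rule mean_collision(1))
  with AE_nodes show ?thesis
  proof eventually_elim
    case (elim \<omega>)
    have "perms (T \<omega>) s \<in> Sym d \<and> (\<forall>i<d. 0 < gap d (cuts (T \<omega>) s) i)" if "s \<in> lists {..<d}" for s
    proof -
      have "perms (T \<omega>) s \<in> set_pmf F" "generic_cuts d (cuts (T \<omega>) s)" using elim(1) that by auto
      then show ?thesis using support gap_pos[of d "cuts (T \<omega>) s"] d2 by auto
    qed
    then show ?case using elim(2) unfolding good_tree_def good_def collision_def by blast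
  qed
qed

end

section \<open>The entropy rate\<close>

text \<open>Squares depend on the cut points only through the gaps. The tree keeps only the
  coordinates below \<open>d - 1\<close>, and this lemma reconciles it with the original
  points.\<close>

lemma limit_permuton_cong:
  assumes "\<And>s. gap d (u s) = gap d (u' s)"
  shows "limit_permuton d a u = limit_permuton d a u'"
proof -
  have s: "side d u s = side d u' s" for s by (induction s) (auto simp: assms)
  have l: "left_edge d u s = left_edge d u' s" for s by (induction s) (auto simp: assms s)
  have b: "bottom_edge d a u s = bottom_edge d a u' s" for s by (induction s) (auto simp: assms s)
  have "level_permuton d a u = level_permuton d a u'"
    by (intro ext) (simp add: level_permuton_def square_def s l b)
  then show ?thesis by (simp add: limit_permuton_def)
qed

lemma square_mean_le:
  fixes p x :: "'a \<Rightarrow> real"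
  assumes "finite L" "\<And>l. l \<in> L \<Longrightarrow> p l \<ge> 0" "(\<Sum>l\<in>L. p l) = 1"
  shows "(\<Sum>l\<in>L. p l * x l)\<^sup>2 \<le> (\<Sum>l\<in>L. p l * (x l)\<^sup>2)"
proof -
  define m where "m = (\<Sum>l\<in>L. p l * x l)"
  have "0 \<le> (\<Sum>l\<in>L. p l * (x l - m)\<^sup>2)" using assms(2) by (intro sum_nonneg) auto
  also have "\<dots> = (\<Sum>l\<in>L. p l * (x l)\<^sup>2) - 2 * m * (\<Sum>l\<in>L. p l * x l) + m\<^sup>2 * (\<Sum>l\<in>L. p l)"
    by (simp add: power2_eq_square algebra_simps sum.distrib sum_subtractf sum_distrib_left)
  finally show ?thesis using assms(3) by (simp add: m_def power2_eq_square)
qed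

text \<open>Puts the logarithmic error into the form C sqrt n expected by
  \<open>uniform_composition_recursion\<close>.\<close>

lemma ln_Suc_le_sqrt: "ln (real n + 1) \<le> 2 * sqrt (real n)"
proof -
  have "ln (real n + 1) = 2 * ln (sqrt (real n + 1))" by (simp add: ln_sqrt)
  also have "\<dots> \<le> 2 * (sqrt (real n + 1) - 1)" using ln_le_minus_one[of "sqrt (real n + 1)"] by simp
  also have "sqrt (real n + 1) \<le> sqrt (real n) + 1" using sqrt_add_le_add_sqrt[of "real n" 1] by simp
  finally show ?thesis by simp
qed

section \<open>Means of the entropy\<close>

context random_tree
begin

abbreviation h :: "nat \<Rightarrow> tree \<Rightarrow> real" where "h n t \<equiv> pattern_entropy d t n"

abbreviation letters :: "nat \<Rightarrow> (nat \<Rightarrow> nat) set" where "letters n \<equiv> {..<n} \<rightarrow>\<^sub>E {..<d}"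

lemma finite_letters [simp]: "finite (letters n)"
  by (auto intro!: finite_PiE)

lemma integrable_tree_fun:
  fixes B :: real
  assumes "tree_fun d \<Phi>" "\<And>t. \<bar>\<Phi> t\<bar> \<le> B"
  shows "integrable M (\<lambda>\<omega>. \<Phi> (T \<omega>))"
  by (rule integrable_const_bound[where B = B]) (use assms tree_fun_measurable[OF assms(1) T_measurable] in auto)

lemma h_integrable: "integrable M (\<lambda>\<omega>. h n (T \<omega>))"
  using pattern_entropy_nonneg pattern_entropy_le
  by (intro integrable_tree_fun[OF tree_fun_pattern_entropy, where B = "real (card (patterns n))"]) (simp add: abs_le_iff order.trans[OF _ pattern_entropy_nonneg])

lemma measurable_letter_prob: "l \<in> letters n \<Longrightarrow> (\<lambda>x. letter_prob d (snd x) n l) \<in> borel_measurable (node_space d)"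
  unfolding letter_prob_def by (intro borel_measurable_prod measurable_node_gap) auto

lemma integrable_letter_prob: "l \<in> letters n \<Longrightarrow> integrable M (\<lambda>\<omega>. letter_prob d (cuts (T \<omega>) []) n l)"
proof (rule root_bounded[where w = "\<lambda>x. letter_prob d (snd x) n l" and B = 1])
  assume l: "l \<in> letters n"
  then show "(\<lambda>x. letter_prob d (snd x) n l) \<in> borel_measurable (node_space d)" by (rule measurable_letter_prob)
  fix x :: "(nat \<Rightarrow> nat) \<times> (nat \<Rightarrow> real)" assume g: "generic_cuts d (snd x)"
  have "0 < gap d (snd x) (l j)" "gap d (snd x) (l j) \<le> 1" if "j < n" for j
  proof -
    have "l j < d" using l that by auto
    then show "0 < gap d (snd x) (l j)" "gap d (snd x) (l j) \<le> 1" using gap_bounds[OF _ g] d2 by auto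
  qed
  note g01 = this
  have "0 \<le> letter_prob d (snd x) n l"
    unfolding letter_prob_def using g01(1) by (intro prod_nonneg ballI less_imp_le) simp
  moreover have "letter_prob d (snd x) n l \<le> 1"
    unfolding letter_prob_def using g01 by (intro prod_le_1 conjI less_imp_le[OF g01(1)]) simp_all
  ultimately have "0 \<le> letter_prob d (snd x) n l" "letter_prob d (snd x) n l \<le> 1" .
  then show "\<bar>letter_prob d (snd x) n l\<bar> \<le> 1" by simp
qed

abbreviation mean_letter :: "nat \<Rightarrow> (nat \<Rightarrow> nat) \<Rightarrow> real" where
  "mean_letter n l \<equiv> (\<integral>\<omega>. letter_prob d (cuts (T \<omega>) []) n l \<partial>M)"

lemma mean_letter_nonneg: "l \<in> letters n \<Longrightarrow> mean_letter n l \<ge> 0"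
proof (rule integral_nonneg_AE, use AE_good in eventually_elim)
  case (elim \<omega>)
  then show ?case using letter_prob_nonneg[OF d2] by blast
qed

text \<open>For fixed spacings the number of points in a subsquare is binomial; averaging over the
  spacings gives the weights of uniform compositions.\<close>

lemma sum_mean_letter: "(\<Sum>l\<in>letters n. mean_letter n l * (\<Sum>i<d. f (cnt l {..<n} i))) = (\<Sum>k\<le>n. split_mean d n k * f k)"
proof -
  have "(\<Sum>l\<in>letters n. mean_letter n l * (\<Sum>i<d. f (cnt l {..<n} i)))
     = (\<integral>\<omega>. (\<Sum>l\<in>letters n. letter_prob d (cuts (T \<omega>) []) n l * (\<Sum>i<d. f (cnt l {..<n} i))) \<partial>M)"
    using integrable_letter_prob by (subst Bochner_Integration.integral_sum) auto
  also have "\<dots> = (\<integral>\<omega>. (\<Sum>i<d. \<Sum>k\<le>n. real (n choose k) * gap d (cuts (T \<omega>) []) i ^ k * (1 - gap d (cuts (T \<omega>) []) i) ^ (n - k) * f k) \<partial>M)"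
  proof (rule Bochner_Integration.integral_cong[OF refl])
    fix \<omega>
    let ?v = "cuts (T \<omega>) []"
    have "(\<Sum>l\<in>letters n. letter_prob d ?v n l * (\<Sum>i<d. f (cnt l {..<n} i))) = (\<Sum>i<d. \<Sum>l\<in>letters n. letter_prob d ?v n l * f (cnt l {..<n} i))"
      unfolding sum_distrib_left by (rule sum.swap)
    also have "\<dots> = (\<Sum>i<d. \<Sum>k\<le>n. real (n choose k) * gap d ?v i ^ k * (1 - gap d ?v i) ^ (n - k) * f k)"
      unfolding letter_prob_def using d2 sum_gap_all[of d ?v] by (intro sum.cong refl binomial_marginal) auto
    finally show "(\<Sum>l\<in>letters n. letter_prob d ?v n l * (\<Sum>i<d. f (cnt l {..<n} i))) = \<dots>" .
  qed
  also have "\<dots> = (\<integral>v. (\<Sum>i<d. \<Sum>k\<le>n. real (n choose k) * gap d v i ^ k * (1 - gap d v i) ^ (n - k) * f k) \<partial>cut_points (d - 1))"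
    by (rule integral_root_cuts)
       (intro borel_measurable_sum borel_measurable_times borel_measurable_power borel_measurable_diff borel_measurable_const measurable_gap; simp)
  also have "\<dots> = (\<Sum>k\<le>n. split_mean d n k * f k)" by (rule mean_of_splits[OF d2])
  finally show ?thesis .
qed

lemma sum_mean_letter_1: "(\<Sum>l\<in>letters n. mean_letter n l) = 1"
proof -
  have "(\<Sum>l\<in>letters n. mean_letter n l) = (\<integral>\<omega>. (\<Sum>l\<in>letters n. letter_prob d (cuts (T \<omega>) []) n l) \<partial>M)"
    using integrable_letter_prob by (subst Bochner_Integration.integral_sum) auto
  then show ?thesis using d2 by (simp add: sum_letter_prob prob_space)
qed

definition g :: "nat \<Rightarrow> real" where "g n = (\<integral>\<omega>. h n (T \<omega>) \<partial>M)"

lemma h_0: "good_tree d t \<Longrightarrow> h 0 t = 0"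
proof -
  assume t: "good_tree d t"
  have "patterns 0 = {{}}" by (auto simp: patterns_def)
  then show ?thesis unfolding pattern_entropy_def ent_def using qlim_small_any[OF d2 t, of 0] by simp
qed

lemma g_0: "g 0 = 0"
proof -
  have "g 0 = (\<integral>\<omega>. 0 \<partial>M)" unfolding g_def
    by (rule integral_cong_AE, use borel_measurable_integrable[OF h_integrable] in blast, simp, use AE_good in eventually_elim) (rule h_0)
  then show ?thesis by simp
qed

text \<open>With the tree fixed, the mean over the letters of the points of the total entropy of the
  subtrees.\<close>

definition mixed :: "nat \<Rightarrow> tree \<Rightarrow> real" where
  "mixed n t = (\<Sum>l\<in>letters n. letter_prob d (cuts t []) n l * (\<Sum>i<d. h (cnt l {..<n} i) (subtree t i)))"

lemma mean_mixed: "integrable M (\<lambda>\<omega>. mixed n (T \<omega>))" "(\<integral>\<omega>. mixed n (T \<omega>) \<partial>M) = (\<Sum>k\<le>n. split_mean d n k * g k)"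
proof -
  note ind = indep_root_subtree[OF measurable_letter_prob integrable_letter_prob tree_fun_pattern_entropy h_integrable]
  have int: "integrable M (\<lambda>\<omega>. \<Sum>i<d. letter_prob d (cuts (T \<omega>) []) n l * h (cnt l {..<n} i) (subtree (T \<omega>) i))" if "l \<in> letters n" for l
    using ind(1)[OF that that] by (intro Bochner_Integration.integrable_sum) auto
  show "integrable M (\<lambda>\<omega>. mixed n (T \<omega>))" unfolding mixed_def
    by (rule Bochner_Integration.integrable_sum, subst sum_distrib_left) (rule int)
  have "(\<integral>\<omega>. mixed n (T \<omega>) \<partial>M) = (\<Sum>l\<in>letters n. \<integral>\<omega>. (\<Sum>i<d. letter_prob d (cuts (T \<omega>) []) n l * h (cnt l {..<n} i) (subtree (T \<omega>) i)) \<partial>M)"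
    unfolding mixed_def sum_distrib_left by (rule Bochner_Integration.integral_sum) (rule int)
  also have "\<dots> = (\<Sum>l\<in>letters n. \<Sum>i<d. mean_letter n l * g (cnt l {..<n} i))"
  proof (rule sum.cong[OF refl])
    fix l assume l: "l \<in> letters n"
    have "(\<integral>\<omega>. (\<Sum>i<d. letter_prob d (cuts (T \<omega>) []) n l * h (cnt l {..<n} i) (subtree (T \<omega>) i)) \<partial>M)
      = (\<Sum>i<d. \<integral>\<omega>. letter_prob d (cuts (T \<omega>) []) n l * h (cnt l {..<n} i) (subtree (T \<omega>) i) \<partial>M)"
      by (rule Bochner_Integration.integral_sum) (rule ind(1)[OF l l], simp)
    also have "\<dots> = (\<Sum>i<d. mean_letter n l * g (cnt l {..<n} i))"
      using ind(2)[OF l l] by (intro sum.cong refl) (simp add: g_def)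
    finally show "(\<integral>\<omega>. (\<Sum>i<d. letter_prob d (cuts (T \<omega>) []) n l * h (cnt l {..<n} i) (subtree (T \<omega>) i)) \<partial>M) = \<dots>" .
  qed
  also have "\<dots> = (\<Sum>k\<le>n. split_mean d n k * g k)" unfolding sum_distrib_left[symmetric] by (rule sum_mean_letter)
  finally show "(\<integral>\<omega>. mixed n (T \<omega>) \<partial>M) = (\<Sum>k\<le>n. split_mean d n k * g k)" .
qed

lemma AE_mixed: "AE \<omega> in M. mixed n (T \<omega>) \<le> h n (T \<omega>) \<and> h n (T \<omega>) \<le> mixed n (T \<omega>) + real d * ln (real n + 1)"
  using AE_good by eventually_elim (use entropy_recursion[OF d2] in \<open>simp add: mixed_def\<close>)

text \<open>The error in the recursion for \<open>g\<close> is the mean of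
  \<open>h n - mixed n\<close>, which lies between 0 and d ln (n + 1).\<close>

lemma mean_entropy_asymptotics:
  "\<exists>c K l. c \<ge> 0 \<and> l > 0 \<and> l \<le> 1/4 \<and> K \<ge> 0 \<and> (\<forall>n\<ge>1. \<bar>g n - c * real n\<bar> \<le> K * real n powr (1 - l)) \<and> ((\<exists>n. g n > 0) \<longrightarrow> c > 0)"
proof (rule uniform_composition_recursion[OF d2])
  let ?e = "\<lambda>n. g n - (\<Sum>k\<le>n. split_mean d n k * g k)"
  show "g n = (\<Sum>k\<le>n. real d * real ((n - k + (d - 2)) choose (d - 2)) / real ((n + d - 1) choose (d - 1)) * g k) + ?e n" for n
    by (simp add: split_mean_def)
  show "g 0 = 0" by (rule g_0)
  show "g n \<ge> 0" for n unfolding g_def by (rule Bochner_Integration.integral_nonneg) (rule pattern_entropy_nonneg)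
  show "?e n \<ge> 0" for n
  proof -
    have "(\<integral>\<omega>. mixed n (T \<omega>) \<partial>M) \<le> g n" unfolding g_def
      by (rule integral_mono_AE[OF mean_mixed(1) h_integrable], use AE_mixed[of n] in eventually_elim) simp
    then show ?thesis by (simp add: mean_mixed(2))
  qed
  show "?e n \<le> (2 * real d) * sqrt (real n)" for n
  proof -
    have "g n \<le> (\<integral>\<omega>. mixed n (T \<omega>) + real d * ln (real n + 1) \<partial>M)" unfolding g_def
      by (rule integral_mono_AE[OF h_integrable], use mean_mixed(1) in simp, use AE_mixed[of n] in eventually_elim) simp
    also have "\<dots> = (\<Sum>k\<le>n. split_mean d n k * g k) + real d * ln (real n + 1)"
      using mean_mixed by (simp add: prob_space)
    also have "real d * ln (real n + 1) \<le> real d * (2 * sqrt (real n))" by (intro mult_left_mono ln_Suc_le_sqrt) simp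
    finally show ?thesis by simp
  qed
qed

section \<open>Second moments of the deviation, and almost sure convergence\<close>

definition deviation :: "real \<Rightarrow> nat \<Rightarrow> tree \<Rightarrow> real" where
  "deviation c n t = h n t - c * real n"

lemma tree_fun_deviation: "tree_fun d (deviation c n)"
  unfolding deviation_def
  by (rule tree_fun_lift[where J = "{n}" and \<Phi> = "\<lambda>n t. h n t"]) (auto intro: tree_fun_pattern_entropy)

lemma deviation_bound: "\<bar>deviation c n t\<bar> \<le> real (card (patterns n)) + \<bar>c * real n\<bar>"
  using pattern_entropy_nonneg[of d t n] pattern_entropy_le[of d t n] unfolding deviation_def by linarith

lemma integrable_deviation: "integrable M (\<lambda>\<omega>. deviation c n (T \<omega>))"
  by (rule integrable_tree_fun[OF tree_fun_deviation deviation_bound])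

lemma tree_fun_deviation_square: "tree_fun d (\<lambda>t. (deviation c n t)\<^sup>2)"
  unfolding power2_eq_square by (rule tree_fun_times[OF tree_fun_deviation tree_fun_deviation])

lemma integrable_deviation_square: "integrable M (\<lambda>\<omega>. (deviation c n (T \<omega>))\<^sup>2)"
proof (rule integrable_tree_fun[OF tree_fun_deviation_square])
  show "\<bar>(deviation c n t)\<^sup>2\<bar> \<le> (real (card (patterns n)) + \<bar>c * real n\<bar>)\<^sup>2" for t
    using power_mono[OF deviation_bound[of c n t], of 2] by simp
qed

definition mean_square :: "real \<Rightarrow> nat \<Rightarrow> real" where
  "mean_square c n = (\<integral>\<omega>. (deviation c n (T \<omega>))\<^sup>2 \<partial>M)"

lemma mean_deviation: "(\<integral>\<omega>. deviation c n (T \<omega>) \<partial>M) = g n - c * real n"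
  unfolding deviation_def using h_integrable by (simp add: g_def prob_space)

text \<open>The occupation numbers add up to \<open>n\<close>, so the linear term c n splits exactly
  among the subtrees. The deviation is then \<open>A + b\<close>, where \<open>A\<close> averages
  the summed deviations of the subtrees and \<open>b\<close> lies between 0 and d ln (n + 1);
  Jensen's inequality bounds the square of \<open>A\<close>.\<close>

lemma deviation_square_le:
  assumes t: "good_tree d t"
  shows "(deviation c n t)\<^sup>2 \<le> 21/20 * (\<Sum>l\<in>letters n. \<Sum>i<d. \<Sum>j<d. letter_prob d (cuts t []) n l *
       (deviation c (cnt l {..<n} i) (subtree t i) * deviation c (cnt l {..<n} j) (subtree t j))) + 21 * (real d * ln (real n + 1))\<^sup>2"
proof -
  let ?p = "letter_prob d (cuts t []) n" and ?Y = "\<lambda>l i. deviation c (cnt l {..<n} i) (subtree t i)"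
  define A b where "A = (\<Sum>l\<in>letters n. ?p l * (\<Sum>i<d. ?Y l i))" and "b = h n t - mixed n t"
  have p1: "(\<Sum>l\<in>letters n. ?p l) = 1" using d2 by (simp add: sum_letter_prob)
  have "(\<Sum>i<d. ?Y l i) = (\<Sum>i<d. h (cnt l {..<n} i) (subtree t i)) - c * real n" if "l \<in> letters n" for l
  proof -
    have "(\<Sum>i<d. real (cnt l {..<n} i)) = real n" using sum_cnt[OF _ that] by (simp flip: of_nat_sum)
    then show ?thesis by (simp add: deviation_def sum_subtractf sum_distrib_left[symmetric])
  qed
  then have "A = (\<Sum>l\<in>letters n. ?p l * (\<Sum>i<d. h (cnt l {..<n} i) (subtree t i)) - ?p l * (c * real n))"
    unfolding A_def by (intro sum.cong refl) (simp add: right_diff_distrib)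
  then have A: "A = mixed n t - c * real n"
    using p1 by (simp add: sum_subtractf mixed_def sum_distrib_right[symmetric])
  have b: "0 \<le> b" "b \<le> real d * ln (real n + 1)"
    using entropy_recursion[OF d2 t, of n] unfolding b_def mixed_def by auto
  have "(deviation c n t)\<^sup>2 = (A + b)\<^sup>2" by (simp add: A b_def deviation_def)
  \<comment> \<open>Young's inequality with weight 20. The factor 21/20 must be close enough to 1 to
    keep the contraction in \<open>split_recursion_bound\<close>; the price is the factor 21 on the
    small term.\<close>
  also have "\<dots> \<le> 21/20 * A\<^sup>2 + 21 * b\<^sup>2"
    using zero_le_power2[of "A - 20 * b"] by (simp add: power2_eq_square algebra_simps)
  also have "A\<^sup>2 \<le> (\<Sum>l\<in>letters n. ?p l * (\<Sum>i<d. ?Y l i)\<^sup>2)"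
    unfolding A_def using letter_prob_nonneg[OF d2 t] p1 by (intro square_mean_le) auto
  also have "b\<^sup>2 \<le> (real d * ln (real n + 1))\<^sup>2" using b by (intro power_mono)
  finally have "(deviation c n t)\<^sup>2 \<le> 21/20 * (\<Sum>l\<in>letters n. ?p l * (\<Sum>i<d. ?Y l i)\<^sup>2) + 21 * (real d * ln (real n + 1))\<^sup>2" by simp
  also have "(\<Sum>l\<in>letters n. ?p l * (\<Sum>i<d. ?Y l i)\<^sup>2) = (\<Sum>l\<in>letters n. \<Sum>i<d. \<Sum>j<d. ?p l * (?Y l i * ?Y l j))"
    by (intro sum.cong refl) (simp only: power2_eq_square sum_product, simp only: sum_distrib_left)
  finally show ?thesis .
qed

text \<open>Diagonal terms reproduce the mean squares of the subtrees. In the cross terms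
  independence leaves products of two centred means, each of order n^(1 - e), so at most of order
  n^(2 - e); there are fewer than d^2 of them and the letter probabilities have total mean
  one.\<close>

lemma mean_square_recursion:
  assumes K: "K \<ge> 0" "\<And>n. \<bar>g n - c * real n\<bar> \<le> K * real n powr (1 - e)" and e: "0 \<le> e" "e \<le> 1/4" and n: "n \<ge> 1"
  shows "mean_square c n \<le> 21/20 * (\<Sum>k\<le>n. split_mean d n k * mean_square c k) + (21/20 * (real d)\<^sup>2 * K\<^sup>2 + 84 * (real d)\<^sup>2) * real n powr (2 - e)"
proof -
  let ?Y = "\<lambda>l i \<omega>. deviation c (cnt l {..<n} i) (subtree (T \<omega>) i)" and ?p = "\<lambda>l \<omega>. letter_prob d (cuts (T \<omega>) []) n l"
  let ?G = "K\<^sup>2 * real n powr (2 - e)"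
  have two: "integrable M (\<lambda>\<omega>. ?p l \<omega> * (?Y l i \<omega> * ?Y l j \<omega>)) \<and>
     (\<integral>\<omega>. ?p l \<omega> * (?Y l i \<omega> * ?Y l j \<omega>) \<partial>M) \<le> mean_letter n l * ((if i = j then mean_square c (cnt l {..<n} i) else 0) + ?G)"
    if l: "l \<in> letters n" and ij: "i < d" "j < d" for l i j
  proof (cases "i = j")
    case True
    note ind = indep_root_subtree[OF measurable_letter_prob[OF l] integrable_letter_prob[OF l] tree_fun_deviation_square integrable_deviation_square ij(1), of c "cnt l {..<n} i"]
    have "mean_letter n l * mean_square c (cnt l {..<n} i) \<le> mean_letter n l * (mean_square c (cnt l {..<n} i) + ?G)"
      using mean_letter_nonneg[OF l] by (intro mult_left_mono) auto
    then show ?thesis using ind True by (simp add: power2_eq_square[symmetric] mean_square_def)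
  next
    case False
    note ind = indep_root_two_subtrees[OF measurable_letter_prob[OF l] integrable_letter_prob[OF l] tree_fun_deviation integrable_deviation tree_fun_deviation integrable_deviation ij False,
        of c "cnt l {..<n} i" c "cnt l {..<n} j"]
    have b: "\<bar>g (cnt l {..<n} k) - c * real (cnt l {..<n} k)\<bar> \<le> K * real n powr (1 - e)" for k
    proof -
      have "real (cnt l {..<n} k) powr (1 - e) \<le> real n powr (1 - e)"
        using cnt_le[of "{..<n}" l k] e by (intro powr_mono2) auto
      then have "K * real (cnt l {..<n} k) powr (1 - e) \<le> K * real n powr (1 - e)" using K(1) by (rule mult_left_mono)
      then show ?thesis using K(2)[of "cnt l {..<n} k"] by linarith
    qed
    have "(g (cnt l {..<n} i) - c * real (cnt l {..<n} i)) * (g (cnt l {..<n} j) - c * real (cnt l {..<n} j))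
       \<le> \<bar>g (cnt l {..<n} i) - c * real (cnt l {..<n} i)\<bar> * \<bar>g (cnt l {..<n} j) - c * real (cnt l {..<n} j)\<bar>"
      by (metis abs_ge_self abs_mult)
    also have "\<dots> \<le> (K * real n powr (1 - e)) * (K * real n powr (1 - e))" using b K by (intro mult_mono) auto
    also have "\<dots> = K\<^sup>2 * real n powr ((1 - e) + (1 - e))" by (simp only: powr_add power2_eq_square mult_ac)
    also have "\<dots> \<le> ?G" using n e by (intro mult_left_mono powr_mono) auto
    finally have "mean_letter n l * ((g (cnt l {..<n} i) - c * real (cnt l {..<n} i)) * (g (cnt l {..<n} j) - c * real (cnt l {..<n} j))) \<le> mean_letter n l * ?G"
      using mean_letter_nonneg[OF l] by (rule mult_left_mono)
    then show ?thesis using ind False by (simp add: mean_deviation)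
  qed
  let ?S = "\<lambda>\<omega>. \<Sum>l\<in>letters n. \<Sum>i<d. \<Sum>j<d. ?p l \<omega> * (?Y l i \<omega> * ?Y l j \<omega>)"
  have intS: "integrable M ?S" using two by (intro Bochner_Integration.integrable_sum) auto
  have "mean_square c n \<le> (\<integral>\<omega>. 21/20 * ?S \<omega> + 21 * (real d * ln (real n + 1))\<^sup>2 \<partial>M)"
    unfolding mean_square_def
    by (rule integral_mono_AE[OF integrable_deviation_square], use intS in simp, use AE_good in eventually_elim) (rule deviation_square_le)
  also have "\<dots> = 21/20 * (\<integral>\<omega>. ?S \<omega> \<partial>M) + 21 * (real d * ln (real n + 1))\<^sup>2"
    using intS by (simp add: prob_space)
  also have "(\<integral>\<omega>. ?S \<omega> \<partial>M) = (\<Sum>l\<in>letters n. \<Sum>i<d. \<Sum>j<d. \<integral>\<omega>. ?p l \<omega> * (?Y l i \<omega> * ?Y l j \<omega>) \<partial>M)"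
  proof -
    have i3: "integrable M (\<lambda>\<omega>. \<Sum>i<d. \<Sum>j<d. ?p l \<omega> * (?Y l i \<omega> * ?Y l j \<omega>))" if "l \<in> letters n" for l
      using two that by (intro Bochner_Integration.integrable_sum) auto
    have i2: "integrable M (\<lambda>\<omega>. \<Sum>j<d. ?p l \<omega> * (?Y l i \<omega> * ?Y l j \<omega>))" if "l \<in> letters n" "i < d" for l i
      using two that by (intro Bochner_Integration.integrable_sum) auto
    have "(\<integral>\<omega>. ?S \<omega> \<partial>M) = (\<Sum>l\<in>letters n. \<integral>\<omega>. (\<Sum>i<d. \<Sum>j<d. ?p l \<omega> * (?Y l i \<omega> * ?Y l j \<omega>)) \<partial>M)"
      by (rule Bochner_Integration.integral_sum) (rule i3)
    also have "\<dots> = (\<Sum>l\<in>letters n. \<Sum>i<d. \<integral>\<omega>. (\<Sum>j<d. ?p l \<omega> * (?Y l i \<omega> * ?Y l j \<omega>)) \<partial>M)"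
      by (rule sum.cong[OF refl], rule Bochner_Integration.integral_sum) (rule i2, simp_all)
    also have "\<dots> = (\<Sum>l\<in>letters n. \<Sum>i<d. \<Sum>j<d. \<integral>\<omega>. ?p l \<omega> * (?Y l i \<omega> * ?Y l j \<omega>) \<partial>M)"
      by (rule sum.cong[OF refl], rule sum.cong[OF refl], rule Bochner_Integration.integral_sum) (use two in auto)
    finally show ?thesis .
  qed
  also have "\<dots> \<le> (\<Sum>l\<in>letters n. \<Sum>i<d. \<Sum>j<d. mean_letter n l * ((if i = j then mean_square c (cnt l {..<n} i) else 0) + ?G))"
    using two by (intro sum_mono) auto
  also have "\<dots> = (\<Sum>l\<in>letters n. mean_letter n l * ((\<Sum>i<d. mean_square c (cnt l {..<n} i)) + (real d)\<^sup>2 * ?G))"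
  proof (rule sum.cong[OF refl])
    fix l
    have "(\<Sum>i<d. \<Sum>j<d. (if i = j then mean_square c (cnt l {..<n} i) else 0) + ?G) = (\<Sum>i<d. mean_square c (cnt l {..<n} i)) + (real d)\<^sup>2 * ?G"
      by (simp add: sum.distrib power2_eq_square)
    then show "(\<Sum>i<d. \<Sum>j<d. mean_letter n l * ((if i = j then mean_square c (cnt l {..<n} i) else 0) + ?G))
       = mean_letter n l * ((\<Sum>i<d. mean_square c (cnt l {..<n} i)) + (real d)\<^sup>2 * ?G)"
      by (simp only: sum_distrib_left[symmetric])
  qed
  also have "\<dots> = (\<Sum>k\<le>n. split_mean d n k * mean_square c k) + (real d)\<^sup>2 * ?G"
    unfolding distrib_left sum.distrib sum_distrib_right[symmetric] sum_mean_letter_1 sum_mean_letter by simp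
  finally have "mean_square c n \<le> 21/20 * ((\<Sum>k\<le>n. split_mean d n k * mean_square c k) + (real d)\<^sup>2 * ?G) + 21 * (real d * ln (real n + 1))\<^sup>2"
    by simp
  \<comment> \<open>The squared logarithm is at most 4 n; together with the factor 21 this gives the
    constant 84.\<close>
  moreover have "(real d * ln (real n + 1))\<^sup>2 \<le> 4 * (real d)\<^sup>2 * real n powr (2 - e)"
  proof -
    have "(ln (real n + 1))\<^sup>2 \<le> (2 * sqrt (real n))\<^sup>2" using ln_Suc_le_sqrt[of n] by (intro power_mono) auto
    also have "\<dots> = 4 * real n powr 1" using n by simp
    also have "\<dots> \<le> 4 * real n powr (2 - e)" using n e by (intro mult_left_mono powr_mono) auto
    finally have "(real d)\<^sup>2 * (ln (real n + 1))\<^sup>2 \<le> (real d)\<^sup>2 * (4 * real n powr (2 - e))" by (rule mult_left_mono) simp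
    then show ?thesis by (simp add: power_mult_distrib mult_ac)
  qed
  ultimately show ?thesis by (simp add: algebra_simps)
qed

lemma AE_sampling_entropy: "AE \<omega> in M. \<forall>n. sampling_entropy n (mu_F_Unif \<omega>) = h n (T \<omega>)"
  using AE_good
proof eventually_elim
  case (elim \<omega>)
  have "mu_F_Unif \<omega> = limit_permuton d (perms (T \<omega>)) (cuts (T \<omega>))"
    unfolding mu_F_Unif_def T_def fst_conv snd_conv by (rule limit_permuton_cong, rule gap_cong) simp
  then show ?case using sampling_entropy_eq[OF d2 elim] by simp
qed

lemma h_step: "good_tree d t \<Longrightarrow> h n t \<le> h (Suc n) t + ln (real (Suc n))"
  using sampling_entropy_Suc[OF permuton_the_limit[OF d2], of t n] sampling_entropy_eq[OF d2, of t] by simp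

lemma almost_sure_limit:
  assumes c: "c \<ge> 0" and e: "0 < e" "e \<le> 1/4" and K: "K \<ge> 0" "\<And>n. n \<ge> 1 \<Longrightarrow> \<bar>g n - c * real n\<bar> \<le> K * real n powr (1 - e)"
  shows "AE \<omega> in M. (\<lambda>n. h n (T \<omega>) / real n) \<longlonglongrightarrow> c"
proof -
  have K': "\<bar>g n - c * real n\<bar> \<le> K * real n powr (1 - e)" for n
    using K(2)[of n] g_0 by (cases "n = 0") auto
  have v0: "mean_square c 0 = 0"
  proof -
    have "mean_square c 0 = (\<integral>\<omega>. 0 \<partial>M)" unfolding mean_square_def
      by (rule integral_cong_AE, use borel_measurable_integrable[OF integrable_deviation_square] in blast, simp, use AE_good in eventually_elim)
         (simp add: deviation_def h_0)
    then show ?thesis by simp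
  qed
  have "\<exists>K\<ge>0. \<forall>n. mean_square c n \<le> K * real n powr (2 - e)"
    by (rule split_recursion_bound[OF d2 _ e(2) _ v0 mean_square_recursion[OF K(1) K' _ e(2)]])
       (use e in \<open>auto simp: mean_square_def\<close>)
  then obtain B where B: "B \<ge> 0" "\<And>n. mean_square c n \<le> B * real n powr (2 - e)" by blast
  \<comment> \<open>With \<open>p * e \<ge> 2\<close> the normalised mean squares along m^p are at
    most B m^(-2), hence summable.\<close>
  define p where "p = nat \<lceil>2 / e\<rceil>"
  have p: "p \<ge> 1" "real p * e \<ge> 2"
  proof -
    have "real p \<ge> 2 / e" unfolding p_def by linarith
    then show "real p * e \<ge> 2" using e by (simp add: pos_divide_le_eq)
    then show "p \<ge> 1" by (cases p) auto
  qed
  let ?f = "\<lambda>m \<omega>. (deviation c (m ^ p) (T \<omega>) / real (m ^ p))\<^sup>2"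
  have "AE \<omega> in M. (\<lambda>m. ?f m \<omega>) \<longlonglongrightarrow> 0"
  proof (rule AE_tendsto_0_if_summable_means)
    show "integrable M (?f m)" for m
      unfolding power_divide using integrable_deviation_square by simp
    show "summable (\<lambda>m. \<integral>\<omega>. ?f m \<omega> \<partial>M)"
    proof (rule summable_comparison_test)
      show "summable (\<lambda>m. B * inverse (real m ^ 2))" by (intro summable_mult inverse_power_summable) simp
      have "norm (\<integral>\<omega>. ?f m \<omega> \<partial>M) \<le> B * inverse (real m ^ 2)" if m: "m \<ge> 1" for m
      proof -
        have mp: "real (m ^ p) > 0" using m by simp
        have "(\<integral>\<omega>. ?f m \<omega> \<partial>M) = mean_square c (m ^ p) / (real (m ^ p))\<^sup>2"
          unfolding power_divide mean_square_def by simp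
        also have "\<dots> \<le> B * real (m ^ p) powr (2 - e) / (real (m ^ p))\<^sup>2" using B(2) by (intro divide_right_mono) (simp_all del: of_nat_power)
        also have "\<dots> = B * real (m ^ p) powr (- e)"
          using mp by (simp add: powr_diff powr_minus powr_numeral field_simps del: of_nat_power)
        also have "real (m ^ p) powr (- e) = real m powr (- (real p * e))"
          using m by (simp add: powr_powr powr_realpow[symmetric])
        also have "B * real m powr (- (real p * e)) \<le> B * real m powr (- 2)" using m p B by (intro mult_left_mono powr_mono) auto
        also have "\<dots> = B * inverse (real m ^ 2)" using m by (simp add: powr_minus powr_numeral)
        finally show ?thesis by simp
      qed
      then show "\<exists>N. \<forall>m\<ge>N. norm (\<integral>\<omega>. ?f m \<omega> \<partial>M) \<le> B * inverse (real m ^ 2)" by blast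
    qed
  qed simp
  with AE_good show ?thesis
  proof eventually_elim
    case (elim \<omega>)
    have "(\<lambda>m. sqrt (?f m \<omega>)) \<longlonglongrightarrow> sqrt 0" by (rule tendsto_real_sqrt[OF elim(2)])
    then have "(\<lambda>m. \<bar>deviation c (m ^ p) (T \<omega>) / real (m ^ p)\<bar>) \<longlonglongrightarrow> 0" by simp
    then have "(\<lambda>m. deviation c (m ^ p) (T \<omega>) / real (m ^ p)) \<longlonglongrightarrow> 0" by (rule tendsto_rabs_zero_cancel)
    from tendsto_add[OF this tendsto_const[of c]]
    have l: "(\<lambda>m. deviation c (m ^ p) (T \<omega>) / real (m ^ p) + c) \<longlonglongrightarrow> c" by simp
    have "(\<lambda>m. h (m ^ p) (T \<omega>) / real (m ^ p)) \<longlonglongrightarrow> c"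
    proof (rule Lim_transform_eventually[OF l])
      show "\<forall>\<^sub>F m in sequentially. deviation c (m ^ p) (T \<omega>) / real (m ^ p) + c = h (m ^ p) (T \<omega>) / real (m ^ p)"
        unfolding eventually_sequentially
      proof (intro exI[of _ 1] allI impI)
        fix m :: nat assume "m \<ge> 1"
        then have "real (m ^ p) \<noteq> 0" by simp
        then show "deviation c (m ^ p) (T \<omega>) / real (m ^ p) + c = h (m ^ p) (T \<omega>) / real (m ^ p)"
          unfolding deviation_def by (simp add: diff_divide_distrib del: of_nat_power)
      qed
    qed
    then show ?case
      by (intro convergence_from_powers[OF pattern_entropy_nonneg h_step[OF elim(1)] p(1)])
  qed
qed

section \<open>When the rate vanishes\<close>

lemma support_of_AE_root: "AE \<omega> in M. P (perms (T \<omega>) []) \<Longrightarrow> p \<in> set_pmf F \<Longrightarrow> P p"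
proof -
  assume P: "AE \<omega> in M. P (perms (T \<omega>) [])" and p: "p \<in> set_pmf F"
  have m: "(\<lambda>\<omega>. fst (T \<omega> [])) \<in> M \<rightarrow>\<^sub>M count_space UNIV"
    by (rule measurable_compose[OF T_measurable measurable_fst]) simp
  have "distr M (count_space UNIV) (\<lambda>\<omega>. fst (T \<omega> [])) = distr (distr M (node_space d) (\<lambda>\<omega>. T \<omega> [])) (count_space UNIV) fst"
    by (subst distr_distr[OF measurable_fst T_measurable]) (simp_all add: comp_def)
  also have "\<dots> = distr node_law (count_space UNIV) fst" by (simp only: distr_T lists.Nil)
  also have "\<dots> = distr node_law (measure_pmf F) fst" by (rule distr_cong) simp_all
  finally have D: "distr M (count_space UNIV) (\<lambda>\<omega>. fst (T \<omega> [])) = measure_pmf F" unfolding distr_node_law_fst .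
  have "AE q in distr M (count_space UNIV) (\<lambda>\<omega>. fst (T \<omega> [])). P q"
    by (subst AE_distr_iff[OF m]) (use P in auto)
  then show "P p" unfolding D using p by (simp add: AE_measure_pmf_iff)
qed

lemma h_2_pos_mixed:
  assumes t: "good_tree d t" and up: "i < j" "j < d" "perms t [] (Suc i) < perms t [] (Suc j)"
    and down: "i' < j'" "j' < d" "\<not> perms t [] (Suc i') < perms t [] (Suc j')"
  shows "h 2 t > 0"
  using pattern_entropy_2_pos[OF d2 t] pos_pair[OF d2 t up(1,2)] pos_pair[OF d2 t down(1,2)] up(3) down(3) by simp

text \<open>An increasing pair is seen between two subsquares of the root, a decreasing pair inside
  subsquare 0.\<close>

lemma h_2_pos_nested:
  assumes t: "good_tree d t" and "perms t [] = id" "perms (subtree t 0) [] = reversal d"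
  shows "h 2 t > 0"
proof (rule pattern_entropy_2_pos[OF d2 t])
  show "qlim d t 2 {(0, 1)} > 0" using pos_pair[OF d2 t, of 0 1] d2 assms(2) by simp
  have "\<not> d < d - Suc 0" by linarith
  then have "qlim d (subtree t 0) 2 {(1, 0)} > 0"
    using pos_pair[OF d2 good_subtree[OF t], of 0 0 1] d2 assms(3) by (simp add: reversal_def)
  then show "qlim d t 2 {(1, 0)} > 0" using nested_pos[OF d2 t, of 0 "{(1, 0)}"] d2 by (simp add: patterns_def)
qed

lemma g_2_pos:
  assumes F: "F \<noteq> return_pmf id" "F \<noteq> return_pmf (reversal d)"
  shows "g 2 > 0"
proof (rule ccontr)
  assume "\<not> g 2 > 0"
  moreover have "g 2 \<ge> 0" unfolding g_def by (rule Bochner_Integration.integral_nonneg) (rule pattern_entropy_nonneg)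
  ultimately have "(\<integral>\<omega>. h 2 (T \<omega>) \<partial>M) = 0" by (simp add: g_def)
  then have z: "AE \<omega> in M. h 2 (T \<omega>) = 0"
    using integral_nonneg_eq_0_iff_AE[OF h_integrable[of 2]] pattern_entropy_nonneg by simp
  have supp: "set_pmf F \<subseteq> {id, reversal d}"
  proof
    fix p assume p: "p \<in> set_pmf F"
    show "p \<in> {id, reversal d}"
    proof (rule ccontr)
      assume np: "p \<notin> {id, reversal d}"
      have pS: "p \<in> Sym d" using p support by blast
      then have pinj: "p (Suc i) \<noteq> p (Suc j)" if "i \<noteq> j" for i j
        using that permutes_inj[of p "{1..d}"] by (auto simp: Sym_def inj_def)
      have "\<not> (\<forall>i j. i < j \<longrightarrow> j < d \<longrightarrow> p (Suc i) < p (Suc j))"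
        using increasing_permutation[OF pS] np by blast
      then obtain i' j' where down: "i' < j'" "j' < d" "\<not> p (Suc i') < p (Suc j')" by blast
      have "\<not> (\<forall>i j. i < j \<longrightarrow> j < d \<longrightarrow> p (Suc j) < p (Suc i))"
        using decreasing_permutation[OF pS] np by blast
      then obtain i j where "i < j" "j < d" "\<not> p (Suc j) < p (Suc i)" by blast
      then have up: "i < j" "j < d" "p (Suc i) < p (Suc j)" using pinj[of i j] by auto
      have "AE \<omega> in M. perms (T \<omega>) [] \<noteq> p"
        using z AE_good
      proof eventually_elim
        case (elim \<omega>)
        show ?case
        proof
          assume "perms (T \<omega>) [] = p"
          then have "h 2 (T \<omega>) > 0" using h_2_pos_mixed[OF elim(2) up(1,2) _ down(1,2)] up(3) down(3) by blast
          then show False using elim(1) by simp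
        qed
      qed
      from support_of_AE_root[OF this p] show False by simp
    qed
  qed
  have both: "id \<in> set_pmf F" "reversal d \<in> set_pmf F"
  proof -
    have "set_pmf F \<noteq> {}" by (rule set_pmf_not_empty)
    moreover have "set_pmf F \<noteq> {id}" "set_pmf F \<noteq> {reversal d}"
      using F set_pmf_subset_singleton[of F] by auto
    ultimately show "id \<in> set_pmf F" "reversal d \<in> set_pmf F" using supp by blast+
  qed
  \<comment> \<open>Independence enters here. The identity at the root and the reversal in subsquare
    0 almost surely do not occur together, so one of the two indicators has mean zero, against
    \<open>both\<close>.\<close>
  define w where "w = (\<lambda>x :: (nat \<Rightarrow> nat) \<times> (nat \<Rightarrow> real). of_bool (fst x = id) :: real)"
  define \<Phi> where "\<Phi> = (\<lambda>t :: tree. of_bool (fst (t []) = reversal d) :: real)"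
  have w: "w \<in> borel_measurable (node_space d)"
    unfolding w_def by (rule measurable_compose[OF measurable_fst]) simp
  have \<Phi>: "tree_fun d \<Phi>" unfolding tree_fun_def
  proof
    show "\<Phi> \<in> borel_measurable (tree_space d)" unfolding \<Phi>_def
      by (rule measurable_compose[OF measurable_compose[OF component_tree_space measurable_fst]]) simp_all
  qed (simp add: \<Phi>_def)
  have iw: "integrable M (\<lambda>\<omega>. w (T \<omega> []))" by (rule root_bounded[OF w, of 1]) (simp add: w_def)
  have i\<Phi>: "integrable M (\<lambda>\<omega>. \<Phi> (T \<omega>))" by (rule integrable_tree_fun[OF \<Phi>, of 1]) (simp add: \<Phi>_def)
  have d0: "0 < d" using d2 by simp
  note ind = indep_root_subtree[OF w iw \<Phi> i\<Phi> d0]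
  have "AE \<omega> in M. w (T \<omega> []) * \<Phi> (subtree (T \<omega>) 0) = 0"
    using z AE_good
  proof eventually_elim
    case (elim \<omega>)
    have "\<not> (perms (T \<omega>) [] = id \<and> perms (subtree (T \<omega>) 0) [] = reversal d)"
      using h_2_pos_nested[OF elim(2)] elim(1) by auto
    then show ?case by (auto simp: w_def \<Phi>_def)
  qed
  then have "(\<integral>\<omega>. w (T \<omega> []) * \<Phi> (subtree (T \<omega>) 0) \<partial>M) = 0"
    by (rule integral_eq_zero_AE)
  then consider "(\<integral>\<omega>. w (T \<omega> []) \<partial>M) = 0" | "(\<integral>\<omega>. \<Phi> (T \<omega>) \<partial>M) = 0" unfolding ind(2) by auto
  then show False
  proof cases
    case 1
    then have "AE \<omega> in M. w (T \<omega> []) = 0" using integral_nonneg_eq_0_iff_AE[OF iw] by (simp add: w_def)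
    then have "AE \<omega> in M. perms (T \<omega>) [] \<noteq> id" by eventually_elim (simp add: w_def)
    from support_of_AE_root[OF this both(1)] show False by simp
  next
    case 2
    then have "AE \<omega> in M. \<Phi> (T \<omega>) = 0" using integral_nonneg_eq_0_iff_AE[OF i\<Phi>] by (simp add: \<Phi>_def)
    then have "AE \<omega> in M. perms (T \<omega>) [] \<noteq> reversal d" by eventually_elim (simp add: \<Phi>_def)
    from support_of_AE_root[OF this both(2)] show False by simp
  qed
qed

lemma AE_entropy_0:
  assumes F: "F = return_pmf id \<or> F = return_pmf (reversal d)"
  shows "AE \<omega> in M. \<forall>n. h n (T \<omega>) = 0"
  using AE_good AE_nodes
proof eventually_elim
  case (elim \<omega>)
  show ?case
  proof (cases "F = return_pmf id")
    case True
    then have "perms (T \<omega>) s = id" if "s \<in> lists {..<d}" for s using elim(2) that by auto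
    then show ?thesis using entropy_0_if_id[OF d2 elim(1)] by blast
  next
    case False
    then have "perms (T \<omega>) s = reversal d" if "s \<in> lists {..<d}" for s using elim(2) that F by auto
    then show ?thesis using entropy_0_if_reversal[OF d2 elim(1)] by blast
  qed
qed

lemma entropy_rate:
  "\<exists>c\<ge>0. (AE \<omega> in M. (\<lambda>n. sampling_entropy n (mu_F_Unif \<omega>) / real n) \<longlonglongrightarrow> c)
     \<and> (c = 0 \<longleftrightarrow> F = return_pmf id \<or> F = return_pmf (reversal d))"
proof -
  obtain c K l where c: "c \<ge> 0" "l > 0" "l \<le> 1/4" "K \<ge> 0" "\<And>n. n \<ge> 1 \<Longrightarrow> \<bar>g n - c * real n\<bar> \<le> K * real n powr (1 - l)"
    "(\<exists>n. g n > 0) \<longrightarrow> c > 0" using mean_entropy_asymptotics by blast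
  have lim: "AE \<omega> in M. (\<lambda>n. h n (T \<omega>) / real n) \<longlonglongrightarrow> c" by (rule almost_sure_limit[OF c(1-4) c(5)])
  have "AE \<omega> in M. (\<lambda>n. sampling_entropy n (mu_F_Unif \<omega>) / real n) \<longlonglongrightarrow> c"
    using lim AE_sampling_entropy by eventually_elim simp
  moreover have "c = 0" if F: "F = return_pmf id \<or> F = return_pmf (reversal d)"
  proof -
    have "AE \<omega> in M. c = 0"
      using lim AE_entropy_0[OF F]
    proof eventually_elim
      case (elim \<omega>)
      then have "(\<lambda>n. 0) \<longlonglongrightarrow> c" by simp
      then show ?case using LIMSEQ_unique[OF _ tendsto_const] by blast
    qed
    then show ?thesis by simp
  qed
  moreover have "F = return_pmf id \<or> F = return_pmf (reversal d)" if "c = 0"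
    using that g_2_pos c(6) by fastforce
  ultimately show ?thesis using c(1) by blast
qed

end

theorem theorem1p6:
  fixes M :: "'w measure" and d :: nat and F :: "(nat \<Rightarrow> nat) pmf"
    and \<alpha> :: "nat list \<Rightarrow> 'w \<Rightarrow> nat \<Rightarrow> nat"
    and U :: "nat list \<Rightarrow> nat \<Rightarrow> 'w \<Rightarrow> real"
    and \<mu> :: "'w \<Rightarrow> (real \<times> real) measure"
  assumes "d \<ge> 2"
    and "set_pmf F \<subseteq> Sym d"
    and "random_squares M d F \<alpha> U"
  defines "\<mu> \<equiv> random_squares.mu_F_Unif d \<alpha> U"
  shows "\<exists>c\<ge>0. (AE \<omega> in M. (\<lambda>n. sampling_entropy n (\<mu> \<omega>) / real n) \<longlonglongrightarrow> c)
     \<and> (c = 0 \<longleftrightarrow> F = return_pmf id \<or> F = return_pmf (reversal d))"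
proof -
  interpret random_tree M d F \<alpha> U
    by (rule random_tree.intro[OF assms(3)]) (unfold_locales, use assms in auto)
  show ?thesis unfolding \<mu>_def by (rule entropy_rate)
qed

end
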